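(* Let $(M,\pi)$ be a Poisson manifold and $C$ a coisotropic submanifold. Identify a tubular neighborhood of $C$ in $M$ with the normal bundle $\nu C$ in such a way that $\pi$ is fiberwise polynomial. There is an $L_\infty[1]$-algebra structure on $\chi^\bullet_{fp}(\nu C)[2]\oplus\Gamma(\wedge\nu C)[1]$ whose Maurer-Cartan elements are exactly the pairs $(\tilde\pi[2],\tilde\Phi[1])$, where $\tilde\pi\in\chi^2_{fp}(\nu C)$ and $\tilde\Phi\in\Gamma(\nu C)$ are such that $\pi+\tilde\pi$ is a Poisson structure and $\mathrm{graph}(-\tilde\Phi)$ is a coisotropic submanifold with respect to $\pi+\tilde\pi$. Its non-vanishing multibrackets $\{\dots\}^\pi$ are given as follows: $$d^\pi(X[1])=(-[\pi,X][1],P(X)),\qquad d^\pi(a)=(0,P([\pi,a])),\qquad \{X[1],Y[1]\}^\pi_2=(-1)^{|X|}[X,Y][1],$$ $$\{a_1,\dots,a_n\}^\pi_n=P([\dots[\pi,a_1],\dots,a_n])\ \text{ for all }n\ge1,\qquad \{X[1],a_1,\dots,a_n\}^\pi_{n+1}=P([\dots[X,a_1],\dots,a_n])\ \text{ for all }n\ge1,$$ where $X,Y\in\chi^\bullet_{fp}(\nu C)[1]$ and $a,a_1,\dots,a_n\in\Gamma(\wedge\nu C)[1]$.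
   Context: An $L_\infty[1]$-algebra is a $\mathbb{Z}$-graded vector space $W$ with graded symmetric degree $1$ multilinear maps $m_k=\{\cdots\}$, $k\ge1$, satisfying $\sum_{i+j=n+1,\,i,j\ge1}\sum_{\sigma\in S_{(i,n-i)}}\epsilon(\sigma)m_j(m_i(v_{\sigma(1)},\dots,v_{\sigma(i)}),v_{\sigma(i+1)},\dots,v_{\sigma(n)})=0$ for all $n\ge1$ ($\epsilon$ Koszul sign, $S_{(i,n-i)}$ unshuffles). A Maurer-Cartan element is a degree $0$ element $\alpha$ with $\sum_{n\ge1}\frac1{n!}\{\alpha,\dots,\alpha\}=0$. Notation: $V[n]_i=V_{i+n}$; $v[1]\in V[1]$ is the element corresponding to $v\in V$. Multibrackets are listed up to permutation of entries. Setting: $\nu C=TM|_C/TC$ is identified with a neighborhood of $C$ in $M$ via an embedding which, together with its derivative, is the identity on $C$. A vector field on $\nu C$ is fiberwise polynomial if it preserves the fiberwise polynomial functions on the vector bundle $\nu C$. $\chi^\bullet_{fp}(\nu C)$ is the space of multivector fields on the total space $\nu C$ that are sums of products of fiberwise polynomial vector fields (and fiberwise polynomial functions in degree $0$). $\chi^\bullet_{fp}(\nu C)[1]$ is a graded Lie algebra under the Schouten bracket $[\cdot,\cdot]$ ($[X,\cdot]$ is the Lie derivative for a vector field $X$); a $k$-vector field has degree $|X|=k-1$ there. "$\pi$ is fiberwise polynomial" means $\pi\in\chi^2_{fp}(\nu C)$. Elements of $\Gamma(\wedge\nu C)$ are regarded as vertical, fiberwise constant multivector fields on $\nu C$. $P:\chi^\bullet_{fp}(\nu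 C)[1]\to\Gamma(\wedge\nu C)[1]$ is restriction to $C$ followed by the projection $\wedge T(\nu C)|_C\to\wedge\nu C$. A Poisson structure is a bivector field $\pi$ with $[\pi,\pi]=0$; a submanifold $N$ is coisotropic if $\pi^\sharp(TN^\circ)\subset TN$, where $TN^\circ$ is the annihilator of $TN$ and $\pi^\sharp:T^*\to T$ is contraction with $\pi$. $\mathrm{graph}(-\tilde\Phi)\subset\nu C$ is the image of the section $-\tilde\Phi$. *)

theory Defs
  imports
    "HOL-Analysis.Analysis"
    "HOL-Library.Function_Algebras"
    "HOL-Combinatorics.Permutations"
begin

section \<open>Pointwise real vector space structure on functions\<close>

instantiation "fun" :: (type, real_vector) real_vector
begin

definition scaleR_fun :: "real \<Rightarrow> ('a \<Rightarrow> 'b) \<Rightarrow> 'a \<Rightarrow> 'b" where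
  "scaleR_fun r f = (\<lambda>x. r *\<^sub>R f x)"

instance
  by standard (auto simp: scaleR_fun_def fun_eq_iff plus_fun_def scaleR_add_right scaleR_add_left)

end


section \<open>Unshuffles and \<open>L\<^sub>\<infinity>[1]\<close>-algebras\<close>

text \<open>Permutations of \<open>{..<n}\<close> that are increasing on the first \<open>i\<close> and on the last \<open>n - i\<close>
  indices.  \<^term>\<open>permute_list \<sigma> vs\<close> is the list with entries \<open>vs ! \<sigma> 0, vs ! \<sigma> 1, \<dots>\<close>.\<close>

definition unshuffles :: "nat \<Rightarrow> nat \<Rightarrow> (nat \<Rightarrow> nat) set" where
  "unshuffles i n = {\<sigma>. \<sigma> permutes {..<n} \<and> strict_mono_on {..<i} \<sigma> \<and> strict_mono_on {i..<n} \<sigma>}"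

definition koszul_sign :: "int list \<Rightarrow> (nat \<Rightarrow> nat) \<Rightarrow> real" where
  "koszul_sign ds \<sigma> =
     (\<Prod>(a, b) \<in> {(a, b). a < b \<and> b < length ds \<and> \<sigma> b < \<sigma> a}. (-1) powi (ds ! \<sigma> a * ds ! \<sigma> b))"

definition graded_space :: "(int \<Rightarrow> 'v::real_vector set) \<Rightarrow> bool" where
  "graded_space W \<longleftrightarrow> (\<forall>i. subspace (W i)) \<and>
     (\<forall>I x. finite I \<and> (\<forall>i\<in>I. x i \<in> W i) \<and> (\<Sum>i\<in>I. x i) = 0 \<longrightarrow> (\<forall>i\<in>I. x i = 0))"

definition homogeneous :: "(int \<Rightarrow> 'v set) \<Rightarrow> 'v list \<Rightarrow> int list \<Rightarrow> bool" where
  "homogeneous W vs ds \<longleftrightarrow> list_all2 (\<lambda>v d. v \<in> W d) vs ds"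

text \<open>\<open>m [v\<^sub>1, \<dots>, v\<^sub>n]\<close> is the \<open>n\<close>-ary bracket, \<open>n \<ge> 1\<close>; it is only constrained on lists of
  homogeneous vectors, which determine the bracket on the direct sum of the \<open>W i\<close>.\<close>

definition L_infinity_1 :: "(int \<Rightarrow> 'v::real_vector set) \<Rightarrow> ('v list \<Rightarrow> 'v) \<Rightarrow> bool" where
  "L_infinity_1 W m \<longleftrightarrow> graded_space W \<and>
     (\<forall>vs ds. homogeneous W vs ds \<and> vs \<noteq> [] \<longrightarrow> m vs \<in> W (sum_list ds + 1)) \<and>
     (\<forall>xs ys ds es d u v r s. homogeneous W xs ds \<and> homogeneous W ys es \<and> u \<in> W d \<and> v \<in> W d \<longrightarrow>
        m (xs @ (r *\<^sub>R u + s *\<^sub>R v) # ys) = r *\<^sub>R m (xs @ u # ys) + s *\<^sub>R m (xs @ v # ys)) \<and>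
     (\<forall>vs ds \<sigma>. homogeneous W vs ds \<and> vs \<noteq> [] \<and> \<sigma> permutes {..<length vs} \<longrightarrow>
        m vs = koszul_sign ds \<sigma> *\<^sub>R m (permute_list \<sigma> vs)) \<and>
     (\<forall>vs ds. homogeneous W vs ds \<and> vs \<noteq> [] \<longrightarrow>
        (\<Sum>i = 1..length vs. \<Sum>\<sigma> \<in> unshuffles i (length vs). koszul_sign ds \<sigma> *\<^sub>R
           m (m (take i (permute_list \<sigma> vs)) # drop i (permute_list \<sigma> vs))) = 0)"

text \<open>For the function spaces used below the topology is that of pointwise convergence.\<close>

definition maurer_cartan ::
  "(int \<Rightarrow> 'v::{real_vector, topological_space} set) \<Rightarrow> ('v list \<Rightarrow> 'v) \<Rightarrow> 'v set" where
  "maurer_cartan W m =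
     {\<alpha> \<in> W 0. (\<lambda>n. (1 / fact (Suc n)) *\<^sub>R m (replicate (Suc n) \<alpha>)) sums 0}"


section \<open>Smooth manifolds\<close>

primrec C_k_on :: "nat \<Rightarrow> ('a::euclidean_space \<Rightarrow> 'b::real_normed_vector) \<Rightarrow> 'a set \<Rightarrow> bool" where
  "C_k_on 0 f U \<longleftrightarrow> continuous_on U f"
| "C_k_on (Suc k) f U \<longleftrightarrow> (\<forall>x\<in>U. f differentiable (at x)) \<and>
     (\<forall>v. C_k_on k (\<lambda>x. frechet_derivative f (at x) v) U)"

text \<open>Only used for open sets \<open>U\<close>.\<close>

definition smooth_on :: "'a::euclidean_space set \<Rightarrow> ('a \<Rightarrow> 'b::real_normed_vector) \<Rightarrow> bool" where
  "smooth_on U f \<longleftrightarrow> (\<forall>k. C_k_on k f U)"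

text \<open>A chart is a domain together with a coordinate map; the values of the map outside the domain
  are irrelevant.  A manifold is given by an atlas, which determines the underlying set, the topology
  and the maximal atlas.\<close>

type_synonym ('a, 'e) chart = "'a set \<times> ('a \<Rightarrow> 'e)"
type_synonym ('a, 'e) atlas = "('a, 'e) chart set"

definition chart_inv :: "('a, 'e) chart \<Rightarrow> 'e \<Rightarrow> 'a" where
  "chart_inv c = inv_into (fst c) (snd c)"

definition is_chart :: "('a, 'e::euclidean_space) chart \<Rightarrow> bool" where
  "is_chart c \<longleftrightarrow> inj_on (snd c) (fst c) \<and> open (snd c ` fst c)"

definition smooth_transition :: "('a, 'e::euclidean_space) chart \<Rightarrow> ('a, 'e) chart \<Rightarrow> bool" where
  "smooth_transition c c' \<longleftrightarrow> open (snd c ` (fst c \<inter> fst c')) \<and>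
     smooth_on (snd c ` (fst c \<inter> fst c')) (snd c' \<circ> chart_inv c)"

definition carrier_of :: "('a, 'e) atlas \<Rightarrow> 'a set" where
  "carrier_of A = \<Union> (fst ` A)"

definition manifold_topology :: "('a, 'e::euclidean_space) atlas \<Rightarrow> 'a topology" where
  "manifold_topology A =
     topology (\<lambda>W. W \<subseteq> carrier_of A \<and> (\<forall>c\<in>A. open (snd c ` (fst c \<inter> W))))"

definition manifold :: "('a, 'e::euclidean_space) atlas \<Rightarrow> bool" where
  "manifold A \<longleftrightarrow> (\<forall>c\<in>A. is_chart c) \<and> (\<forall>c\<in>A. \<forall>c'\<in>A. smooth_transition c c') \<and>
     Hausdorff_space (manifold_topology A) \<and> second_countable (manifold_topology A)"

definition smooth_charts :: "('a, 'e::euclidean_space) atlas \<Rightarrow> ('a, 'e) chart set" where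
  "smooth_charts A = {c. is_chart c \<and> fst c \<subseteq> carrier_of A \<and>
     (\<forall>c'\<in>A. smooth_transition c c' \<and> smooth_transition c' c)}"

definition charts_at :: "('a, 'e::euclidean_space) atlas \<Rightarrow> 'a \<Rightarrow> ('a, 'e) chart set" where
  "charts_at A p = {c \<in> smooth_charts A. p \<in> fst c}"

definition smooth_map ::
  "('a, 'e::euclidean_space) atlas \<Rightarrow> ('b, 'f::euclidean_space) atlas \<Rightarrow> ('a \<Rightarrow> 'b) \<Rightarrow> bool" where
  "smooth_map A B h \<longleftrightarrow> h ` carrier_of A \<subseteq> carrier_of B \<and>
     (\<forall>c\<in>A. \<forall>d\<in>B. let V = snd c ` (fst c \<inter> h -` fst d) in
        open V \<and> smooth_on V (snd d \<circ> h \<circ> chart_inv c))"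

definition open_submanifold :: "('a, 'e) atlas \<Rightarrow> 'a set \<Rightarrow> ('a, 'e) atlas" where
  "open_submanifold A W = (\<lambda>c. (fst c \<inter> W, snd c)) ` A"

definition open_embedding ::
  "('a, 'e::euclidean_space) atlas \<Rightarrow> ('b, 'e) atlas \<Rightarrow> ('a \<Rightarrow> 'b) \<Rightarrow> bool" where
  "open_embedding A B h \<longleftrightarrow> smooth_map A B h \<and> inj_on h (carrier_of A) \<and>
     openin (manifold_topology B) (h ` carrier_of A) \<and>
     smooth_map (open_submanifold B (h ` carrier_of A)) A (inv_into (carrier_of A) h)"

text \<open>Smooth real functions are extended by \<open>0\<close> outside the underlying set of the manifold.\<close>

definition smooth_functions :: "('a, 'e::euclidean_space) atlas \<Rightarrow> ('a \<Rightarrow> real) set" where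
  "smooth_functions A = {f. (\<forall>x. x \<notin> carrier_of A \<longrightarrow> f x = 0) \<and>
     (\<forall>c\<in>A. smooth_on (snd c ` fst c) (f \<circ> chart_inv c))}"

text \<open>A tangent vector is the family of its coordinate representations in all charts around the
  point, related by the derivatives of the transition maps.\<close>

type_synonym ('a, 'e) tvector = "('a, 'e) chart \<Rightarrow> 'e"
type_synonym ('a, 'e) covector = "('a, 'e) tvector \<Rightarrow> real"

definition tangent_space ::
  "('a, 'e::euclidean_space) atlas \<Rightarrow> 'a \<Rightarrow> ('a, 'e) tvector set" where
  "tangent_space A p = {v. (\<forall>c. c \<notin> charts_at A p \<longrightarrow> v c = 0) \<and>
     (\<forall>c \<in> charts_at A p. \<forall>c' \<in> charts_at A p.
        v c' = frechet_derivative (snd c' \<circ> chart_inv c) (at (snd c p)) (v c))}"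

definition velocity ::
  "('a, 'e::euclidean_space) atlas \<Rightarrow> (real \<Rightarrow> 'a) \<Rightarrow> ('a, 'e) tvector" where
  "velocity A \<gamma> =
     (\<lambda>c. if c \<in> charts_at A (\<gamma> 0) then vector_derivative (snd c \<circ> \<gamma>) (at 0) else 0)"

text \<open>Covectors are extended by \<open>0\<close> outside the tangent space.\<close>

definition cotangent_space ::
  "('a, 'e::euclidean_space) atlas \<Rightarrow> 'a \<Rightarrow> ('a, 'e) covector set" where
  "cotangent_space A p = {\<alpha>. (\<forall>v. v \<notin> tangent_space A p \<longrightarrow> \<alpha> v = 0) \<and>
     (\<forall>v \<in> tangent_space A p. \<forall>w \<in> tangent_space A p. \<forall>r s.
        \<alpha> (r *\<^sub>R v + s *\<^sub>R w) = r * \<alpha> v + s * \<alpha> w)}"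

definition differential ::
  "('a, 'e::euclidean_space) atlas \<Rightarrow> 'a \<Rightarrow> ('a \<Rightarrow> real) \<Rightarrow> ('a, 'e) covector" where
  "differential A p f = (\<lambda>v. if v \<in> tangent_space A p
     then (let c = (SOME c. c \<in> charts_at A p) in
             frechet_derivative (f \<circ> chart_inv c) (at (snd c p)) (v c))
     else 0)"


section \<open>Multivector fields and the Schouten bracket\<close>

definition alternating_form :: "'v::real_vector set \<Rightarrow> nat \<Rightarrow> ('v list \<Rightarrow> real) \<Rightarrow> bool" where
  "alternating_form V k \<omega> \<longleftrightarrow>
     (\<forall>xs ys \<alpha> \<beta> r s. set xs \<union> set ys \<union> {\<alpha>, \<beta>} \<subseteq> V \<and> length xs + 1 + length ys = k \<longrightarrow>
        \<omega> (xs @ (r *\<^sub>R \<alpha> + s *\<^sub>R \<beta>) # ys) = r * \<omega> (xs @ \<alpha> # ys) + s * \<omega> (xs @ \<beta> # ys)) \<and>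
     (\<forall>xs ys \<alpha>. set xs \<union> set ys \<union> {\<alpha>} \<subseteq> V \<and> length xs + 2 + length ys = k \<longrightarrow>
        \<omega> (xs @ \<alpha> # \<alpha> # ys) = 0)"

text \<open>A \<open>k\<close>-vector at \<open>p\<close> is an alternating \<open>k\<close>-linear form on the cotangent space at \<open>p\<close>.
  A \<open>k\<close>-vector field \<open>X\<close> is recorded by its values
  \<open>X [f\<^sub>1, \<dots>, f\<^sub>k] p = X\<^sub>p (d\<^sub>p f\<^sub>1, \<dots>, d\<^sub>p f\<^sub>k)\<close> on differentials of smooth functions, which
  determine it because every covector at \<open>p\<close> is a differential.  Since a \<open>k\<close>-vector field
  vanishes on lists of length other than \<open>k\<close>, the sum of the spaces \<open>multivector_fields A k\<close>
  inside the function type is direct; in particular a function \<open>f\<close> appears as the \<open>0\<close>-vector field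
  with value \<open>f\<close> at the empty list.\<close>

type_synonym 'a multivector = "('a \<Rightarrow> real) list \<Rightarrow> 'a \<Rightarrow> real"

definition multivector_fields ::
  "('a, 'e::euclidean_space) atlas \<Rightarrow> nat \<Rightarrow> 'a multivector set" where
  "multivector_fields A k = {X.
     (\<forall>fs. \<not> (length fs = k \<and> set fs \<subseteq> smooth_functions A) \<longrightarrow> X fs = 0) \<and>
     (\<forall>fs. X fs \<in> smooth_functions A) \<and>
     (\<forall>p \<in> carrier_of A. \<exists>\<omega>. alternating_form (cotangent_space A p) k \<omega> \<and>
        (\<forall>fs. length fs = k \<and> set fs \<subseteq> smooth_functions A \<longrightarrow>
           X fs p = \<omega> (map (differential A p) fs)))}"

text \<open>\<open>X\<^sub>p (\<alpha>\<^sub>1, \<dots>, \<alpha>\<^sub>k)\<close> for covectors \<open>\<alpha>\<^sub>i\<close> at \<open>p\<close>.\<close>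

definition multivector_at ::
  "('a, 'e::euclidean_space) atlas \<Rightarrow> 'a multivector \<Rightarrow> 'a \<Rightarrow> ('a, 'e) covector list \<Rightarrow> real" where
  "multivector_at A X p \<alpha>s =
     X (SOME fs. set fs \<subseteq> smooth_functions A \<and> map (differential A p) fs = \<alpha>s) p"

definition wedge ::
  "('a, 'e::euclidean_space) atlas \<Rightarrow> 'a multivector list \<Rightarrow> 'a multivector" where
  "wedge A Xs = (\<lambda>fs. if length fs = length Xs \<and> set fs \<subseteq> smooth_functions A
     then (\<lambda>x. \<Sum>\<sigma> | \<sigma> permutes {..<length Xs}.
             of_int (sign \<sigma>) * (\<Prod>i<length Xs. (Xs ! i) [fs ! \<sigma> i] x))
     else 0)"

text \<open>The Schouten bracket, i.e. the extension of the Lie bracket of vector fields and of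
  \<open>[X, f] = X f\<close> satisfying \<open>[X, Y \<and> Z] = [X, Y] \<and> Z + (-1)\<^bsup>(k-1)l\<^esup> Y \<and> [X, Z]\<close> for
  \<open>X\<close> of degree \<open>k\<close> and \<open>Y\<close> of degree \<open>l\<close>.  On functions it is
  \<open>[X, Y] = (-1)\<^bsup>(k-1)(l-1)\<^esup> X \<circ> Y - Y \<circ> X\<close>, where \<open>X \<circ> Y\<close> inserts \<open>Y\<close> into the first slot of
  \<open>X\<close> and antisymmetrises over unshuffles.  In the \<open>i\<close>-th summand for a list of length \<open>n\<close>, the first term
  only sees the component of \<open>X\<close> of degree \<open>n - i + 1\<close> and that of \<open>Y\<close> of degree \<open>i\<close>; so the
  definition is additive in inhomogeneous arguments and no degrees need to be passed.\<close>

definition schouten :: "'a multivector \<Rightarrow> 'a multivector \<Rightarrow> 'a multivector" where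
  "schouten X Y = (\<lambda>fs. \<Sum>i\<le>length fs. \<Sum>\<sigma> \<in> unshuffles i (length fs).
     of_int (sign \<sigma>) *\<^sub>R
       (let gs = permute_list \<sigma> fs in
          ((-1) powi ((int (length fs) - int i) * (int i - 1))) *\<^sub>R X (Y (take i gs) # drop i gs)
          - Y (X (take i gs) # drop i gs)))"

definition poisson_structure :: "('a, 'e::euclidean_space) atlas \<Rightarrow> 'a multivector \<Rightarrow> bool" where
  "poisson_structure A \<pi> \<longleftrightarrow> \<pi> \<in> multivector_fields A 2 \<and> schouten \<pi> \<pi> = 0"

definition sharp ::
  "('a, 'e::euclidean_space) atlas \<Rightarrow> 'a multivector \<Rightarrow> 'a \<Rightarrow> ('a, 'e) covector \<Rightarrow> ('a, 'e) tvector" where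
  "sharp A \<pi> p \<alpha> = (THE w. w \<in> tangent_space A p \<and>
     (\<forall>\<beta> \<in> cotangent_space A p. \<beta> w = multivector_at A \<pi> p [\<alpha>, \<beta>]))"


section \<open>Coisotropic submanifolds\<close>

definition slice_chart ::
  "('a, 'e::euclidean_space) atlas \<Rightarrow> 'a set \<Rightarrow> ('a, 'e) chart \<Rightarrow> 'e set \<Rightarrow> bool" where
  "slice_chart A N c S \<longleftrightarrow> c \<in> smooth_charts A \<and> subspace S \<and>
     snd c ` (fst c \<inter> N) = snd c ` fst c \<inter> S"

definition submanifold :: "('a, 'e::euclidean_space) atlas \<Rightarrow> 'a set \<Rightarrow> bool" where
  "submanifold A N \<longleftrightarrow> N \<subseteq> carrier_of A \<and>
     (\<exists>d. \<forall>p\<in>N. \<exists>c S. slice_chart A N c S \<and> p \<in> fst c \<and> dim S = d)"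

definition submanifold_tangent ::
  "('a, 'e::euclidean_space) atlas \<Rightarrow> 'a set \<Rightarrow> 'a \<Rightarrow> ('a, 'e) tvector set" where
  "submanifold_tangent A N p =
     {v \<in> tangent_space A p. \<exists>c S. slice_chart A N c S \<and> p \<in> fst c \<and> v c \<in> S}"

definition conormal_space ::
  "('a, 'e::euclidean_space) atlas \<Rightarrow> 'a set \<Rightarrow> 'a \<Rightarrow> ('a, 'e) covector set" where
  "conormal_space A N p = {\<alpha> \<in> cotangent_space A p. \<forall>v \<in> submanifold_tangent A N p. \<alpha> v = 0}"

definition coisotropic ::
  "('a, 'e::euclidean_space) atlas \<Rightarrow> 'a multivector \<Rightarrow> 'a set \<Rightarrow> bool" where
  "coisotropic A \<pi> N \<longleftrightarrow> submanifold A N \<and>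
     (\<forall>p\<in>N. sharp A \<pi> p ` conormal_space A N p \<subseteq> submanifold_tangent A N p)"


section \<open>The normal bundle\<close>

text \<open>Elements of \<open>\<nu>\<^sub>pC = T\<^sub>pM / T\<^sub>pC\<close> are cosets, and points of \<open>\<nu>C\<close> are pairs of a point of \<open>C\<close>
  and such a coset.\<close>

type_synonym ('a, 'e) nvector = "('a, 'e) tvector set"
type_synonym ('a, 'e) npoint = "'a \<times> ('a, 'e) nvector"

definition normal_space ::
  "('a, 'e::euclidean_space) atlas \<Rightarrow> 'a set \<Rightarrow> 'a \<Rightarrow> ('a, 'e) nvector set" where
  "normal_space A C p = (\<lambda>v. (\<lambda>w. v + w) ` submanifold_tangent A C p) ` tangent_space A p"

definition nplus :: "('a, 'e::euclidean_space) nvector \<Rightarrow> ('a, 'e) nvector \<Rightarrow> ('a, 'e) nvector" where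
  "nplus u u' = {v + v' | v v'. v \<in> u \<and> v' \<in> u'}"

text \<open>Adding the coset of \<open>0\<close> makes this correct for \<open>r = 0\<close> as well.\<close>

definition nscale :: "('a, 'e::euclidean_space) atlas \<Rightarrow> 'a set \<Rightarrow> 'a \<Rightarrow> real \<Rightarrow>
    ('a, 'e) nvector \<Rightarrow> ('a, 'e) nvector" where
  "nscale A C p r u = {r *\<^sub>R v + w | v w. v \<in> u \<and> w \<in> submanifold_tangent A C p}"

definition normal_points ::
  "('a, 'e::euclidean_space) atlas \<Rightarrow> 'a set \<Rightarrow> ('a, 'e) npoint set" where
  "normal_points A C = {(p, u). p \<in> C \<and> u \<in> normal_space A C p}"

text \<open>A slice chart \<open>(U, \<phi>)\<close> with \<open>\<phi> (U \<inter> C) = \<phi> U \<inter> S\<close> induces linear isomorphisms of the fibres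
  \<open>\<nu>\<^sub>pC\<close>, \<open>p \<in> U \<inter> C\<close>, with the orthogonal complement of \<open>S\<close>, and the bundle chart
  \<open>(p, u) \<mapsto> \<phi> p + normal_coord (U, \<phi>) S u\<close> of \<open>\<nu>C\<close> over \<open>U \<inter> C\<close>.\<close>

definition normal_coord ::
  "('a, 'e::euclidean_space) chart \<Rightarrow> 'e set \<Rightarrow> ('a, 'e) nvector \<Rightarrow> 'e" where
  "normal_coord c S u = (THE y. y \<in> orthogonal_comp S \<and> (\<forall>v\<in>u. v c - y \<in> S))"

definition normal_chart :: "('a, 'e::euclidean_space) atlas \<Rightarrow> 'a set \<Rightarrow>
    ('a, 'e) chart \<Rightarrow> 'e set \<Rightarrow> (('a, 'e) npoint, 'e) chart" where
  "normal_chart A C c S =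
     ({q \<in> normal_points A C. fst q \<in> fst c}, \<lambda>(p, u). snd c p + normal_coord c S u)"

definition normal_bundle ::
  "('a, 'e::euclidean_space) atlas \<Rightarrow> 'a set \<Rightarrow> (('a, 'e) npoint, 'e) atlas" where
  "normal_bundle A C = {normal_chart A C c S | c S. slice_chart A C c S}"

definition zero_vec ::
  "('a, 'e::euclidean_space) atlas \<Rightarrow> 'a set \<Rightarrow> 'a \<Rightarrow> ('a, 'e) npoint" where
  "zero_vec A C p = (p, submanifold_tangent A C p)"

definition zero_section ::
  "('a, 'e::euclidean_space) atlas \<Rightarrow> 'a set \<Rightarrow> ('a, 'e) npoint set" where
  "zero_section A C = zero_vec A C ` C"

text \<open>The embedding restricts to the identity on \<open>C\<close>, and its derivative along \<open>C\<close> induces the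
  identity of \<open>\<nu>\<^sub>pC = T\<^sub>pM / T\<^sub>pC\<close>: the velocity of \<open>t \<mapsto> \<psi> (p, t u)\<close> represents the coset \<open>u\<close>.\<close>

definition tubular_embedding ::
  "('a, 'e::euclidean_space) atlas \<Rightarrow> 'a set \<Rightarrow> (('a, 'e) npoint \<Rightarrow> 'a) \<Rightarrow> bool" where
  "tubular_embedding A C \<psi> \<longleftrightarrow> open_embedding (normal_bundle A C) A \<psi> \<and>
     (\<forall>p\<in>C. \<psi> (zero_vec A C p) = p) \<and>
     (\<forall>p\<in>C. \<forall>u \<in> normal_space A C p. velocity A (\<lambda>t. \<psi> (p, nscale A C p t u)) \<in> u)"

text \<open>\<open>\<rho>\<close> on \<open>\<nu>C\<close> corresponds to \<open>\<pi>\<close> on \<open>M\<close> under the open embedding \<open>\<psi>\<close>.  The functions \<open>f \<circ> \<psi>\<close>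
  with \<open>f\<close> smooth on \<open>M\<close> realise all covectors of \<open>\<nu>C\<close>, so \<open>\<rho>\<close> is uniquely determined.\<close>

definition is_pullback :: "('a, 'e::euclidean_space) atlas \<Rightarrow> 'a set \<Rightarrow>
    (('a, 'e) npoint \<Rightarrow> 'a) \<Rightarrow> nat \<Rightarrow> 'a multivector \<Rightarrow> ('a, 'e) npoint multivector \<Rightarrow> bool" where
  "is_pullback A C \<psi> k \<pi> \<rho> \<longleftrightarrow> \<rho> \<in> multivector_fields (normal_bundle A C) k \<and>
     (\<forall>fs. length fs = k \<and> set fs \<subseteq> smooth_functions A \<longrightarrow>
        (\<forall>q \<in> normal_points A C.
           \<rho> (map (\<lambda>f q'. if q' \<in> normal_points A C then f (\<psi> q') else 0) fs) q = \<pi> fs (\<psi> q)))"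


section \<open>Fibrewise polynomial multivector fields\<close>

definition fp_functions ::
  "('a, 'e::euclidean_space) atlas \<Rightarrow> 'a set \<Rightarrow> (('a, 'e) npoint \<Rightarrow> real) set" where
  "fp_functions A C = {f \<in> smooth_functions (normal_bundle A C).
     \<forall>c S. slice_chart A C c S \<longrightarrow> (\<forall>p \<in> C \<inter> fst c.
       \<exists>g. real_polynomial_function g \<and> (\<forall>u \<in> normal_space A C p. f (p, u) = g (normal_coord c S u)))}"

definition fp_vector_fields ::
  "('a, 'e::euclidean_space) atlas \<Rightarrow> 'a set \<Rightarrow> ('a, 'e) npoint multivector set" where
  "fp_vector_fields A C = {X \<in> multivector_fields (normal_bundle A C) 1.
     \<forall>f \<in> fp_functions A C. X [f] \<in> fp_functions A C}"

definition fp_multivector_fields ::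
  "('a, 'e::euclidean_space) atlas \<Rightarrow> 'a set \<Rightarrow> nat \<Rightarrow> ('a, 'e) npoint multivector set" where
  "fp_multivector_fields A C k =
     (if k = 0 then {X \<in> multivector_fields (normal_bundle A C) 0. X [] \<in> fp_functions A C}
      else span {wedge (normal_bundle A C) Xs | Xs. length Xs = k \<and> set Xs \<subseteq> fp_vector_fields A C})"


section \<open>Sections of exterior powers of the normal bundle\<close>

definition conormal_fibre ::
  "('a, 'e::euclidean_space) atlas \<Rightarrow> 'a set \<Rightarrow> 'a \<Rightarrow> (('a, 'e) nvector \<Rightarrow> real) set" where
  "conormal_fibre A C p = {\<xi>. (\<forall>u. u \<notin> normal_space A C p \<longrightarrow> \<xi> u = 0) \<and>
     (\<forall>u \<in> normal_space A C p. \<forall>u' \<in> normal_space A C p. \<forall>r s.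
        \<xi> (nplus (nscale A C p r u) (nscale A C p s u')) = r * \<xi> u + s * \<xi> u')}"

text \<open>The differential at \<open>q = (p, w)\<close> of the restriction of \<open>f\<close> to the fibre \<open>\<nu>\<^sub>pC\<close>.\<close>

definition vertical_differential :: "('a, 'e::euclidean_space) atlas \<Rightarrow> 'a set \<Rightarrow>
    ('a, 'e) npoint \<Rightarrow> (('a, 'e) npoint \<Rightarrow> real) \<Rightarrow> ('a, 'e) nvector \<Rightarrow> real" where
  "vertical_differential A C q f = (\<lambda>u. if u \<in> normal_space A C (fst q)
     then deriv (\<lambda>t. f (fst q, nplus (snd q) (nscale A C (fst q) t u))) 0 else 0)"

text \<open>A section \<open>\<eta>\<close> of \<open>\<Lambda>\<^sup>k\<nu>C\<close> is represented by the corresponding vertical, fibrewise constant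
  multivector field \<open>a\<close> on \<open>\<nu>C\<close>: \<open>a\<close> only depends on vertical differentials, and is given by the
  same \<open>\<eta>\<^sub>p \<in> \<Lambda>\<^sup>k\<nu>\<^sub>pC\<close> at all points \<open>(p, w)\<close> of the fibre over \<open>p\<close>.\<close>

definition normal_multisections ::
  "('a, 'e::euclidean_space) atlas \<Rightarrow> 'a set \<Rightarrow> nat \<Rightarrow> ('a, 'e) npoint multivector set" where
  "normal_multisections A C k = {a \<in> multivector_fields (normal_bundle A C) k.
     \<forall>p\<in>C. \<exists>\<eta>. alternating_form (conormal_fibre A C p) k \<eta> \<and>
       (\<forall>w \<in> normal_space A C p. \<forall>fs. length fs = k \<and>
          set fs \<subseteq> smooth_functions (normal_bundle A C) \<longrightarrow>
            a fs (p, w) = \<eta> (map (vertical_differential A C (p, w)) fs))}"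

definition normal_sections ::
  "('a, 'e::euclidean_space) atlas \<Rightarrow> 'a set \<Rightarrow> ('a \<Rightarrow> ('a, 'e) nvector) set" where
  "normal_sections A C = {s. (\<forall>p\<in>C. s p \<in> normal_space A C p) \<and>
     (\<forall>c S. slice_chart A C c S \<longrightarrow>
        smooth_on (snd (normal_chart A C c S) ` fst (normal_chart A C c S))
          (\<lambda>z. normal_coord c S (s (fst (chart_inv (normal_chart A C c S) z)))))}"

definition vertical_lift :: "('a, 'e::euclidean_space) atlas \<Rightarrow> 'a set \<Rightarrow>
    ('a \<Rightarrow> ('a, 'e) nvector) \<Rightarrow> ('a, 'e) npoint multivector" where
  "vertical_lift A C s = (\<lambda>fs q.
     if length fs = 1 \<and> set fs \<subseteq> smooth_functions (normal_bundle A C) \<and> q \<in> normal_points A C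
     then vertical_differential A C q (hd fs) (s (fst q)) else 0)"

definition graph_minus :: "('a, 'e::euclidean_space) atlas \<Rightarrow> 'a set \<Rightarrow>
    ('a \<Rightarrow> ('a, 'e) nvector) \<Rightarrow> ('a, 'e) npoint set" where
  "graph_minus A C s = (\<lambda>p. (p, nscale A C p (-1) (s p))) ` C"

text \<open>The composite of \<open>\<xi> \<in> \<nu>\<^sub>pC\<^sup>*\<close> with the projection \<open>T\<^sub>p(\<nu>C) = T\<^sub>pC \<oplus> \<nu>\<^sub>pC \<rightarrow> \<nu>\<^sub>pC\<close> at the point \<open>p\<close> of
  the zero section.\<close>

definition project_covector :: "('a, 'e::euclidean_space) atlas \<Rightarrow> 'a set \<Rightarrow> 'a \<Rightarrow>
    (('a, 'e) nvector \<Rightarrow> real) \<Rightarrow> (('a, 'e) npoint, 'e) covector" where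
  "project_covector A C p \<xi> = (THE \<alpha>.
     \<alpha> \<in> cotangent_space (normal_bundle A C) (zero_vec A C p) \<and>
     (\<forall>v \<in> submanifold_tangent (normal_bundle A C) (zero_section A C) (zero_vec A C p). \<alpha> v = 0) \<and>
     (\<forall>u \<in> normal_space A C p.
        \<alpha> (velocity (normal_bundle A C) (\<lambda>t. (p, nscale A C p t u))) = \<xi> u))"

text \<open>\<open>(P X)\<^sub>p (\<xi>\<^sub>1, \<dots>, \<xi>\<^sub>k) = X\<^sub>p (\<xi>\<^sub>1 \<circ> pr, \<dots>, \<xi>\<^sub>k \<circ> pr)\<close> for \<open>p \<in> C\<close>, again viewed as a vertical, fibrewise
  constant multivector field.\<close>

definition restrict_project :: "('a, 'e::euclidean_space) atlas \<Rightarrow> 'a set \<Rightarrow>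
    ('a, 'e) npoint multivector \<Rightarrow> ('a, 'e) npoint multivector" where
  "restrict_project A C X = (\<lambda>fs q.
     if set fs \<subseteq> smooth_functions (normal_bundle A C) \<and> q \<in> normal_points A C
     then multivector_at (normal_bundle A C) X (zero_vec A C (fst q))
            (map (\<lambda>f. project_covector A C (fst q) (vertical_differential A C q f)) fs)
     else 0)"


section \<open>The graded vector space\<close>

definition graded_piece :: "(nat \<Rightarrow> 'v::zero set) \<Rightarrow> int \<Rightarrow> 'v set" where
  "graded_piece V i = (if i \<ge> 0 then V (nat i) else {0})"

text \<open>The graded space \<open>\<chi>\<^sub>f\<^sub>p(\<nu>C)[2] \<oplus> \<Gamma>(\<Lambda>\<nu>C)[1]\<close>; shifts are encoded in the index only, so \<open>X[1]\<close> and \<open>a\<close>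
  are \<open>(X, 0)\<close> and \<open>(0, a)\<close>.\<close>

definition deformation_space :: "('a, 'e::euclidean_space) atlas \<Rightarrow> 'a set \<Rightarrow> int \<Rightarrow>
    (('a, 'e) npoint multivector \<times> ('a, 'e) npoint multivector) set" where
  "deformation_space A C i =
     graded_piece (fp_multivector_fields A C) (i + 2) \<times> graded_piece (normal_multisections A C) (i + 1)"

end

theory Submission
 imports Defs
begin

text \<open>On a manifold with bump functions, multivector fields are the alternating multiderivations of the
  algebra of smooth functions (Hadamard's lemma), and the Schouten bracket is the graded commutator of the
  insertion product, hence a graded Lie bracket. For this bracket the sections of \<open>\<Lambda>\<nu>C\<close> form an abelian
  subalgebra, the projection \<open>P\<close> satisfies \<open>P [X, Y] = P [P X, Y] + P [X, P Y]\<close>, and \<open>P \<pi> = 0\<close> since \<open>C\<close> is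
  coisotropic. So Voronov's higher derived brackets give an \<open>L\<^sub>\<infinity>[1]\<close>-structure. Bracketing with
  the vertical lift of a section \<open>s\<close> differentiates along the fibres; for fibrewise polynomial bivector fields,
  evaluated on functions that are linear on the fibres, the Maurer-Cartan series is therefore a finite Taylor
  expansion, whose sum is the value at \<open>- s\<close> of \<open>\<pi> + \<rho>\<close> on functions whose differentials span the conormal
  space of the graph.\<close>

text \<open>The sections of \<Lambda>\<nu>C are not shown to be finite sums of products of fibrewise
  polynomial fields. The derived brackets are therefore formed in the Lie algebra of all multivector
  fields, and only the first summand is restricted to a subalgebra: \<open>derived_brackets\<close>
  has separate spaces \<open>L\<close>, \<open>A\<close> and \<open>K\<close>. Unshuffles and signs
  are replaced by one recursion over lists, \<open>ssum\<close>. Its coassociativity and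
  cocommutativity carry the L-infinity relations as well as the Jacobi identity and the Leibniz rule
  of the Schouten bracket. Functions on \<nu>C are cut off by bump functions of the base coordinate
  alone. This preserves linearity along the fibres, and the support condition becomes closedness of
  a compact coordinate ball in the Hausdorff space M. In the Maurer-Cartan series, smoothness alone
  would give a formal Taylor expansion along t -> -t s(p), with no control of its value at t = 1.
  Polynomials make it exact. The minus sign arises because bracketing with the lift on the right is
  minus the Lie derivative.\<close>

notation (input) scaleR (infixr "*:" 75)
abbreviation (input) cinv where "cinv == chart_inv"
abbreviation (input) fder where "fder == frechet_derivative"
abbreviation (input) dif where "dif == differential"
abbreviation (input) tsp where "tsp == tangent_space"
abbreviation (input) ctsp where "ctsp == cotangent_space"
abbreviation (input) stan where "stan == submanifold_tangent"
abbreviation (input) coord where "coord == normal_coord"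
abbreviation (input) rpf where "rpf == real_polynomial_function"
abbreviation (input) plist where "plist == permute_list"
abbreviation (input) ocomp where "ocomp == orthogonal_comp"
abbreviation (input) cimg where "cimg c == snd c ` fst c"
lemmas fzero = zero_fun_apply and fplus = plus_fun_apply and fscale = scaleR_fun_def
 and rpfI = real_polynomial_function.intros

section \<open>Signed sums over unshuffles\<close>

text \<open>Takes integers because degrees in the shifted spaces can be negative.\<close>

definition sg :: "int => real" where
 "sg n = (if even n then 1 else -1)"

lemma sg_add: "sg (a + b) = sg a * sg b"
 by (simp add: sg_def)

lemma sg_mult_self [simp]: "sg a * sg a = 1" "sg a * (sg a * x) = x"
 by (simp_all add: sg_def)

lemma sg_minus [simp]: "sg (- a) = sg a"
 by (simp add: sg_def)

lemma sg_simps [simp]: "sg 0 = 1" "sg 1 = -1"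
 by (simp_all add: sg_def)

lemma sg_scale_self [simp]: "sg a *: sg a *: (x :: 'b::real_vector) = x"
 by (simp add: sg_def)

lemma powi_minus_one: "(-1 :: real) powi n = sg n"
 by (cases "n >= 0") (auto simp: sg_def power_int_def even_nat_iff minus_one_power_iff)

text \<open>The sum runs over the ways of splitting a list into two sublists; the sign is the Koszul
  sign of moving the first one to the front.\<close>

fun ssum :: "('x => int) => ('x list => 'x list => 'b::real_vector) => 'x list => 'b" where
 "ssum d F [] = F [] []"
| "ssum d F (v # vs) = ssum d (%L R. F (v # L) R) vs
  + ssum d (%L R. sg (d v * sum_list (map d L)) *: F L (v # R)) vs"

text \<open>The multiset condition is all that is kept of \<open>(L, R)\<close> being a splitting of
  \<open>vs\<close>: lengths, degree sums and membership follow from it, so later termwise arguments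
  rely on nothing else.\<close>

lemma ssum_cong:
 assumes "!!L R. mset L + mset R = mset vs ==> F L R = G L R"
 shows "ssum d F vs = ssum d G vs"
 using assms
proof (induction vs arbitrary: F G)
 case Nil
 thus ?case by simp
next
 case (Cons v vs)
 show ?case
  by (simp, intro arg_cong2[where f = "(+)"] Cons.IH) (auto intro!: Cons.prems)
qed

lemma ssum_add: "ssum d (%L R. F L R + G L R) vs = ssum d F vs + ssum d G vs"
 by (induction vs arbitrary: F G) (simp_all add: scaleR_add_right)

lemma ssum_zero [simp]: "ssum d (%L R. 0) vs = 0"
 by (induction vs) simp_all

lemma ssum_closed:
 assumes "subspace V" "!!L R. mset L + mset R = mset vs ==> F L R : V"
 shows "ssum d F vs : V"
 using assms(2)
proof (induction vs arbitrary: F)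
 case Nil
 thus ?case by simp
next
 case (Cons v vs)
 show ?case
  by (simp, intro subspace_add[OF assms(1)] Cons.IH subspace_scale[OF assms(1)])
   (auto intro!: Cons.prems)
qed

text \<open>Brackets and projections are linear only within one homogeneous component, hence
  linearity is asked for on a subspace that contains all terms.\<close>

lemma ssum_linear_on:
 assumes V: "subspace V" and lin: "!!r s x y. x : V ==> y : V ==> f (r *: x + s *: y) = r *: f x + s *: f y"
  and "!!L R. mset L + mset R = mset vs ==> F L R : V"
 shows "f (ssum d F vs) = ssum d (%L R. f (F L R)) vs"
 using assms(3)
proof (induction vs arbitrary: F)
 case Nil
 thus ?case by simp
next
 case (Cons v vs)
 have scale: "f (r *: x) = r *: f x" if "x : V" for r x
  using lin[OF that that, of r 0] by simp
 have 1: "ssum d (%L R. F (v # L) R) vs : V"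
  by (intro ssum_closed[OF V]) (auto intro!: Cons.prems)
 have 2: "ssum d (%L R. sg (d v * sum_list (map d L)) *: F L (v # R)) vs : V"
  by (intro ssum_closed[OF V] subspace_scale[OF V]) (auto intro!: Cons.prems)
 have "f (ssum d F (v # vs)) = f (ssum d (%L R. F (v # L) R) vs)
   + f (ssum d (%L R. sg (d v * sum_list (map d L)) *: F L (v # R)) vs)"
  using lin[OF 1 2, of 1 1] by simp
 also have "f (ssum d (%L R. F (v # L) R) vs) = ssum d (%L R. f (F (v # L) R)) vs"
  by (intro Cons.IH) (auto intro!: Cons.prems)
 also have "f (ssum d (%L R. sg (d v * sum_list (map d L)) *: F L (v # R)) vs) =
   ssum d (%L R. f (sg (d v * sum_list (map d L)) *: F L (v # R))) vs"
  by (intro Cons.IH subspace_scale[OF V]) (auto intro!: Cons.prems)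
 also have "... = ssum d (%L R. sg (d v * sum_list (map d L)) *: f (F L (v # R))) vs"
  by (intro ssum_cong scale) (auto intro!: Cons.prems)
 finally show ?case by simp
qed

lemma ssum_linear:
 assumes "linear f"
 shows "f (ssum d F vs) = ssum d (%L R. f (F L R)) vs"
 by (rule ssum_linear_on[of UNIV]) (use assms in \<open>simp_all add: linear_add linear_scale\<close>)

lemma ssum_scaleR: "ssum d (%L R. c *: F L R) vs = c *: ssum d F vs"
 by (rule ssum_linear[symmetric]) (simp add: linear_iff scaleR_add_right)

lemma ssum_diff: "ssum d (%L R. F L R - G L R) vs = ssum d F vs - ssum d G vs"
 using ssum_add[of d F "%L R. - 1 *: G L R" vs] ssum_scaleR[of d "-1" G vs] by simp

lemma ssum_minus: "ssum d (%L R. - G L R) vs = - ssum d G vs"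
 using ssum_scaleR[of d "-1" G vs] by simp

lemma ssum_fun_apply: "ssum d F vs x = ssum d (%L R. F L R x) vs"
 by (induction vs arbitrary: F) (simp_all add: plus_fun_def fscale)

lemma ssum_map: "ssum d F (map h vs) = ssum (%x. d (h x)) (%L R. F (map h L) (map h R)) vs"
 by (induction vs arbitrary: F) (simp_all add: o_def)

text \<open>Coassociativity of the unshuffle coproduct: both sides run over the splittings of
  \<open>vs\<close> into three sublists, with the same Koszul sign.\<close>

lemma ssum_coassoc:
 "ssum d (%L R. ssum d (%R1 R2. G L R1 R2) R) vs = ssum d (%K R2. ssum d (%L R1. G L R1 R2) K) vs"
proof (induction vs arbitrary: G)
 case Nil
 thus ?case by simp
next
 case (Cons v vs)
 let ?s = "%L. sum_list (map d L)"
 \<comment> \<open>Moving \<open>v\<close> past \<open>L\<close> and then past \<open>R1\<close>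
   costs the sign of moving it past the whole of \<open>K\<close>.\<close>
 have K: "ssum d (%L R1. (sg (d v * ?s L) * sg (d v * ?s R1)) *: G L R1 (v # R2)) K
   = sg (d v * ?s K) *: ssum d (%L R1. G L R1 (v # R2)) K" for K R2
  unfolding ssum_scaleR[symmetric]
 proof (rule ssum_cong)
  fix L R assume "mset L + mset R = mset K"
  hence "?s K = ?s L + ?s R"
   by (metis mset_append mset_map sum_list_append map_append sum_mset_sum_list)
  thus "(sg (d v * ?s L) * sg (d v * ?s R)) *: G L R (v # R2)
    = sg (d v * ?s K) *: G L R (v # R2)"
   by (simp add: distrib_left sg_add)
 qed
 have "ssum d (%L R. ssum d (%R1 R2. G L R1 R2) R) (v # vs) =
   ssum d (%L R. ssum d (%R1 R2. G (v # L) R1 R2) R) vs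
   + ssum d (%L R. ssum d (%R1 R2. sg (d v * ?s L) *: G L (v # R1) R2) R) vs
   + ssum d (%L R. ssum d (%R1 R2. sg (d v * ?s L) *: sg (d v * ?s R1) *: G L R1 (v # R2)) R) vs"
  by (simp add: scaleR_add_right ssum_add flip: ssum_scaleR)
 also have "... = ssum d (%K R2. ssum d (%L R1. G (v # L) R1 R2) K) vs
   + ssum d (%K R2. ssum d (%L R1. sg (d v * ?s L) *: G L (v # R1) R2) K) vs
   + ssum d (%K R2. ssum d (%L R1. sg (d v * ?s L) *: sg (d v * ?s R1) *: G L R1 (v # R2)) K) vs"
  by (simp only: Cons.IH)
 also have "... = ssum d (%K R2. ssum d (%L R1. G L R1 R2) K) (v # vs)"
  by (simp add: K ssum_add ssum_scaleR)
 finally show ?case .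
qed

text \<open>Graded cocommutativity: exchanging the two halves of a splitting costs the Koszul sign
  of moving one past the other.\<close>

lemma ssum_cocomm:
 "ssum d F vs = ssum d (%L R. sg (sum_list (map d L) * sum_list (map d R)) *: F R L) vs"
proof (induction vs arbitrary: F)
 case Nil
 thus ?case by simp
next
 case (Cons v vs)
 let ?s = "%L. sum_list (map d L)"
 have "ssum d F (v # vs) =
   ssum d (%L R. sg (?s L * ?s R) *: F (v # R) L) vs
   + ssum d (%L R. sg (?s L * ?s R) *: sg (d v * ?s R) *: F R (v # L)) vs"
  using Cons.IH[of "%L R. F (v # L) R"]
   Cons.IH[of "%L R. sg (d v * ?s L) *: F L (v # R)"] by simp
 also have "ssum d (%L R. sg (?s L * ?s R) *: F (v # R) L) vs
   = ssum d (%L R. sg (d v * ?s L) *: sg (?s L * ?s (v # R)) *: F (v # R) L) vs"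
  by (intro ssum_cong) (simp add: sg_def distrib_left algebra_simps)
 also have "ssum d (%L R. sg (?s L * ?s R) *: sg (d v * ?s R) *: F R (v # L)) vs =
   ssum d (%L R. sg (?s (v # L) * ?s R) *: F R (v # L)) vs"
  by (intro ssum_cong) (auto simp: sg_def)
 finally show ?case
  by (simp add: add.commute)
qed

lemma ssum_snoc:
 "ssum d F (vs @ [v]) = ssum d (%L R. F L (R @ [v])) vs
  + ssum d (%L R. sg (d v * sum_list (map d R)) *: F (L @ [v]) R) vs"
proof (induction vs arbitrary: F)
 case Nil
 thus ?case by simp
next
 case (Cons w vs)
 have "ssum d (%L R. sg (d w * sum_list (map d (L @ [v]))) *: sg (d v * sum_list (map d R)) *: F (L @ [v]) (w # R)) vs =
  ssum d (%L R. sg (d w * sum_list (map d L)) *: sg (d v * sum_list (map d (w # R))) *: F (L @ [v]) (w # R)) vs"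
  by (intro ssum_cong) (simp add: sg_def distrib_left algebra_simps)
 thus ?case
  using Cons.IH[of "%L R. F (w # L) R"] Cons.IH[of "%L R. sg (d w * sum_list (map d L)) *: F L (w # R)"]
  by (simp add: scaleR_add_right add_ac mult.commute)
qed

text \<open>Splittings that separate \<open>u\<close> from \<open>v\<close> are matched with each
  other, and their signs already differ by the right factor; only those that keep both in the same
  half use the symmetry of \<open>F\<close>.\<close>

lemma ssum_swap:
 assumes sw1: "!!ls ms R. mset ls + mset ms + {#u,v#} + mset R = mset (xs @ u # v # ys) ==>
   F (ls @ u # v # ms) R = sg (d u * d v) *: F (ls @ v # u # ms) R"
  and sw2: "!!ls ms L. mset ls + mset ms + {#u,v#} + mset L = mset (xs @ u # v # ys) ==>
   F L (ls @ u # v # ms) = sg (d u * d v) *: F L (ls @ v # u # ms)"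
 shows "ssum d F (xs @ u # v # ys) = sg (d u * d v) *: ssum d F (xs @ v # u # ys)"
 using assms
proof (induction xs arbitrary: F)
 case Nil
 let ?s = "%L. sum_list (map d L)"
 have 1: "ssum d (%L R. F (u # v # L) R) ys = sg (d u * d v) *: ssum d (%L R. F (v # u # L) R) ys"
  unfolding ssum_scaleR[symmetric]
  by (intro ssum_cong Nil(1)[of "[]", simplified]) simp
 have 2: "ssum d (%L R. sg (d u * ?s L) *: sg (d v * ?s L) *: F L (u # v # R)) ys
   = sg (d u * d v) *: ssum d (%L R. sg (d u * ?s L) *: sg (d v * ?s L) *: F L (v # u # R)) ys"
  unfolding ssum_scaleR[symmetric]
 proof (intro ssum_cong)
  fix L R assume "mset L + mset R = mset ys"
  hence "F L (u # v # R) = sg (d u * d v) *: F L (v # u # R)"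
   by (intro Nil(2)[of "[]", simplified]) (simp add: add.commute)
  thus "sg (d u * ?s L) *: sg (d v * ?s L) *: F L (u # v # R)
    = sg (d u * d v) *: sg (d u * ?s L) *: sg (d v * ?s L) *: F L (v # u # R)"
   by (simp add: mult_ac)
 qed
 show ?case
  using 2 by (simp add: 1 scaleR_add_right distrib_left sg_add ssum_add mult_ac flip: ssum_scaleR)
next
 case (Cons x xs)
 have a: "ssum d (%L R. F (x # L) R) (xs @ u # v # ys)
   = sg (d u * d v) *: ssum d (%L R. F (x # L) R) (xs @ v # u # ys)"
  by (intro Cons.IH Cons.prems(1)[of "x # _", simplified] Cons.prems(2)) (auto simp: add_ac)
 have b: "ssum d (%L R. sg (d x * sum_list (map d L)) *: F L (x # R)) (xs @ u # v # ys)
   = sg (d u * d v) *: ssum d (%L R. sg (d x * sum_list (map d L)) *: F L (x # R)) (xs @ v # u # ys)"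
 proof (rule Cons.IH)
  fix ls ms R assume *: "mset ls + mset ms + {#u,v#} + mset R = mset (xs @ u # v # ys)"
  have "F (ls @ u # v # ms) (x # R) = sg (d u * d v) *: F (ls @ v # u # ms) (x # R)"
   by (rule Cons.prems(1)) (use * in auto)
  thus "sg (d x * sum_list (map d (ls @ u # v # ms))) *: F (ls @ u # v # ms) (x # R) =
   sg (d u * d v) *: sg (d x * sum_list (map d (ls @ v # u # ms))) *: F (ls @ v # u # ms) (x # R)"
   by (simp add: add_ac mult_ac)
 next
  fix ls ms L assume *: "mset ls + mset ms + {#u,v#} + mset L = mset (xs @ u # v # ys)"
  have "F L ((x # ls) @ u # v # ms) = sg (d u * d v) *: F L ((x # ls) @ v # u # ms)"
   by (rule Cons.prems(2)) (use * in auto)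
  thus "sg (d x * sum_list (map d L)) *: F L (x # ls @ u # v # ms) =
   sg (d u * d v) *: sg (d x * sum_list (map d L)) *: F L (x # ls @ v # u # ms)"
   by (simp add: mult_ac)
 qed
 show ?case by (simp add: a b scaleR_add_right)
qed


section \<open>Koszul signs of permutations, by adjacent transpositions\<close>

definition inversions :: "nat => (nat => nat) => (nat \<times> nat) set" where
 "inversions n si = {(a, b). a < b & b < n & si b < si a}"

lemma finite_inversions [simp]: "finite (inversions n si)"
 by (rule finite_subset[of _ "{..<n} \<times> {..<n}"]) (auto simp: inversions_def)

lemma koszul_sign_eq:
 "koszul_sign ds si = (PROD (a, b):inversions (length ds) si. sg (ds ! si a * ds ! si b))"
 by (simp add: koszul_sign_def inversions_def powi_minus_one)

text \<open>Swapping two neighbours in increasing order creates exactly one inversion, the pair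
  \<open>(k, Suc k)\<close>; all others are transported by the transposition.\<close>

lemma inversions_swap:
 assumes k: "Suc k < n" and lt: "si k < si (Suc k)"
 defines "t == Transposition.transpose k (Suc k)"
 shows "inversions n (si o t) = insert (k, Suc k) ((%(a, b). (t a, t b)) ` inversions n si)"
  and "(k, Suc k) ~: (%(a, b). (t a, t b)) ` inversions n si"
  and "inj_on (%(a, b). (t a, t b)) X"
proof -
 have tt: "t (t a) = a" for a by (simp add: t_def)
 have mono: "t a < t b" if "a < b" "(a, b) ~= (k, Suc k)" for a b
  using that by (auto simp: t_def Transposition.transpose_def)
 have less: "t b < n" if "b < n" for b
  using that k by (auto simp: t_def Transposition.transpose_def)
 have tk: "t k = Suc k" "t (Suc k) = k" by (simp_all add: t_def)
 show "inversions n (si o t) = insert (k, Suc k) ((%(a, b). (t a, t b)) ` inversions n si)"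
 proof (intro equalityI subsetI)
  fix x assume "x : inversions n (si o t)"
  then obtain a b where x: "x = (a, b)" "a < b" "b < n" "si (t b) < si (t a)"
   by (auto simp: inversions_def)
  show "x : insert (k, Suc k) ((%(a, b). (t a, t b)) ` inversions n si)"
  proof (cases "(a, b) = (k, Suc k)")
   case False
   hence "(t a, t b) : inversions n si"
    using x mono less by (auto simp: inversions_def)
   thus ?thesis
    using x(1) by (intro insertI2 image_eqI[of _ _ "(t a, t b)"]) (simp_all add: tt)
  qed (use x in simp)
 next
  fix x assume "x : insert (k, Suc k) ((%(a, b). (t a, t b)) ` inversions n si)"
  thus "x : inversions n (si o t)"
  proof
   assume "x = (k, Suc k)"
   thus ?thesis using k lt tk by (simp add: inversions_def)
  next
   assume "x : (%(a, b). (t a, t b)) ` inversions n si"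
   then obtain a b where ab: "x = (t a, t b)" "a < b" "b < n" "si b < si a"
    by (auto simp: inversions_def)
   hence "(a, b) ~= (k, Suc k)" using lt by auto
   thus ?thesis using ab mono less by (simp add: inversions_def tt)
  qed
 qed
 show "(k, Suc k) ~: (%(a, b). (t a, t b)) ` inversions n si"
 proof
  assume "(k, Suc k) : (%(a, b). (t a, t b)) ` inversions n si"
  then obtain a b where "t a = k" "t b = Suc k" "a < b"
   by (auto simp: inversions_def)
  hence "a = Suc k" "b = k" using tt tk by metis+
  with \<open>a < b\<close> show False by simp
 qed
 show "inj_on (%(a, b). (t a, t b)) X"
  by (rule inj_on_inverseI[of _ "%(a, b). (t a, t b)"]) (auto simp: tt)
qed

lemma permutes_strict_mono_id:
 assumes p: "si permutes {..<n}" and mono: "!!k. Suc k < n ==> si k < si (Suc k)"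
 shows "si = id"
proof -
 have lt: "si a < si b" if "a < b" "b < n" for a b
  using that
 proof (induction b)
  case (Suc b)
  thus ?case using mono[of b] by (cases "a = b") auto
 qed simp
 have "sorted (map si [0..<n])"
  by (auto simp: sorted_iff_nth_mono_less intro!: less_imp_le lt)
 moreover have "distinct (map si [0..<n])"
  by (simp add: distinct_map inj_on_subset[OF permutes_inj[OF p]])
 moreover have "set (map si [0..<n]) = set [0..<n]"
  using permutes_image[OF p] by (simp add: lessThan_atLeast0)
 ultimately have "map si [0..<n] = [0..<n]"
  by (intro sorted_distinct_set_unique) auto
 hence eq: "map si [0..<n] = [0..<n]" .
 have "si k = k" if "k < n" for k
  using arg_cong[OF eq, of "%l. l ! k"] that by simp
 moreover have "si k = k" if "~ k < n" for k
  using permutes_not_in[OF p] that by simp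
 ultimately show ?thesis by (auto simp: fun_eq_iff)
qed

text \<open>Induction on the number of inversions: a permutation without descents is the identity,
  and undoing a descent lowers the number by one. The ascent in the hypothesis of the step makes the
  Koszul sign change by a single factor.\<close>

lemma permutes_adjacent_induct [consumes 1, case_names id swap]:
 assumes "si permutes {..<n}" and "Q id"
  and "!!si k. si permutes {..<n} ==> Suc k < n ==> si k < si (Suc k) ==> Q si ==>
   Q (si o Transposition.transpose k (Suc k))"
 shows "Q si"
 using assms(1)
proof (induction "card (inversions n si)" arbitrary: si rule: less_induct)
 case less
 show ?case
 proof (cases "ALL k. Suc k < n --> si k < si (Suc k)")
  case True
  thus ?thesis using permutes_strict_mono_id[OF less.prems] assms(2) by auto
 next
  case False
  then obtain k where k: "Suc k < n" "si (Suc k) <= si k" by (auto simp: not_less)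
  let ?t = "Transposition.transpose k (Suc k)"
  define tu where "tu = si o ?t"
  have si: "si = tu o ?t" by (auto simp: tu_def fun_eq_iff)
  have tu: "tu permutes {..<n}"
   unfolding tu_def by (intro permutes_compose less.prems permutes_swap_id) (use k in auto)
  have "si (Suc k) ~= si k"
   by (simp add: inj_eq[OF permutes_inj[OF less.prems]])
  hence lt: "tu k < tu (Suc k)" using k by (simp add: tu_def)
  have card: "card (inversions n (tu o ?t)) = Suc (card (inversions n tu))"
   unfolding inversions_swap(1)[OF k(1) lt]
   by (subst card_insert_disjoint[OF _ inversions_swap(2)[OF k(1) lt]])
    (simp_all add: card_image[OF inversions_swap(3)[OF k(1) lt]])
  have "Q tu"
  proof (rule less.hyps[OF _ tu])
   show "card (inversions n tu) < card (inversions n si)"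
    by (subst si) (simp only: card lessI)
  qed
  hence "Q (tu o ?t)" by (intro assms(3) tu k lt)
  thus ?thesis by (simp only: si[symmetric])
 qed
qed

lemma koszul_sign_id [simp]: "koszul_sign ds id = 1" "koszul_sign ds (%x. x) = 1"
proof -
 have "inversions (length ds) id = {}" "inversions (length ds) (%x. x) = {}"
  by (auto simp: inversions_def)
 thus "koszul_sign ds id = 1" "koszul_sign ds (%x. x) = 1" by (simp_all add: koszul_sign_eq)
qed

lemma koszul_sign_swap:
 assumes k: "Suc k < length ds" and lt: "si k < si (Suc k)"
 shows "koszul_sign ds (si o Transposition.transpose k (Suc k)) = sg (ds ! si k * ds ! si (Suc k)) * koszul_sign ds si"
proof -
 let ?t = "Transposition.transpose k (Suc k)"
 let ?h = "%(a, b). (?t a, ?t b)" and ?I = "inversions (length ds) si"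
 have "koszul_sign ds (si o ?t) =
   (PROD (a, b):insert (k, Suc k) (?h ` ?I). sg (ds ! (si o ?t) a * ds ! (si o ?t) b))"
  unfolding koszul_sign_eq inversions_swap(1)[where si = si, OF k lt] ..
 also have "... = sg (ds ! si (Suc k) * ds ! si k) *
   (PROD (a, b):?h ` ?I. sg (ds ! (si o ?t) a * ds ! (si o ?t) b))"
  using inversions_swap(2)[where si = si, OF k lt] by (subst prod.insert) simp_all
 also have "(PROD (a, b):?h ` ?I. sg (ds ! (si o ?t) a * ds ! (si o ?t) b)) = koszul_sign ds si"
  unfolding koszul_sign_eq by (subst prod.reindex[OF inversions_swap(3)[OF k lt]])
   (simp add: o_def case_prod_unfold)
 finally show ?thesis by (simp add: mult.commute o_def)
qed

text \<open>The ordinary sign is the Koszul sign of elements that all have degree 1; this lets the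
  Schouten bracket share the calculus of \<open>ssum\<close>.\<close>

lemma sign_eq_koszul_sign:
 assumes "si permutes {..<n}"
 shows "of_int (sign si) = koszul_sign (replicate n 1) si"
 using assms
proof (induction rule: permutes_adjacent_induct)
 case id
 thus ?case by simp
next
 case (swap si k)
 have "permutation si" "permutation (Transposition.transpose k (Suc k))"
  using permutes_imp_permutation[OF _ swap(1)] by (simp_all add: permutation_swap_id)
 hence 1: "sign (si o Transposition.transpose k (Suc k)) = - sign si"
  by (simp add: sign_compose sign_swap_id)
 have "si k < n" "si (Suc k) < n"
  using permutes_in_image[OF swap(1)] swap(2) by simp_all
 hence 2: "koszul_sign (replicate n 1) (si o Transposition.transpose k (Suc k)) =
   - koszul_sign (replicate n 1) si"
  using swap(2) by (subst koszul_sign_swap) (simp_all add: swap(3))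
 show ?case
  unfolding 1 2 using swap(4) by simp
qed

lemma plist_swap:
 assumes si: "si permutes {..<length vs}" and k: "Suc k < length vs"
 obtains xs ys where "plist si vs = xs @ vs ! si k # vs ! si (Suc k) # ys"
  "plist (si o Transposition.transpose k (Suc k)) vs = xs @ vs ! si (Suc k) # vs ! si k # ys"
proof
 let ?p = "plist si vs" and ?q = "plist (si o Transposition.transpose k (Suc k)) vs"
 have "?p = take k ?p @ ?p ! k # ?p ! Suc k # drop (Suc (Suc k)) ?p"
  using k by (metis Cons_nth_drop_Suc Suc_lessD append_take_drop_id length_permute_list)
 thus "?p = take k ?p @ vs ! si k # vs ! si (Suc k) # drop (Suc (Suc k)) ?p"
  using k by (simp add: permute_list_def)
 have "?q = take k ?q @ ?q ! k # ?q ! Suc k # drop (Suc (Suc k)) ?q"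
  using k by (metis Cons_nth_drop_Suc Suc_lessD append_take_drop_id length_permute_list)
 moreover have "take k ?q = take k ?p" "drop (Suc (Suc k)) ?q = drop (Suc (Suc k)) ?p"
  using k by (auto intro!: nth_equalityI simp: permute_list_def)
 ultimately show "?q = take k ?p @ vs ! si (Suc k) # vs ! si k # drop (Suc (Suc k)) ?p"
  using k by (simp add: permute_list_def)
qed

text \<open>Symmetry has to be checked for neighbouring entries only; the general sign accumulates
  one inversion at a time.\<close>

lemma koszul_symmetric:
 assumes adj: "!!xs u v ys. mset (xs @ u # v # ys) = mset vs ==>
   f (xs @ u # v # ys) = sg (d u * d v) *: f (xs @ v # u # ys)"
  and si: "si permutes {..<length vs}"
 shows "f vs = koszul_sign (map d vs) si *: (f (plist si vs) :: 'b::real_vector)"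
 using si
proof (induction rule: permutes_adjacent_induct)
 case id
 thus ?case by simp
next
 case (swap si k)
 obtain xs ys where p: "plist si vs = xs @ vs ! si k # vs ! si (Suc k) # ys"
  "plist (si o Transposition.transpose k (Suc k)) vs = xs @ vs ! si (Suc k) # vs ! si k # ys"
  using plist_swap[OF swap(1,2)] by metis
 have "mset (plist si vs) = mset vs"
  using swap(1) by simp
 hence 1: "f (plist si vs) = sg (d (vs ! si k) * d (vs ! si (Suc k))) *:
   f (plist (si o Transposition.transpose k (Suc k)) vs)"
  unfolding p by (rule adj)
 have "si k < length vs" "si (Suc k) < length vs"
  using permutes_in_image[OF swap(1)] swap(2) by simp_all
 hence 2: "koszul_sign (map d vs) (si o Transposition.transpose k (Suc k)) =
   sg (d (vs ! si k) * d (vs ! si (Suc k))) * koszul_sign (map d vs) si"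
  using swap(2) by (subst koszul_sign_swap) (simp_all add: swap(3))
 show ?case
  unfolding 2 using swap(4) unfolding 1 by (simp only: scaleR_scaleR mult.commute)
qed

section \<open>Unshuffles as sets of positions\<close>

lemma nths_eq_map_filter: "nths xs I = map ((!) xs) (filter (%i. i : I) [0..<length xs])"
proof -
 have "nths [0..<n] I = filter (%i. i : I) [0..<n]" for n
  by (induction n) (simp_all add: nths_append)
 thus ?thesis
  by (metis map_nth nths_map)
qed

text \<open>Splittings of a list are indexed by the set of positions going to the first sublist.\<close>

definition cut_sign :: "int list => nat set => real" where
 "cut_sign ds I = (PROD (x, y):{(x, y). x < y & y < length ds & x ~: I & y : I}. sg (ds ! x * ds ! y))"

lemma sum_Pow_Suc:
 fixes G :: "nat set => 'b::comm_monoid_add"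
 shows "(SUM I:Pow {..<Suc n}. G I) = (SUM J:Pow {..<n}. G (insert 0 (Suc ` J))) + (SUM J:Pow {..<n}. G (Suc ` J))"
proof -
 let ?A = "(%J. Suc ` J) ` Pow {..<n}"
 have S: "{..<Suc n} = insert 0 (Suc ` {..<n})" by (rule lessThan_Suc_eq_insert_0)
 have A: "Pow (Suc ` {..<n}) = ?A" by (simp add: image_Pow_surj)
 have inj: "inj_on (insert 0) ?A" "inj_on ((`) Suc) X" for X
  by (force simp: inj_on_def inj_image_eq_iff)+
 have "Pow {..<Suc n} = ?A Un insert 0 ` ?A" "?A Int insert 0 ` ?A = {}"
  unfolding S by (auto simp: Pow_insert A)
 hence "(SUM I:Pow {..<Suc n}. G I) = (SUM I:?A. G I) + (SUM I:insert 0 ` ?A. G I)"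
  by (simp add: sum.union_disjoint)
 thus ?thesis
  by (simp only: sum.reindex[OF inj(1)] sum.reindex[OF inj(2)] o_def add.commute)
qed

text \<open>The two equations mirror the recursion of \<open>ssum\<close>: a new position 0 in the
  first part adds no crossing, while in the second part it is crossed by every element of the
  first.\<close>

lemma cut_sign_Suc:
 "cut_sign (e # ds) (Suc ` J) = sg (e * sum_list (nths ds J)) * cut_sign ds J"
 "cut_sign (e # ds) (insert 0 (Suc ` J)) = cut_sign ds J"
proof -
 let ?T = "%ds I. {(x, y). x < y & y < length ds & x ~: I & y : (I :: nat set)}"
 let ?h = "%(x, y). (Suc x, Suc y)"
 have fin: "finite (?T ds I)" for ds :: "int list" and I
  by (rule finite_subset[of _ "{..<length ds} \<times> {..<length ds}"]) auto
 have inj: "inj_on ?h X" for X by (auto simp: inj_on_def)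
 have "?T (e # ds) (insert 0 (Suc ` J)) = ?h ` ?T ds J"
 proof (intro equalityI subsetI)
  fix z assume "z : ?T (e # ds) (insert 0 (Suc ` J))"
  then obtain x y where "z = (Suc x, Suc y)" "(x, y) : ?T ds J"
   by (cases z; cases "fst z"; cases "snd z") auto
  thus "z : ?h ` ?T ds J" by force
 qed auto
 hence "cut_sign (e # ds) (insert 0 (Suc ` J)) =
   (PROD (x, y):?h ` ?T ds J. sg ((e # ds) ! x * (e # ds) ! y))"
  unfolding cut_sign_def by (rule arg_cong)
 also have "... = cut_sign ds J"
  unfolding cut_sign_def by (subst prod.reindex[OF inj]) (simp add: case_prod_unfold o_def)
 finally show "cut_sign (e # ds) (insert 0 (Suc ` J)) = cut_sign ds J" .
 \<comment> \<open>The crossings that involve the new position 0; their signs multiply to the extra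
   factor.\<close>
 let ?Z = "(%y. (0, Suc y)) ` {y:J. y < length ds}"
 have "?T (e # ds) (Suc ` J) = ?h ` ?T ds J Un ?Z"
 proof (intro equalityI subsetI)
  fix z assume z: "z : ?T (e # ds) (Suc ` J)"
  obtain x y where xy: "z = (x, y)" by (cases z)
  then obtain y' where y': "y = Suc y'" "y' : J" "y' < length ds" using z by auto
  show "z : ?h ` ?T ds J Un ?Z"
  proof (cases x)
   case 0
   thus ?thesis using xy y' by auto
  next
   case (Suc x')
   hence "(x', y') : ?T ds J" using z xy y' by auto
   thus ?thesis using xy y' Suc by force
  qed
 qed auto
 hence "cut_sign (e # ds) (Suc ` J) =
   (PROD (x, y):?h ` ?T ds J Un ?Z. sg ((e # ds) ! x * (e # ds) ! y))"
  unfolding cut_sign_def by (rule arg_cong)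
 also have "... = (PROD (x, y):?h ` ?T ds J. sg ((e # ds) ! x * (e # ds) ! y)) *
   (PROD (x, y):?Z. sg ((e # ds) ! x * (e # ds) ! y))"
  by (rule prod.union_disjoint[OF finite_imageI[OF fin]]) auto
 also have "(PROD (x, y):?h ` ?T ds J. sg ((e # ds) ! x * (e # ds) ! y)) = cut_sign ds J"
  unfolding cut_sign_def by (subst prod.reindex[OF inj]) (simp add: case_prod_unfold o_def)
 also have "(PROD (x, y):?Z. sg ((e # ds) ! x * (e # ds) ! y)) = (PROD y:{y:J. y < length ds}. sg (e * ds ! y))"
  by (subst prod.reindex) (auto simp: inj_on_def)
 also have "... = sg (SUM y:{y:J. y < length ds}. e * ds ! y)"
 proof -
  have "finite {y:J. y < length ds}" by simp
  thus ?thesis by (induction rule: finite_induct) (simp_all add: sg_add)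
 qed
 also have "(SUM y:{y:J. y < length ds}. e * ds ! y) = e * sum_list (nths ds J)"
 proof -
  have "sum_list (nths ds J) = (\<Sum>y\<leftarrow>filter (%y. y : J) [0..<length ds]. ds ! y)"
   by (simp add: nths_eq_map_filter)
  thus ?thesis
   by (simp add: sum_list_distinct_conv_sum_set sum_distrib_left conj_commute)
 qed
 finally show "cut_sign (e # ds) (Suc ` J) = sg (e * sum_list (nths ds J)) * cut_sign ds J"
  by (simp add: mult.commute)
qed

lemma ssum_eq_sum_Pow:
 "ssum d F vs = (SUM I:Pow {..<length vs}. cut_sign (map d vs) I *: F (nths vs I) (nths vs (- I)))"
proof (induction vs arbitrary: F)
 case Nil
 thus ?case by (simp add: cut_sign_def)
next
 case (Cons v vs)
 have 1: "{j. Suc j : Suc ` J} = J" "{j. Suc j : - Suc ` J} = - J"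
  "{j. Suc j : - insert 0 (Suc ` J)} = - J" "{j. Suc j : insert 0 (Suc ` J)} = J" for J by auto
 show ?case
  unfolding ssum.simps Cons.IH list.size add_0_right add_Suc_right sum_Pow_Suc list.map cut_sign_Suc nths_Cons 1
  by (simp add: nths_map mult.commute)
qed

lemma sorted_map_strict_mono_on:
 assumes "strict_mono_on {i..<n} (si :: nat => nat)"
 shows "sorted (map si [i..<n])" "distinct (map si [i..<n])"
proof -
 show "sorted (map si [i..<n])"
  by (auto simp: sorted_iff_nth_mono_less intro!: less_imp_le strict_mono_onD[OF assms])
 show "distinct (map si [i..<n])"
  using strict_mono_on_imp_inj_on[OF assms] by (simp add: distinct_map)
qed

lemma unshuffle_lists:
 assumes si: "si : unshuffles i n" and i: "i <= n"
 defines "I == si ` {..<i}"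
 shows "map si [0..<i] = filter (%k. k : I) [0..<n]"
  and "map si [i..<n] = filter (%k. k : - I) [0..<n]"
  and "I <= {..<n}" "card I = i" "si ` {i..<n} = {..<n} - I"
proof -
 have p: "si permutes {..<n}" and m1: "strict_mono_on {0..<i} si" and m2: "strict_mono_on {i..<n} si"
  using si by (auto simp: unshuffles_def lessThan_atLeast0)
 have inj: "inj si" by (rule permutes_inj[OF p])
 have im: "si ` {..<n} = {..<n}" by (rule permutes_image[OF p])
 show sub: "I <= {..<n}" using im i by (auto simp: I_def)
 show "card I = i" using inj by (simp add: I_def card_image inj_on_subset)
 have "{..<n} = {..<i} Un {i..<n}" using i by auto
 hence "{..<n} = I Un si ` {i..<n}" using im by (metis I_def image_Un)
 moreover have "I Int si ` {i..<n} = {}"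
  unfolding I_def by (subst image_Int[OF inj, symmetric]) auto
 ultimately show im2: "si ` {i..<n} = {..<n} - I" by auto
 show "map si [0..<i] = filter (%k. k : I) [0..<n]"
  by (rule sorted_distinct_set_unique)
   (use sorted_map_strict_mono_on[OF m1] sub in \<open>auto simp: I_def sorted_wrt_filter image_subset_iff\<close>)
 show "map si [i..<n] = filter (%k. k : - I) [0..<n]"
  by (rule sorted_distinct_set_unique)
   (use sorted_map_strict_mono_on[OF m2] im2 in \<open>auto simp: sorted_wrt_filter\<close>)
qed

text \<open>An unshuffle is increasing on both blocks, so the image of the first block determines
  it; conversely a set of \<open>i\<close> positions and its complement, each listed in order,
  define one.\<close>

lemma bij_betw_unshuffles:
 assumes i: "i <= n"
 shows "bij_betw (%si. si ` {..<i}) (unshuffles i n) {I:Pow {..<n}. card I = i}"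
 unfolding bij_betw_def
proof (intro conjI equalityI subsetI)
 show "inj_on (%si. si ` {..<i}) (unshuffles i n)"
 proof (rule inj_onI)
  fix si tu assume si: "si : unshuffles i n" and tu: "tu : unshuffles i n" and eq: "si ` {..<i} = tu ` {..<i}"
  have "map si [0..<i] = map tu [0..<i]" "map si [i..<n] = map tu [i..<n]"
   using unshuffle_lists(1,2)[OF si i] unshuffle_lists(1,2)[OF tu i] eq by simp_all
  hence "si k = tu k" if "k < n" for k
   using that by (cases "k < i") (auto simp: map_eq_conv)
  moreover have "si k = tu k" if "~ k < n" for k
   using si tu that by (auto simp: unshuffles_def permutes_def)
  ultimately show "si = tu" by (auto simp: fun_eq_iff)
 qed
next
 fix I assume "I : (%si. si ` {..<i}) ` unshuffles i n"
 thus "I : {I:Pow {..<n}. card I = i}" using unshuffle_lists(3,4)[OF _ i] by auto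
next
 fix I assume I: "I : {I:Pow {..<n}. card I = i}"
 define l1 where "l1 = filter (%k. k : I) [0..<n]"
 define l2 where "l2 = filter (%k. k : - I) [0..<n]"
 have s1: "set l1 = I" and s2: "set l2 = {..<n} - I" using I by (auto simp: l1_def l2_def)
 have len1: "length l1 = i" using I s1 distinct_card[of l1] by (auto simp: l1_def)
 have dl: "distinct (l1 @ l2)" by (auto simp: l1_def l2_def)
 have set12: "set (l1 @ l2) = {..<n}" using s1 s2 I by auto
 have len: "length (l1 @ l2) = n" using distinct_card[OF dl] set12 by simp
 have st: "sorted_wrt (<) l1" "sorted_wrt (<) l2"
  unfolding l1_def l2_def by (auto intro: sorted_wrt_filter)
 have so: "l1 ! a < l1 ! b" if "a < b" "b < i" for a b
  using that len1 st(1) by (simp add: sorted_wrt_nth_less)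
 have so2: "l2 ! a < l2 ! b" if "a < b" "b < n - i" for a b
  using that len len1 st(2) by (simp add: sorted_wrt_nth_less)
 define si where "si k = (if k < n then (l1 @ l2) ! k else k)" for k
 have "bij_betw (%k. (l1 @ l2) ! k) {..<n} {..<n}"
  using bij_betw_nth[OF dl _ refl] set12 len by simp
 hence "bij_betw si {..<n} {..<n}"
  by (rule bij_betw_cong[THEN iffD1, rotated]) (simp add: si_def)
 hence p: "si permutes {..<n}"
  by (rule bij_imp_permutes) (simp add: si_def)
 have "strict_mono_on {..<i} si"
  using so i by (auto simp: strict_mono_on_def si_def nth_append len1)
 moreover have "strict_mono_on {i..<n} si"
  using i by (auto simp: strict_mono_on_def si_def nth_append len1 intro!: so2)
 ultimately have "si : unshuffles i n" using p by (simp add: unshuffles_def)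
 moreover have "si ` {..<i} = I"
 proof -
  have "si ` {..<i} = (%k. l1 ! k) ` {..<i}"
   using i by (intro image_cong) (auto simp: si_def nth_append len1)
  also have "... = set l1" using len1 by (auto simp: set_conv_nth)
  finally show ?thesis by (simp add: s1)
 qed
 ultimately show "I : (%si. si ` {..<i}) ` unshuffles i n" by auto
qed

text \<open>Inversions of an unshuffle occur only between its two blocks, and they are exactly the
  pairs counted by \<open>cut_sign\<close>.\<close>

lemma koszul_sign_unshuffle:
 assumes si: "si : unshuffles i (length ds)" and i: "i <= length ds"
 shows "koszul_sign ds si = cut_sign ds (si ` {..<i})"
proof -
 let ?n = "length ds" and ?I = "si ` {..<i}"
 have p: "si permutes {..<?n}" and m1: "strict_mono_on {..<i} si" and m2: "strict_mono_on {i..<?n} si"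
  using si by (auto simp: unshuffles_def)
 have inj: "inj si" by (rule permutes_inj[OF p])
 note im = unshuffle_lists(5)[OF si i]
 have block: "a < i & i <= b" if "a < b" "b < ?n" "si b < si a" for a b
 proof (rule ccontr)
  assume "~ (a < i & i <= b)"
  then consider "b < i" | "i <= a" using that by linarith
  hence "si a < si b"
  proof cases
   case 1
   thus ?thesis using that(1) by (intro strict_mono_onD[OF m1]) auto
  next
   case 2
   thus ?thesis using that(1,2) by (intro strict_mono_onD[OF m2]) auto
  qed
  with that show False by simp
 qed
 let ?h = "%(a, b). (si b, si a)"
 have "{(x, y). x < y & y < ?n & x ~: ?I & y : ?I} = ?h ` inversions ?n si"
 proof (intro equalityI subsetI)
  fix z assume "z : {(x, y). x < y & y < ?n & x ~: ?I & y : ?I}"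
  then obtain x y where z: "z = (x, y)" "x < y" "y < ?n" "x ~: ?I" "y : ?I" by auto
  then obtain a where a: "y = si a" "a < i" by auto
  have "x : si ` {i..<?n}" using im z by auto
  then obtain b where b: "x = si b" "i <= b" "b < ?n" by auto
  show "z : ?h ` inversions ?n si"
   using z a b by (intro image_eqI[of _ _ "(a, b)"]) (auto simp: inversions_def)
 next
  fix z assume "z : ?h ` inversions ?n si"
  then obtain a b where z: "z = (si b, si a)" "a < b" "b < ?n" "si b < si a"
   by (auto simp: inversions_def)
  hence ab: "a < i" "i <= b" using block by auto
  have "si b : si ` {i..<?n}" using z ab by auto
  hence "si b ~: ?I" using im by auto
  moreover have "si a < ?n" using permutes_in_image[OF p, of a] z by auto
  ultimately show "z : {(x, y). x < y & y < ?n & x ~: ?I & y : ?I}" using z ab by auto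
 qed
 moreover have "inj_on ?h X" for X by (rule inj_onI) (auto simp: inj_eq[OF inj])
 ultimately have "cut_sign ds ?I = (PROD z:inversions ?n si. case ?h z of (x, y) => sg (ds ! x * ds ! y))"
  unfolding cut_sign_def by (simp only: prod.reindex o_def)
 thus ?thesis
  by (simp add: koszul_sign_eq case_prod_unfold mult.commute)
qed

lemma take_permute_unshuffle:
 assumes si: "si : unshuffles i (length vs)" and i: "i <= length vs"
 shows "take i (plist si vs) = nths vs (si ` {..<i})"
  and "drop i (plist si vs) = nths vs (- (si ` {..<i}))"
proof -
 have "plist si vs = map ((!) vs) (map si [0..<length vs])"
  by (simp add: permute_list_def)
 moreover have "take i [0..<length vs] = [0..<i]" "drop i [0..<length vs] = [i..<length vs]"
  using i by simp_all
 ultimately show "take i (plist si vs) = nths vs (si ` {..<i})"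
  "drop i (plist si vs) = nths vs (- (si ` {..<i}))"
  unfolding nths_eq_map_filter using unshuffle_lists(1,2)[OF si i]
  by (simp_all only: take_map drop_map)
qed

text \<open>The lower bound \<open>m\<close> is 1 for the L-infinity relations, where the inner
  bracket has at least one argument, and 0 for the Schouten bracket.\<close>

lemma sum_unshuffles:
 "(SUM i:{m..length vs}. SUM si:unshuffles i (length vs). koszul_sign (map d vs) si *:
   F (take i (plist si vs)) (drop i (plist si vs)))
  = ssum d (%L R. if length L >= m then F L R else 0) vs"
proof -
 let ?n = "length vs"
 let ?H = "%I. cut_sign (map d vs) I *: F (nths vs I) (nths vs (- I))"
 have "(SUM si:unshuffles i ?n. koszul_sign (map d vs) si *:
   F (take i (plist si vs)) (drop i (plist si vs)))
   = (SUM I:{I:Pow {..<?n}. card I = i}. ?H I)" if "i <= ?n" for i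
  using that
  by (intro sum.reindex_bij_betw_not_neutral[of "{}" "{}", simplified] sum.reindex_bij_betw[OF bij_betw_unshuffles[OF that], THEN trans[rotated]] sum.cong)
   (simp_all add: take_permute_unshuffle koszul_sign_unshuffle)
 hence "(SUM i:{m..length vs}. SUM si:unshuffles i (length vs). koszul_sign (map d vs) si *:
   F (take i (plist si vs)) (drop i (plist si vs)))
  = (SUM i:{m..?n}. SUM I:{I:Pow {..<?n}. card I = i}. ?H I)"
  by (intro sum.cong) auto
 also have "... = (SUM i:{m..?n}. SUM I:{I:{I:Pow {..<?n}. m <= card I}. card I = i}. ?H I)"
  by (intro sum.cong) auto
 also have "... = (SUM I:{I:Pow {..<?n}. m <= card I}. ?H I)"
 proof (rule sum.group)
  show "card ` {I:Pow {..<?n}. m <= card I} <= {m..?n}"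
   using card_mono[of "{..<?n}"] by fastforce
 qed auto
 also have "... = (SUM I:Pow {..<?n}. if m <= card I then ?H I else 0)"
  by (intro sum.inter_filter) simp
 also have "... = ssum d (%L R. if length L >= m then F L R else 0) vs"
  unfolding ssum_eq_sum_Pow
 proof (intro sum.cong refl)
  fix I assume "I : Pow {..<?n}"
  hence "{i. i < ?n & i : I} = I" by auto
  hence "length (nths vs I) = card I" by (simp add: length_nths)
  thus "(if m <= card I then ?H I else 0) = cut_sign (map d vs) I *:
   (if m <= length (nths vs I) then F (nths vs I) (nths vs (- I)) else 0)"
   by simp
 qed
 finally show ?thesis .
qed

lemma schouten_eq_ssum:
 "schouten X Y fs = ssum (%_. 1) (%L R. sg (int (length R) * (int (length L) - 1)) *: X (Y L # R)
   - Y (X L # R)) fs"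
proof -
 let ?n = "length fs"
 have "schouten X Y fs = (SUM i:{0..?n}. SUM si:unshuffles i ?n. koszul_sign (map (%_. 1) fs) si *:
  (sg (int (length (drop i (plist si fs))) * (int (length (take i (plist si fs))) - 1)) *:
    X (Y (take i (plist si fs)) # drop i (plist si fs))
   - Y (X (take i (plist si fs)) # drop i (plist si fs))))"
  unfolding schouten_def atMost_atLeast0
  by (intro sum.cong refl)
   (auto simp: Let_def unshuffles_def map_replicate_const sign_eq_koszul_sign powi_minus_one of_nat_diff min_def)
 also have "... = ssum (%_. 1) (%L R. if length L >= 0 then sg (int (length R) * (int (length L) - 1)) *: X (Y L # R)
   - Y (X L # R) else 0) fs"
  by (rule sum_unshuffles[where F = "%L R. sg (int (length R) * (int (length L) - 1)) *: X (Y L # R)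
   - Y (X L # R)"])
 finally show ?thesis by simp
qed

section \<open>Higher derived brackets\<close>

text \<open>The three entries must have equal degrees because these enter the signs of the
  recursion.\<close>

lemma ssum_linear_slot:
 assumes "d w = d u" "d w = d v"
  and "!!ls ms R. mset ls + mset ms + mset R = mset xs + mset ys ==>
   F (ls @ w # ms) R = r *: F (ls @ u # ms) R + s *: F (ls @ v # ms) R"
  and "!!ls ms L. mset ls + mset ms + mset L = mset xs + mset ys ==>
   F L (ls @ w # ms) = r *: F L (ls @ u # ms) + s *: F L (ls @ v # ms)"
 shows "ssum d F (xs @ w # ys) = r *: ssum d F (xs @ u # ys) + s *: ssum d F (xs @ v # ys)"
 using assms(3,4)
proof (induction xs arbitrary: F)
 case Nil
 have 1: "ssum d (%L R. F (w # L) R) ys = r *: ssum d (%L R. F (u # L) R) ys + s *: ssum d (%L R. F (v # L) R) ys"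
  unfolding ssum_scaleR[symmetric] ssum_add[symmetric]
  by (intro ssum_cong Nil(1)[of "[]", simplified]) simp
 have 2: "ssum d (%L R. sg (d w * sum_list (map d L)) *: F L (w # R)) ys =
   r *: ssum d (%L R. sg (d w * sum_list (map d L)) *: F L (u # R)) ys
  + s *: ssum d (%L R. sg (d w * sum_list (map d L)) *: F L (v # R)) ys"
  unfolding ssum_scaleR[symmetric] ssum_add[symmetric]
 proof (intro ssum_cong)
  fix L R assume "mset L + mset R = mset ys"
  hence "F L (w # R) = r *: F L (u # R) + s *: F L (v # R)"
   by (intro Nil(2)[of "[]", simplified]) (simp add: add.commute)
  thus "sg (d w * sum_list (map d L)) *: F L (w # R) =
    r *: sg (d w * sum_list (map d L)) *: F L (u # R) +
    s *: sg (d w * sum_list (map d L)) *: F L (v # R)"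
   by (simp add: scaleR_add_right mult.commute)
 qed
 show ?case
  by (simp add: 1 2 flip: assms(1,2)) (simp add: scaleR_add_right)
next
 case (Cons x xs)
 have 1: "ssum d (%L R. F (x # L) R) (xs @ w # ys) = r *: ssum d (%L R. F (x # L) R) (xs @ u # ys)
   + s *: ssum d (%L R. F (x # L) R) (xs @ v # ys)"
  by (intro Cons.IH Cons.prems(1)[of "x # _", simplified] Cons.prems(2)) (auto simp: add_ac)
 let ?G = "%L R. sg (d x * sum_list (map d L)) *: F L (x # R)"
 have 2: "ssum d ?G (xs @ w # ys) = r *: ssum d ?G (xs @ u # ys) + s *: ssum d ?G (xs @ v # ys)"
 proof (rule Cons.IH)
  fix ls ms R assume *: "mset ls + mset ms + mset R = mset xs + mset ys"
  have "F (ls @ w # ms) (x # R) = r *: F (ls @ u # ms) (x # R) + s *: F (ls @ v # ms) (x # R)"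
   by (rule Cons.prems(1)) (use * in auto)
  thus "?G (ls @ w # ms) R = r *: ?G (ls @ u # ms) R + s *: ?G (ls @ v # ms) R"
   by (simp add: scaleR_add_right mult.commute assms(1)[symmetric] assms(2)[symmetric])
 next
  fix ls ms L assume *: "mset ls + mset ms + mset L = mset xs + mset ys"
  have "F L ((x # ls) @ w # ms) = r *: F L ((x # ls) @ u # ms) + s *: F L ((x # ls) @ v # ms)"
   by (rule Cons.prems(2)) (use * in auto)
  thus "?G L (ls @ w # ms) = r *: ?G L (ls @ u # ms) + s *: ?G L (ls @ v # ms)"
   by (simp add: scaleR_add_right mult.commute)
 qed
 show ?case by (simp add: 1 2 scaleR_add_right)
qed

lemma ssum_Nil_left: "ssum d (%L R. if L = [] then G R else 0) vs = G vs"
proof (induction vs arbitrary: G)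
 case (Cons v vs)
 have "ssum d (%L R. sg (d v * sum_list (map d L)) *: (if L = [] then G (v # R) else 0)) vs =
  ssum d (%L R. if L = [] then G (v # R) else 0) vs"
  by (intro ssum_cong) simp
 thus ?case using Cons.IH by simp
qed simp

text \<open>Signs depend on degrees, and the vector 0 lies in every degree. Carrying the degree
  along with the pair \<open>(X, a)\<close> keeps the sign calculations free of choices.\<close>

type_synonym 'l typed = "int \<times> 'l \<times> 'l"

abbreviation tX :: "'l typed => 'l" where "tX t == fst (snd t)"
abbreviation ta :: "'l typed => 'l" where "ta t == snd (snd t)"
abbreviation tdeg :: "'l typed list => int" where "tdeg ts == sum_list (map fst ts)"

lemma tdeg_mset: "mset L + mset R = mset ts ==> tdeg ts = tdeg L + tdeg R"
 by (metis mset_append mset_map sum_list_append map_append sum_mset_sum_list)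

lemma set_split_mset: "mset L + mset R = mset ts ==> set ts = set L Un set R"
 by (metis mset_append set_append set_mset_mset)

text \<open>Voronov's data with three graded spaces. Degrees are those of the shifted Lie algebra: a
  k-vector field has degree k - 1, and \<open>q\<close> has degree 1. \<open>P_br\<close> expresses,
  for a projection onto an abelian subalgebra, that the kernel is closed under the bracket. A
  bracket of an element of \<open>K\<close> with one of \<open>A\<close> is only asked to lie in
  \<open>L\<close>.\<close>

locale derived_brackets =
 fixes L A K :: "int => 'l::real_vector set" and br :: "'l => 'l => 'l" and P :: "'l => 'l" and q :: 'l
 assumes subspace_L: "subspace (L i)"
  and graded_A: "graded_space A" and graded_K: "graded_space K"
  and A_sub: "A i <= L i" and K_sub: "K i <= L i"
  and br_L: "x : L i ==> y : L j ==> br x y : L (i + j)"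
  and br_K: "x : K i ==> y : K j ==> br x y : K (i + j)"
  and br_lin: "x : L i ==> y : L i ==> z : L j ==> br (r *: x + s *: y) z = r *: br x z + s *: br y z"
  and br_anti: "x : L i ==> y : L j ==> br x y = - (sg (i * j) *: br y x)"
  and jacobi: "x : L i ==> y : L j ==> z : L k ==>
   br (br x y) z = br x (br y z) + sg (j * k) *: br (br x z) y"
  and P_A: "x : L i ==> P x : A i"
  and P_lin: "x : L i ==> y : L i ==> P (r *: x + s *: y) = r *: P x + s *: P y"
  and abelian: "a : A i ==> b : A j ==> br a b = 0"
  and P_br: "x : L i ==> y : L j ==> P (br x y) = P (br (P x) y) + P (br x (P y))"
  and q: "q : K 1" "br q q = 0" "P q = 0"
begin

abbreviation W :: "int => ('l \<times> 'l) set" where "W i == K (i + 1) \<times> A i"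

lemma subspace_A: "subspace (A i)" and subspace_K: "subspace (K i)"
 using graded_A graded_K by (auto simp: graded_space_def)

lemma zero_mem [simp]: "0 : L i" "0 : A i" "0 : K i"
 using subspace_L subspace_A subspace_K subspace_0 by auto

lemma A_L: "a : A i ==> a : L i" and K_L: "x : K i ==> x : L i"
 using A_sub K_sub by auto

lemma L_lin: "x : L i ==> y : L i ==> r *: x + s *: y : L i"
 by (intro subspace_add subspace_scale subspace_L)

lemma br_zero_left [simp]: "z : L j ==> br 0 z = 0"
 using br_lin[of 0 0 0 z j 0 0] by simp

lemma br_zero_right [simp]: "z : L j ==> br z 0 = 0"
 using br_anti[of z j 0 0] by simp

lemma br_lin_right:
 assumes "x : L i" "y : L i" "z : L j"
 shows "br z (r *: x + s *: y) = r *: br z x + s *: br z y"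
 using br_anti[OF assms(3) L_lin[OF assms(1,2)]] br_anti[OF assms(3,1)] br_anti[OF assms(3,2)]
  br_lin[OF assms] by (simp add: scaleR_add_right mult.commute)

lemma P_zero [simp]: "P 0 = 0"
 using P_lin[of 0 0 0 0 0] by simp

definition act :: "'l => 'l typed list => 'l" where
 "act x ts = foldl br x (map ta ts)"

lemma act_simps [simp]: "act x [] = x" "act x (t # ts) = act (br x (ta t)) ts"
 "act x (ts @ us) = act (act x ts) us"
 by (simp_all add: act_def)

definition aok :: "'l typed list => bool" where
 "aok ts \<longleftrightarrow> (ALL t:set ts. ta t : A (fst t))"

lemma aok_simps [simp]: "aok []" "aok (t # ts) \<longleftrightarrow> ta t : A (fst t) & aok ts" "aok (ts @ us) \<longleftrightarrow> aok ts & aok us"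
 by (auto simp: aok_def)

lemma aok_mset: "mset ts = mset us ==> aok ts \<longleftrightarrow> aok us"
 unfolding aok_def by (metis set_mset_mset)

lemma aok_split: "aok ts ==> mset Ls + mset R = mset ts ==> aok Ls & aok R"
 using aok_mset[of "Ls @ R" ts] by simp

lemma act_L: "x : L i ==> aok ts ==> act x ts : L (i + tdeg ts)"
proof (induction ts arbitrary: x i)
 case (Cons t ts)
 thus ?case using Cons.IH[of "br x (ta t)" "i + fst t"] br_L A_L by (simp add: add.assoc)
qed simp

lemma act_lin:
 "x : L i ==> y : L i ==> aok ts ==> act (r *: x + s *: y) ts = r *: act x ts + s *: act y ts"
proof (induction ts arbitrary: x y i)
 case (Cons t ts)
 thus ?case using Cons.IH[of "br x (ta t)" "i + fst t" "br y (ta t)"] br_L A_L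
  by (simp add: br_lin[of _ i _ _ "fst t"])
qed simp

lemma act_scale: "x : L i ==> aok ts ==> act (r *: x) ts = r *: act x ts"
 using act_lin[of x i x ts r 0] by simp

lemma act_zero [simp]: "aok ts ==> act 0 ts = 0"
 using act_scale[of 0 0 ts 0] by simp

lemma act_zero_elem: "x : L i ==> aok ts ==> t : set ts ==> ta t = 0 ==> act x ts = 0"
proof (induction ts arbitrary: x i)
 case (Cons u ts)
 thus ?case using Cons.IH[of "br x (ta u)" "i + fst u"] br_L A_L by (cases "t = u") auto
qed simp

lemma P_scale: "x : L i ==> P (r *: x) = r *: P x"
 using P_lin[of x i x r 0] by simp

text \<open>The Jacobi identity with the bracket of two elements of the abelian part removed. This
  is the source of the graded symmetry of the derived brackets.\<close>

lemma br_commute_A: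
 assumes "x : L i" "a : A j" "b : A k"
 shows "br (br x a) b = sg (j * k) *: br (br x b) a"
 using jacobi[OF assms(1) A_L[OF assms(2)] A_L[OF assms(3)]] abelian[OF assms(2,3)] assms(1) by simp

lemma act_swap:
 assumes "x : L i" "aok (xs @ u # v # ys)"
 shows "act x (xs @ u # v # ys) = sg (fst u * fst v) *: act x (xs @ v # u # ys)"
proof -
 have a: "act x xs : L (i + tdeg xs)" using act_L assms by simp
 have "br (br (act x xs) (ta v)) (ta u) : L (i + tdeg xs + fst v + fst u)"
  using br_L[OF br_L[OF a A_L] A_L, of "ta v" "fst v" "ta u" "fst u"] assms by simp
 thus ?thesis
  using br_commute_A[OF a, of "ta u" "fst u" "ta v" "fst v"] assms
  by (simp add: act_scale)
qed

text \<open>An element of the abelian part commutes up to sign with all the entries, so it can be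
  applied before them.\<close>

lemma act_br_right:
 assumes "x : L i" "b : A k" "aok ts"
 shows "br (act x ts) b = sg (k * tdeg ts) *: act (br x b) ts"
 using assms
proof (induction ts arbitrary: x i)
 case (Cons t ts)
 have x: "br x (ta t) : L (i + fst t)" and b: "br x b : L (i + k)" using Cons.prems br_L A_L by auto
 hence xb: "br (br x b) (ta t) : L (i + k + fst t)" using Cons.prems br_L A_L by auto
 have "br (act x (t # ts)) b = sg (k * tdeg ts) *: act (br (br x (ta t)) b) ts"
  using Cons.IH[OF x] Cons.prems by simp
 also have "br (br x (ta t)) b = sg (fst t * k) *: br (br x b) (ta t)"
  using Cons.prems by (intro br_commute_A) auto
 finally show ?case
  using xb Cons.prems by (simp add: act_scale distrib_left sg_add mult_ac)
qed simp

text \<open>Bracketing on the right with one element is a graded derivation of the bracket;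
  iterating the Leibniz rule distributes the entries over both factors in all ways.\<close>

lemma act_br:
 assumes "x : L i" "y : L j" "aok ts"
 shows "act (br x y) ts = ssum fst (%Ls R. sg (j * tdeg Ls) *: br (act x Ls) (act y R)) ts"
 using assms
proof (induction ts arbitrary: x y i j)
 case (Cons t ts)
 let ?a = "ta t"
 have a: "?a : L (fst t)" using Cons.prems A_L by auto
 have xa: "br x ?a : L (i + fst t)" and ya: "br y ?a : L (j + fst t)" using Cons.prems a br_L by auto
 have "act (br x y) (t # ts) = act (br x (br y ?a) + sg (j * fst t) *: br (br x ?a) y) ts"
  using jacobi[OF Cons.prems(1,2) a] by simp
 also have "... = act (br x (br y ?a)) ts + sg (j * fst t) *: act (br (br x ?a) y) ts"
  using act_lin[of "br x (br y ?a)" "i + j + fst t" "br (br x ?a) y" ts 1 "sg (j * fst t)"]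
   br_L[OF Cons.prems(1) ya] br_L[OF xa Cons.prems(2)] Cons.prems by (simp add: add_ac)
 also have "act (br x (br y ?a)) ts = ssum fst (%Ls R. sg ((j + fst t) * tdeg Ls) *: br (act x Ls) (act (br y ?a) R)) ts"
  using Cons.IH[OF Cons.prems(1) ya] Cons.prems by simp
 also have "act (br (br x ?a) y) ts = ssum fst (%Ls R. sg (j * tdeg Ls) *: br (act (br x ?a) Ls) (act y R)) ts"
  using Cons.IH[OF xa Cons.prems(2)] Cons.prems by simp
 finally show ?case
  by (simp add: distrib_left distrib_right sg_add add.commute mult_ac flip: ssum_scaleR)
qed simp

text \<open>All quadratic relations between the derived brackets are instances of this identity.\<close>

lemma P_act_br:
 assumes x: "x : L i" and y: "y : L j" and ts: "aok ts"
 shows "P (act (br x y) ts) = ssum fst (%Ls R. P (act (br x (P (act y Ls))) R)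
   - sg (i * j) *: P (act (br y (P (act x Ls))) R)) ts"
proof -
 have actx: "act x Ls : L (i + tdeg Ls)" "P (act x Ls) : A (i + tdeg Ls)"
  and acty: "act y Ls : L (j + tdeg Ls)" "P (act y Ls) : A (j + tdeg Ls)" if "aok Ls" for Ls
  using act_L[OF x that] act_L[OF y that] P_A by auto
 have "P (act (br x y) ts) = P (ssum fst (%Ls R. sg (j * tdeg Ls) *: br (act x Ls) (act y R)) ts)"
  using act_br[OF x y ts] by simp
 also have "... = ssum fst (%Ls R. P (sg (j * tdeg Ls) *: br (act x Ls) (act y R))) ts"
 proof (rule ssum_linear_on[OF subspace_L[of "i + j + tdeg ts"]])
  fix Ls R assume *: "mset Ls + mset R = mset ts"
  have "br (act x Ls) (act y R) : L (i + j + tdeg ts)"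
   using br_L[OF actx(1)[of Ls] acty(1)[of R]] aok_split[OF ts *] tdeg_mset[OF *] by (simp add: add_ac)
  thus "sg (j * tdeg Ls) *: br (act x Ls) (act y R) : L (i + j + tdeg ts)"
   by (intro subspace_scale subspace_L)
 qed (rule P_lin)
 also have "... = ssum fst (%Ls R. - (sg (i * j) *: P (act (br y (P (act x Ls))) R))
   + sg (j * tdeg Ls) *: P (br (act x Ls) (P (act y R)))) ts"
 proof (rule ssum_cong)
  fix Ls R assume *: "mset Ls + mset R = mset ts"
  have ok: "aok Ls" "aok R" using aok_split[OF ts *] by auto
  let ?b = "P (act x Ls)"
  have b: "?b : A (i + tdeg Ls)" by (rule actx(2)[OF ok(1)])
  have yb: "act (br y ?b) R : L (j + (i + tdeg Ls) + tdeg R)"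
   by (intro act_L br_L y A_L b ok)
  \<comment> \<open>The projected factor \<open>?b\<close> lies in the abelian part, so after
    antisymmetry it can be moved through the entries of \<open>R\<close> next to
    \<open>y\<close>.\<close>
  have "br ?b (act y R) = - (sg ((i + tdeg Ls) * (j + tdeg R)) *: br (act y R) ?b)"
   by (intro br_anti A_L b acty ok)
  also have "... = - (sg ((i + tdeg Ls) * (j + tdeg R)) * sg ((i + tdeg Ls) * tdeg R)) *: act (br y ?b) R"
   using act_br_right[OF y b ok(2)] by simp
  finally have 1: "br ?b (act y R) = - (sg ((i + tdeg Ls) * j)) *: act (br y ?b) R"
   by (simp add: distrib_left sg_add mult_ac)
  have "P (sg (j * tdeg Ls) *: br (act x Ls) (act y R)) =
   sg (j * tdeg Ls) *: (P (br ?b (act y R)) + P (br (act x Ls) (P (act y R))))"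
   using P_scale[OF br_L[OF actx(1) acty(1)]] P_br[OF actx(1) acty(1)] ok by simp
  also have "P (br ?b (act y R)) = - (sg ((i + tdeg Ls) * j)) *: P (act (br y ?b) R)"
   unfolding 1 by (rule P_scale[OF yb])
  finally show "P (sg (j * tdeg Ls) *: br (act x Ls) (act y R)) =
   - (sg (i * j) *: P (act (br y (P (act x Ls))) R))
   + sg (j * tdeg Ls) *: P (br (act x Ls) (P (act y R)))"
   by (simp add: scaleR_diff_right distrib_left sg_add mult_ac)
 qed
 also have "... = ssum fst (%Ls R. sg (j * tdeg Ls) *: P (br (act x Ls) (P (act y R)))) ts
   - ssum fst (%Ls R. sg (i * j) *: P (act (br y (P (act x Ls))) R)) ts"
  by (subst ssum_add) (simp add: ssum_minus)
 \<comment> \<open>Exchanging the two sublists puts the other half into the shape of the first one,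
   with the projected factor inside.\<close>
 also have "ssum fst (%Ls R. sg (j * tdeg Ls) *: P (br (act x Ls) (P (act y R)))) ts
  = ssum fst (%Ls R. P (act (br x (P (act y Ls))) R)) ts"
  unfolding ssum_cocomm[of fst "%Ls R. sg (j * tdeg Ls) *: P (br (act x Ls) (P (act y R)))"]
 proof (rule ssum_cong)
  fix Ls R assume *: "mset Ls + mset R = mset ts"
  have ok: "aok Ls" "aok R" using aok_split[OF ts *] by auto
  have b: "P (act y Ls) : A (j + tdeg Ls)" by (rule acty(2)[OF ok(1)])
  have xb: "act (br x (P (act y Ls))) R : L (i + (j + tdeg Ls) + tdeg R)"
   by (intro act_L br_L x A_L b ok)
  have "P (br (act x R) (P (act y Ls))) = sg ((j + tdeg Ls) * tdeg R) *: P (act (br x (P (act y Ls))) R)"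
   unfolding act_br_right[OF x b ok(2)] by (rule P_scale[OF xb])
  thus "sg (tdeg Ls * tdeg R) *: sg (j * tdeg R) *: P (br (act x R) (P (act y Ls)))
    = P (act (br x (P (act y Ls))) R)"
   by (simp add: distrib_left distrib_right sg_add mult_ac)
 qed
 finally show ?thesis by (simp add: ssum_diff)
qed

text \<open>The differential and the bracket of \<open>K\<close>, moved to the shifted space. The
  number \<open>fst t + 1\<close> is the degree of \<open>tX t\<close> in the Lie algebra, which
  produces the sign (-1)^|X| of the binary bracket.\<close>

definition m1 :: "'l typed list => 'l" where
 "m1 ts = (case ts of [t] => - br q (tX t) | [t, u] => sg (fst t + 1) *: br (tX t) (tX u) | _ => 0)"

lemma m1_eq_0: "length ts ~= 1 ==> length ts ~= 2 ==> m1 ts = 0"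
 by (auto simp: m1_def split: list.splits)

lemma length_1_2_cases:
 obtains t where "ts = [t]" | t u where "ts = [t, u]" | "length ts ~= 1" "length ts ~= 2"
 by (cases ts; cases "tl ts"; cases "tl (tl ts)") auto

definition single :: "'l typed list => 'l typed list => 'l" where
 "single Ls R = (case Ls of [t] => P (act (tX t) R) | _ => 0)"

text \<open>All brackets with values in \<open>A\<close> in one formula that also covers mixed
  entries: either every entry contributes its \<open>a\<close> to an iterated bracket starting from
  \<open>q\<close>, or exactly one entry contributes its \<open>X\<close>, which takes the place of
  \<open>q\<close>.\<close>

definition m2 :: "'l typed list => 'l" where
 "m2 ts = P (act q ts) + ssum fst single ts"

definition mt :: "'l typed list => 'l \<times> 'l" where
 "mt ts = (m1 ts, m2 ts)"

definition ok :: "'l typed list => bool" where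
 "ok ts \<longleftrightarrow> (ALL t:set ts. snd t : W (fst t))"

lemma ok_simps [simp]: "ok []" "ok (t # ts) \<longleftrightarrow> snd t : W (fst t) & ok ts" "ok (ts @ us) \<longleftrightarrow> ok ts & ok us"
 by (auto simp: ok_def)

lemma ok_aok: "ok ts ==> aok ts"
 by (auto simp: ok_def aok_def)

lemma ok_mset: "mset ts = mset us ==> ok ts \<longleftrightarrow> ok us"
 unfolding ok_def by (metis set_mset_mset)

lemma ok_split: "ok ts ==> mset Ls + mset R = mset ts ==> ok Ls & ok R"
 using ok_mset[of "Ls @ R" ts] by simp

lemma W_zero [simp]: "0 : W i"
 by (simp add: zero_prod_def)

lemma subspace_W: "subspace (W i)"
 by (intro subspace_Times subspace_A subspace_K)

lemma q_L: "q : L 1"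
 by (rule K_L[OF q(1)])

lemma q_q:
 assumes x: "x : L i"
 shows "br q (br q x) = 0"
proof -
 have "br q x : L (1 + i)" by (rule br_L[OF q_L x])
 hence "br (br q x) q = - (sg ((1 + i) * 1) *: br q (br q x))"
  by (rule br_anti[OF _ q_L])
 hence "0 = br q (br q x) + br q (br q x)"
  using jacobi[OF q_L q_L x] q(2) x by (simp add: sg_add)
 thus ?thesis by (simp flip: scaleR_2)
qed

lemma act_lin_slot:
 assumes x: "x : L i" and "aok xs" "aok ys" "b : A d" "c : A d"
 shows "act x (xs @ (d, X, r *: b + s *: c) # ys)
  = r *: act x (xs @ (d, Y, b) # ys) + s *: act x (xs @ (d, Z, c) # ys)"
proof -
 have "act x xs : L (i + tdeg xs)" using act_L x assms by simp
 thus ?thesis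
  using assms br_lin_right[of b d c "act x xs" _ r s] act_lin[of "br (act x xs) b" "i + tdeg xs + d" "br (act x xs) c" ys r s]
  by (simp add: A_L br_L)
qed

lemma P_act_A: "x : L i ==> aok ts ==> P (act x ts) : A (i + tdeg ts)"
 by (intro P_A act_L)

lemma P_act_lin:
 assumes "x : L i" "y : L i" "aok ts"
 shows "P (act (r *: x + s *: y) ts) = r *: P (act x ts) + s *: P (act y ts)"
 using assms by (simp add: act_lin[of x i y] P_lin[OF act_L act_L])

lemma P_act_lin_slot:
 assumes x: "x : L i" and "aok xs" "aok ys" "b : A d" "c : A d"
 shows "P (act x (xs @ (d, X, r *: b + s *: c) # ys))
  = r *: P (act x (xs @ (d, Y, b) # ys)) + s *: P (act x (xs @ (d, Z, c) # ys))"
 using assms by (subst act_lin_slot[OF assms, of _ r s Y Z], subst P_lin[OF act_L[OF x], of _ _ r s])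
  (auto intro!: act_L[of x i "xs @ (d, Z, c) # ys", simplified])

lemma single_eq_0: "length Ls ~= 1 ==> single Ls R = 0"
 by (auto simp: single_def split: list.splits)

lemma single_A:
 assumes "ok ts" "mset Ls + mset R = mset ts"
 shows "single Ls R : A (tdeg ts + 1)"
proof (cases "length Ls = 1")
 case True
 then obtain t where t: "Ls = [t]" by (auto simp: length_Suc_conv)
 have "ok Ls" "ok R" using ok_split[OF assms] by auto
 hence "P (act (tX t) R) : A (fst t + 1 + tdeg R)"
  unfolding t by (intro P_act_A) (auto intro: K_L ok_aok)
 thus ?thesis using tdeg_mset[OF assms(2)] t by (simp add: single_def add_ac)
qed (simp add: single_eq_0)

lemma m2_A:
 assumes "ok ts"
 shows "m2 ts : A (tdeg ts + 1)"
 unfolding m2_def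
 using P_act_A[OF q_L ok_aok[OF assms]] single_A[OF assms]
 by (intro subspace_add subspace_A ssum_closed) (auto simp: add.commute)

lemma m1_K:
 assumes "ok ts"
 shows "m1 ts : K (tdeg ts + 2)"
proof -
 show ?thesis
 proof (cases ts rule: length_1_2_cases)
  case (1 t)
  thus ?thesis using assms br_K[OF q(1), of "tX t" "fst t + 1"]
   by (auto simp: m1_def subspace_neg[OF subspace_K] add_ac)
 next
  case (2 t u)
  thus ?thesis using assms br_K[of "tX t" "fst t + 1" "tX u" "fst u + 1"]
   by (auto simp: m1_def subspace_scale[OF subspace_K] add_ac)
 qed (simp add: m1_eq_0)
qed

lemma mt_W: "ok ts ==> mt ts : W (tdeg ts + 1)"
 using m1_K[of ts] m2_A[of ts] by (simp add: mt_def add.assoc)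

lemma m2_swap:
 assumes "ok (xs @ u # v # ys)"
 shows "m2 (xs @ u # v # ys) = sg (fst u * fst v) *: m2 (xs @ v # u # ys)"
proof -
 have ok': "ok (xs @ v # u # ys)" using assms by auto
 have "P (act q (xs @ u # v # ys)) = sg (fst u * fst v) *: P (act q (xs @ v # u # ys))"
  by (subst act_swap[OF q_L ok_aok[OF assms]]) (rule P_scale[OF act_L[OF q_L ok_aok[OF ok']]])
 moreover have "ssum fst single (xs @ u # v # ys) = sg (fst u * fst v) *: ssum fst single (xs @ v # u # ys)"
 proof (rule ssum_swap)
  fix ls ms R
  show "single (ls @ u # v # ms) R = sg (fst u * fst v) *: single (ls @ v # u # ms) R"
   by (simp add: single_eq_0)
 next
  fix ls ms Ls assume *: "mset ls + mset ms + {#u, v#} + mset Ls = mset (xs @ u # v # ys)"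
  have ok1: "ok Ls" "ok (ls @ u # v # ms)"
   using ok_split[OF assms, of Ls "ls @ u # v # ms"] * by (auto simp: add_ac)
  hence ok2: "ok (ls @ v # u # ms)" by auto
  show "single Ls (ls @ u # v # ms) = sg (fst u * fst v) *: single Ls (ls @ v # u # ms)"
  proof (cases "length Ls = 1")
   case True
   then obtain t where t: "Ls = [t]" by (auto simp: length_Suc_conv)
   have x: "tX t : L (fst t + 1)" using ok1 t K_L by auto
   show ?thesis unfolding t single_def list.case
    by (subst act_swap[OF x ok_aok[OF ok1(2)]]) (rule P_scale[OF act_L[OF x ok_aok[OF ok2]]])
  qed (simp add: single_eq_0)
 qed
 ultimately show ?thesis by (simp add: m2_def scaleR_add_right)
qed

lemma m1_swap:
 assumes "ok (xs @ u # v # ys)"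
 shows "m1 (xs @ u # v # ys) = sg (fst u * fst v) *: m1 (xs @ v # u # ys)"
proof (cases "xs = [] & ys = []")
 case True
 have "br (tX u) (tX v) = - (sg ((fst u + 1) * (fst v + 1)) *: br (tX v) (tX u))"
  using assms by (intro br_anti K_L) auto
 thus ?thesis using True
  by (simp add: m1_def) (simp add: sg_def)
next
 case False
 hence "length xs + length ys ~= 0" by simp
 hence "m1 (xs @ w # w' # ys) = 0" for w w'
  by (intro m1_eq_0) auto
 thus ?thesis by simp
qed

lemma mt_swap:
 "ok (xs @ u # v # ys) ==> mt (xs @ u # v # ys) = sg (fst u * fst v) *: mt (xs @ v # u # ys)"
 using m1_swap[of xs u v ys] m2_swap[of xs u v ys] by (simp add: mt_def)

lemma m2_lin:
 assumes "ok xs" "ok ys" "u : W d" "v : W d"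
 shows "m2 (xs @ (d, r *: u + s *: v) # ys) = r *: m2 (xs @ (d, u) # ys) + s *: m2 (xs @ (d, v) # ys)"
proof -
 obtain X a Y b where u: "u = (X, a)" and v: "v = (Y, b)" by (cases u, cases v)
 have mem: "X : K (d + 1)" "Y : K (d + 1)" "a : A d" "b : A d" using assms u v by auto
 have "ssum fst single (xs @ (d, r *: u + s *: v) # ys)
  = r *: ssum fst single (xs @ (d, u) # ys) + s *: ssum fst single (xs @ (d, v) # ys)"
 proof (rule ssum_linear_slot)
  fix ls ms R assume *: "mset ls + mset ms + mset R = mset xs + mset ys"
  have okR: "ok R" using ok_split[of "xs @ ys" "ls @ ms" R] * assms by auto
  show "single (ls @ (d, r *: u + s *: v) # ms) R = r *: single (ls @ (d, u) # ms) R + s *: single (ls @ (d, v) # ms) R"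
   using P_act_lin[OF mem(1,2)[THEN K_L] ok_aok[OF okR]]
    single_eq_0[of "ls @ _ # ms" R]
   by (cases "ls = [] & ms = []") (simp_all add: single_def u v)
 next
  fix ls ms Ls assume *: "mset ls + mset ms + mset Ls = mset xs + mset ys"
  have okR: "ok Ls" "ok ls" "ok ms" using ok_split[of "xs @ ys" "ls @ ms" Ls] * assms by auto
  show "single Ls (ls @ (d, r *: u + s *: v) # ms) = r *: single Ls (ls @ (d, u) # ms) + s *: single Ls (ls @ (d, v) # ms)"
  proof (cases "length Ls = 1")
   case True
   then obtain t where t: "Ls = [t]" by (auto simp: length_Suc_conv)
   have x: "tX t : L (fst t + 1)" using okR t K_L by auto
   show ?thesis unfolding t single_def list.case u v
    using P_act_lin_slot[OF x ok_aok ok_aok mem(3,4), OF okR(2,3)] by simp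
  qed (simp add: single_eq_0)
 qed simp_all
 moreover have "P (act q (xs @ (d, r *: u + s *: v) # ys)) =
   r *: P (act q (xs @ (d, u) # ys)) + s *: P (act q (xs @ (d, v) # ys))"
  using P_act_lin_slot[OF q_L ok_aok ok_aok mem(3,4), OF assms(1,2)] by (simp add: u v)
 ultimately show ?thesis by (simp add: m2_def scaleR_add_right)
qed

lemma m1_lin:
 assumes "ok xs" "ok ys" "u : W d" "v : W d"
 shows "m1 (xs @ (d, r *: u + s *: v) # ys) = r *: m1 (xs @ (d, u) # ys) + s *: m1 (xs @ (d, v) # ys)"
proof -
 have mem: "fst u : L (d + 1)" "fst v : L (d + 1)" using assms K_L by auto
 consider "xs = []" "ys = []" | t where "xs = [t]" "ys = []" | t where "xs = []" "ys = [t]"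
  | "length xs + length ys ~= 0" "length xs + length ys ~= 1"
  by (cases xs; cases ys; cases "tl xs"; cases "tl ys") auto
 thus ?thesis
 proof cases
  case 1
  thus ?thesis using br_lin_right[OF mem q_L] by (simp add: m1_def)
 next
  case 2
  thus ?thesis using br_lin_right[OF mem K_L, of "tX t" "fst t + 1"] assms
   by (auto simp: m1_def scaleR_add_right mult.commute)
 next
  case 3
  thus ?thesis using br_lin[OF mem K_L, of "tX t" "fst t + 1"] assms
   by (auto simp: m1_def scaleR_add_right mult.commute)
 next
  case 4
  hence "m1 (xs @ w # ys) = 0" for w
   by (intro m1_eq_0) auto
  thus ?thesis by simp
 qed
qed

lemma mt_lin:
 assumes "ok xs" "ok ys" "u : W d" "v : W d"
 shows "mt (xs @ (d, r *: u + s *: v) # ys) = r *: mt (xs @ (d, u) # ys) + s *: mt (xs @ (d, v) # ys)"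
 using m1_lin[OF assms] m2_lin[OF assms] by (simp add: mt_def)

section \<open>The quadratic relations, component by component\<close>

lemma mt_zero_elem:
 assumes "ok xs" "ok ys" shows "mt (xs @ (d, 0) # ys) = 0"
 using mt_lin[OF assms, of 0 d 0 0 0] by simp

text \<open>The nested terms with \<open>x\<close> in the outer and \<open>y\<close> in the inner
  derived bracket. By \<open>P_act_br\<close>, their graded antisymmetrization in \<open>x\<close>
  and \<open>y\<close> is the derived expression that starts from the bracket of \<open>x\<close>
  and \<open>y\<close>.\<close>

definition dd :: "'l => 'l => 'l typed list => 'l" where
 "dd x y = ssum fst (%Ls R. P (act (br x (P (act y Ls))) R))"

lemma m2_Cons_typed:
 "m2 ((e, X, b) # ts) = P (act (br q b) ts) + P (act X ts) + ssum fst (%Ls R. sg (e * tdeg Ls) *: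
  (case Ls of [t] => P (act (br (tX t) b) R) | _ => 0)) ts"
proof -
 have "ssum fst (%Ls. single ((e, X, b) # Ls)) ts = ssum fst (%Ls R. if Ls = [] then P (act X R) else 0) ts"
  by (intro ssum_cong) (auto simp: single_def split: list.splits)
 moreover have "single Ls ((e, X, b) # R) = (case Ls of [t] => P (act (br (tX t) b) R) | _ => 0)" for Ls R
  by (auto simp: single_def split: list.splits)
 ultimately show ?thesis by (simp add: m2_def ssum_Nil_left)
qed

text \<open>Since \<open>m2\<close> is a sum over its starting element, the inner element of the
  nested terms is either \<open>q\<close> or the \<open>X\<close> of one of the entries.\<close>

lemma ssum_br_m2:
 assumes x: "x : L i" and ts: "ok ts"
 shows "ssum fst (%Ls R. P (act (br x (m2 Ls)) R)) ts =
  dd x q ts + ssum fst (%Us R. case Us of [u] => dd x (tX u) R | _ => 0) ts"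
proof -
 let ?G = "%Us V R. P (act (br x (single Us V)) R)"
 have "P (act (br x (m2 Ls)) R) = P (act (br x (P (act q Ls))) R) + ssum fst (%Us V. ?G Us V R) Ls"
  if *: "mset Ls + mset R = mset ts" for Ls R
 proof -
  have oks: "ok Ls" "ok R" using ok_split[OF ts *] by auto
  have lin: "P (act (br x (r *: b + s *: c)) R) = r *: P (act (br x b) R) + s *: P (act (br x c) R)"
   if "b : A (tdeg Ls + 1)" "c : A (tdeg Ls + 1)" for b c r s
   using br_lin_right[OF that[THEN A_L] x] P_act_lin[OF br_L br_L ok_aok, OF x A_L x A_L, OF that oks(2)] by simp
  have "ssum fst single Ls : A (tdeg Ls + 1)" "P (act q Ls) : A (tdeg Ls + 1)"
   using single_A[OF oks(1)] P_act_A[OF q_L ok_aok[OF oks(1)]] by (auto intro: ssum_closed subspace_A simp: add.commute)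
  from lin[OF this(2,1), of 1 1] have "P (act (br x (m2 Ls)) R) =
   P (act (br x (P (act q Ls))) R) + P (act (br x (ssum fst single Ls)) R)" by (simp add: m2_def)
  also have "P (act (br x (ssum fst single Ls)) R) = ssum fst (%Us V. ?G Us V R) Ls"
   by (rule ssum_linear_on[OF subspace_A[of "tdeg Ls + 1"] lin single_A[OF oks(1)]])
  finally show ?thesis .
 qed
 hence "ssum fst (%Ls R. P (act (br x (m2 Ls)) R)) ts =
   ssum fst (%Ls R. P (act (br x (P (act q Ls))) R) + ssum fst (%Us V. ?G Us V R) Ls) ts"
  by (intro ssum_cong)
 also have "... = dd x q ts + ssum fst (%Us S. ssum fst (?G Us) S) ts"
  by (simp add: ssum_add dd_def ssum_coassoc[of fst ?G])
 also have "ssum fst (%Us S. ssum fst (?G Us) S) ts = ssum fst (%Us R. case Us of [u] => dd x (tX u) R | _ => 0) ts"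
 proof (rule ssum_cong)
  fix Us S assume *: "mset Us + mset S = mset ts"
  have S: "ok S" using ok_split[OF ts *] by simp
  show "ssum fst (?G Us) S = (case Us of [u] => dd x (tX u) S | _ => 0)"
  proof (cases "length Us = 1")
   case True
   thus ?thesis by (auto simp: length_Suc_conv single_def dd_def)
  next
   case False
   have "ssum fst (?G Us) S = ssum fst (%_ _. 0) S"
    by (intro ssum_cong) (use x False ok_split[OF S] ok_aok in \<open>auto simp: single_eq_0\<close>)
   thus ?thesis using False by (auto split: list.splits)
  qed
 qed
 finally show ?thesis .
qed

text \<open>The nested terms are sorted by their outer and inner starting elements: \<open>q\<close>
  with \<open>q\<close>, \<open>q\<close> with one \<open>X\<close>, and two different
  \<open>X\<close>. In the mixed classes \<open>P_act_br\<close> collapses the antisymmetric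
  combination to the derived expression of a single bracket, which cancels against the contribution
  of \<open>m1\<close>; the class of \<open>q\<close> with \<open>q\<close> vanishes because the
  bracket of \<open>q\<close> with itself does.\<close>

lemma jacobi_second_component:
 assumes ts: "ok ts"
 shows "ssum fst (%Ls R. m2 ((tdeg Ls + 1, mt Ls) # R)) ts = 0"
proof -
 let ?c = "%Us Ls R. case Us of [t] => P (act (br (tX t) (m2 Ls)) R) | _ => 0"
 let ?e = "%Us Ts R. case Us of [t] => (case Ts of [u] => sg (fst t) *: dd (tX t) (tX u) R | _ => 0) | _ => 0"
 let ?e' = "%Ks R. case Ks of [t, u] => sg (fst t) *: dd (tX t) (tX u) R
   + sg (fst t * fst u) *: sg (fst u) *: dd (tX u) (tX t) R | _ => 0"
 let ?q = "%Us R. case Us of [u] => dd q (tX u) R | _ => 0"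
  and ?q' = "%Us R. case Us of [t] => sg (fst t) *: dd (tX t) q R | _ => 0"
 \<comment> \<open>Terms whose outer element is the \<open>X\<close> of an entry that the inner
   bracket has not consumed. Cocommutativity and coassociativity rearrange the sum so that this
   entry is chosen before the inner ones.\<close>
 have "ssum fst (%Ls R. ssum fst (%Us S. sg ((tdeg Ls + 1) * tdeg Us) *: ?c Us Ls S) R) ts
  = ssum fst (%Ks R. ssum fst (%Us Ls. sg (tdeg Us) *: ?c Us Ls R) Ks) ts"
 proof -
  have "ssum fst (%Ls Us. sg ((tdeg Ls + 1) * tdeg Us) *: ?c Us Ls R) Ks = ssum fst (%Us Ls. sg (tdeg Us) *: ?c Us Ls R) Ks" for Ks R
   unfolding ssum_cocomm[of fst "%Ls Us. sg ((tdeg Ls + 1) * tdeg Us) *: ?c Us Ls R"]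
   by (intro ssum_cong) (simp add: distrib_left sg_add mult_ac)
  thus ?thesis by (simp add: ssum_coassoc[of fst "%Ls Us. %S. sg ((tdeg Ls + 1) * tdeg Us) *: ?c Us Ls S"])
 qed
 also have "... = ssum fst (%Us S. ssum fst (%Ls R. sg (tdeg Us) *: ?c Us Ls R) S) ts"
  by (simp add: ssum_coassoc[of fst "%Us Ls R. sg (tdeg Us) *: ?c Us Ls R"])
 also have "... = ssum fst (%Us S. ?q' Us S + ssum fst (?e Us) S) ts"
 proof (rule ssum_cong)
  fix Us S assume *: "mset Us + mset S = mset ts"
  have S: "ok S" "ok Us" using ok_split[OF ts *] by auto
  show "ssum fst (%Ls R. sg (tdeg Us) *: ?c Us Ls R) S = ?q' Us S + ssum fst (?e Us) S"
  proof (cases "length Us = 1")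
   case True
   then obtain t where t: "Us = [t]" by (auto simp: length_Suc_conv)
   have "ssum fst (?e [t]) S = sg (fst t) *: ssum fst (%Ts R. case Ts of [u] => dd (tX t) (tX u) R | _ => 0) S"
    unfolding ssum_scaleR[symmetric] by (intro ssum_cong) (auto split: list.splits)
   thus ?thesis
    using ssum_br_m2[OF K_L S(1), of "tX t" "fst t + 1"] S(2) t by (simp add: ssum_scaleR scaleR_add_right mem_Times_iff)
  qed (auto split: list.splits)
 qed
 also have "... = ssum fst ?q' ts + ssum fst (%Ks R. ssum fst (%Us Ts. ?e Us Ts R) Ks) ts"
  by (simp add: ssum_add ssum_coassoc[of fst ?e])
 also have "(%Ks R. ssum fst (%Us Ts. ?e Us Ts R) Ks) = ?e'"
 proof (intro ext)
  fix Ks R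
  show "ssum fst (%Us Ts. ?e Us Ts R) Ks = ?e' Ks R"
  proof (cases Ks rule: length_1_2_cases)
   case 3
   have "ssum fst (%Us Ts. ?e Us Ts R) Ks = ssum fst (%_ _. 0) Ks"
   proof (rule ssum_cong)
    fix Us Ts assume "mset Us + mset Ts = mset Ks"
    hence "length Us + length Ts = length Ks" by (metis size_mset size_union)
    thus "?e Us Ts R = 0" using 3 by (auto split: list.splits)
   qed
   thus ?thesis using 3 by (auto split: list.splits)
  qed simp_all
 qed
 finally have third: "ssum fst (%Ls R. ssum fst (%Us S. sg ((tdeg Ls + 1) * tdeg Us) *: ?c Us Ls S) R) ts
  = ssum fst ?q' ts + ssum fst ?e' ts" .
 have "ssum fst (%Ls R. m2 ((tdeg Ls + 1, mt Ls) # R)) ts =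
  dd q q ts + ssum fst (%Ks R. ?q Ks R + P (act (m1 Ks) R) + (?q' Ks R + ?e' Ks R)) ts"
  unfolding mt_def m2_Cons_typed ssum_add third ssum_br_m2[OF q_L ts] by (simp add: add_ac)
 also have "dd q q ts = 0"
 proof -
  \<comment> \<open>The degree of \<open>q\<close> is odd, so the two halves of
    \<open>P_act_br\<close> have the same sign and add up.\<close>
  have "2 *: dd q q ts = P (act (br q q) ts)"
   unfolding dd_def P_act_br[OF q_L q_L ok_aok[OF ts]] ssum_scaleR[symmetric] by (simp add: scaleR_2)
  thus ?thesis using q ok_aok[OF ts] by simp
 qed
 also have "ssum fst (%Ks R. ?q Ks R + P (act (m1 Ks) R) + (?q' Ks R + ?e' Ks R)) ts = ssum fst (%_ _. 0) ts"
 proof (rule ssum_cong)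
  fix Ks R assume *: "mset Ks + mset R = mset ts"
  have oks: "ok Ks" "aok R" using ok_split[OF ts *] ok_aok by auto
  have br: "P (act (r *: br x y) R) = r *: (dd x y R - sg (i * j) *: dd y x R)" if "x : L i" "y : L j" for x y i j r
   using P_act_br[OF that oks(2)] P_scale[OF act_L[OF br_L[OF that] oks(2)]] act_scale[OF br_L[OF that] oks(2)]
   by (simp add: dd_def ssum_diff ssum_scaleR)
  show "?q Ks R + P (act (m1 Ks) R) + (?q' Ks R + ?e' Ks R) = 0"
  proof (cases Ks rule: length_1_2_cases)
   case (1 t)
   have "tX t : L (fst t + 1)" using oks 1 K_L by auto
   from br[OF q_L this, of "-1"] show ?thesis using 1 by (simp add: m1_def sg_add)
  next
   case (2 t u)
   have "tX t : L (fst t + 1)" "tX u : L (fst u + 1)" using oks 2 K_L by auto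
   from br[OF this, of "sg (fst t + 1)"] show ?thesis
    using 2 by (cases "even (fst t)"; cases "even (fst u)"; simp add: m1_def sg_def)
  next
   case 3
   thus ?thesis using oks by (auto simp: m1_eq_0 split: list.splits)
  qed
 qed
 finally show ?thesis by simp
qed

text \<open>Only lists of at most three entries matter since \<open>m1\<close> vanishes on longer
  ones. One, two and three entries give respectively that the differential squares to zero, that it
  is a derivation, and the Jacobi identity.\<close>

lemma jacobi_first_component:
 assumes ts: "ok ts"
 shows "ssum fst (%Ls R. m1 ((tdeg Ls + 1, mt Ls) # R)) ts = 0"
proof -
 let ?g = "%e x R. case R of [] => - br q x | [v] => sg e *: br x (tX v) | _ => 0"
 have g: "m1 ((tdeg Ls + 1, mt Ls) # R) = ?g (tdeg Ls) (m1 Ls) R" for Ls R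
  by (auto simp: m1_def mt_def sg_def split: list.splits)
 have m1s: "m1 [] = 0" "m1 [t] = - br q (tX t)" "m1 [t, u] = sg (fst t + 1) *: br (tX t) (tX u)"
  "m1 (t # u # v # us) = 0" for t u v us
  by (simp_all add: m1_def)
 have neg: "br (- x) y = - br x y" "br q (r *: x) = r *: br q x" "br (r *: x) y = r *: br x y"
   "br q (- x) = - br q x"
  if "x : L i" "y : L j" for x y i j r
  using br_lin[OF that(1,1,2), of "-1" 0] br_lin_right[OF that(1,1) q_L, of r 0] br_lin[OF that(1,1,2), of r 0]
   br_lin_right[OF that(1,1) q_L, of "-1" 0] by simp_all
 consider "ts = []" | t where "ts = [t]" | t u where "ts = [t, u]" | t u v where "ts = [t, u, v]" | "length ts >= 4"
  by (cases ts; cases "tl ts"; cases "tl (tl ts)"; cases "tl (tl (tl ts))") auto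
 thus ?thesis
 proof cases
  case 1
  thus ?thesis using q_L by (simp add: g m1s)
 next
  case (2 t)
  have x: "tX t : L (fst t + 1)" using ts 2 K_L by auto
  show ?thesis using 2 x q_q[OF x] neg(4)[OF br_L[OF q_L x] q_L] by (simp add: g m1s)
 next
  case (3 t u)
  have xy: "tX t : L (fst t + 1)" "tX u : L (fst u + 1)" using ts 3 K_L by auto
  have "br (br q (tX t)) (tX u) = br q (br (tX t) (tX u)) + sg ((fst t + 1) * (fst u + 1)) *: br (br q (tX u)) (tX t)"
   by (rule jacobi[OF q_L xy])
  thus ?thesis
   using 3 xy neg(2,4)[OF br_L[OF xy] q_L] neg(1)[OF br_L[OF q_L xy(1)] xy(2)] neg(1)[OF br_L[OF q_L xy(2)] xy(1)]
   by (cases "even (fst t)"; cases "even (fst u)"; simp add: g m1s sg_def)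
 next
  case (4 t u v)
  let ?x = "tX t" and ?y = "tX u" and ?z = "tX v"
  have xyz: "?x : L (fst t + 1)" "?y : L (fst u + 1)" "?z : L (fst v + 1)" using ts 4 K_L by auto
  have 1: "br (br ?x ?y) ?z = br ?x (br ?y ?z) + sg ((fst u + 1) * (fst v + 1)) *: br (br ?x ?z) ?y"
   by (rule jacobi[OF xyz])
  have 2: "br ?x (br ?y ?z) = - (sg ((fst t + 1) * (fst u + 1 + (fst v + 1))) *: br (br ?y ?z) ?x)"
   by (rule br_anti[OF xyz(1) br_L[OF xyz(2,3)]])
  show ?thesis
   using 4 1[unfolded 2] q_L neg(1,3)[OF br_L[OF xyz(1,2)] xyz(3)] neg(1,3)[OF br_L[OF xyz(1,3)] xyz(2)]
    neg(1,3)[OF br_L[OF xyz(2,3)] xyz(1)]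
   by (cases "even (fst t)"; cases "even (fst u)"; cases "even (fst v)"; simp add: g m1s sg_def)
 next
  case 5
  have "ssum fst (%Ls R. m1 ((tdeg Ls + 1, mt Ls) # R)) ts = ssum fst (%_ _. 0) ts"
  proof (rule ssum_cong)
   fix Ls R assume *: "mset Ls + mset R = mset ts"
   hence "length Ls + length R >= 4" using 5 by (metis size_mset size_union)
   hence "length R >= 2 | m1 Ls = 0 & length R < 2" using m1_eq_0[of Ls] by linarith
   moreover have "tX v : L (fst v + 1)" if "v : set R" for v
    using ok_split[OF ts *] that K_L by (auto simp: ok_def)
   ultimately show "m1 ((tdeg Ls + 1, mt Ls) # R) = 0"
    using q_L unfolding g by (auto split: list.splits)
  qed
  thus ?thesis by simp
 qed
qed

definition nX :: "'l typed list => nat" where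
 "nX ts = length (filter (%t. ta t = 0) ts)"

lemma nX_simps [simp]: "nX [] = 0" "nX (t # ts) = (if ta t = 0 then Suc (nX ts) else nX ts)"
 "nX (ts @ us) = nX ts + nX us"
 by (simp_all add: nX_def)

lemma nX_mset: "mset ts = mset us ==> nX ts = nX us"
 unfolding nX_def by (metis mset_filter size_mset)

lemma nX_split: "mset Ls + mset R = mset ts ==> nX ts = nX Ls + nX R"
 using nX_mset[of "Ls @ R" ts] by simp

lemma act_nX: "x : L i ==> aok ts ==> nX ts ~= 0 ==> act x ts = 0"
 using act_zero_elem by (fastforce simp: nX_def filter_empty_conv)

text \<open>An entry with vanishing \<open>a\<close>-part must be the one that supplies its
  \<open>X\<close>, and there is room for only one such entry.\<close>

lemma m2_nX:
 assumes "ok ts" "nX ts >= 2"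
 shows "m2 ts = 0"
proof -
 have "single Ls R = 0" if *: "mset Ls + mset R = mset ts" for Ls R
 proof (cases "length Ls = 1")
  case True
  then obtain t where t: "Ls = [t]" by (auto simp: length_Suc_conv)
  have "ok Ls" "ok R" using ok_split[OF assms(1) *] by auto
  hence "tX t : L (fst t + 1)" "aok R" using t K_L ok_aok by auto
  moreover have "nX R ~= 0" using nX_split[OF *] assms(2) t by (auto split: if_splits)
  ultimately show ?thesis using act_nX by (simp add: t single_def)
 qed (simp add: single_eq_0)
 hence "ssum fst single ts = ssum fst (%_ _. 0) ts" by (intro ssum_cong)
 thus ?thesis
  using act_nX[OF q_L ok_aok[OF assms(1)]] assms(2) by (simp add: m2_def)
qed

definition atype :: "'l typed list => bool" where
 "atype ts \<longleftrightarrow> (ALL t:set ts. tX t = 0)"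

lemma atype_simps [simp]: "atype []" "atype (t # ts) \<longleftrightarrow> tX t = 0 & atype ts"
 "atype (ts @ us) \<longleftrightarrow> atype ts & atype us"
 by (auto simp: atype_def)

lemma atype_split: "atype ts ==> mset Ls + mset R = mset ts ==> atype Ls & atype R"
 unfolding atype_def using set_split_mset[of Ls R ts] by auto

lemma single_atype:
 assumes "atype Ls" "ok R"
 shows "single Ls R = 0"
proof (cases "length Ls = 1")
 case True
 thus ?thesis using assms ok_aok by (auto simp: length_Suc_conv single_def)
qed (simp add: single_eq_0)

lemma m1_atype: "atype ts ==> ok ts ==> m1 ts = 0"
 by (cases ts rule: length_1_2_cases) (simp add: m1_def q_L[THEN br_zero_right], simp add: m1_def, simp add: m1_eq_0)

lemma ssum_single_atype:
 assumes "atype ts" "ok ts"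
 shows "ssum fst single ts = 0"
proof -
 have "ssum fst single ts = ssum fst (%_ _. 0) ts"
  by (intro ssum_cong single_atype) (use assms atype_split ok_split in blast)+
 thus ?thesis by simp
qed

lemma m2_atype: "atype ts ==> ok ts ==> m2 ts = P (act q ts)"
 by (simp add: m2_def ssum_single_atype)

lemma m2_Cons:
 assumes ts: "atype ts" "ok ts" and b: "b : A d"
 shows "m2 ((d, X, b) # ts) = P (act (br q b) ts) + P (act X ts)"
proof -
 have "ssum fst (%Ls R. sg (d * tdeg Ls) *: (case Ls of [t] => P (act (br (tX t) b) R) | _ => 0)) ts
   = ssum fst (%_ _. 0) ts"
  by (intro ssum_cong) (use atype_split[OF ts(1)] ok_split[OF ts(2)] ok_aok A_L[OF b] in \<open>force split: list.splits\<close>)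
 thus ?thesis by (simp add: m2_Cons_typed)
qed

lemma m1_atype_Cons: "atype ts ==> ok ts ==> X : K (d + 1) ==> m1 ((d, X, b) # ts) = (if ts = [] then - br q X else 0)"
 using K_L[of X "d + 1"] by (cases ts; cases "tl ts") (auto simp: m1_def)

end

section \<open>From typed lists to brackets of vectors\<close>

lemma graded_spaceD:
 assumes "graded_space W" "finite I" "!!i. i : I ==> x i : W i" "(SUM i:I. x i) = 0" "i : I"
 shows "x i = 0"
proof -
 have "finite I & (ALL i:I. x i : W i) & (SUM i:I. x i) = 0 --> (ALL i:I. x i = 0)"
  using assms(1) unfolding graded_space_def by (elim conjE) (drule spec, erule spec)
 with assms(2-5) show ?thesis by simp
qed

lemma graded_space_degree_unique:
 assumes V: "graded_space V" and v: "v : V d" "v : V e" "v ~= 0"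
 shows "d = e"
proof (rule ccontr)
 assume "d ~= e"
 have "- v : V e" using V v(2) by (auto simp: graded_space_def subspace_neg)
 hence "(if d = d then v else - v) = 0"
  by (intro graded_spaceD[OF V, of "{d, e}" "%i. if i = d then v else - v"])
   (use v \<open>d ~= e\<close> in auto)
 thus False using v(3) by simp
qed

context derived_brackets
begin

lemma mt_two: "x : K (d + 1) ==> y : K (e + 1) ==> mt [(d, x, 0), (e, y, 0)] = (sg (d + 1) *: br x y, 0)"
 using m2_nX[of "[(d, x, 0), (e, y, 0)]"] by (simp add: mt_def m1_def)

lemma snd_ssum: "snd (ssum d G ts) = ssum d (%L R. snd (G L R)) ts"
 and fst_ssum: "fst (ssum d G ts) = ssum d (%L R. fst (G L R)) ts"
 by (rule ssum_linear; simp add: linear_iff)+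

text \<open>The degree of a nonzero homogeneous vector is unique, and a zero entry makes the bracket
  vanish whichever degree is picked for it; so the choice is harmless on homogeneous lists.\<close>

definition m :: "('l \<times> 'l) list => 'l \<times> 'l" where
 "m vs = mt (map (%v. (SOME d. v : W d, v)) vs)"

lemma graded_W: "graded_space W"
 unfolding graded_space_def
proof (intro conjI allI impI ballI)
 show "subspace (W i)" for i by (rule subspace_W)
 fix I x i assume I: "finite I & (ALL i:I. x i : W i) & sum x I = 0" and i: "i : I"
 have fin: "finite I" using I by blast
 have "fst (sum x I) = 0" "snd (sum x I) = 0" using I by simp_all
 hence s1: "(SUM i:(%i. i + 1) ` I. fst (x (i - 1))) = 0" "(SUM i:I. snd (x i)) = 0"
  by (simp_all add: sum.reindex inj_on_def fst_sum snd_sum)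
 have mem: "fst (x i) : K (i + 1) & snd (x i) : A i" if "i : I" for i
 proof -
  have "x i : W i" using I that by blast
  thus ?thesis by (simp only: mem_Times_iff)
 qed
 have "fst (x (i + 1 - 1)) = 0"
  by (rule graded_spaceD[OF graded_K, of "(%i. i + 1) ` I" "%i. fst (x (i - 1))"])
   (use fin i mem s1(1) in auto)
 moreover have "snd (x i) = 0"
  by (rule graded_spaceD[OF graded_A, of I "%i. snd (x i)"]) (use fin i mem s1(2) in auto)
 ultimately show "x i = 0" by (simp add: prod_eq_iff)
qed

lemma degree_unique: "v : W d ==> v : W e ==> v ~= 0 ==> d = e"
 by (rule graded_space_degree_unique[OF graded_W])

lemma m_eq_mt:
 assumes "ok ts"
 shows "m (map snd ts) = mt ts"
proof (cases "EX t:set ts. snd t = 0")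
 case True
 then obtain t xs ys where ts: "ts = xs @ t # ys" "snd t = 0" by (metis split_list)
 let ?h = "%t :: 'l typed. (SOME d. snd t : W d, snd t)"
 have "ok (map ?h zs)" if "ok zs" for zs
  using that by (induction zs) (auto intro: someI)
 hence "mt (map ?h ts) = 0" "mt ts = 0"
  using assms mt_zero_elem[of "map ?h xs" "map ?h ys" "SOME d. 0 : W d"] mt_zero_elem[of xs ys "fst t"] ts
  by (simp_all, metis prod.collapse)
 thus ?thesis by (simp add: m_def o_def)
next
 case False
 have "(SOME d. snd t : W d, snd t) = t" if "t : set ts" for t
 proof -
  have mem: "snd t : W (fst t)" using assms that by (simp only: ok_def)
  have nz: "snd t ~= 0" using False that by blast
  have "snd t : W (SOME d. snd t : W d)" by (rule someI[of "%d. snd t : W d", OF mem])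
  hence "(SOME d. snd t : W d) = fst t" by (rule degree_unique[OF _ mem nz])
  thus ?thesis by simp
 qed
 hence "map (%t. (SOME d. snd t : W d, snd t)) ts = ts" by (simp add: map_idI)
 thus ?thesis by (simp add: m_def o_def)
qed

lemma homogeneous_typed:
 assumes "homogeneous W vs ds"
 obtains ts where "ok ts" "map snd ts = vs" "map fst ts = ds"
proof
 have "length vs = length ds" using assms by (auto simp: homogeneous_def list_all2_lengthD)
 thus "map snd (zip ds vs) = vs" "map fst (zip ds vs) = ds" by simp_all
 show "ok (zip ds vs)"
  using assms unfolding homogeneous_def by (induction rule: list_all2_induct) auto
qed

theorem L_infinity_1_m: "L_infinity_1 W m"
 unfolding L_infinity_1_def
proof (intro conjI allI impI)
 show "graded_space W" by (rule graded_W)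
next
 fix vs ds assume *: "homogeneous W vs ds & vs ~= []"
 obtain ts where ts: "ok ts" "map snd ts = vs" "map fst ts = ds" by (rule homogeneous_typed[OF conjunct1[OF *]])
 show "m vs : W (sum_list ds + 1)"
  using mt_W[OF ts(1)] m_eq_mt[OF ts(1)] unfolding ts(2,3) by (simp only:)
next
 fix xs ys ds es d u v r s
 assume *: "homogeneous W xs ds & homogeneous W ys es & u : W d & v : W d"
 obtain ts where ts: "ok ts" "map snd ts = xs" by (rule homogeneous_typed[OF conjunct1[OF *]])
 obtain us where us: "ok us" "map snd us = ys" by (rule homogeneous_typed[OF conjunct1[OF conjunct2[OF *]]])
 have uv: "u : W d" "v : W d" using * by (simp_all only:)
 have "m (xs @ w # ys) = mt (ts @ (d, w) # us)" if "w : W d" for w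
 proof -
  have "ok (ts @ (d, w) # us)" using ts us that by (simp only: ok_simps snd_conv fst_conv simp_thms)
  from m_eq_mt[OF this] show ?thesis by (simp only: map_append list.map ts us snd_conv)
 qed
 moreover have "r *: u + s *: v : W d" by (intro subspace_add subspace_scale subspace_W uv)
 ultimately show "m (xs @ (r *: u + s *: v) # ys) = r *: m (xs @ u # ys) + s *: m (xs @ v # ys)"
  using mt_lin[OF ts(1) us(1) uv, of r s] uv by (simp only:)
next
 fix vs ds si assume *: "homogeneous W vs ds & vs ~= [] & si permutes {..<length vs}"
 obtain ts where ts: "ok ts" "map snd ts = vs" "map fst ts = ds" by (rule homogeneous_typed[OF conjunct1[OF *]])
 have "length vs = length ts" using ts(2) by auto
 hence si: "si permutes {..<length ts}" using conjunct2[OF conjunct2[OF *]] by (simp only:)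
 have "ok (plist si ts)" using ok_mset[of "plist si ts" ts] ts(1) si by simp
 hence "m (plist si vs) = mt (plist si ts)"
  using m_eq_mt[of "plist si ts"] ts(2) permute_list_map[OF si, of snd] by simp
 moreover have "mt ts = koszul_sign (map fst ts) si *: mt (plist si ts)"
 proof (rule koszul_symmetric[OF _ si])
  fix xs u v ys assume "mset (xs @ u # v # ys) = mset ts"
  hence "ok (xs @ u # v # ys)" using ok_mset ts(1) by blast
  thus "mt (xs @ u # v # ys) = sg (fst u * fst v) *: mt (xs @ v # u # ys)" by (rule mt_swap)
 qed
 ultimately show "m vs = koszul_sign ds si *: m (plist si vs)"
  using m_eq_mt[OF ts(1)] unfolding ts(2,3) by (simp only:)
next
 fix vs ds assume *: "homogeneous W vs ds & vs ~= []"
 obtain ts where ts: "ok ts" "map snd ts = vs" "map fst ts = ds" by (rule homogeneous_typed[OF conjunct1[OF *]])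
 have len: "length vs = length ts" using ts(2) by auto
 have "(\<Sum>i = 1..length vs. SUM si:unshuffles i (length vs). koszul_sign ds si *:
     m (m (take i (plist si vs)) # drop i (plist si vs)))
   = (\<Sum>i = 1..length ts. SUM si:unshuffles i (length ts). koszul_sign (map fst ts) si *:
     (%Ls R. mt ((tdeg Ls + 1, mt Ls) # R)) (take i (plist si ts)) (drop i (plist si ts)))"
  unfolding len
 proof (intro sum.cong refl)
  fix i si assume "si : unshuffles i (length ts)"
  hence si: "si permutes {..<length ts}" by (simp add: unshuffles_def)
  have "ok (plist si ts)" using ok_mset[of "plist si ts" ts] ts(1) si by simp
  hence "ok (take i (plist si ts) @ drop i (plist si ts))" by simp
  hence oks: "ok (take i (plist si ts))" "ok (drop i (plist si ts))" by (simp_all only: ok_simps)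
  have p: "plist si vs = map snd (plist si ts)"
   using ts(2) permute_list_map[OF si, of snd] by simp
  let ?Ls = "take i (plist si ts)" and ?R = "drop i (plist si ts)"
  have "m (mt ?Ls # map snd ?R) = mt ((tdeg ?Ls + 1, mt ?Ls) # ?R)"
   using m_eq_mt[of "(tdeg ?Ls + 1, mt ?Ls) # ?R"] mt_W[OF oks(1)] oks(2) by simp
  thus "koszul_sign ds si *: m (m (take i (plist si vs)) # drop i (plist si vs)) =
   koszul_sign (map fst ts) si *: mt ((tdeg ?Ls + 1, mt ?Ls) # ?R)"
   unfolding p take_map drop_map m_eq_mt[OF oks(1)] ts(3) by simp
 qed
 also have "... = ssum fst (%Ls R. if 1 <= length Ls then mt ((tdeg Ls + 1, mt Ls) # R) else 0) ts"
  by (rule sum_unshuffles)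
 also have "... = ssum fst (%Ls R. mt ((tdeg Ls + 1, mt Ls) # R)) ts"
 proof (rule ssum_cong)
  fix Ls R assume *: "mset Ls + mset R = mset ts"
  \<comment> \<open>The empty inner list may be added to the sum: its bracket is the curvature
    \<open>P q\<close>, which is zero.\<close>
  show "(if 1 <= length Ls then mt ((tdeg Ls + 1, mt Ls) # R) else 0) = mt ((tdeg Ls + 1, mt Ls) # R)"
   using mt_zero_elem[of "[]" R 1] ok_split[OF ts(1) *] q(3)
   by (cases "Ls = []") (simp_all add: Suc_le_eq mt_def[of "[]"] m1_def[of "[]"] m2_def[of "[]"] single_def zero_prod_def)
 qed
 also have "... = 0"
  using jacobi_first_component[OF ts(1)] jacobi_second_component[OF ts(1)]
  by (simp add: prod_eq_iff mt_def[of "_ # _"] fst_ssum snd_ssum)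
 finally show "(\<Sum>i = 1..length vs. SUM si:unshuffles i (length vs). koszul_sign ds si *:
     m (m (take i (plist si vs)) # drop i (plist si vs))) = 0" .
qed

lemma m_X:
 assumes "x : K (d + 1)"
 shows "m [(x, 0)] = (- br q x, P x)"
 using m_eq_mt[of "[(d, x, 0)]"] m2_Cons[of "[]" 0 d x] m1_atype_Cons[of "[]" x d 0] assms q_L
 by (simp add: mt_def)

lemma m_XY:
 assumes "x : K (d + 1)" "y : K (e + 1)"
 shows "m [(x, 0), (y, 0)] = (sg (d + 1) *: br x y, 0)"
 using m_eq_mt[of "[(d, x, 0), (e, y, 0)]"] mt_two assms by simp

lemma typed_as:
 assumes "set as <= (\<Union>d. A d)"
 obtains ts where "ok ts" "atype ts" "map snd ts = map (%a. (0, a)) as" "map ta ts = as"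
proof -
 let ?ts = "map (%a. (SOME d. a : A d, 0, a)) as"
 have "a : A (SOME d. a : A d)" if "a : set as" for a
  using assms that by (intro someI_ex[of "%d. a : A d"]) auto
 hence "ok ?ts" "atype ?ts" by (auto simp: ok_def atype_def)
 thus thesis by (intro that[of ?ts]) (auto simp: o_def)
qed

lemma m_as:
 assumes "set as <= (\<Union>d. A d)"
 shows "m (map (%a. (0, a)) as) = (0, P (foldl br q as))"
proof -
 obtain ts where ts: "ok ts" "atype ts" "map snd ts = map (%a. (0, a)) as" "map ta ts = as"
  by (rule typed_as[OF assms])
 show ?thesis
  using m_eq_mt[OF ts(1)] m1_atype[OF ts(2,1)] m2_atype[OF ts(2,1)]
  by (simp add: ts(3) mt_def act_def ts(4))
qed

lemma m_Xas:
 assumes "set as <= (\<Union>d. A d)" "as ~= []" "x : K (d + 1)"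
 shows "m ((x, 0) # map (%a. (0, a)) as) = (0, P (foldl br x as))"
proof -
 obtain ts where ts: "ok ts" "atype ts" "map snd ts = map (%a. (0, a)) as" "map ta ts = as"
  by (rule typed_as[OF assms(1)])
 have "ts ~= []" using ts(4) assms(2) by auto
 thus ?thesis
  using m_eq_mt[of "(d, x, 0) # ts"] m1_atype_Cons[OF ts(2,1) assms(3), of 0] m2_Cons[OF ts(2,1), of 0 d x] ts(1)
   assms(3) q_L ok_aok[OF ts(1)]
  by (simp add: ts(3) mt_def act_def[of x] ts(4))
qed

lemma m_many:
 assumes "set Xs <= (\<Union>d. K d)" "set as <= (\<Union>d. A d)"
  "length Xs >= 3 | length Xs = 2 & as ~= []"
 shows "m (map (%X. (X, 0)) Xs @ map (%a. (0, a)) as) = 0"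
proof -
 obtain ts where ts: "ok ts" "map snd ts = map (%a. (0, a)) as"
  by (rule typed_as[OF assms(2)])
 let ?us = "map (%X. ((SOME d. X : K d) - 1, X, 0)) Xs"
 have "X : K (SOME d. X : K d)" if "X : set Xs" for X
  using assms(1) that by (intro someI_ex[of "%d. X : K d"]) auto
 hence us: "ok ?us" by (auto simp: ok_def)
 have us': "map snd ?us = map (%X. (X, 0)) Xs" by simp
 have okt: "ok (?us @ ts)" using us ts by simp
 have "nX ?us = length Xs" by (simp add: nX_def filter_map o_def)
 hence "nX (?us @ ts) >= 2" using assms(3) by auto
 hence "m2 (?us @ ts) = 0" by (rule m2_nX[OF okt])
 moreover have "length ts = length as" using ts(2) by (metis length_map)
 hence "m1 (?us @ ts) = 0" using assms(3) by (intro m1_eq_0) auto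
 ultimately have "mt (?us @ ts) = 0" by (simp add: mt_def zero_prod_def)
 thus ?thesis using m_eq_mt[OF okt] by (simp only: map_append us' ts(2))
qed

text \<open>The number \<open>k\<close> counts the copies already moved to the second list, which
  the recursion of \<open>ssum\<close> increases. The factor \<open>n\<close> is the number of
  choices for the entry that supplies \<open>x\<close>; all degrees are 0, so no signs
  appear.\<close>

lemma ssum_single_replicate:
 "ssum fst (%Ls R. single Ls (replicate k (0, x, a) @ R)) (replicate n (0, x, a))
  = real n *: P (act x (replicate (k + n - 1) (0, x, a)))"
proof (induction n arbitrary: k)
 case 0
 thus ?case by (simp add: single_def)
next
 case (Suc n)
 let ?t = "(0, x, a) :: 'l typed"
 have "ssum fst (%Ls R. single (?t # Ls) (replicate k ?t @ R)) (replicate n ?t)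
  = ssum fst (%Ls R. if Ls = [] then P (act x (replicate k ?t @ R)) else 0) (replicate n ?t)"
  by (intro ssum_cong) (auto simp: single_def split: list.splits)
 also have "... = P (act x (replicate (k + n) ?t))" by (simp add: ssum_Nil_left replicate_add)
 finally have 1: "ssum fst (%Ls R. single (?t # Ls) (replicate k ?t @ R)) (replicate n ?t) = P (act x (replicate (k + n) ?t))" .
 have eq: "replicate k ?t @ ?t # R = replicate (Suc k) ?t @ R" for R
  by (metis append_Cons replicate_Suc replicate_app_Cons_same)
 have "ssum fst (%Ls R. single Ls (replicate k ?t @ ?t # R)) (replicate n ?t)
  = real n *: P (act x (replicate (k + n) ?t))"
  unfolding eq using Suc.IH[of "Suc k"] by (simp only: add_Suc diff_Suc_1)
 with 1 show ?case by (simp add: scaleR_add_left)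
qed

text \<open>The terms of the Maurer-Cartan series. The factor \<open>real (Suc n)\<close> later
  turns 1/(n+1)! into 1/n! in the part that involves \<open>x\<close>.\<close>

lemma m_replicate:
 assumes "x : K 1" "a : A 0"
 shows "m (replicate (Suc n) (x, a)) = ((if n = 0 then - br q x else if n = 1 then - br x x else 0),
  P (foldl br q (replicate (Suc n) a)) + real (Suc n) *: P (foldl br x (replicate n a)))"
proof -
 let ?ts = "replicate (Suc n) (0, x, a) :: 'l typed list"
 have ok: "ok ?ts" using assms by (auto simp: ok_def)
 have "m (replicate (Suc n) (x, a)) = mt ?ts" using m_eq_mt[OF ok] by simp
 moreover have "m1 ?ts = (if n = 0 then - br q x else if n = 1 then - br x x else 0)"
 proof (cases "n = 0 | n = 1")
  case False
  thus ?thesis by (subst m1_eq_0) auto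
 qed (auto simp: m1_def)
 moreover have "m2 ?ts = P (foldl br q (replicate (Suc n) a)) + real (Suc n) *: P (foldl br x (replicate n a))"
  using ssum_single_replicate[of 0 x a "Suc n"] by (simp add: m2_def act_def del: replicate_Suc ssum.simps)
 ultimately show ?thesis by (simp add: mt_def)
qed

end

section \<open>Multiderivations and the Nijenhuis-Richardson bracket\<close>

locale fun_algebra =
 fixes F :: "('a => real) set"
 assumes subspace_F: "subspace F" and mult_F: "f : F ==> g : F ==> f * g : F"
begin

text \<open>Skew symmetry is imposed on all lists, including those on which \<open>X\<close>
  vanishes by convention; linearity in the first slot then extends to every slot.\<close>

definition ALT :: "nat => 'a multivector set" where
 "ALT k = {X. (ALL fs. ~ (length fs = k & set fs <= F) --> X fs = 0) & (ALL fs. X fs : F) &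
  (ALL xs u v ys. X (xs @ u # v # ys) = - X (xs @ v # u # ys)) &
  (ALL f:F. ALL g:F. ALL r s fs. X ((r *: f + s *: g) # fs) = r *: X (f # fs) + s *: X (g # fs))}"

definition MD :: "nat => 'a multivector set" where
 "MD k = {X:ALT k. ALL f:F. ALL g:F. ALL fs. X ((f * g) # fs) = f * X (g # fs) + g * X (f # fs)}"

lemma F_simps [simp]: "0 : F" "f : F ==> g : F ==> f + g : F" "f : F ==> - f : F"
 "f : F ==> g : F ==> f - g : F" "f : F ==> r *: f : F" "f : F ==> g : F ==> f * g : F"
 using subspace_F mult_F by (auto simp: subspace_0 subspace_add subspace_neg subspace_diff subspace_scale)

lemma ALT_dom: "X : ALT k ==> ~ (length fs = k & set fs <= F) ==> X fs = 0"
 and ALT_F: "X : ALT k ==> X fs : F"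
 and ALT_swap: "X : ALT k ==> X (xs @ u # v # ys) = - X (xs @ v # u # ys)"
 and ALT_lin: "X : ALT k ==> f : F ==> g : F ==> X ((r *: f + s *: g) # fs) = r *: X (f # fs) + s *: X (g # fs)"
 unfolding ALT_def by blast+

lemma MD_ALT: "X : MD k ==> X : ALT k"
 and MD_deriv: "X : MD k ==> f : F ==> g : F ==> X ((f * g) # fs) = f * X (g # fs) + g * X (f # fs)"
 by (simp_all add: MD_def)

lemma ALT_swap_head: "X : ALT k ==> X (u # v # ys) = - X (v # u # ys)"
 using ALT_swap[where xs = "[]"] unfolding append_Nil .

lemma ALT_scale: "X : ALT k ==> f : F ==> X ((r *: f) # fs) = r *: X (f # fs)"
 using ALT_lin[of X k f f r 0 fs] by simp

lemma ALT_add: "X : ALT k ==> f : F ==> g : F ==> X ((f + g) # fs) = X (f # fs) + X (g # fs)"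
 using ALT_lin[of X k f g 1 1 fs] by simp

lemma ALT_zero: "X : ALT k ==> X (0 # fs) = 0"
 using ALT_scale[of X k 0 0 fs] by simp

lemma ALT_zero2: "X : ALT k ==> X (u # 0 # fs) = 0"
 by (subst ALT_swap_head) (simp_all only: ALT_zero minus_zero)

lemma ALT_neg: "X : ALT k ==> f : F ==> X ((- f) # fs) = - X (f # fs)"
 using ALT_scale[of X k f "-1" fs] by simp

lemma ALT_ssum:
 assumes "X : ALT k" "!!L R. mset L + mset R = mset vs ==> G L R : F"
 shows "X (ssum d G vs # fs) = ssum d (%L R. X (G L R # fs)) vs"
 by (rule ssum_linear_on[of F "%g. X (g # fs)"]) (use assms ALT_lin subspace_F in auto)

lemma ALT_lin_slot:
 assumes X: "X : ALT k" and "f : F" "g : F"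
 shows "X (xs @ (r *: f + s *: g) # ys) = r *: X (xs @ f # ys) + s *: X (xs @ g # ys)"
proof -
 \<comment> \<open>Moving a slot to the front costs a sign \<open>c\<close> that does not depend on
   the entry.\<close>
 have "EX c. ALL h. X (xs @ h # ys) = c *: X (h # xs @ ys)"
 proof (induction xs arbitrary: ys rule: rev_induct)
  case Nil
  thus ?case by (auto intro: exI[of _ 1])
 next
  case (snoc x xs)
  obtain c where c: "!!h. X (xs @ h # x # ys) = c *: X (h # xs @ x # ys)"
   using snoc[of "x # ys"] by blast
  have "X ((xs @ [x]) @ h # ys) = (- c) *: X (h # (xs @ [x]) @ ys)" for h
   using c[of h] ALT_swap[OF X, of xs x h ys] by simp
  thus ?case by blast
 qed
 then obtain c where c: "!!h. X (xs @ h # ys) = c *: X (h # xs @ ys)" by blast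
 show ?thesis
  unfolding c using ALT_lin[OF X assms(2,3)] by (simp add: scaleR_add_right mult.commute)
qed

lemma ALT_repeat:
 assumes "X : ALT k" shows "X (xs @ u # u # ys) = 0"
proof -
 have "X (xs @ u # u # ys) = - X (xs @ u # u # ys)" by (rule ALT_swap[OF assms])
 thus ?thesis by (auto simp: fun_eq_iff)
qed

lemma sub_ALT: "subspace (ALT k)"
 unfolding subspace_def
proof (intro conjI ballI allI)
 show "0 : ALT k" by (simp add: ALT_def)
 fix X Y assume XY: "X : ALT k" "Y : ALT k"
 show "X + Y : ALT k"
  unfolding ALT_def mem_Collect_eq
 proof (intro conjI allI ballI impI)
  show "(X + Y) (xs @ u # v # ys) = - (X + Y) (xs @ v # u # ys)" for xs u v ys
   by (simp add: ALT_swap[OF XY(1), of xs u v] ALT_swap[OF XY(2), of xs u v])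
 qed (use ALT_dom[OF XY(1)] ALT_dom[OF XY(2)] ALT_F[OF XY(1)] ALT_F[OF XY(2)]
   ALT_lin[OF XY(1)] ALT_lin[OF XY(2)] in \<open>auto simp: scaleR_add_right\<close>)
next
 fix c X assume X: "X : ALT k"
 have s: "(c *: X) fs = c *: X fs" for fs by (simp add: fscale)
 show "c *: X : ALT k"
  unfolding ALT_def mem_Collect_eq s
 proof (intro conjI allI ballI impI)
  show "c *: X (xs @ u # v # ys) = - (c *: X (xs @ v # u # ys))" for xs u v ys
   unfolding ALT_swap[OF X, of xs u v] by simp
 qed (use ALT_dom[OF X] ALT_F[OF X] ALT_lin[OF X] in \<open>auto simp: scaleR_add_right mult.commute\<close>)
qed

lemma sub_MD: "subspace (MD k)"
 unfolding subspace_def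
proof (intro conjI ballI allI)
 show "0 : MD k" using sub_ALT by (simp add: MD_def subspace_0)
 fix X Y assume XY: "X : MD k" "Y : MD k"
 thus "X + Y : MD k"
  using MD_deriv[OF XY(1)] MD_deriv[OF XY(2)] sub_ALT
  by (simp add: MD_def subspace_add algebra_simps)
next
 fix c X assume X: "X : MD k"
 have s: "(c *: X) fs = c *: X fs" for fs by (simp add: fscale)
 show "c *: X : MD k"
  using X MD_deriv[OF X] sub_ALT by (simp add: MD_def subspace_scale s)
   (simp add: fun_eq_iff fscale algebra_simps)
qed

text \<open>The insertion product of Nijenhuis and Richardson: \<open>Y\<close> goes into the first
  slot of \<open>X\<close>, and the arguments are antisymmetrized over unshuffles.\<close>

definition comp :: "'a multivector => 'a multivector => 'a multivector" where
 "comp X Y fs = ssum (%_. 1) (%L R. X (Y L # R)) fs"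

lemma comp_term_dom:
 assumes "X : ALT k" "Y : ALT l" "~ (length L = l & Suc (length R) = k & set L Un set R <= F)"
 shows "X (Y L # R) = 0"
proof (cases "length L = l & set L <= F")
 case True
 thus ?thesis using assms ALT_dom[OF assms(1), of "Y L # R"] by auto
next
 case False
 hence "Y L = 0" by (rule ALT_dom[OF assms(2)])
 thus ?thesis by (simp only: ALT_zero[OF assms(1)])
qed

lemma mset_split_length: "mset L + mset R = mset fs ==> length fs = length L + length R"
 by (metis size_mset size_union)

lemma mset_split_set: "mset L + mset R = mset fs ==> set fs = set L Un set R"
 by (metis mset_append set_append set_mset_mset)

lemma tdeg_1 [simp]: "sum_list (map (%_. 1) xs) = int (length xs)"
 by (induction xs) simp_all

lemma comp_ALT:
 assumes X: "X : ALT k" and Y: "Y : ALT l"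
 shows "comp X Y : ALT (k + l - 1)"
 unfolding ALT_def mem_Collect_eq
proof (intro conjI allI ballI impI)
 fix fs assume fs: "~ (length fs = k + l - 1 & set fs <= F)"
 have "comp X Y fs = ssum (%_. 1) (%L R. 0) fs"
  unfolding comp_def
 proof (rule ssum_cong)
  fix L R assume *: "mset L + mset R = mset fs"
  show "X (Y L # R) = 0"
   using fs mset_split_length[OF *] mset_split_set[OF *] by (intro comp_term_dom[OF X Y]) auto
 qed
 thus "comp X Y fs = 0" by simp
next
 fix fs show "comp X Y fs : F"
  unfolding comp_def by (intro ssum_closed subspace_F ALT_F[OF X])
next
 fix xs u v ys
 have "comp X Y (xs @ u # v # ys) = sg (1 * 1) *: comp X Y (xs @ v # u # ys)"
  unfolding comp_def
 proof (rule ssum_swap)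
  fix ls ms R
  have "X (Y (ls @ u # v # ms) # R) = X ((- Y (ls @ v # u # ms)) # R)"
   by (simp only: ALT_swap[OF Y, of ls u v ms])
  thus "X (Y (ls @ u # v # ms) # R) = sg (1 * 1) *: X (Y (ls @ v # u # ms) # R)"
   by (simp add: ALT_neg[OF X ALT_F[OF Y]])
 next
  fix ls ms L
  show "X (Y L # ls @ u # v # ms) = sg (1 * 1) *: X (Y L # ls @ v # u # ms)"
   using ALT_swap[OF X, of "Y L # ls" u v ms] by (simp only: append_Cons) simp
 qed
 thus "comp X Y (xs @ u # v # ys) = - comp X Y (xs @ v # u # ys)" by simp
next
 fix f g r s fs assume fg: "f : F" "g : F"
 have 1: "X (Y ((r *: f + s *: g) # L) # R) = r *: X (Y (f # L) # R) + s *: X (Y (g # L) # R)" for L R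
  using ALT_lin[OF Y fg] ALT_lin[OF X ALT_F[OF Y] ALT_F[OF Y]] by simp
 have 2: "X (Y L # (r *: f + s *: g) # R) = r *: X (Y L # f # R) + s *: X (Y L # g # R)" for L R
  using ALT_lin_slot[OF X fg, of "[Y L]" r s R] by simp
 show "comp X Y ((r *: f + s *: g) # fs) = r *: comp X Y (f # fs) + s *: comp X Y (g # fs)"
  by (simp add: comp_def 1 2 scaleR_add_right ssum_add flip: ssum_scaleR)
   (simp add: mult.commute)
qed

lemma comp_add_left: "comp (X + X') Y = comp X Y + comp X' Y"
 by (simp add: fun_eq_iff comp_def ssum_add)

lemma comp_scale_left: "comp (r *: X) Y = r *: comp X Y"
 by (auto simp: fun_eq_iff comp_def fscale[of r X] ssum_scaleR fscale[of r "comp X Y"])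

lemma comp_add_right: "X : ALT k ==> Y : ALT l ==> Y' : ALT l' ==> comp X (Y + Y') = comp X Y + comp X Y'"
proof
 fix fs assume X: "X : ALT k" and Y: "Y : ALT l" "Y' : ALT l'"
 show "comp X (Y + Y') fs = (comp X Y + comp X Y') fs"
  unfolding fplus[of "comp X Y"] comp_def ssum_add[symmetric] fplus[of Y]
  by (simp only: ALT_add[OF X ALT_F[OF Y(1)] ALT_F[OF Y(2)]])
qed

lemma comp_scale_right: "X : ALT k ==> Y : ALT l ==> comp X (r *: Y) = r *: comp X Y"
 by (auto simp: fun_eq_iff comp_def fscale[of r Y] ALT_scale ALT_F ssum_scaleR fscale[of r "comp X Y"])

text \<open>In the nonzero terms the lengths of both sublists are fixed by \<open>k\<close> and
  \<open>l\<close>, so the varying sign of the definition becomes the constant sign of a graded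
  commutator.\<close>

lemma schouten_comp:
 assumes X: "X : ALT k" and Y: "Y : ALT l"
 shows "schouten X Y = sg ((int k - 1) * (int l - 1)) *: comp X Y - comp Y X"
proof
 fix fs
 have "schouten X Y fs = ssum (%_. 1) (%L R. sg ((int k - 1) * (int l - 1)) *: X (Y L # R) - Y (X L # R)) fs"
  unfolding schouten_eq_ssum
 proof (rule ssum_cong)
  fix L R
  show "sg (int (length R) * (int (length L) - 1)) *: X (Y L # R) - Y (X L # R)
    = sg ((int k - 1) * (int l - 1)) *: X (Y L # R) - Y (X L # R)"
   by (cases "length L = l & Suc (length R) = k") (auto simp: comp_term_dom[OF X Y])
 qed
 thus "schouten X Y fs = (sg ((int k - 1) * (int l - 1)) *: comp X Y - comp Y X) fs"
  by (simp add: ssum_diff ssum_scaleR comp_def fscale[of _ "comp X Y"])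
qed

text \<open>The associator of \<open>comp\<close>: the terms in which \<open>Y\<close> and
  \<open>Z\<close> are inserted into two different slots of \<open>X\<close>.\<close>

definition assoc_defect :: "'a multivector => 'a multivector => 'a multivector => 'a multivector" where
 "assoc_defect X Y Z fs = ssum (%_. 1) (%L R. ssum (%_. 1) (%R1 R2.
   sg (int (length R1)) *: X (Y R1 # Z L # R2)) R) fs"

lemma comp_comp:
 assumes X: "X : ALT k" and Y: "Y : ALT l" and Z: "Z : ALT n"
 shows "comp (comp X Y) Z = comp X (comp Y Z) + assoc_defect X Y Z"
proof
 fix fs
 have "comp (comp X Y) Z fs = ssum (%_. 1) (%L R. ssum (%_. 1) (%R1 R2. X (Y (Z L # R1) # R2)) R) fs
   + assoc_defect X Y Z fs"
  by (simp add: comp_def assoc_defect_def ssum_add)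
 also have "ssum (%_. 1) (%L R. ssum (%_. 1) (%R1 R2. X (Y (Z L # R1) # R2)) R) fs
   = ssum (%_. 1) (%K R2. ssum (%_. 1) (%L R1. X (Y (Z L # R1) # R2)) K) fs"
  by (rule ssum_coassoc)
 also have "... = comp X (comp Y Z) fs"
  unfolding comp_def by (simp add: ALT_ssum[OF X] ALT_F[OF Y])
 finally show "comp (comp X Y) Z fs = (comp X (comp Y Z) + assoc_defect X Y Z) fs" by (simp add: plus_fun_def)
qed

text \<open>Graded symmetry of the associator in its last two arguments says that
  \<open>comp\<close> is a graded pre-Lie product; the Jacobi identity for its commutator follows
  from this.\<close>

lemma assoc_defect_swap:
 assumes X: "X : ALT k" and Y: "Y : ALT l" and Z: "Z : ALT n"
 shows "assoc_defect X Y Z = sg ((int l - 1) * (int n - 1)) *: assoc_defect X Z Y"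
proof
 fix fs
 let ?d = "%_ :: 'a => real. 1 :: int"
 have "assoc_defect X Y Z fs = ssum ?d (%K R2. ssum ?d (%L R1. sg (int (length R1)) *: X (Y R1 # Z L # R2)) K) fs"
  unfolding assoc_defect_def by (rule ssum_coassoc)
 also have "... = ssum ?d (%K R2. ssum ?d (%L R1. sg (int (length L) * int (length R1)) *:
   sg (int (length L)) *: X (Y L # Z R1 # R2)) K) fs"
  by (subst ssum_cocomm) simp
 also have "... = ssum ?d (%K R2. ssum ?d (%L R1. sg ((int l - 1) * (int n - 1)) *:
   sg (int (length R1)) *: X (Z R1 # Y L # R2)) K) fs"
 proof (intro ssum_cong)
  fix L R1 R2
  show "sg (int (length L) * int (length R1)) *: sg (int (length L)) *: X (Y L # Z R1 # R2)
   = sg ((int l - 1) * (int n - 1)) *: sg (int (length R1)) *: X (Z R1 # Y L # R2)"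
  proof (cases "length L = l & length R1 = n")
   case True
   thus ?thesis
    unfolding ALT_swap_head[OF X, of "Y L"] by (simp add: sg_def)
  next
   case False
   hence "Y L = 0 | Z R1 = 0" using ALT_dom Y Z by blast
   thus ?thesis by (elim disjE) (simp_all only: ALT_zero[OF X] ALT_zero2[OF X] scaleR_zero_right)
  qed
 qed
 also have "... = sg ((int l - 1) * (int n - 1)) *: ssum ?d (%K R2. ssum ?d (%L R1. sg (int (length R1)) *: X (Z R1 # Y L # R2)) K) fs"
  by (simp only: ssum_scaleR)
 also have "ssum ?d (%K R2. ssum ?d (%L R1. sg (int (length R1)) *: X (Z R1 # Y L # R2)) K) fs = assoc_defect X Z Y fs"
  unfolding assoc_defect_def by (rule ssum_coassoc[symmetric])
 finally show "assoc_defect X Y Z fs = (sg ((int l - 1) * (int n - 1)) *: assoc_defect X Z Y) fs"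
  by (simp add: fscale[of _ "assoc_defect X Z Y"])
qed

lemma schouten_anti:
 assumes X: "X : ALT k" and Y: "Y : ALT l"
 shows "schouten X Y = - (sg ((int k - 1) * (int l - 1)) *: schouten Y X)"
 unfolding schouten_comp[OF X Y] schouten_comp[OF Y X]
 by (simp add: scaleR_diff_right mult.commute)

lemma schouten_ALT:
 assumes X: "X : ALT k" and Y: "Y : ALT l"
 shows "schouten X Y : ALT (k + l - 1)"
 unfolding schouten_comp[OF X Y]
 using comp_ALT[OF X Y] comp_ALT[OF Y X]
 by (auto intro!: subspace_diff[OF sub_ALT] subspace_scale[OF sub_ALT] simp: add.commute)

lemma comp_0: "X : ALT 0 ==> comp X Y = 0"
proof
 fix fs assume X: "X : ALT 0"
 have "comp X Y fs = ssum (%_. 1) (%_ _. 0) fs"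
  unfolding comp_def by (intro ssum_cong ALT_dom[OF X]) simp
 thus "comp X Y fs = 0 fs" by simp
qed

lemma schouten_0_0: "X : ALT 0 ==> Y : ALT 0 ==> schouten X Y = 0"
 by (simp add: schouten_comp comp_0)

lemma comp_zero: "comp 0 X = 0" "X : ALT k ==> comp X 0 = 0"
 using comp_scale_left[of 0 0 X] comp_scale_right[of X k 0 0 0] subspace_0[OF sub_ALT] by auto

lemma schouten_zero: "X : ALT k ==> schouten 0 X = 0" "X : ALT k ==> schouten X 0 = 0"
 using schouten_comp[OF subspace_0[OF sub_ALT[of 0]], of X k]
  schouten_comp[OF _ subspace_0[OF sub_ALT[of 0]], of X k] by (simp_all add: comp_zero)

lemma schouten_jacobi:
 assumes X: "X : ALT k" and Y: "Y : ALT l" and Z: "Z : ALT n"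
 shows "schouten (schouten X Y) Z = schouten X (schouten Y Z)
  + sg ((int l - 1) * (int n - 1)) *: schouten (schouten X Z) Y"
proof -
 let ?s = "%a b. sg ((int a - 1) * (int b - 1))"
 let ?s2 = "%a b c. sg ((int a - 1 + (int b - 1)) * (int c - 1))"
 have nested: "schouten (schouten X Y) Z = ?s2 k l n *: comp (schouten X Y) Z - comp Z (schouten X Y)"
  if X: "X : ALT k" and Y: "Y : ALT l" and Z: "Z : ALT n" for X Y Z k l n
 \<comment> \<open>For two functions the truncated degree \<open>k + l - 1\<close> is 0 instead of
   -1; their bracket is zero, so the formula still holds.\<close>
 proof (cases "k + l = 0")
  case True
  hence 0: "schouten X Y = 0" using X Y schouten_0_0 by simp
  show ?thesis by (simp add: 0 schouten_zero[OF Z] comp_zero comp_zero(2)[OF Z])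
 next
  case False
  hence "int (k + l - 1) - 1 = int k - 1 + (int l - 1)" by auto
  thus ?thesis using schouten_comp[OF schouten_ALT[OF X Y] Z] by simp
 qed
 have cc: "comp (schouten X Y) Z = ?s k l *: (comp X (comp Y Z) + assoc_defect X Y Z)
   - (comp Y (comp X Z) + assoc_defect Y X Z)"
  "comp Z (schouten X Y) = ?s k l *: comp Z (comp X Y) - comp Z (comp Y X)"
  if X: "X : ALT k" and Y: "Y : ALT l" and Z: "Z : ALT n" for X Y Z k l n
 proof -
  have e: "schouten X Y = ?s k l *: comp X Y + (- 1) *: comp Y X"
   using schouten_comp[OF X Y] by simp
  show "comp (schouten X Y) Z = ?s k l *: (comp X (comp Y Z) + assoc_defect X Y Z)
   - (comp Y (comp X Z) + assoc_defect Y X Z)"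
   unfolding e comp_add_left comp_scale_left comp_comp[OF X Y Z] comp_comp[OF Y X Z] by simp
  have "comp Z (schouten X Y) = comp Z (?s k l *: comp X Y) + comp Z ((- 1) *: comp Y X)"
   unfolding e by (rule comp_add_right[OF Z]) (rule subspace_scale[OF sub_ALT] comp_ALT X Y)+
  thus "comp Z (schouten X Y) = ?s k l *: comp Z (comp X Y) - comp Z (comp Y X)"
   unfolding comp_scale_right[OF Z comp_ALT[OF X Y]] comp_scale_right[OF Z comp_ALT[OF Y X]] by simp
 qed
 have swap: "schouten X (schouten Y Z) = - (sg ((int k - 1) * (int l - 1 + (int n - 1))) *: schouten (schouten Y Z) X)"
 proof (cases "l + n = 0")
  case True
  hence "schouten Y Z = 0" using Y Z schouten_0_0 by simp
  thus ?thesis using schouten_zero[OF X] by simp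
 next
  case False
  hence "int (l + n - 1) - 1 = int l - 1 + (int n - 1)" by auto
  thus ?thesis using schouten_anti[OF X schouten_ALT[OF Y Z]] by simp
 qed
 show ?thesis
  unfolding swap nested[OF X Y Z] nested[OF Y Z X] nested[OF X Z Y] cc[OF X Y Z] cc[OF Y Z X] cc[OF X Z Y]
   assoc_defect_swap[OF X Z Y] assoc_defect_swap[OF Y Z X] assoc_defect_swap[OF Z Y X]
  by (cases "even k"; cases "even l"; cases "even n"; simp add: sg_def)
qed

text \<open>The second-order terms of \<open>comp X Y\<close> and of \<open>comp Y X\<close> cancel in the Schouten bracket.\<close>

definition leibniz_defect :: "'a multivector => 'a multivector => ('a => real) => ('a => real) => 'a multivector" where
 "leibniz_defect X Y f g fs = ssum (%_. 1) (%L R. X (f # R) * Y (g # L) + X (g # R) * Y (f # L)) fs"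

lemma ssum_mult: "ssum d (%L R. (f :: 'b => real) * G L R) vs = f * ssum d G vs"
 by (rule ssum_linear[of "%g. f * g", symmetric]) (simp add: linear_iff distrib_left fun_eq_iff fscale)

lemma comp_leibniz:
 assumes X: "X : MD k" and Y: "Y : MD l" and f: "f : F" and g: "g : F"
 shows "comp X Y ((f * g) # fs) = f * comp X Y (g # fs) + g * comp X Y (f # fs) + leibniz_defect X Y f g fs"
proof -
 note XA = MD_ALT[OF X] and YA = MD_ALT[OF Y]
 have YF: "Y gs : F" for gs by (rule ALT_F[OF YA])
 have 1: "X (Y ((f * g) # L) # R) = f * X (Y (g # L) # R) + g * X (Y (f # L) # R)
   + (X (f # R) * Y (g # L) + X (g # R) * Y (f # L))" for L R
  unfolding MD_deriv[OF Y f g]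
  using f g YF by (simp add: ALT_add[OF XA] MD_deriv[OF X] algebra_simps)
 have 2: "X (Y L # (f * g) # R) = f * X (Y L # g # R) + g * X (Y L # f # R)" for L R
  unfolding ALT_swap_head[OF XA, of "Y L"] MD_deriv[OF X f g] by (simp add: algebra_simps)
 have s: "c *: (f * g) = f * (c *: g)" for c and f g :: "'a => real"
  by (simp add: fun_eq_iff fscale)
 show ?thesis
  by (simp add: comp_def leibniz_defect_def 1 2 ssum_add scaleR_add_right s ssum_mult algebra_simps)
qed

lemma leibniz_defect_swap:
 assumes X: "X : ALT k" and Y: "Y : ALT l"
 shows "leibniz_defect X Y f g fs = sg ((int k - 1) * (int l - 1)) *: leibniz_defect Y X f g fs"
 proof -
 have "X (f # R) * Y (g # L) + X (g # R) * Y (f # L) = 0" if "~ (Suc (length R) = k & Suc (length L) = l)" for L R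
  using that ALT_dom[OF X, of "_ # R"] ALT_dom[OF Y, of "_ # L"] by (auto simp: zero_fun_def)
 hence "sg (int (length L) * int (length R)) *: (X (f # L) * Y (g # R) + X (g # L) * Y (f # R))
   = sg ((int k - 1) * (int l - 1)) *: (Y (f # R) * X (g # L) + Y (g # R) * X (f # L))" for L R
  by (cases "Suc (length L) = k & Suc (length R) = l") (auto simp: algebra_simps)
 thus ?thesis
  unfolding leibniz_defect_def ssum_scaleR[symmetric]
  by (subst ssum_cocomm) simp
qed

lemma schouten_MD:
 assumes X: "X : MD k" and Y: "Y : MD l"
 shows "schouten X Y : MD (k + l - 1)"
 unfolding MD_def mem_Collect_eq
proof (intro conjI ballI allI)
 note XA = MD_ALT[OF X] and YA = MD_ALT[OF Y]
 show "schouten X Y : ALT (k + l - 1)" by (rule schouten_ALT[OF XA YA])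
 fix f g fs assume f: "f : F" and g: "g : F"
 have s: "(c *: Z) gs = c *: Z gs" for c gs and Z :: "'a multivector" by (simp add: fscale)
 have m: "c *: (f * g) = f * (c *: g)" for c and f g :: "'a => real"
  by (simp add: fun_eq_iff fscale)
 show "schouten X Y ((f * g) # fs) = f * schouten X Y (g # fs) + g * schouten X Y (f # fs)"
  unfolding schouten_comp[OF XA YA] minus_apply s comp_leibniz[OF X Y f g] comp_leibniz[OF Y X f g]
   leibniz_defect_swap[OF XA YA]
  by (simp add: scaleR_add_right m fun_eq_iff algebra_simps)
qed

text \<open>The wedge product as a shuffle product. Written with \<open>ssum\<close>, its
  associativity and the Leibniz rule are consequences of coassociativity and
  cocommutativity.\<close>

definition wdg :: "'a multivector => 'a multivector => 'a multivector" where
 "wdg X Y fs = ssum (%_. 1) (%L R. X L * Y R) fs"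

lemma scaleR_mult_fun: "c *: (f * g) = (c *: f) * g" "(f :: 'b => real) * (c *: g) = c *: (f * g)"
 by (simp_all add: fun_eq_iff fscale)

lemma wdg_ALT:
 assumes X: "X : ALT k" and Y: "Y : ALT l"
 shows "wdg X Y : ALT (k + l)"
 unfolding ALT_def mem_Collect_eq
proof (intro conjI allI ballI impI)
 fix fs assume fs: "~ (length fs = k + l & set fs <= F)"
 have "wdg X Y fs = ssum (%_. 1) (%L R. 0) fs"
  unfolding wdg_def
 proof (rule ssum_cong)
  fix L R assume *: "mset L + mset R = mset fs"
  have "~ (length L = k & set L <= F) | ~ (length R = l & set R <= F)"
   using fs mset_split_length[OF *] mset_split_set[OF *] by auto
  hence "X L = 0 | Y R = 0" using ALT_dom[OF X] ALT_dom[OF Y] by blast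
  thus "X L * Y R = 0" by (auto simp: fun_eq_iff)
 qed
 thus "wdg X Y fs = 0" by simp
next
 show "wdg X Y fs : F" for fs
  unfolding wdg_def by (intro ssum_closed subspace_F mult_F ALT_F[OF X] ALT_F[OF Y])
next
 fix xs u v ys
 have "wdg X Y (xs @ u # v # ys) = sg (1 * 1) *: wdg X Y (xs @ v # u # ys)"
  unfolding wdg_def
 proof (rule ssum_swap)
  show "X (ls @ u # v # ms) * Y R = sg (1 * 1) *: (X (ls @ v # u # ms) * Y R)" for ls ms R
   unfolding ALT_swap[OF X, of ls u] by (simp add: fun_eq_iff)
  show "X L * Y (ls @ u # v # ms) = sg (1 * 1) *: (X L * Y (ls @ v # u # ms))" for ls ms L
   unfolding ALT_swap[OF Y, of ls u] by (simp add: fun_eq_iff)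
 qed
 thus "wdg X Y (xs @ u # v # ys) = - wdg X Y (xs @ v # u # ys)" by simp
next
 fix f g r s fs assume fg: "f : F" "g : F"
 show "wdg X Y ((r *: f + s *: g) # fs) = r *: wdg X Y (f # fs) + s *: wdg X Y (g # fs)"
  by (simp add: wdg_def ALT_lin[OF X fg] ALT_lin[OF Y fg] distrib_left distrib_right scaleR_add_right ssum_add
    scaleR_mult_fun flip: ssum_scaleR)
   (simp add: mult.commute flip: scaleR_mult_fun)
qed

lemma wdg_MD:
 assumes X: "X : MD k" and Y: "Y : MD l"
 shows "wdg X Y : MD (k + l)"
 unfolding MD_def mem_Collect_eq
proof (intro conjI ballI allI)
 show "wdg X Y : ALT (k + l)" by (rule wdg_ALT[OF MD_ALT[OF X] MD_ALT[OF Y]])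
 fix f g fs assume fg: "f : F" "g : F"
 have 1: "X ((f * g) # L) * Y R = f * (X (g # L) * Y R) + g * (X (f # L) * Y R)" for L R
  unfolding MD_deriv[OF X fg] by (simp add: algebra_simps)
 have 2: "c *: (X L * Y ((f * g) # R)) = f * (c *: (X L * Y (g # R))) + g * (c *: (X L * Y (f # R)))" for c L R
  unfolding MD_deriv[OF Y fg] by (simp add: fun_eq_iff fscale algebra_simps)
 show "wdg X Y ((f * g) # fs) = f * wdg X Y (g # fs) + g * wdg X Y (f # fs)"
  unfolding wdg_def ssum.simps 1 2 ssum_add ssum_mult by (simp add: algebra_simps)
qed

lemma wdg_assoc: "wdg X (wdg Y Z) = wdg (wdg X Y) Z"
proof
 fix fs
 have "wdg X (wdg Y Z) fs = ssum (%_. 1) (%L R. ssum (%_. 1) (%R1 R2. X L * Y R1 * Z R2) R) fs"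
  by (simp add: wdg_def mult.assoc ssum_mult)
 also have "... = ssum (%_. 1) (%K R2. ssum (%_. 1) (%L R1. X L * Y R1 * Z R2) K) fs"
  by (rule ssum_coassoc)
 also have "... = wdg (wdg X Y) Z fs"
  unfolding wdg_def by (simp only: mult.commute[of _ "Z _"] ssum_mult)
 finally show "wdg X (wdg Y Z) fs = wdg (wdg X Y) Z fs" .
qed

lemma wdg_linear: "linear (%Y. wdg X Y)" "linear (%X. wdg X Y)"
proof -
 have s: "(c *: Z) gs = c *: Z gs" for c gs and Z :: "'a multivector" by (simp add: fscale)
 show "linear (%Y. wdg X Y)"
  by (rule linearI; rule ext) (simp_all add: wdg_def distrib_left ssum_add s scaleR_mult_fun(2) ssum_scaleR)
 show "linear (%X. wdg X Y)"
  by (rule linearI; rule ext) (simp_all add: wdg_def distrib_right ssum_add s scaleR_mult_fun(1)[symmetric] ssum_scaleR)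
qed

lemma ssum_mult_eta: "ssum d (%L R. (f :: 'b => real) * G L R) = (%vs. f * ssum d G vs)"
 by (rule ext) (rule ssum_mult)

text \<open>\<open>Z\<close> is a derivation in the slot that receives the product, so it acts on
  one factor at a time. The sign comes from moving the other \<open>n - 1\<close> arguments of
  \<open>Z\<close> past the \<open>l\<close> arguments of \<open>Y\<close>.\<close>

lemma comp_wdg_right:
 assumes Z: "Z : MD n" and X: "X : ALT k" and Y: "Y : ALT l"
 shows "comp Z (wdg X Y) = wdg X (comp Z Y) + sg (int l * (int n - 1)) *: wdg (comp Z X) Y"
proof
 fix fs
 let ?d = "%_ :: 'a => real. 1 :: int"
 note ZA = MD_ALT[OF Z]
 have XF: "X gs : F" and YF: "Y gs : F" for gs by (rule ALT_F[OF X], rule ALT_F[OF Y])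
 have "comp Z (wdg X Y) fs = ssum ?d (%K R. ssum ?d (%L1 L2. Z ((X L1 * Y L2) # R)) K) fs"
  unfolding comp_def wdg_def by (simp add: ALT_ssum[OF ZA] XF YF)
 also have "... = ssum ?d (%K R. ssum ?d (%L1 L2. X L1 * Z (Y L2 # R)) K) fs
   + ssum ?d (%K R. ssum ?d (%L1 L2. Z (X L1 # R) * Y L2) K) fs"
  by (simp add: MD_deriv[OF Z XF YF] ssum_add mult.commute)
 also have "ssum ?d (%K R. ssum ?d (%L1 L2. X L1 * Z (Y L2 # R)) K) fs = wdg X (comp Z Y) fs"
  unfolding ssum_coassoc[symmetric] wdg_def comp_def by (simp only: ssum_mult_eta)
 also have "ssum ?d (%K R. ssum ?d (%L1 L2. Z (X L1 # R) * Y L2) K) fs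
   = ssum ?d (%L1 M. ssum ?d (%L2 R. Z (X L1 # R) * Y L2) M) fs"
  by (rule ssum_coassoc[symmetric])
 also have "... = ssum ?d (%L1 M. ssum ?d (%R L2. sg (int (length R) * int (length L2)) *: (Z (X L1 # R) * Y L2)) M) fs"
  by (subst ssum_cocomm) simp
 also have "... = ssum ?d (%L1 M. ssum ?d (%R L2. sg (int l * (int n - 1)) *: (Z (X L1 # R) * Y L2)) M) fs"
 proof (intro ssum_cong)
  fix L1 R L2
  show "sg (int (length R) * int (length L2)) *: (Z (X L1 # R) * Y L2)
   = sg (int l * (int n - 1)) *: (Z (X L1 # R) * Y L2)"
  proof (cases "length L2 = l & Suc (length R) = n")
   case False
   hence "Z (X L1 # R) = 0 | Y L2 = 0" using ALT_dom[OF ZA, of "X L1 # R"] ALT_dom[OF Y, of L2] by auto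
   hence "Z (X L1 # R) * Y L2 = 0" by (auto simp: fun_eq_iff)
   thus ?thesis by simp
  qed (auto simp: mult.commute)
 qed
 also have "... = sg (int l * (int n - 1)) *: ssum ?d (%L1 M. ssum ?d (%R L2. Z (X L1 # R) * Y L2) M) fs"
  by (simp only: ssum_scaleR)
 also have "ssum ?d (%L1 M. ssum ?d (%R L2. Z (X L1 # R) * Y L2) M) fs = wdg (comp Z X) Y fs"
  unfolding ssum_coassoc wdg_def comp_def by (simp only: mult.commute[of _ "Y _"] ssum_mult)
 finally show "comp Z (wdg X Y) fs = (wdg X (comp Z Y) + sg (int l * (int n - 1)) *: wdg (comp Z X) Y) fs"
  by (simp only: plus_fun_def fscale[of _ "wdg _ _"])
qed

text \<open>The value of \<open>Z\<close> is the first entry of the list that is split, so it is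
  handed to exactly one of the two factors; in the second case it has passed the arguments of
  \<open>X\<close>.\<close>

lemma comp_wdg_left:
 assumes Z: "Z : ALT n" and X: "X : ALT k" and Y: "Y : ALT l"
 shows "comp (wdg X Y) Z = wdg (comp X Z) Y + sg (int k * (int n - 1)) *: wdg X (comp Y Z)"
proof
 fix fs
 let ?d = "%_ :: 'a => real. 1 :: int"
 have s: "c *: (f * g) = f * (c *: g)" for c and f g :: "'a => real"
  by (simp add: fun_eq_iff fscale)
 have "comp (wdg X Y) Z fs = ssum ?d (%L R. ssum ?d (%R1 R2. X (Z L # R1) * Y R2) R) fs
   + ssum ?d (%L R. ssum ?d (%R1 R2. sg (int (length R1)) *: (X R1 * Y (Z L # R2))) R) fs"
  unfolding comp_def wdg_def by (simp add: ssum_add)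
 also have "ssum ?d (%L R. ssum ?d (%R1 R2. X (Z L # R1) * Y R2) R) fs = wdg (comp X Z) Y fs"
  unfolding ssum_coassoc wdg_def comp_def by (simp only: mult.commute[of _ "Y _"] ssum_mult)
 also have "ssum ?d (%L R. ssum ?d (%R1 R2. sg (int (length R1)) *: (X R1 * Y (Z L # R2))) R) fs
  = ssum ?d (%K R2. ssum ?d (%L R1. sg (int (length R1)) *: (X R1 * Y (Z L # R2))) K) fs"
  by (rule ssum_coassoc)
 also have "... = ssum ?d (%K R2. ssum ?d (%R1 L. sg (int (length R1) * int (length L)) *: sg (int (length R1)) *: (X R1 * Y (Z L # R2))) K) fs"
  by (subst ssum_cocomm) simp
 also have "... = ssum ?d (%K R2. ssum ?d (%R1 L. sg (int k * (int n - 1)) *: (X R1 * Y (Z L # R2))) K) fs"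
 proof (intro ssum_cong)
  fix R1 L R2
  show "sg (int (length R1) * int (length L)) *: sg (int (length R1)) *: (X R1 * Y (Z L # R2))
   = sg (int k * (int n - 1)) *: (X R1 * Y (Z L # R2))"
  proof (cases "length R1 = k & length L = n")
   case False
   hence "X R1 = 0 | Z L = 0" using ALT_dom[OF X, of R1] ALT_dom[OF Z, of L] by auto
   hence "X R1 = 0 | Y (Z L # R2) = 0" by (elim disjE) (simp_all only: ALT_zero[OF Y] simp_thms)
   hence "X R1 * Y (Z L # R2) = 0" by (auto simp: fun_eq_iff)
   thus ?thesis by simp
  qed (simp add: sg_def)
 qed
 also have "... = sg (int k * (int n - 1)) *: ssum ?d (%K R2. ssum ?d (%R1 L. X R1 * Y (Z L # R2)) K) fs"
  by (simp only: ssum_scaleR)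
 also have "ssum ?d (%K R2. ssum ?d (%R1 L. X R1 * Y (Z L # R2)) K) fs = wdg X (comp Y Z) fs"
  unfolding ssum_coassoc[symmetric] wdg_def comp_def by (simp only: ssum_mult_eta)
 finally show "comp (wdg X Y) Z fs = (wdg (comp X Z) Y + sg (int k * (int n - 1)) *: wdg X (comp Y Z)) fs"
  by (simp only: plus_fun_def fscale[of _ "wdg _ _"])
qed

lemma schouten_wdg:
 assumes Z: "Z : MD n" and X: "X : ALT k" and Y: "Y : ALT l"
 shows "schouten Z (wdg X Y) = wdg (schouten Z X) Y + sg (int k * (int n - 1)) *: wdg X (schouten Z Y)"
proof -
 note ZA = MD_ALT[OF Z]
 note d = linear_diff[OF wdg_linear(1)] linear_diff[OF wdg_linear(2)]
  linear_scale[OF wdg_linear(1)] linear_scale[OF wdg_linear(2)]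
 show ?thesis
  unfolding schouten_comp[OF ZA wdg_ALT[OF X Y]] schouten_comp[OF ZA X] schouten_comp[OF ZA Y]
   comp_wdg_right[OF Z X Y] comp_wdg_left[OF ZA X Y] d
  by (cases "even k"; cases "even l"; cases "even n"; simp add: sg_def)
qed

definition wedge_F :: "'a multivector list => 'a multivector" where
 "wedge_F Xs = (%fs. if length fs = length Xs & set fs <= F
  then (%x. \<Sum>si | si permutes {..<length Xs}.
      of_int (sign si) * (\<Prod>i<length Xs. (Xs ! i) [fs ! si i] x))
  else 0)"

text \<open>\<open>X\<close> takes a single entry. Taking it out of the list costs the same sign as
  moving \<open>v\<close> from the end of \<open>L\<close> into the vacated place, so no sign is
  left.\<close>

lemma ssum_last:
 fixes W X :: "'a multivector"
 assumes swap: "!!xs u v ys. W (xs @ u # v # ys) = - W (xs @ v # u # ys)" and X: "X : ALT 1"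
 shows "ssum (%_. 1) (%L R. W (L @ [v]) * X R) fs = (\<Sum>b<length fs. W (fs[b := v]) * X [fs ! b])"
 using swap
proof (induction fs arbitrary: W)
 case Nil
 have "X [] = 0" using ALT_dom[OF X, of "[]"] by simp
 thus ?case by (simp add: fun_eq_iff)
next
 case (Cons f fs)
 note swap = Cons.prems
 have move: "W (v # fs) = sg (int (length fs)) *: W (fs @ [v])" for fs
 proof -
  have "W (zs @ v # fs) = sg (int (length fs)) *: W (zs @ fs @ [v])" for zs
  proof (induction fs arbitrary: zs)
   case (Cons g fs)
   have "W (zs @ v # g # fs) = - W ((zs @ [g]) @ v # fs)" using swap[of zs v g fs] by (simp only: append_assoc append_Cons append_Nil)
   thus ?case unfolding Cons.IH[of "zs @ [g]"] by (simp add: sg_add)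
  qed simp
  from this[of "[]"] show ?thesis by simp
 qed
 have 1: "ssum (%_. 1) (%L R. W (f # L @ [v]) * X R) fs = (\<Sum>b<length fs. W (f # fs[b := v]) * X [fs ! b])"
 proof (rule Cons.IH)
  show "W (f # xs @ u # w # ys) = - W (f # xs @ w # u # ys)" for xs u w ys
   using swap[of "f # xs" u w ys] by (simp only: append_Cons)
 qed
 have "ssum (%_. 1) (%L R. sg (int (length L)) *: (W (L @ [v]) * X (f # R))) fs
   = ssum (%_. 1) (%L R. if R = [] then W (v # L) * X [f] else 0) fs"
 proof (rule ssum_cong)
  fix L R
  show "sg (int (length L)) *: (W (L @ [v]) * X (f # R)) = (if R = [] then W (v # L) * X [f] else 0)"
  proof (cases "R = []")
   case True
   thus ?thesis by (simp add: move scaleR_mult_fun)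
  next
   case False
   hence "X (f # R) = 0" using ALT_dom[OF X, of "f # R"] by auto
   thus ?thesis using False by (simp add: fun_eq_iff fscale)
  qed
 qed
 also have "... = W (v # fs) * X [f]"
  by (subst ssum_cocomm) (simp add: ssum_Nil_left if_distrib cong: if_cong)
 finally have 2: "ssum (%_. 1) (%L R. sg (int (length L)) *: (W (L @ [v]) * X (f # R))) fs = W (v # fs) * X [f]" .
 have "(\<Sum>b<length (f # fs). W ((f # fs)[b := v]) * X [(f # fs) ! b])
   = W (v # fs) * X [f] + (\<Sum>b<length fs. W (f # fs[b := v]) * X [fs ! b])"
  by (simp only: length_Cons sum.lessThan_Suc_shift list_update.simps nat.case nth_Cons_0 nth_Cons_Suc)
 thus ?case
  using 1 2 by (simp only: ssum.simps tdeg_1 append_Cons mult_1 add.commute)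
qed

lemma fun_sum_apply: "(SUM b:S. f b) x = (SUM b:S. f b x)" for f :: "'c => 'b => real"
 by (induction S rule: infinite_finite_induct) simp_all

lemma wedge_F_singleton:
 assumes "X : ALT 1"
 shows "wedge_F [X] = X"
proof
 fix fs
 show "wedge_F [X] fs = X fs"
 proof (cases "length fs = 1 & set fs <= F")
  case True
  then obtain f where "fs = [f]" by (auto simp: length_Suc_conv)
  with True show ?thesis by (simp add: wedge_F_def lessThan_Suc)
 next
  case False
  hence "wedge_F [X] fs = 0" by (auto simp: wedge_F_def)
  thus ?thesis using ALT_dom[OF assms False] by (simp only:)
 qed
qed

text \<open>Laplace expansion along the last factor. A permutation of \<open>Suc n\<close> indices
  is a permutation of the first \<open>n\<close> followed by the transposition of \<open>n\<close>
  with some \<open>b\<close>; on the shuffle side \<open>b\<close> is the position of the entry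
  given to \<open>X\<close>. Both have sign +1 for \<open>b = n\<close> and -1 otherwise.\<close>

lemma wedge_F_snoc:
 assumes W: "wedge_F Xs : ALT (length Xs)" and X: "X : ALT 1"
 shows "wedge_F (Xs @ [X]) = wdg (wedge_F Xs) X"
proof
 fix fs
 let ?n = "length Xs"
 let ?t = "Transposition.transpose ?n"
 show "wedge_F (Xs @ [X]) fs = wdg (wedge_F Xs) X fs"
 proof (cases "length fs = Suc ?n & set fs <= F")
  case False
  hence "wedge_F (Xs @ [X]) fs = 0" by (auto simp: wedge_F_def)
  moreover have "wdg (wedge_F Xs) X fs = 0" using False by (intro ALT_dom[OF wdg_ALT[OF W X]]) auto
  ultimately show ?thesis by (simp only:)
 next
  case True
  then obtain gs v where fs: "fs = gs @ [v]" and len: "length gs = ?n"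
   by (metis length_Suc_conv_rev)
  have sub: "set gs <= F" "v : F" using True fs by auto
  have "wdg (wedge_F Xs) X fs = wedge_F Xs gs * X [v] - (\<Sum>b<?n. wedge_F Xs (gs[b := v]) * X [gs ! b])"
  proof -
   have "ssum (%_. 1) (%L R. wedge_F Xs L * X (R @ [v])) gs
    = ssum (%_. 1) (%L R. if R = [] then wedge_F Xs L * X [v] else 0) gs"
   proof (rule ssum_cong)
    fix L R
    show "wedge_F Xs L * X (R @ [v]) = (if R = [] then wedge_F Xs L * X [v] else 0)"
    proof (cases "R = []")
     case False
     hence "X (R @ [v]) = 0" by (intro ALT_dom[OF X]) auto
     thus ?thesis using False by (simp add: fun_eq_iff)
    qed simp
   qed
   also have "... = wedge_F Xs gs * X [v]"
    by (subst ssum_cocomm) (simp add: ssum_Nil_left if_distrib cong: if_cong)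
   finally have 1: "ssum (%_. 1) (%L R. wedge_F Xs L * X (R @ [v])) gs = wedge_F Xs gs * X [v]" .
   have "ssum (%_. 1) (%L R. sg (1 * int (length R)) *: (wedge_F Xs (L @ [v]) * X R)) gs
    = ssum (%_. 1) (%L R. - (wedge_F Xs (L @ [v]) * X R)) gs"
   proof (rule ssum_cong)
    fix L R
    show "sg (1 * int (length R)) *: (wedge_F Xs (L @ [v]) * X R) = - (wedge_F Xs (L @ [v]) * X R)"
    proof (cases "length R = 1")
     case False
     hence "X R = 0" by (intro ALT_dom[OF X]) auto
     thus ?thesis by (simp add: fun_eq_iff fscale)
    qed simp
   qed
   hence "ssum (%_. 1) (%L R. sg (1 * int (length R)) *: (wedge_F Xs (L @ [v]) * X R)) gs
    = - (\<Sum>b<?n. wedge_F Xs (gs[b := v]) * X [gs ! b])"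
    using ssum_last[of "wedge_F Xs" X v gs, OF ALT_swap[OF W] X] by (simp only: ssum_minus len)
   thus ?thesis using 1 by (simp only: wdg_def fs ssum_snoc tdeg_1 diff_conv_add_uminus)
  qed
  also have "... = wedge_F (Xs @ [X]) fs"
  proof
   fix x
   define T where "T gs q = (\<Prod>i<?n. (Xs ! i) [gs ! q i] x)" for gs :: "('a => real) list" and q
   have WT: "wedge_F Xs gs' x = (\<Sum>q | q permutes {..<?n}. of_int (sign q) * T gs' q)"
    if "length gs' = ?n" "set gs' <= F" for gs'
    using that by (simp add: wedge_F_def T_def)
   have "wedge_F (Xs @ [X]) fs x = (\<Sum>si | si permutes insert ?n {..<?n}.
     of_int (sign si) * (\<Prod>i<Suc ?n. ((Xs @ [X]) ! i) [fs ! si i] x))"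
    using True by (simp add: wedge_F_def flip: lessThan_Suc)
   also have "... = (SUM b:insert ?n {..<?n}. \<Sum>q | q permutes {..<?n}.
     of_int (sign (?t b o q)) * (\<Prod>i<Suc ?n. ((Xs @ [X]) ! i) [fs ! (?t b o q) i] x))"
    by (rule sum_over_permutations_insert) auto
   also have "... = (SUM b:insert ?n {..<?n}. (if b = ?n then 1 else - 1) *
     (wedge_F Xs (gs[b := v]) x * X [fs ! b] x))"
   proof (rule sum.cong[OF refl])
    fix b assume b: "b : insert ?n {..<?n}"
    have gsb: "length (gs[b := v]) = ?n" "set (gs[b := v]) <= F"
     using len sub set_update_subset_insert[of gs b v] by auto
    have "of_int (sign (?t b o q)) * (\<Prod>i<Suc ?n. ((Xs @ [X]) ! i) [fs ! (?t b o q) i] x)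
      = (if b = ?n then 1 else - 1) * (of_int (sign q) * T (gs[b := v]) q * X [fs ! b] x)"
     if q: "q permutes {..<?n}" for q
    proof -
     have qn: "q ?n = ?n" using permutes_not_in[OF q] by simp
     have "permutation q" using permutes_imp_permutation[OF _ q] by simp
     hence sgn: "sign (?t b o q) = (if b = ?n then 1 else - 1) * sign q"
      by (simp add: sign_compose permutation_swap_id sign_swap_id)
     have "(\<Prod>i<?n. ((Xs @ [X]) ! i) [fs ! (?t b o q) i] x) = T (gs[b := v]) q"
      unfolding T_def
     proof (rule prod.cong[OF refl])
      fix i assume i: "i : {..<?n}"
      hence qi: "q i < ?n" using permutes_in_image[OF q, of i] by simp
      have "fs ! ?t b (q i) = gs[b := v] ! q i"
       using qi b len by (cases "q i = b") (auto simp: fs nth_append Transposition.transpose_def)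
      thus "((Xs @ [X]) ! i) [fs ! (?t b o q) i] x = (Xs ! i) [gs[b := v] ! q i] x"
       using i by (simp add: nth_append)
     qed
     moreover have "((Xs @ [X]) ! ?n) [fs ! (?t b o q) ?n] x = X [fs ! b] x"
      by (simp add: qn)
     ultimately have "(\<Prod>i<Suc ?n. ((Xs @ [X]) ! i) [fs ! (?t b o q) i] x) = T (gs[b := v]) q * X [fs ! b] x"
      by (simp only: prod.lessThan_Suc)
     thus ?thesis unfolding sgn by simp
    qed
    thus "(\<Sum>q | q permutes {..<?n}.
     of_int (sign (?t b o q)) * (\<Prod>i<Suc ?n. ((Xs @ [X]) ! i) [fs ! (?t b o q) i] x))
     = (if b = ?n then 1 else - 1) * (wedge_F Xs (gs[b := v]) x * X [fs ! b] x)"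
     unfolding WT[OF gsb] sum_distrib_left sum_distrib_right by (intro sum.cong) auto
   qed
   also have "... = wedge_F Xs gs x * X [v] x - (\<Sum>b<?n. wedge_F Xs (gs[b := v]) x * X [gs ! b] x)"
   proof -
    have "(\<Sum>b<?n. (if b = ?n then 1 else - 1) * (wedge_F Xs (gs[b := v]) x * X [fs ! b] x))
     = (\<Sum>b<?n. - (wedge_F Xs (gs[b := v]) x * X [gs ! b] x))"
     by (intro sum.cong) (auto simp: fs nth_append len)
    thus ?thesis
     by (simp add: fs sum_negf list_update_beyond flip: len)
   qed
   finally show "(wedge_F Xs gs * X [v] - (\<Sum>b<?n. wedge_F Xs (gs[b := v]) * X [gs ! b])) x = wedge_F (Xs @ [X]) fs x"
    by (simp add: fun_sum_apply)
  qed
  finally show ?thesis by simp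
 qed
qed

end

section \<open>The exterior algebra generated by a submodule of vector fields\<close>

declare fplus [simp del] fzero [simp del] times_fun_apply [simp del] uminus_apply [simp del] minus_apply [simp del]

text \<open>A Lie-Rinehart pair inside all functions and vector fields: \<open>V1\<close> acts on
  \<open>V0\<close>, is a module over it, and is closed under the bracket. The fibrewise polynomial
  functions and fields are the instance in mind.\<close>

locale field_submodule = fun_algebra F for F :: "('a => real) set" +
 fixes V0 :: "('a => real) set" and V1 :: "'a multivector set"
 assumes V0: "subspace V0" "V0 <= F" "!!f g. f : V0 ==> g : V0 ==> f * g : V0"
  and V1: "subspace V1" "V1 <= MD 1" "!!X f. X : V1 ==> f : V0 ==> X [f] : V0"
  and V1_mult: "!!X f. X : V1 ==> f : V0 ==> (%fs. f * X fs) : V1"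
  and V1_bracket: "!!X Y. X : V1 ==> Y : V1 ==> schouten X Y : V1"
begin

definition FP :: "nat => 'a multivector set" where
 "FP k = (if k = 0 then {X:MD 0. X [] : V0}
   else span {wedge_F Xs | Xs. length Xs = k & set Xs <= V1})"

lemma V1_MD: "X : V1 ==> X : MD 1"
 using V1 by auto

lemma wedge_F_MD: "Xs ~= [] ==> set Xs <= MD 1 ==> wedge_F Xs : MD (length Xs)"
proof (induction Xs rule: rev_induct)
 case (snoc X Xs)
 hence X: "X : MD 1" by simp
 show ?case
 proof (cases "Xs = []")
  case True
  thus ?thesis using X wedge_F_singleton[OF MD_ALT[OF X]] by simp
 next
  case False
  hence W: "wedge_F Xs : MD (length Xs)" using snoc by simp
  thus ?thesis
   using wedge_F_snoc[OF MD_ALT[OF W] MD_ALT[OF X]] wdg_MD[OF W X] by simp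
 qed
qed simp

lemma sub_FP: "subspace (FP k)"
proof (cases "k = 0")
 case True
 have "FP 0 = MD 0 Int {X. X [] : V0}" by (auto simp: FP_def)
 moreover have "subspace {X :: 'a multivector. X [] : V0}"
  using V0(1) by (auto simp: subspace_def fscale[of _ "_ :: 'a multivector"] fplus fzero)
 ultimately show ?thesis using True subspace_Int[of UNIV] sub_MD by (simp add: subspace_inter)
qed (simp add: FP_def)

lemma FP_MD: "X : FP k ==> X : MD k"
proof (cases "k = 0")
 case False
 assume "X : FP k"
 moreover have "span {wedge_F Xs | Xs. length Xs = k & set Xs <= V1} <= MD k"
 proof (rule span_minimal[OF _ sub_MD], safe)
  fix Xs assume "set Xs <= V1" "k = length Xs"
  thus "wedge_F Xs : MD (length Xs)" using False V1(2) by (intro wedge_F_MD) auto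
 qed
 ultimately show ?thesis using False by (auto simp: FP_def)
qed (simp add: FP_def)

lemma FP_ALT: "X : FP k ==> X : ALT k"
 by (rule MD_ALT[OF FP_MD])

lemma FP_1: "FP 1 = V1"
proof -
 have "{wedge_F Xs | Xs. length Xs = 1 & set Xs <= V1} = V1"
 proof (intro equalityI subsetI)
  fix X assume X: "X : V1"
  thus "X : {wedge_F Xs | Xs. length Xs = 1 & set Xs <= V1}"
   using wedge_F_singleton[OF MD_ALT[OF V1_MD[OF X]]] by (auto intro!: exI[of _ "[X]"])
 next
  fix X assume "X : {wedge_F Xs | Xs. length Xs = 1 & set Xs <= V1}"
  then obtain Y where "X = wedge_F [Y]" "Y : V1" by (auto simp: length_Suc_conv)
  thus "X : V1" using wedge_F_singleton[OF MD_ALT[OF V1_MD]] by simp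
 qed
 thus ?thesis using V1(1) span_eq_iff[of V1] by (simp add: FP_def)
qed

text \<open>Splits off the last vector field of a product. Functions form a separate base case
  because they are not products of fields; membership in \<open>FP\<close> is carried along so that
  it is available for every partial sum.\<close>

lemma FP_induct [consumes 1, case_names add scale zero func field wedge]:
 assumes "X : FP k"
  and "!!k X Y. X : FP k ==> Y : FP k ==> Q k X ==> Q k Y ==> Q k (X + Y)"
  and "!!k X c. X : FP k ==> Q k X ==> Q k (c *: X)"
  and "!!k. Q k 0"
  and "!!X. X : FP 0 ==> Q 0 X"
  and "!!X. X : V1 ==> Q 1 X"
  and "!!k W X. W : FP (Suc k) ==> Q (Suc k) W ==> X : V1 ==> Q (Suc (Suc k)) (wdg W X)"
 shows "Q k X"
proof (cases "k = 0")
 case True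
 thus ?thesis using assms(1,5) by simp
next
 case False
 have gen: "wedge_F Xs : FP (length Xs) & Q (length Xs) (wedge_F Xs)" if "Xs ~= []" "set Xs <= V1" for Xs
  using that
 proof (induction Xs rule: rev_induct)
  case (snoc X Xs)
  hence X: "X : V1" by simp
  have mem: "wedge_F (Xs @ [X]) : FP (length (Xs @ [X]))"
   using snoc.prems by (auto simp: FP_def intro!: span_base exI[of _ "Xs @ [X]"])
  show ?case
  proof (cases "Xs = []")
   case True
   thus ?thesis using mem X assms(6) wedge_F_singleton[OF MD_ALT[OF V1_MD[OF X]]] by simp
  next
   case False
   hence W: "wedge_F Xs : FP (length Xs)" "Q (length Xs) (wedge_F Xs)" using snoc by auto
   obtain j where j: "length Xs = Suc j" using False by (cases Xs) auto
   have "Q (Suc (Suc j)) (wdg (wedge_F Xs) X)"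
    using assms(7)[of "wedge_F Xs" j X] W X unfolding j by blast
   thus ?thesis
    using mem wedge_F_snoc[OF FP_ALT[OF W(1)] MD_ALT[OF V1_MD[OF X]]] j by simp
  qed
 qed simp
 have "X : span {wedge_F Xs | Xs. length Xs = k & set Xs <= V1}" using assms(1) False by (simp add: FP_def)
 hence "X : FP k & Q k X"
 proof (induction rule: span_induct_alt)
  case base
  thus ?case using assms(4) subspace_0[OF sub_FP] by blast
 next
  case (step c x y)
  obtain Xs where Xs: "x = wedge_F Xs" "length Xs = k" "set Xs <= V1" using step(1) by blast
  hence x: "x : FP k" "Q k x" using gen[of Xs] False by auto
  have cx: "c *: x : FP k" "Q k (c *: x)"
   by (rule subspace_scale[OF sub_FP x(1)], rule assms(3)[OF x])
  have y: "y : FP k" "Q k y" using step by simp_all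
  show ?case by (intro conjI subspace_add[OF sub_FP] assms(2) cx y)
 qed
 thus ?thesis by blast
qed

lemma wdg_add: "wdg X (Y + Z) = wdg X Y + wdg X Z" "wdg (X + Y) Z = wdg X Z + wdg Y Z"
 and wdg_scale: "wdg X (c *: Y) = c *: wdg X Y" "wdg (c *: X) Y = c *: wdg X Y"
 and wdg_zero: "wdg X 0 = 0" "wdg 0 X = 0"
 using linear_add[OF wdg_linear(1)] linear_add[OF wdg_linear(2)] linear_scale[OF wdg_linear(1)] linear_scale[OF wdg_linear(2)]
  linear_0[OF wdg_linear(1)] linear_0[OF wdg_linear(2)] by metis+

lemma wdg_fun_left:
 assumes "f : ALT 0"
 shows "wdg f W = (%fs. f [] * W fs)"
proof
 fix fs
 have "wdg f W fs = ssum (%_. 1) (%L R. if L = [] then f [] * W R else 0) fs"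
  unfolding wdg_def
 proof (rule ssum_cong)
  fix L R
  show "f L * W R = (if L = [] then f [] * W R else 0)"
   using ALT_dom[OF assms, of L] by auto
 qed
 thus "wdg f W fs = f [] * W fs" by (simp add: ssum_Nil_left)
qed

lemma wdg_fun_right:
 assumes "f : ALT 0"
 shows "wdg W f = (%fs. f [] * W fs)"
proof
 fix fs
 have "wdg W f fs = ssum (%_. 1) (%L R. sg (int (length L) * int (length R)) *: (W R * f L)) fs"
  unfolding wdg_def by (subst ssum_cocomm) simp
 also have "... = ssum (%_. 1) (%L R. if L = [] then f [] * W R else 0) fs"
 proof (rule ssum_cong)
  fix L R
  show "sg (int (length L) * int (length R)) *: (W R * f L) = (if L = [] then f [] * W R else 0)"
   using ALT_dom[OF assms, of L] by (auto simp: mult.commute)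
 qed
 finally show "wdg W f fs = f [] * W fs" by (simp add: ssum_Nil_left)
qed

lemma wdg_FP_field:
 assumes "W : FP (Suc k)" "X : V1"
 shows "wdg W X : FP (Suc (Suc k))"
proof -
 have "W : span {wedge_F Xs | Xs. length Xs = Suc k & set Xs <= V1}" using assms(1) by (simp add: FP_def)
 thus ?thesis
 proof (induction rule: span_induct_alt)
  case base
  thus ?case using subspace_0[OF sub_FP] by (simp only: wdg_zero)
 next
  case (step c x y)
  then obtain Xs where Xs: "x = wedge_F Xs" "length Xs = Suc k" "set Xs <= V1" by auto
  have "wedge_F Xs : MD (length Xs)" using Xs V1(2) by (intro wedge_F_MD) auto
  hence "wdg x X = wedge_F (Xs @ [X])"
   unfolding Xs(1) using wedge_F_snoc[OF MD_ALT MD_ALT[OF V1_MD[OF assms(2)]]] by simp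
  moreover have "wedge_F (Xs @ [X]) : FP (Suc (Suc k))"
   using Xs assms(2) by (auto simp: FP_def intro!: span_base exI[of _ "Xs @ [X]"])
  ultimately show ?case
   using step by (simp only: wdg_add wdg_scale subspace_add[OF sub_FP] subspace_scale[OF sub_FP])
 qed
qed

lemma wdg_fun_FP:
 assumes f: "f : FP 0" and W: "W : FP k"
 shows "wdg f W : FP k"
 using W
proof (induction rule: FP_induct)
 case (func X)
 have "wdg f X : MD 0" using wdg_MD[OF FP_MD[OF f] FP_MD[OF func]] by simp
 moreover have "wdg f X [] = f [] * X []" by (simp add: wdg_def)
 ultimately show ?case using f func V0(3) by (simp add: FP_def)
next
 case (field X)
 have "f [] : V0" using f by (simp add: FP_def)
 thus ?case using V1_mult[OF field] by (simp only: wdg_fun_left[OF FP_ALT[OF f]] FP_1)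
next
 case (wedge k W X)
 thus ?case by (simp only: wdg_assoc wdg_FP_field)
qed (simp_all only: wdg_add wdg_scale wdg_zero subspace_add[OF sub_FP] subspace_scale[OF sub_FP] subspace_0[OF sub_FP])

lemma wdg_FP_fun:
 assumes f: "f : FP 0" and W: "W : FP k"
 shows "wdg W f : FP k"
 using wdg_fun_FP[OF assms] wdg_fun_left[OF FP_ALT[OF f]] wdg_fun_right[OF FP_ALT[OF f]] by simp

lemma wdg_FP:
 assumes W: "W : FP k" and Z: "Z : FP l"
 shows "wdg W Z : FP (k + l)"
 using Z
proof (induction rule: FP_induct)
 case (func X)
 thus ?case using wdg_FP_fun[OF func W] by simp
next
 case (field X)
 show ?case
 proof (cases k)
  case 0
  have "X : FP 1" using field FP_1 by blast
  thus ?thesis using wdg_fun_FP[of W X 1] W 0 by simp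
 next
  case (Suc k')
  thus ?thesis using wdg_FP_field[of W k' X] W field by simp
 qed
next
 case (wedge l V X)
 have "wdg W V : FP (Suc (k + l))" using wedge.IH by (simp only: add_Suc_right)
 from wdg_FP_field[OF this wedge.hyps(2)] show ?case by (simp add: wdg_assoc)
qed (simp_all only: wdg_add wdg_scale wdg_zero subspace_add[OF sub_FP] subspace_scale[OF sub_FP] subspace_0[OF sub_FP])

lemma schouten_lin_right:
 assumes "Z : ALT n" "X : ALT k" "Y : ALT k"
 shows "schouten Z (X + Y) = schouten Z X + schouten Z Y" "schouten Z (c *: X) = c *: schouten Z X"
proof -
 show "schouten Z (X + Y) = schouten Z X + schouten Z Y"
  unfolding schouten_comp[OF assms(1) subspace_add[OF sub_ALT assms(2,3)]]
   schouten_comp[OF assms(1,2)] schouten_comp[OF assms(1,3)] comp_add_left comp_add_right[OF assms]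
  by (simp add: scaleR_add_right)
 show "schouten Z (c *: X) = c *: schouten Z X"
  unfolding schouten_comp[OF assms(1) subspace_scale[OF sub_ALT assms(2)]]
   schouten_comp[OF assms(1,2)] comp_scale_left comp_scale_right[OF assms(1,2)]
  by (simp add: scaleR_diff_right mult.commute)
qed

lemma schouten_FP_base:
 assumes "X : FP k" "k <= 1" "Y : FP l" "l <= 1"
 shows "schouten X Y : FP (k + l - 1)"
proof -
 have XA: "X : ALT k" and YA: "Y : ALT l" using assms FP_ALT by auto
 have vf: "schouten X f : FP 0" if "X : V1" "f : FP 0" for X f
 proof -
  have "schouten X f : MD 0" using schouten_MD[OF V1_MD[OF that(1)] FP_MD[OF that(2)]] by simp
  moreover have "schouten X f [] = X [f []]"
   using schouten_eq_ssum[of X f "[]"] ALT_dom[OF FP_ALT[OF that(2)], of "[X []]"] by simp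
  ultimately show ?thesis using V1(3)[OF that(1)] that(2) by (simp add: FP_def)
 qed
 consider "k = 0" "l = 0" | "k = 1" "l = 0" | "k = 0" "l = 1" | "k = 1" "l = 1" using assms(2,4) by linarith
 thus ?thesis
 proof cases
  case 1
  thus ?thesis using schouten_0_0 XA YA subspace_0[OF sub_FP] by simp
 next
  case 2
  thus ?thesis using vf[of X Y] assms(1,3) FP_1 by simp
 next
  case 3
  hence "schouten Y X : FP 0" using vf[of Y X] assms(1,3) FP_1 by simp
  thus ?thesis using schouten_anti[OF XA YA] 3 subspace_scale[OF sub_FP] subspace_neg[OF sub_FP] by simp
 next
  case 4
  hence "schouten X Y : FP 1" using V1_bracket[of X Y] assms(1,3) FP_1 by blast
  thus ?thesis using 4 by simp
 qed
qed

text \<open>The Leibniz rule in the second argument reduces it to degree at most 1.\<close>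

lemma schouten_FP_step:
 assumes Z: "Z : FP n" and base: "!!k Y. k <= 1 ==> Y : FP k ==> schouten Z Y : FP (n + k - 1)" and Y: "Y : FP k"
 shows "schouten Z Y : FP (n + k - 1)"
 using Y
proof (induction rule: FP_induct)
 case (add k X Y)
 thus ?case using schouten_lin_right(1)[OF FP_ALT[OF Z] FP_ALT FP_ALT] subspace_add[OF sub_FP] by simp
next
 case (scale k X c)
 thus ?case using schouten_lin_right(2)[OF FP_ALT[OF Z] FP_ALT FP_ALT] subspace_scale[OF sub_FP] by simp
next
 case (zero k)
 thus ?case using schouten_zero(2)[OF FP_ALT[OF Z]] subspace_0[OF sub_FP] by simp
next
 case (func X)
 thus ?case using base[of 0 X] by simp
next
 case (field X)
 thus ?case using base[of 1 X] FP_1 by simp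
next
 case (wedge k W X)
 have X: "X : FP 1" using wedge.hyps FP_1 by blast
 have s1: "schouten Z W : FP (n + k)" using wedge.IH by simp
 have s2: "schouten Z X : FP n" using base[of 1 X] X by simp
 have "schouten Z (wdg W X) = wdg (schouten Z W) X + sg (int (Suc k) * (int n - 1)) *: wdg W (schouten Z X)"
  by (rule schouten_wdg[OF FP_MD[OF Z] FP_ALT[OF wedge.hyps(1)] FP_ALT[OF X]])
 moreover have "wdg (schouten Z W) X : FP (n + k + 1)" by (rule wdg_FP[OF s1 X])
 moreover have "wdg W (schouten Z X) : FP (Suc k + n)" by (rule wdg_FP[OF wedge.hyps(1) s2])
 ultimately show ?case
  using subspace_add[OF sub_FP] subspace_scale[OF sub_FP] by (simp add: add_ac)
qed

text \<open>The reduction is applied twice, with antisymmetry exchanging the arguments in between;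
  what remains are brackets of functions and vector fields, where closure is part of the
  locale.\<close>

lemma schouten_FP:
 assumes Z: "Z : FP n" and Y: "Y : FP k"
 shows "schouten Z Y : FP (n + k - 1)"
proof (rule schouten_FP_step[OF Z _ Y])
 fix k Y assume k: "k <= 1" and Y: "Y : FP k"
 have "schouten Y Z : FP (k + n - 1)"
  by (rule schouten_FP_step[OF Y schouten_FP_base[OF Y k] Z])
 thus "schouten Z Y : FP (n + k - 1)"
  using schouten_anti[OF FP_ALT[OF Z] FP_ALT[OF Y]] subspace_scale[OF sub_FP] subspace_neg[OF sub_FP]
  by (simp add: add.commute)
qed

end

section \<open>Calculus of smooth functions\<close>

lemma hd_cong_open:
 assumes "open U" "x : U" "!!y. y : U ==> f y = g y"
 shows "(f has_derivative D) (at x) \<longleftrightarrow> (g has_derivative D) (at x)"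
 using has_derivative_transform_within_open[OF _ assms(1,2), of f D UNIV g]
  has_derivative_transform_within_open[OF _ assms(1,2), of g D UNIV f] assms(3) by auto

lemma frechet_derivative_cong_open:
 assumes "open U" "x : U" "!!y. y : U ==> f y = g y"
 shows "fder f (at x) = fder g (at x)"
 by (simp only: frechet_derivative_def hd_cong_open[OF assms])

lemma C_k_on_cong:
 assumes "open U" "!!x. x : U ==> f x = g x" "C_k_on k f U"
 shows "C_k_on k g U"
 using assms(2,3)
proof (induction k arbitrary: f g)
 case 0
 thus ?case using continuous_on_cong[OF refl, of U f g] by simp
next
 case (Suc k)
 have D: "fder f (at x) v = fder g (at x) v" if "x : U" for x v
  using frechet_derivative_cong_open[OF assms(1) that] Suc.prems(1) by metis
 have "g differentiable (at x)" if "x : U" for x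
 proof -
  have "f differentiable (at x)" using Suc.prems(2) that by simp
  then obtain D where "(f has_derivative D) (at x)" by (auto simp: differentiable_def)
  thus ?thesis
   using hd_cong_open[OF assms(1) that Suc.prems(1), where D = D] by (auto simp: differentiable_def)
 qed
 moreover have "C_k_on k (%x. fder g (at x) v) U" for v
  using Suc.IH[of "%x. fder f (at x) v" "%x. fder g (at x) v"] D Suc.prems(2) by simp
 ultimately show ?case by simp
qed

lemma C_k_on_subset: "C_k_on k f U ==> V <= U ==> C_k_on k f V"
 by (induction k arbitrary: f) (auto intro: continuous_on_subset)

text \<open>Any explicit derivative may replace \<open>frechet_derivative\<close>, and only its
  values in fixed directions have to be controlled.\<close>

lemma C_k_on_SucI:
 assumes "open U" "!!x. x : U ==> (f has_derivative f' x) (at x)" "!!v. C_k_on k (%x. f' x v) U"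
 shows "C_k_on (Suc k) f U"
proof -
 have "C_k_on k (%x. fder f (at x) v) U" for v
  by (rule C_k_on_cong[OF assms(1) _ assms(3)]) (simp add: frechet_derivative_at[OF assms(2), symmetric])
 thus ?thesis using assms(2) by (auto simp: differentiable_def)
qed

lemma C_k_on_has_derivative:
 "C_k_on (Suc k) f U ==> x : U ==> (f has_derivative fder f (at x)) (at x)"
 by (simp add: frechet_derivative_works[symmetric])

lemma C_k_on_deriv: "C_k_on (Suc k) f U ==> C_k_on k (%x. fder f (at x) v) U"
 by simp

lemma C_k_on_Suc_D: "C_k_on (Suc k) f U ==> C_k_on k f U"
proof (induction k arbitrary: f)
 case 0
 thus ?case
  by (simp add: continuous_at_imp_continuous_on differentiable_imp_continuous_within)
next
 case (Suc k)
 have "C_k_on k (%x. fder f (at x) v) U" for v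
  by (rule Suc.IH[OF C_k_on_deriv[OF Suc.prems]])
 moreover have "ALL x:U. f differentiable (at x)" using Suc.prems by simp
 ultimately show ?case by simp
qed

lemma C_k_on_local:
 assumes "!!x. x : U ==> EX V. open V & x : V & C_k_on k f (U Int V)" "open U"
 shows "C_k_on k f U"
 using assms(1)
proof (induction k arbitrary: f)
 case 0
 show ?case unfolding C_k_on.simps
 proof (intro continuous_at_imp_continuous_on ballI)
  fix x assume "x : U"
  with 0 obtain V where "open V" "x : V" "continuous_on (U Int V) f" by auto
  thus "isCont f x" using \<open>x : U\<close> assms(2) by (meson IntI continuous_on_eq_continuous_at open_Int)
 qed
next
 case (Suc k)
 have "f differentiable (at x)" if "x : U" for x using Suc.prems[OF that] that by auto
 moreover have "C_k_on k (%x. fder f (at x) v) U" for v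
  by (rule Suc.IH) (use Suc.prems in fastforce)
 ultimately show ?case by simp
qed

lemma C_k_on_const: "open U ==> C_k_on k (%x. c) U"
proof (induction k arbitrary: c)
 case (Suc k)
 show ?case by (rule C_k_on_SucI[OF Suc.prems, of _ "%x v. 0"]) (use Suc in auto)
qed auto

lemma C_k_on_linear: "bounded_linear f ==> open U ==> C_k_on k f U"
proof (cases k)
 case 0
 assume "bounded_linear f"
 thus ?thesis using 0 by (auto intro: linear_continuous_on)
next
 case (Suc j)
 assume f: "bounded_linear f" and U: "open U"
 show ?thesis unfolding Suc
  by (rule C_k_on_SucI[OF U, of _ "%x. f"]) (auto intro: bounded_linear_imp_has_derivative[OF f] C_k_on_const[OF U])
qed

lemma C_k_on_add: "open U ==> C_k_on k f U ==> C_k_on k g U ==> C_k_on k (%x. f x + g x) U"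
proof (induction k arbitrary: f g)
 case (Suc k)
 show ?case
 proof (rule C_k_on_SucI[OF Suc.prems(1)])
  show "((%x. f x + g x) has_derivative (%v. fder f (at x) v + fder g (at x) v)) (at x)"
   if "x : U" for x
   by (intro has_derivative_add C_k_on_has_derivative[OF _ that]) (rule Suc.prems)+
  show "C_k_on k (%x. fder f (at x) v + fder g (at x) v) U" for v
   by (intro Suc.IH Suc.prems(1) C_k_on_deriv) (rule Suc.prems)+
 qed
qed (auto intro: continuous_on_add)

lemma C_k_on_sum: "open U ==> (!!i. i : I ==> C_k_on k (f i) U) ==> C_k_on k (%x. SUM i:I. f i x) U"
 by (induction I rule: infinite_finite_induct) (auto intro: C_k_on_const C_k_on_add)

lemma C_k_on_bilinear:
 assumes "bounded_bilinear B" "open U"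
 shows "C_k_on k f U ==> C_k_on k g U ==> C_k_on k (%x. B (f x) (g x)) U"
proof (induction k arbitrary: f g)
 case 0
 thus ?case using bounded_bilinear.continuous_on[OF assms(1)] by auto
next
 case (Suc k)
 show ?case
 proof (rule C_k_on_SucI[OF assms(2)])
  show "((%x. B (f x) (g x)) has_derivative (%v. B (f x) (fder g (at x) v) + B (fder f (at x) v) (g x))) (at x)"
   if "x : U" for x
   by (intro bounded_bilinear.FDERIV[OF assms(1)] C_k_on_has_derivative[OF _ that]) (rule Suc.prems)+
  show "C_k_on k (%x. B (f x) (fder g (at x) v) + B (fder f (at x) v) (g x)) U" for v
   by (intro C_k_on_add assms(2) Suc.IH C_k_on_deriv[OF Suc.prems(1)] C_k_on_deriv[OF Suc.prems(2)]
    C_k_on_Suc_D[OF Suc.prems(1)] C_k_on_Suc_D[OF Suc.prems(2)])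
 qed
qed

lemma C_k_on_bounded_linear:
 assumes "bounded_linear h" "open U"
 shows "C_k_on k f U ==> C_k_on k (%x. h (f x)) U"
proof (induction k arbitrary: f)
 case 0
 thus ?case using bounded_linear.continuous_on[OF assms(1)] by auto
next
 case (Suc k)
 show ?case
 proof (rule C_k_on_SucI[OF assms(2)])
  show "((%x. h (f x)) has_derivative (%v. h (fder f (at x) v))) (at x)" if "x : U" for x
   by (intro bounded_linear.has_derivative[OF assms(1)] C_k_on_has_derivative[OF _ that]) (rule Suc.prems)+
  show "C_k_on k (%x. h (fder f (at x) v)) U" for v
   by (intro Suc.IH C_k_on_deriv) (rule Suc.prems)+
 qed
qed

lemma lin_sum:
 assumes "linear (D :: 'a::euclidean_space => 'b::real_vector)"
 shows "D v = (SUM b:Basis. (v \<bullet> b) *: D b)"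
proof -
 have "D v = D (SUM b:Basis. (v \<bullet> b) *: b)" by (simp add: euclidean_representation)
 also have "... = (SUM b:Basis. (v \<bullet> b) *: D b)"
  by (simp only: linear_sum[OF assms] linear_scale[OF assms])
 finally show ?thesis .
qed

lemma C_k_on_compose:
 fixes f :: "'a::euclidean_space => 'b::euclidean_space" and g :: "'b => 'c::real_normed_vector"
 assumes "open U"
 shows "C_k_on k f U ==> C_k_on k g V ==> f ` U <= V ==> C_k_on k (%x. g (f x)) U"
proof (induction k arbitrary: f g)
 case 0
 thus ?case using continuous_on_compose2[of V g U f] by auto
next
 case (Suc k)
 let ?Df = "%x. fder f (at x)" and ?Dg = "%x. fder g (at x)"
 have Df: "(f has_derivative ?Df x) (at x)" if "x : U" for x
  by (rule C_k_on_has_derivative[OF Suc.prems(1) that])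
 have Dg: "(g has_derivative ?Dg (f x)) (at (f x))" if "x : U" for x
  by (rule C_k_on_has_derivative[OF Suc.prems(2)]) (use Suc.prems(3) that in auto)
 show ?case
 proof (rule C_k_on_SucI[OF assms])
  fix x assume x: "x : U"
  have "((%x. g (f x)) has_derivative (%v. ?Dg (f x) (?Df x v))) (at x)"
   by (rule has_derivative_compose[OF Df[OF x] Dg[OF x]])
  \<comment> \<open>The induction controls derivatives in fixed directions only, so the direction
    \<open>?Df x v\<close>, which varies with \<open>x\<close>, is expanded in the basis.\<close>
  moreover have "?Dg (f x) (?Df x v) = (SUM b:Basis. (?Df x v \<bullet> b) *: ?Dg (f x) b)" for v
   by (rule lin_sum[OF has_derivative_linear[OF Dg[OF x]]])
  ultimately show "((%x. g (f x)) has_derivative (%v. SUM b:Basis. (?Df x v \<bullet> b) *: ?Dg (f x) b)) (at x)"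
   by simp
 next
  fix v
  show "C_k_on k (%x. SUM b:Basis. (?Df x v \<bullet> b) *: ?Dg (f x) b) U"
  proof (intro C_k_on_sum C_k_on_bilinear[OF bounded_bilinear_scaleR] assms)
   fix b
   show "C_k_on k (%x. ?Df x v \<bullet> b) U"
    by (rule C_k_on_bounded_linear[OF bounded_linear_inner_left assms C_k_on_deriv[OF Suc.prems(1)]])
   show "C_k_on k (%x. ?Dg (f x) b) U"
    by (rule Suc.IH[OF C_k_on_Suc_D[OF Suc.prems(1)] C_k_on_deriv[OF Suc.prems(2)] Suc.prems(3)])
  qed
 qed
qed

lemma C_k_on_inverse:
 fixes f :: "'a::euclidean_space => real"
 assumes "open U" "!!x. x : U ==> f x ~= 0"
 shows "C_k_on k f U ==> C_k_on k (%x. inverse (f x)) U"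
proof (induction k)
 case 0
 thus ?case using assms(2) by (auto intro!: continuous_on_inverse)
next
 case (Suc k)
 let ?Df = "%x. fder f (at x)"
 have inv: "C_k_on k (%x. inverse (f x)) U" by (rule Suc.IH[OF C_k_on_Suc_D[OF Suc.prems]])
 show ?case
 proof (rule C_k_on_SucI[OF assms(1)])
  show "((%x. inverse (f x)) has_derivative (%v. - (inverse (f x) * ?Df x v * inverse (f x)))) (at x)" if "x : U" for x
   by (rule Deriv.has_derivative_inverse[OF assms(2)[OF that] C_k_on_has_derivative[OF Suc.prems that]])
  show "C_k_on k (%x. - (inverse (f x) * ?Df x v * inverse (f x))) U" for v
   by (intro C_k_on_bounded_linear[OF bounded_linear_minus[OF bounded_linear_ident] assms(1)]
    C_k_on_bilinear[OF bounded_bilinear_mult assms(1)] inv C_k_on_deriv Suc.prems)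
 qed
qed

lemma smooth_onD: "smooth_on U f ==> C_k_on k f U"
 by (simp add: smooth_on_def)

lemma sm_cong: "open U ==> smooth_on U f ==> (!!x. x : U ==> f x = g x) ==> smooth_on U g"
 unfolding smooth_on_def using C_k_on_cong by blast

lemma sm_subset: "smooth_on U f ==> V <= U ==> smooth_on V f"
 unfolding smooth_on_def using C_k_on_subset by blast

lemma sm_local:
 assumes "open U" "!!x. x : U ==> EX V. open V & x : V & smooth_on (U Int V) f"
 shows "smooth_on U f"
 unfolding smooth_on_def by (intro allI C_k_on_local[OF _ assms(1)]) (use assms(2) smooth_onD in blast)

lemma sm_const: "open U ==> smooth_on U (%x. c)"
 by (simp add: smooth_on_def C_k_on_const)

lemma sm_linear: "linear f ==> open U ==> smooth_on U f" for f :: "'a::euclidean_space => 'b::real_normed_vector"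
 by (simp add: smooth_on_def C_k_on_linear linear_conv_bounded_linear)

lemma sm_ident: "open U ==> smooth_on U (%x. x)"
 by (rule sm_linear) (simp_all add: linear_iff)

lemma sm_add: "open U ==> smooth_on U f ==> smooth_on U g ==> smooth_on U (%x. f x + g x)"
 by (simp add: smooth_on_def C_k_on_add)

lemma sm_sum: "open U ==> (!!i. i : I ==> smooth_on U (f i)) ==> smooth_on U (%x. SUM i:I. f i x)"
 by (simp add: smooth_on_def C_k_on_sum)

lemma sm_scaleR: "open U ==> smooth_on U f ==> smooth_on U g ==> smooth_on U (%x. f x *: g x)"
 by (simp add: smooth_on_def C_k_on_bilinear[OF bounded_bilinear_scaleR])

lemma sm_mult: "open U ==> smooth_on U f ==> smooth_on U g ==> smooth_on U (%x. f x * g x)"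
 for f :: "'a::euclidean_space => real"
 by (simp add: smooth_on_def C_k_on_bilinear[OF bounded_bilinear_mult])

lemma sm_inner: "open U ==> smooth_on U f ==> smooth_on U g ==> smooth_on U (%x. f x \<bullet> g x)"
 by (simp add: smooth_on_def C_k_on_bilinear[OF bounded_bilinear_inner])

lemma sm_linear_compose: "linear h ==> open U ==> smooth_on U f ==> smooth_on U (%x. h (f x))"
 for h :: "'b::euclidean_space => 'c::real_normed_vector"
 by (simp add: smooth_on_def C_k_on_bounded_linear linear_conv_bounded_linear)

lemma sm_minus: "open U ==> smooth_on U f ==> smooth_on U (%x. - f x)"
 unfolding smooth_on_def using C_k_on_bounded_linear[OF bounded_linear_minus[OF bounded_linear_ident]] by blast

lemma sm_diff: "open U ==> smooth_on U f ==> smooth_on U g ==> smooth_on U (%x. f x - g x)"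
 using sm_add[of U f "%x. - g x"] sm_minus[of U g] by simp

lemma sm_compose:
 fixes f :: "'a::euclidean_space => 'b::euclidean_space"
 shows "open U ==> smooth_on U f ==> smooth_on V g ==> f ` U <= V ==> smooth_on U (%x. g (f x))"
 unfolding smooth_on_def using C_k_on_compose by blast

lemma sm_inverse:
 fixes f :: "'a::euclidean_space => real"
 shows "open U ==> smooth_on U f ==> (!!x. x : U ==> f x ~= 0) ==> smooth_on U (%x. inverse (f x))"
 by (simp add: smooth_on_def C_k_on_inverse)

lemma sm_has_derivative: "smooth_on U f ==> x : U ==> (f has_derivative fder f (at x)) (at x)"
 by (rule C_k_on_has_derivative[OF smooth_onD])

lemma sm_deriv: "smooth_on U f ==> smooth_on U (%x. fder f (at x) v)"
 unfolding smooth_on_def using C_k_on_deriv by blast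

lemma sm_continuous: "smooth_on U f ==> continuous_on U f"
 using smooth_onD[of U f 0] by simp

lemma sm_deriv_apply:
 fixes f :: "'a::euclidean_space => 'b::real_normed_vector" and g h :: "'c::euclidean_space => 'a"
 assumes U: "open U" and g: "smooth_on U g" "g ` U <= V" and h: "smooth_on U h" and f: "smooth_on V f"
 shows "smooth_on U (%x. fder f (at (g x)) (h x))"
proof (rule sm_cong[OF U])
 show "smooth_on U (%x. SUM b:Basis. (h x \<bullet> b) *: fder f (at (g x)) b)"
  by (intro sm_sum sm_scaleR U sm_compose[OF U g(1) sm_deriv[OF f] g(2)]
   sm_inner h sm_const)
 fix x assume "x : U"
 hence "linear (fder f (at (g x)))"
  using sm_has_derivative[OF f] g(2) by (auto intro: has_derivative_linear)
 thus "(SUM b:Basis. (h x \<bullet> b) *: fder f (at (g x)) b) = fder f (at (g x)) (h x)"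
  by (rule lin_sum[symmetric])
qed

section \<open>Bump functions on Euclidean space and Hadamard's lemma\<close>

definition flat :: "nat => real => real" where
 "flat n t = (if t > 0 then inverse t ^ n * exp (- inverse t) else 0)"

lemma flat_tendsto_0: "(flat n \<longlongrightarrow> 0) (at 0)"
proof -
 have "((%t. inverse t ^ n / exp (inverse t)) \<longlongrightarrow> 0) (at_right (0::real))"
  by (rule filterlim_compose[OF tendsto_power_div_exp_0 filterlim_inverse_at_top_right])
 hence "(flat n \<longlongrightarrow> 0) (at_right 0)"
  by (rule Lim_transform_eventually)
   (auto simp: flat_def eventually_at_filter exp_minus divide_inverse)
 moreover have "(flat n \<longlongrightarrow> 0) (at_left 0)"
  by (rule tendsto_eventually) (auto simp: flat_def eventually_at_filter)
 ultimately show ?thesis by (simp add: filterlim_at_split)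
qed

text \<open>The family over all \<open>n\<close> is closed under differentiation up to linear
  combinations, which makes smoothness an induction. At 0 the difference quotient of one member is
  the next member, and the exponential beats every power.\<close>

lemma flat_deriv: "(flat n has_real_derivative (flat (n + 2) t - real n * flat (n + 1) t)) (at t)"
proof -
 consider "t > 0" | "t < 0" | "t = 0" by linarith
 thus ?thesis
 proof cases
  case 1
  have "((%t. inverse t ^ n * exp (- inverse t)) has_real_derivative
    (flat (n + 2) t - real n * flat (n + 1) t)) (at t)"
   using 1 by (cases n) (auto intro!: derivative_eq_intros simp: flat_def field_simps power2_eq_square,
    metis One_nat_def mult.commute not_gr0 power_minus_mult)
  thus ?thesis
   by (rule has_field_derivative_transform_within_open[of _ _ _ "{0<..}"]) (use 1 in \<open>auto simp: flat_def\<close>)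
 next
  case 2
  have "((%t. 0) has_real_derivative (flat (n + 2) t - real n * flat (n + 1) t)) (at t)"
   using 2 by (simp add: flat_def)
  thus ?thesis
   by (rule has_field_derivative_transform_within_open[of _ _ _ "{..<0}"]) (use 2 in \<open>auto simp: flat_def\<close>)
 next
  case 3
  have "((%h. (flat n (0 + h) - flat n 0) / h) \<longlongrightarrow> 0) (at 0)"
   by (rule Lim_transform_eventually[OF flat_tendsto_0[of "n + 1"]])
    (auto simp: flat_def eventually_at_filter divide_inverse)
  thus ?thesis using 3 by (simp add: DERIV_def flat_def)
 qed
qed

lemma C_k_on_flat: "C_k_on k (flat n) UNIV"
proof (induction k arbitrary: n)
 case 0
 have "isCont (flat n) t" for t by (rule DERIV_isCont[OF flat_deriv])
 thus ?case by (simp add: continuous_at_imp_continuous_on)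
next
 case (Suc k)
 show ?case
 proof (rule C_k_on_SucI[OF open_UNIV])
  show "(flat n has_derivative (%v. v * (flat (n + 2) t + (- real n) * flat (n + 1) t))) (at t)" for t
   using flat_deriv[of n t] by (simp add: has_field_derivative_def mult.commute[of _ "_ - _"])
  show "C_k_on k (%t. v * (flat (n + 2) t + (- real n) * flat (n + 1) t)) UNIV" for v
   by (intro C_k_on_bilinear[OF bounded_bilinear_mult] C_k_on_add C_k_on_const open_UNIV Suc.IH)
 qed
qed

text \<open>Equal to 1 at the centre but without a plateau. Later arguments either use only this
  value at the centre, or divide by the bump where it does not vanish.\<close>

definition bump :: "'e::euclidean_space => real => 'e => real" where
 "bump z0 r z = flat 0 (r\<^sup>2 - (z - z0) \<bullet> (z - z0)) / flat 0 (r\<^sup>2)"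

lemma sm_bump: "smooth_on UNIV (bump z0 r)"
proof -
 have "smooth_on UNIV (%z. flat 0 (r\<^sup>2 - (z - z0) \<bullet> (z - z0)))"
  by (rule sm_compose[of UNIV _ UNIV "flat 0"])
   (auto intro!: sm_diff sm_const sm_inner sm_ident simp: smooth_on_def[of _ "flat 0"] C_k_on_flat)
 hence "smooth_on UNIV (%z. flat 0 (r\<^sup>2 - (z - z0) \<bullet> (z - z0)) * inverse (flat 0 (r\<^sup>2)))"
  by (intro sm_mult sm_const) auto
 thus ?thesis by (simp add: bump_def[abs_def] divide_inverse)
qed

lemma bump_center: "r > 0 ==> bump z0 r z0 = 1"
 by (simp add: bump_def flat_def)

lemma bump_zero: "r > 0 ==> z ~: ball z0 r ==> bump z0 r z = 0"
proof -
 assume r: "r > 0" and z: "z ~: ball z0 r"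
 have "r <= norm (z - z0)" using z by (simp add: dist_norm norm_minus_commute)
 hence "r\<^sup>2 <= (z - z0) \<bullet> (z - z0)"
  using power_mono[of r "norm (z - z0)" 2] r by (simp add: dot_square_norm)
 thus ?thesis by (simp add: bump_def flat_def)
qed

text \<open>The coefficient functions in Hadamard's lemma.\<close>

definition segint :: "'a::euclidean_space => nat => ('a => real) => 'a => real" where
 "segint z0 n h z = integral {0..1} (%t. t ^ n * h (z0 + t *: (z - z0)))"

lemma segment_in_convex:
 assumes "convex W" "z0 : W" "z : W" "t : {0..1}"
 shows "z0 + t *: (z - z0) : W"
 using convexD_alt[OF assms(1-3), of t] assms(4) by (simp add: algebra_simps)

text \<open>Differentiation under the integral sign. The inner derivative contributes a factor
  \<open>t\<close>, which is why the weight \<open>t ^ n\<close> is part of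
  \<open>segint\<close>.\<close>

lemma segint_has_derivative:
 assumes W: "open W" "convex W" "z0 : W" and h: "smooth_on W h" and z: "z : W"
 shows "(segint z0 n h has_derivative (%v. segint z0 (Suc n) (%x. fder h (at x) v) z)) (at z)"
proof -
 let ?D = "%x. fder h (at x)"
 let ?p = "%z t. z0 + t *: (z - z0)"
 have pW: "?p z t : W" if "z : W" "t : {0..1}" for z t
  by (rule segment_in_convex[OF W(2,3) that])
 have Dh: "(h has_derivative ?D x) (at x)" if "x : W" for x
  by (rule sm_has_derivative[OF h that])
 \<comment> \<open>The derivative is packaged as a bounded linear function because the rule for
   parameter integrals asks for continuity of the derivative as an operator.\<close>
 define fx where "fx z t = Blinfun (%v. t ^ Suc n * ?D (?p z t) v)" for z t
 have bl: "bounded_linear (%v. t ^ Suc n * ?D (?p z t) v)" if "z : W" "t : {0..1}" for z t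
  using has_derivative_bounded_linear[OF Dh[OF pW[OF that]]] by (rule bounded_linear_const_mult)
 have fx: "blinfun_apply (fx z t) v = t ^ Suc n * ?D (?p z t) v" if "z : W" "t : {0..1}" for z t v
  unfolding fx_def by (subst bounded_linear_Blinfun_apply[OF bl[OF that]]) simp
 have d: "((%z. t ^ n * h (?p z t)) has_derivative blinfun_apply (fx z t)) (at z within W)"
  if "z : W" "t : {0..1}" for z t
 proof -
  have "((%z. ?p z t) has_derivative (%v. t *: v)) (at z)"
   by (auto intro!: derivative_eq_intros)
  from has_derivative_compose[OF this Dh[OF pW[OF that]]]
  have "((%z. h (?p z t)) has_derivative (%v. ?D (?p z t) (t *: v))) (at z)" by simp
  hence "((%z. t ^ n * h (?p z t)) has_derivative (%v. t ^ n * ?D (?p z t) (t *: v))) (at z)"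
   by (rule has_derivative_mult_right)
  moreover have "(%v. t ^ n * ?D (?p z t) (t *: v)) = blinfun_apply (fx z t)"
   using has_derivative_linear[OF Dh[OF pW[OF that]]] by (simp add: fun_eq_iff fx[OF that] linear_scale)
  ultimately show ?thesis by (simp add: has_derivative_at_withinI)
 qed
 have cont: "continuous_on (W \<times> {0..1}) (%(z, t). fx z t)"
 proof (rule continuous_on_blinfun_componentwise)
  fix i :: 'a assume "i : Basis"
  have "continuous_on W (%x. ?D x i)"
   by (rule sm_continuous[OF sm_deriv[OF h]])
  hence "continuous_on (W \<times> {0..1}) (%w. ?D (?p (fst w) (snd w)) i)"
   by (rule continuous_on_compose2) (auto intro!: continuous_intros pW)
  hence "continuous_on (W \<times> {0..1}) (%w. snd w ^ Suc n * ?D (?p (fst w) (snd w)) i)"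
   by (intro continuous_intros)
  thus "continuous_on (W \<times> {0..1}) (%w. blinfun_apply (case w of (z, t) => fx z t) i)"
   by (rule continuous_on_cong[THEN iffD1, rotated -1]) (auto simp: fx)
 qed
 have int: "(%t. t ^ n * h (?p z t)) integrable_on cbox 0 1" if "z : W" for z
 proof (rule integrable_continuous)
  have "continuous_on {0..1} (%t. h (?p z t))"
   by (rule continuous_on_compose2[OF sm_continuous[OF h]]) (auto intro!: continuous_intros pW that)
  thus "continuous_on (cbox 0 1) (%t. t ^ n * h (?p z t))"
   by (auto intro!: continuous_intros)
 qed
 have "((%z. integral (cbox 0 1) (%t. t ^ n * h (?p z t))) has_derivative
   blinfun_apply (integral (cbox 0 1) (fx z))) (at z within W)"
  by (rule leibniz_rule) (use d int cont z W in auto)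
 moreover have "blinfun_apply (integral (cbox 0 1) (fx z)) v = segint z0 (Suc n) (%x. ?D x v) z" for v
 proof -
  have "continuous_on {0..1} (fx z)"
   by (rule continuous_on_compose2[OF cont, of _ "%t. (z, t)", simplified]) (auto intro!: continuous_intros z)
  hence "fx z integrable_on cbox 0 1" by (simp add: integrable_continuous_real)
  hence "blinfun_apply (integral (cbox 0 1) (fx z)) v = integral (cbox 0 1) (%t. blinfun_apply (fx z t) v)"
   by (rule blinfun_apply_integral)
  thus ?thesis by (simp add: segint_def, intro integral_cong) (simp add: fx[OF z])
 qed
 hence "blinfun_apply (integral (cbox 0 1) (fx z)) = (%v. segint z0 (Suc n) (%x. ?D x v) z)"
  by (rule ext)
 ultimately show ?thesis
  using at_within_open[OF z W(1)] by (simp add: segint_def[abs_def])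
qed

lemma sm_segint:
 assumes W: "open W" "convex W" "z0 : W" and h: "smooth_on W h"
 shows "smooth_on W (segint z0 n h)"
proof -
 have "C_k_on k (segint z0 n h) W" if "smooth_on W h" for k n h
  using that
 proof (induction k arbitrary: n h)
  case 0
  show ?case unfolding C_k_on.simps
   by (intro continuous_at_imp_continuous_on ballI has_derivative_continuous[OF segint_has_derivative[OF W 0]])
 next
  case (Suc k)
  show ?case
   by (rule C_k_on_SucI[OF W(1) segint_has_derivative[OF W Suc.prems]])
    (assumption, rule Suc.IH[OF sm_deriv[OF Suc.prems]])
 qed
 thus ?thesis using h by (simp add: smooth_on_def)
qed

text \<open>The fundamental theorem of calculus along the segment from \<open>z0\<close> to
  \<open>z\<close>, with the direction expanded in the basis. At \<open>z0\<close> the coefficients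
  are the partial derivatives.\<close>

lemma hadamard:
 assumes W: "open W" "convex W" "z0 : W" and h: "smooth_on W h" and z: "z : W"
 shows "h z = h z0 + (SUM b:Basis. ((z - z0) \<bullet> b) * segint z0 0 (%x. fder h (at x) b) z)"
proof -
 let ?D = "%x. fder h (at x)"
 let ?p = "%t. z0 + t *: (z - z0)"
 have pW: "?p t : W" if "t : {0..1}" for t
  by (rule segment_in_convex[OF W(2,3) z that])
 have Dh: "(h has_derivative ?D x) (at x)" if "x : W" for x
  by (rule sm_has_derivative[OF h that])
 have cont: "continuous_on {0..1} (%t. ?D (?p t) b)" for b
  by (rule continuous_on_compose2[OF sm_continuous[OF sm_deriv[OF h]]]) (auto intro!: continuous_intros pW)
 have "((%t. ?D (?p t) (z - z0)) has_integral (h (?p 1) - h (?p 0))) {0..1}"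
 proof (rule fundamental_theorem_of_calculus)
  fix t :: real assume t: "t : {0..1}"
  have "(?p has_derivative (%s. s *: (z - z0))) (at t)" by (auto intro!: derivative_eq_intros)
  from has_derivative_compose[OF this Dh[OF pW[OF t]]]
  have "((%t. h (?p t)) has_derivative (%s. s *: ?D (?p t) (z - z0))) (at t)"
   using has_derivative_linear[OF Dh[OF pW[OF t]]] by (simp add: linear_scale)
  thus "((%t. h (?p t)) has_vector_derivative ?D (?p t) (z - z0)) (at t within {0..1})"
   by (simp add: has_vector_derivative_def has_derivative_at_withinI)
 qed simp
 hence "h z - h z0 = integral {0..1} (%t. ?D (?p t) (z - z0))"
  by (simp add: integral_unique)
 also have "... = integral {0..1} (%t. SUM b:Basis. ((z - z0) \<bullet> b) * ?D (?p t) b)"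
 proof (rule integral_cong)
  fix t :: real assume "t : {0..1}"
  thus "?D (?p t) (z - z0) = (SUM b:Basis. ((z - z0) \<bullet> b) * ?D (?p t) b)"
   using lin_sum[OF has_derivative_linear[OF Dh[OF pW]], of t "z - z0"] by simp
 qed
 also have "... = (SUM b:Basis. integral {0..1} (%t. ((z - z0) \<bullet> b) * ?D (?p t) b))"
  by (rule integral_sum) (auto intro!: integrable_continuous_real continuous_intros cont)
 finally show ?thesis by (simp add: segint_def)
qed

lemma segint_center: "segint z0 0 h z0 = h z0"
 by (simp add: segint_def)

section \<open>Charts, tangent vectors and covectors\<close>

lemma ch_simps:
 assumes "is_chart c"
 shows "x : fst c ==> cinv c (snd c x) = x"
  and "z : cimg c ==> snd c (cinv c z) = z"
  and "z : cimg c ==> cinv c z : fst c"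
  and "open (cimg c)"
 using assms by (auto simp: is_chart_def chart_inv_def inv_into_f_f f_inv_into_f inv_into_into)

lemma sm_compose_at:
 fixes f :: "'a::euclidean_space => 'b::euclidean_space"
 assumes "open U" "smooth_on U f" "open V" "smooth_on V g" "x : U" "f x : V"
 obtains W where "open W" "x : W" "W <= U" "f ` W <= V" "smooth_on W (%x. g (f x))"
proof
 have "open (f -` V Int U)"
  using continuous_open_preimage[OF sm_continuous[OF assms(2)] assms(1,3)] by (simp add: Int_commute)
 thus o: "open (U Int f -` V)" by (simp add: Int_commute)
 show "x : U Int f -` V" "U Int f -` V <= U" "f ` (U Int f -` V) <= V" using assms by auto
 show "smooth_on (U Int f -` V) (%x. g (f x))"
  by (rule sm_compose[OF o sm_subset[OF assms(2)] assms(4)]) auto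
qed

text \<open>Compatibility of two charts near a point passes through a third chart around it; the
  neighbourhood is shrunk until all three domains contain the points involved.\<close>

lemma smooth_transition_via:
 assumes charts: "is_chart c" "is_chart c0" "is_chart d"
  and tr: "smooth_transition c c0" "smooth_transition c0 d"
  and p: "p : fst c" "p : fst c0" "p : fst d"
 obtains W where "open W" "snd c p : W" "W <= snd c ` (fst c Int fst c0 Int fst d)" "smooth_on W (snd d o cinv c)"
proof -
 let ?U = "snd c ` (fst c Int fst c0)" and ?V = "snd c0 ` (fst c0 Int fst d)"
 let ?f = "snd c0 o cinv c" and ?g = "snd d o cinv c0"
 have "snd c p : ?U" "?f (snd c p) : ?V" using p ch_simps(1)[OF charts(1)] by auto
 then obtain W where W: "open W" "snd c p : W" "W <= ?U" "?f ` W <= ?V" "smooth_on W (%x. ?g (?f x))"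
  using tr sm_compose_at[of ?U ?f ?V ?g "snd c p"] unfolding smooth_transition_def by blast
 have in_W: "EX x. z = snd c x & x : fst c & x : fst c0 & x : fst d" if z: "z : W" for z
 proof -
  obtain x where x: "z = snd c x" "x : fst c" "x : fst c0" using z W(3) by auto
  have "?f z : ?V" using z W(4) by auto
  then obtain y where y: "snd c0 x = snd c0 y" "y : fst c0" "y : fst d"
   using x ch_simps(1)[OF charts(1)] by auto
  have "x = y" using charts(2) x y by (auto simp: is_chart_def dest: inj_onD)
  thus ?thesis using x y by blast
 qed
 show thesis
 proof (rule that[OF W(1,2)])
  show "W <= snd c ` (fst c Int fst c0 Int fst d)" using in_W by blast
  show "smooth_on W (snd d o cinv c)"
  proof (rule sm_cong[OF W(1,5)])
   fix z assume "z : W"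
   then obtain x where "z = snd c x" "x : fst c" "x : fst c0" using in_W by blast
   thus "?g (?f z) = (snd d o cinv c) z"
    using ch_simps(1)[OF charts(1)] ch_simps(1)[OF charts(2)] by simp
  qed
 qed
qed

text \<open>Compatibility of charts is separated from the topological conditions in
  \<open>manifold\<close>, so that the calculus below is available for M and for the normal bundle
  alike.\<close>

locale smooth_atlas =
 fixes A :: "('a, 'e::euclidean_space) atlas"
 assumes atlas_chart: "c : A ==> is_chart c"
  and atlas_transition: "c : A ==> d : A ==> smooth_transition c d"
begin

abbreviation F :: "('a => real) set" where "F == smooth_functions A"

lemma atlas_smch: "c : A ==> c : smooth_charts A"
 using atlas_chart atlas_transition by (auto simp: smooth_charts_def carrier_of_def)

lemma smch_chart: "c : smooth_charts A ==> is_chart c"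
 by (simp add: smooth_charts_def)

lemma carrier_chart:
 assumes "p : carrier_of A" obtains c where "c : A" "p : fst c"
 using assms by (auto simp: carrier_of_def)

lemma smch_carrier: "c : smooth_charts A ==> p : fst c ==> p : carrier_of A"
 by (auto simp: smooth_charts_def)

lemma smooth_charts_local:
 assumes "c : smooth_charts A" "d : smooth_charts A" "p : fst c" "p : fst d"
 obtains W where "open W" "snd c p : W" "W <= snd c ` (fst c Int fst d)" "smooth_on W (snd d o cinv c)"
proof -
 obtain c0 where c0: "c0 : A" "p : fst c0" using smch_carrier[OF assms(1,3)] by (rule carrier_chart)
 have "smooth_transition c c0" "smooth_transition c0 d" using assms(1,2) c0 by (auto simp: smooth_charts_def)
 then obtain W where "open W" "snd c p : W" "W <= snd c ` (fst c Int fst c0 Int fst d)" "smooth_on W (snd d o cinv c)"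
  using smooth_transition_via[of c c0 d p] assms c0 atlas_chart smch_chart by metis
 thus thesis by (intro that[of W]) auto
qed

lemma smch_trans:
 assumes c: "c : smooth_charts A" and d: "d : smooth_charts A"
 shows "smooth_transition c d"
proof -
 let ?U = "snd c ` (fst c Int fst d)"
 have loc: "EX W. open W & z : W & W <= ?U & smooth_on W (snd d o cinv c)" if "z : ?U" for z
  using that smooth_charts_local[OF c d] by blast
 hence "open ?U" by (subst open_subopen) blast
 moreover have "smooth_on ?U (snd d o cinv c)"
  by (rule sm_local[OF \<open>open ?U\<close>]) (use loc in \<open>metis inf.absorb_iff2\<close>)
 ultimately show ?thesis by (simp add: smooth_transition_def)
qed

lemma smf_local:
 assumes f: "f : F" and c: "c : smooth_charts A"
 shows "smooth_on (cimg c) (f o cinv c)"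
proof (rule sm_local)
 show o: "open (cimg c)" using c by (simp add: smooth_charts_def is_chart_def)
 fix z assume "z : cimg c"
 then obtain p where p: "z = snd c p" "p : fst c" by auto
 obtain c0 where c0: "c0 : A" "p : fst c0" using smch_carrier[OF c p(2)] by (rule carrier_chart)
 let ?U = "snd c ` (fst c Int fst c0)"
 have tr: "open ?U" "smooth_on ?U (snd c0 o cinv c)"
  using smch_trans[OF c atlas_smch[OF c0(1)]] by (auto simp: smooth_transition_def)
 have f0: "smooth_on (snd c0 ` fst c0) (f o cinv c0)" using f c0(1) by (simp add: smooth_functions_def)
 have cc: "is_chart c" "is_chart c0" using c c0(1) smch_chart atlas_chart by auto
 have "smooth_on ?U (%x. (f o cinv c0) ((snd c0 o cinv c) x))"
  by (rule sm_compose[OF tr f0]) (auto simp: ch_simps(1)[OF cc(1)])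
 hence "smooth_on ?U (f o cinv c)"
  by (rule sm_cong[OF tr(1)]) (auto simp: ch_simps(1)[OF cc(1)] ch_simps(1)[OF cc(2)])
 thus "EX V. open V & z : V & smooth_on (cimg c Int V) (f o cinv c)"
  using tr(1) p c0 by (intro exI[of _ ?U]) (auto intro: sm_subset)
qed

lemma smfI:
 assumes "!!x. x ~: carrier_of A ==> f x = 0"
  and loc: "!!p. p : carrier_of A ==> EX c W. c : smooth_charts A & p : fst c & open W & snd c p : W & W <= cimg c
   & smooth_on W (f o cinv c)"
 shows "f : F"
 unfolding smooth_functions_def mem_Collect_eq
proof (intro conjI ballI allI impI assms(1))
 fix d assume d: "d : A"
 note ds = atlas_smch[OF d]
 show "smooth_on (cimg d) (f o cinv d)"
 proof (rule sm_local)
  show o: "open (cimg d)" using atlas_chart[OF d] by (simp add: is_chart_def)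
  fix z assume "z : cimg d"
  then obtain p where p: "z = snd d p" "p : fst d" by auto
  obtain c W where c: "c : smooth_charts A" "p : fst c" and W: "open W" "snd c p : W" "W <= cimg c" "smooth_on W (f o cinv c)"
   using loc[OF smch_carrier[OF ds p(2)]] by blast
  have cc: "is_chart c" "is_chart d" using c(1) d smch_chart atlas_chart by auto
  let ?U = "snd d ` (fst d Int fst c)"
  have tr: "open ?U" "smooth_on ?U (snd c o cinv d)"
   using smch_trans[OF ds c(1)] by (auto simp: smooth_transition_def)
  have "z : ?U" "(snd c o cinv d) z : W" using p c W ch_simps(1)[OF cc(2)] by auto
  then obtain V where V: "open V" "z : V" "V <= ?U" "smooth_on V (%x. (f o cinv c) ((snd c o cinv d) x))"
   using sm_compose_at[OF tr W(1,4), of z] by metis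
  have "smooth_on V (f o cinv d)"
   using V(3) by (intro sm_cong[OF V(1,4)]) (auto simp: ch_simps(1)[OF cc(1)] ch_simps(1)[OF cc(2)])
  thus "EX V. open V & z : V & smooth_on (cimg d Int V) (f o cinv d)"
   using V by (intro exI[of _ V]) (auto intro: sm_subset)
 qed
qed

lemma smf_zero: "f : F ==> x ~: carrier_of A ==> f x = 0"
 by (simp add: smooth_functions_def)

lemma open_chart: "c : A ==> open (cimg c)"
 using atlas_chart by (simp add: is_chart_def)

sublocale fun_algebra F
proof
 have FI: "h : F" if "!!c. c : A ==> smooth_on (cimg c) (%z. h (cinv c z))" "!!x. x ~: carrier_of A ==> h x = 0" for h
  using that by (simp add: smooth_functions_def o_def)
 have FD: "smooth_on (cimg c) (%z. h (cinv c z))" if "h : F" "c : A" for h c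
  using that by (simp add: smooth_functions_def o_def)
 show "subspace F"
  unfolding subspace_def
 proof (intro conjI ballI allI)
  show "0 : F" by (rule FI) (simp_all add: fzero sm_const open_chart)
  show "f + g : F" if "f : F" "g : F" for f g
   by (rule FI) (simp_all add: fplus smf_zero that sm_add[OF open_chart FD FD])
  show "r *: f : F" if "f : F" for r f
   by (rule FI) (simp_all add: fscale smf_zero that sm_mult[OF open_chart sm_const[OF open_chart] FD])
 qed
 show "f * g : F" if "f : F" "g : F" for f g
  by (rule FI) (simp_all add: times_fun_apply smf_zero that sm_mult[OF open_chart FD FD])
qed

definition trd :: "'a => ('a, 'e) chart => ('a, 'e) chart => 'e => 'e" where
 "trd p c d = fder (snd d o cinv c) (at (snd c p))"

lemma charts_atD: "c : charts_at A p ==> c : smooth_charts A" "c : charts_at A p ==> p : fst c"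
 by (auto simp: charts_at_def)

lemma charts_at_nonempty: "p : carrier_of A ==> EX c. c : charts_at A p"
 by (elim carrier_chart, drule atlas_smch) (unfold charts_at_def, blast)

lemma trd_has_derivative:
 assumes c: "c : charts_at A p" and d: "d : charts_at A p"
 shows "((snd d o cinv c) has_derivative trd p c d) (at (snd c p))"
proof -
 obtain W where "open W" "snd c p : W" "smooth_on W (snd d o cinv c)"
  using smooth_charts_local[of c d p] charts_atD c d by metis
 thus ?thesis unfolding trd_def by (intro sm_has_derivative[of W])
qed

lemma trd_linear: "c : charts_at A p ==> d : charts_at A p ==> linear (trd p c d)"
 by (rule has_derivative_linear[OF trd_has_derivative])

lemma chart_image_nbhd:
 assumes c: "c : charts_at A p" and d: "d : charts_at A p"
 shows "open (snd c ` (fst c Int fst d))" "snd c p : snd c ` (fst c Int fst d)"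
 using smch_trans[of c d] charts_atD c d by (auto simp: smooth_transition_def)

lemma trd_comp:
 assumes c: "c : charts_at A p" and d: "d : charts_at A p" and e: "e : charts_at A p"
 shows "trd p d e (trd p c d v) = trd p c e v"
proof -
 have cc: "is_chart c" "is_chart d" using c d charts_atD smch_chart by auto
 have eq: "(snd d o cinv c) (snd c p) = snd d p" using ch_simps(1)[OF cc(1)] charts_atD(2)[OF c] by simp
 have "((snd e o cinv d) o (snd d o cinv c) has_derivative (trd p d e o trd p c d)) (at (snd c p))"
  by (rule diff_chain_at[OF trd_has_derivative[OF c d]]) (use trd_has_derivative[OF d e] eq in simp)
 moreover have "((snd e o cinv d) o (snd d o cinv c)) z = (snd e o cinv c) z"
  if "z : snd c ` (fst c Int fst d)" for z
  using that ch_simps(1)[OF cc(1)] ch_simps(1)[OF cc(2)] by auto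
 ultimately have "((snd e o cinv c) has_derivative (trd p d e o trd p c d)) (at (snd c p))"
  by (rule has_derivative_transform_within_open[OF _ chart_image_nbhd[OF c d]])
 hence "trd p d e o trd p c d = trd p c e"
  by (rule has_derivative_unique[OF _ trd_has_derivative[OF c e]])
 thus ?thesis by (metis comp_apply)
qed

lemma trd_self:
 assumes c: "c : charts_at A p" shows "trd p c c v = v"
proof -
 have "((%z. z) has_derivative (%v. v)) (at (snd c p))" by (rule has_derivative_ident)
 hence "((snd c o cinv c) has_derivative (%v. v)) (at (snd c p))"
  by (rule has_derivative_transform_within_open[OF _ chart_image_nbhd[OF c c]])
   (use ch_simps(2)[OF smch_chart[OF charts_atD(1)[OF c]]] in auto)
 hence "(%v. v) = trd p c c" by (rule has_derivative_unique[OF _ trd_has_derivative[OF c c]])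
 thus ?thesis by metis
qed

definition tvec :: "'a => ('a, 'e) chart => 'e => ('a, 'e) tvector" where
 "tvec p c v = (%d. if d : charts_at A p then trd p c d v else 0)"

lemma tangent_space_iff:
 "v : tsp A p \<longleftrightarrow> (ALL c. c ~: charts_at A p --> v c = 0) &
  (ALL c:charts_at A p. ALL d:charts_at A p. v d = trd p c d (v c))"
 by (simp add: tangent_space_def trd_def)

lemma tvec_tangent: "c : charts_at A p ==> tvec p c v : tsp A p"
 by (simp add: tangent_space_iff tvec_def trd_comp)

lemma tvec_coord [simp]: "c : charts_at A p ==> tvec p c v c = v"
 by (simp add: tvec_def trd_self)

lemma tangent_transition: "c : charts_at A p ==> d : charts_at A p ==> v : tsp A p ==> v d = trd p c d (v c)"
 unfolding tangent_space_iff by blast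

lemma tangent_off: "d ~: charts_at A p ==> v : tsp A p ==> v d = 0"
 unfolding tangent_space_iff by blast

lemma tangent_eq_tvec:
 assumes "c : charts_at A p" "v : tsp A p"
 shows "tvec p c (v c) = v"
proof
 fix d show "tvec p c (v c) d = v d"
  using tangent_transition[OF assms(1) _ assms(2), of d] tangent_off[OF _ assms(2), of d]
  by (cases "d : charts_at A p") (simp_all add: tvec_def)
qed

lemma tangent_eqI: "c : charts_at A p ==> v : tsp A p ==> w : tsp A p ==> v c = w c ==> v = w"
 by (rule trans[OF tangent_eq_tvec[of c p v, symmetric] trans[OF arg_cong[of "v c" "w c" "tvec p c"] tangent_eq_tvec[of c p w]]])

lemma lin_apply: "(r *: v + s *: w) c = r *: v c + s *: w c" for v w :: "'x => 'y::real_vector"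
 by (simp add: fplus fscale)

lemma tangent_lin:
 assumes "v : tsp A p" "w : tsp A p"
 shows "r *: v + s *: w : tsp A p"
 unfolding tangent_space_iff lin_apply
proof (intro conjI allI impI ballI)
 fix c d assume c: "c : charts_at A p" and d: "d : charts_at A p"
 show "r *: v d + s *: w d = trd p c d (r *: v c + s *: w c)"
  unfolding tangent_transition[OF c d assms(1)] tangent_transition[OF c d assms(2)]
  by (simp add: linear_add[OF trd_linear[OF c d]] linear_scale[OF trd_linear[OF c d]])
qed (simp add: tangent_off[OF _ assms(1)] tangent_off[OF _ assms(2)])

lemma sub_tan: "subspace (tsp A p)"
proof -
 have "0 : tsp A p"
  using trd_linear by (auto simp: tangent_space_iff fzero linear_0)
 thus ?thesis using tangent_lin[of _ p _ 1 1] tangent_lin[of _ p 0 _ 0] unfolding subspace_def by auto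
qed

text \<open>\<open>differential\<close> picks one chart by choice; by the chain rule every chart at
  \<open>p\<close> gives the same value.\<close>

lemma dif_eq:
 assumes f: "f : F" and c: "c : charts_at A p" and v: "v : tsp A p"
 shows "dif A p f v = fder (f o cinv c) (at (snd c p)) (v c)"
proof -
 have der: "((f o cinv d) has_derivative fder (f o cinv d) (at (snd d p))) (at (snd d p))"
  if "d : charts_at A p" for d
  using smf_local[OF f charts_atD(1)[OF that]] charts_atD(2)[OF that] by (intro sm_has_derivative) auto
 define d where "d = (SOME c. c : charts_at A p)"
 have d: "d : charts_at A p" unfolding d_def by (rule someI[of "%c. c : charts_at A p", OF c])
 have cc: "is_chart c" "is_chart d" using c d charts_atD smch_chart by auto
 have eq: "(snd d o cinv c) (snd c p) = snd d p" using ch_simps(1)[OF cc(1)] charts_atD(2)[OF c] by simp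
 have "((f o cinv d) o (snd d o cinv c) has_derivative
   (fder (f o cinv d) (at (snd d p)) o trd p c d)) (at (snd c p))"
  by (rule diff_chain_at[OF trd_has_derivative[OF c d]]) (use der[OF d] eq in simp)
 hence "((f o cinv c) has_derivative
   (fder (f o cinv d) (at (snd d p)) o trd p c d)) (at (snd c p))"
  by (rule has_derivative_transform_within_open[OF _ chart_image_nbhd[OF c d]])
   (use ch_simps(1)[OF cc(1)] ch_simps(1)[OF cc(2)] in auto)
 hence "fder (f o cinv d) (at (snd d p)) o trd p c d = fder (f o cinv c) (at (snd c p))"
  by (rule has_derivative_unique[OF _ der[OF c]])
 moreover have "dif A p f v = fder (f o cinv d) (at (snd d p)) (v d)"
  using v by (simp add: differential_def Let_def d_def)
 ultimately show ?thesis using tangent_transition[OF c d v] by (simp add: fun_eq_iff)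
qed

lemma smf_deriv:
 assumes "f : F" "c : charts_at A p"
 shows "((f o cinv c) has_derivative fder (f o cinv c) (at (snd c p))) (at (snd c p))"
 using smf_local[OF assms(1) charts_atD(1)[OF assms(2)]] charts_atD(2)[OF assms(2)]
 by (intro sm_has_derivative) auto

lemma dif_off: "v ~: tsp A p ==> dif A p f v = 0"
 by (simp add: differential_def)

lemma dif_cotangent:
 assumes f: "f : F" and p: "p : carrier_of A"
 shows "dif A p f : ctsp A p"
proof -
 obtain c where c: "c : charts_at A p" using charts_at_nonempty[OF p] by blast
 note lin = has_derivative_linear[OF smf_deriv[OF f c]]
 show ?thesis
  unfolding cotangent_space_def mem_Collect_eq
  by (simp add: dif_eq[OF f c] tangent_lin lin_apply linear_add[OF lin] linear_scale[OF lin] dif_off)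
qed

lemma dif_lin:
 assumes f: "f : F" and g: "g : F" and p: "p : carrier_of A"
 shows "dif A p (r *: f + s *: g) = r *: dif A p f + s *: dif A p g"
proof
 fix v
 obtain c where c: "c : charts_at A p" using charts_at_nonempty[OF p] by blast
 show "dif A p (r *: f + s *: g) v = (r *: dif A p f + s *: dif A p g) v"
 proof (cases "v : tsp A p")
  case True
  have "(((r *: f + s *: g) o cinv c) has_derivative (%v. r *: fder (f o cinv c) (at (snd c p)) v
    + s *: fder (g o cinv c) (at (snd c p)) v)) (at (snd c p))"
   using has_derivative_add[OF has_derivative_scaleR_right[OF smf_deriv[OF f c], of r]
     has_derivative_scaleR_right[OF smf_deriv[OF g c], of s]]
   by (simp add: o_def lin_apply)
  from frechet_derivative_at[OF this, symmetric] show ?thesis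
   using f g c True by (simp add: dif_eq[of _ c] lin_apply)
 qed (simp add: differential_def lin_apply)
qed

lemma dif_mult:
 assumes f: "f : F" and g: "g : F" and p: "p : carrier_of A"
 shows "dif A p (f * g) = f p *: dif A p g + g p *: dif A p f"
proof
 fix v
 obtain c where c: "c : charts_at A p" using charts_at_nonempty[OF p] by blast
 show "dif A p (f * g) v = (f p *: dif A p g + g p *: dif A p f) v"
 proof (cases "v : tsp A p")
  case True
  have e: "cinv c (snd c p) = p" using ch_simps(1)[OF smch_chart] charts_atD c by blast
  have "(((f * g) o cinv c) has_derivative (%v. f p * fder (g o cinv c) (at (snd c p)) v
    + fder (f o cinv c) (at (snd c p)) v * g p)) (at (snd c p))"
   using has_derivative_mult[OF smf_deriv[OF f c] smf_deriv[OF g c]]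
   by (simp add: o_def times_fun_apply e)
  from frechet_derivative_at[OF this, symmetric] show ?thesis
   using f g c True by (simp add: dif_eq[of _ c] lin_apply mult.commute)
 qed (simp add: differential_def lin_apply)
qed

lemma cot_repr:
 assumes al: "al : ctsp A p" and c: "c : charts_at A p"
 obtains a where "!!v. v : tsp A p ==> al v = a \<bullet> v c"
proof -
 have lin: "al (r *: v + s *: w) = r * al v + s * al w" if "v : tsp A p" "w : tsp A p" for r s v w
  using al that by (auto simp: cotangent_space_def)
 have tv: "tvec p c (r *: x + s *: y) = r *: tvec p c x + s *: tvec p c y" for x y r s
  by (rule tangent_eqI[OF c tvec_tangent[OF c] tangent_lin[OF tvec_tangent[OF c] tvec_tangent[OF c]]])
   (simp only: lin_apply tvec_coord[OF c])
 have "al (tvec p c (r *: x + s *: y)) = r * al (tvec p c x) + s * al (tvec p c y)" for r s x y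
  unfolding tv by (rule lin[OF tvec_tangent[OF c] tvec_tangent[OF c]])
 from this[of 1 _ 1] this[of _ _ 0] have "linear (%x. al (tvec p c x))" by (intro linearI) simp_all
 note s = lin_sum[OF this]
 show thesis
 proof (rule that[of "SUM b:Basis. al (tvec p c b) *: b"])
  fix v assume v: "v : tsp A p"
  have "al v = al (tvec p c (v c))" by (simp add: tangent_eq_tvec[OF c v])
  also have "... = (SUM b:Basis. (v c \<bullet> b) *: al (tvec p c b))" by (rule s)
  also have "... = (SUM b:Basis. al (tvec p c b) *: b) \<bullet> v c"
   by (simp add: inner_sum_left inner_commute[of "v c"] mult.commute)
  finally show "al v = (SUM b:Basis. al (tvec p c b) *: b) \<bullet> v c" .
 qed
qed

lemma cotangentI:
 assumes c: "c : charts_at A p" and "!!v. v : tsp A p ==> al v = a \<bullet> v c" "!!v. v ~: tsp A p ==> al v = 0"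
 shows "al : ctsp A p"
 using assms tangent_lin by (auto simp: cotangent_space_def lin_apply inner_add_right)

lemma cot_eqI: "al : ctsp A p ==> bt : ctsp A p ==> (!!v. v : tsp A p ==> al v = bt v) ==> al = bt"
 by (rule ext, case_tac "x : tsp A p") (simp_all add: cotangent_space_def)

end

text \<open>The form in which topology enters the algebra: near each point one fixed function
  \<open>bt\<close>, such that \<open>bt\<close> times any smooth coordinate function extends by
  zero. Convexity of \<open>W\<close> is there for Hadamard's lemma.\<close>

locale bump_atlas = smooth_atlas A for A :: "('a, 'e::euclidean_space) atlas" +
 assumes bump_extension: "p : carrier_of A ==> EX c:A. EX W bt. p : fst c & open W & convex W & snd c p : W &
   W <= cimg c & bt : smooth_functions A & bt p = 1 &
   (ALL h. smooth_on W h --> (%x. if x : fst c & snd c x : W then bt x * h (snd c x) else 0) : smooth_functions A)"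
begin

text \<open>Near \<open>p\<close>, Hadamard's lemma writes \<open>f\<close> minus its value at
  \<open>p\<close> as a sum of products of two functions that both vanish at \<open>p\<close>,
  because the coefficients there are the partial derivatives of \<open>f\<close>. A derivation at
  \<open>p\<close> kills such products; bump functions make all factors global.\<close>

lemma derivation_vanishes:
 assumes lin: "!!f g r s. f : F ==> g : F ==> D (r *: f + s *: g) = r * D f + s * D g"
  and der: "!!f g. f : F ==> g : F ==> D (f * g) = f p * D g + g p * D f"
  and p: "p : carrier_of A" and f: "f : F" and df: "dif A p f = 0"
 shows "D f = (0 :: real)"
proof -
 obtain c W bt where c: "c : A" "p : fst c" and W: "open W" "convex W" "snd c p : W" "W <= cimg c"
  and bt: "bt : F" "bt p = 1"
  and ext: "!!h. smooth_on W h ==> (%x. if x : fst c & snd c x : W then bt x * h (snd c x) else 0) : F"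
  using bump_extension[OF p] by blast
 have cat: "c : charts_at A p" using c atlas_smch by (simp add: charts_at_def)
 have cc: "is_chart c" by (rule atlas_chart[OF c(1)])
 let ?z0 = "snd c p" and ?h = "f o cinv c"
 define E where "E h = (%x. if x : fst c & snd c x : W then bt x * h (snd c x) else 0)" for h
 have E: "E h : F" if "smooth_on W h" for h using ext[OF that] by (simp add: E_def)
 have Ep: "E h p = h ?z0" for h using c W bt by (simp add: E_def)
 have fs: "smooth_on W ?h"
  by (rule sm_subset[OF smf_local[OF f atlas_smch[OF c(1)]] W(4)])
 let ?D = "%x. fder ?h (at x)"
 have D0: "?D ?z0 v = 0" for v
 proof -
  have "?D ?z0 v = dif A p f (tvec p c v)"
   using dif_eq[OF f cat tvec_tangent[OF cat]] cat by simp
  thus ?thesis by (simp add: df fzero)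
 qed
 let ?g = "%b. segint ?z0 0 (%x. ?D x b)"
 have gs: "smooth_on W (?g b)" for b
  by (rule sm_segint[OF W(1,2,3) sm_deriv[OF fs]])
 have xs: "smooth_on W (%z. (z - ?z0) \<bullet> b)" for b
  by (intro sm_inner sm_diff sm_ident sm_const W)
 have os: "smooth_on W (%z. 1)" by (intro sm_const W)
 text \<open>\<open>E\<close> multiplies by the bump function once, so the square of that function times \<open>f\<close> is a combination of products of two extensions.\<close>
 have decomp: "bt * E ?h = f p *: (bt * E (%z. 1)) + 1 *: (SUM b:Basis. E (%z. (z - ?z0) \<bullet> b) * E (?g b))"
 proof
  fix x
  show "(bt * E ?h) x = (f p *: (bt * E (%z. 1)) + 1 *: (SUM b:Basis. E (%z. (z - ?z0) \<bullet> b) * E (?g b))) x"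
  proof (cases "x : fst c & snd c x : W")
   case True
   have "?h (snd c x) = ?h ?z0 + (SUM b:Basis. ((snd c x - ?z0) \<bullet> b) * ?g b (snd c x))"
    by (rule hadamard[OF W(1,2,3) fs]) (use True in simp)
   moreover have "?h ?z0 = f p" using ch_simps(1)[OF cc c(2)] by simp
   moreover have "E h x = bt x * h (snd c x)" for h using True by (simp add: E_def)
   ultimately show ?thesis
    unfolding lin_apply times_fun_apply fun_sum_apply by (simp add: sum_distrib_left distrib_left mult_ac)
  next
   case False
   have "E h x = 0" for h using False by (auto simp: E_def)
   thus ?thesis unfolding lin_apply times_fun_apply fun_sum_apply by simp
  qed
 qed
 have Dsum: "D (SUM b:S. u b) = (SUM b:S. D (u b))" if "!!b. b : S ==> u b : F" "finite S" for S and u :: "'e => 'a => real"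
  using that(2,1)
 proof (induction S rule: finite_induct)
  case empty
  show ?case using lin[of 0 0 0 0] by simp
 next
  case (insert b S)
  have "sum u S : F" using insert by (intro subspace_sum[OF subspace_F]) auto
  thus ?case using insert lin[of "u b" "sum u S" 1 1] by simp
 qed
 have Dprod: "D (E (%z. (z - ?z0) \<bullet> b) * E (?g b)) = 0" for b
  using der[OF E[OF xs] E[OF gs]] by (simp add: Ep segint_center D0)
 have "D (SUM b:Basis. E (%z. (z - ?z0) \<bullet> b) * E (?g b)) = 0"
  by (subst Dsum) (auto simp: Dprod intro!: mult_F E xs gs)
 hence "D (bt * E ?h) = f p * D (bt * E (%z. 1))"
  unfolding decomp using lin[of "bt * E (%z. 1)" "SUM b:Basis. E (%z. (z - ?z0) \<bullet> b) * E (?g b)" "f p" 1]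
  by (simp add: mult_F bt E os subspace_sum[OF subspace_F] xs gs)
 moreover have "E ?h = f * E (%z. 1)"
  using ch_simps(1)[OF cc] by (auto simp: fun_eq_iff E_def times_fun_apply)
 ultimately have "D (bt * (f * E (%z. 1))) = f p * D (bt * E (%z. 1))" by simp
 \<comment> \<open>In the Leibniz expansions with \<open>bt p = 1\<close>, the derivatives of
   \<open>bt\<close> and of the extension of 1 occur equally on both sides, and \<open>D f\<close>
   is what remains.\<close>
 thus "D f = 0"
  using der[OF bt(1) mult_F[OF f E[OF os]]] der[OF f E[OF os]] der[OF bt(1) E[OF os]] bt(2) Ep
  by (simp add: times_fun_apply algebra_simps)
qed

text \<open>A linear function of the coordinates that vanishes at \<open>p\<close>, cut off by the
  bump; since it vanishes at \<open>p\<close>, the derivative of the cutoff does not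
  contribute.\<close>

lemma covector_extension:
 assumes p: "p : carrier_of A" and c: "c : charts_at A p"
 obtains f where "f : F" "f p = 0" "!!v. v : tsp A p ==> dif A p f v = a \<bullet> v c"
proof -
 obtain c0 W bt where c0: "c0 : A" "p : fst c0" and W: "open W" "convex W" "snd c0 p : W" "W <= snd c0 ` fst c0"
  and bt: "bt : F" "bt p = 1"
  and ext: "!!h. smooth_on W h ==> (%x. if x : fst c0 & snd c0 x : W then bt x * h (snd c0 x) else 0) : F"
  using bump_extension[OF p] by blast
 have cat: "c0 : charts_at A p" using c0 atlas_smch by (simp add: charts_at_def)
 have cc: "is_chart c0" by (rule atlas_chart[OF c0(1)])
 define h where "h z = a \<bullet> trd p c0 c (z - snd c0 p)" for z
 have hd: "(h has_derivative (%v. a \<bullet> trd p c0 c v)) (at z)" for z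
  unfolding h_def
  by (intro has_derivative_inner_right bounded_linear.has_derivative[OF linear_conv_bounded_linear[THEN iffD1, OF trd_linear[OF cat c]]])
   (auto intro!: derivative_eq_intros)
 have hs: "smooth_on W h"
  unfolding h_def by (intro sm_inner sm_const sm_linear_compose[OF trd_linear[OF cat c]] sm_diff sm_ident W)
 define f where "f = (%x. if x : fst c0 & snd c0 x : W then bt x * h (snd c0 x) else 0)"
 have f: "f : F" using ext[OF hs] by (simp add: f_def)
 have h0: "h (snd c0 p) = 0" by (simp add: h_def linear_0[OF trd_linear[OF cat c]])
 have "f p = 0" using c0 W h0 by (simp add: f_def)
 moreover have "dif A p f v = a \<bullet> v c" if v: "v : tsp A p" for v
 proof -
  have b: "((bt o cinv c0) has_derivative fder (bt o cinv c0) (at (snd c0 p))) (at (snd c0 p))"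
   by (rule smf_deriv[OF bt(1) cat])
  have bp: "(bt o cinv c0) (snd c0 p) = 1" using ch_simps(1)[OF cc c0(2)] bt by simp
  have "((%z. (bt o cinv c0) z * h z) has_derivative (%v. a \<bullet> trd p c0 c v)) (at (snd c0 p))"
   using has_derivative_mult[OF b hd] bp h0 by simp
  hence "((f o cinv c0) has_derivative (%v. a \<bullet> trd p c0 c v)) (at (snd c0 p))"
   by (rule has_derivative_transform_within_open[OF _ W(1,3)])
    (use W(4) ch_simps(2,3)[OF cc] in \<open>auto simp: f_def\<close>)
  from frechet_derivative_at[OF this, symmetric] show ?thesis
   using dif_eq[OF f cat v] tangent_transition[OF cat c v] by simp
 qed
 ultimately show thesis using f that by blast
qed

lemma covec_dif:
 assumes p: "p : carrier_of A" and al: "al : ctsp A p"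
 shows "EX f:F. dif A p f = al"
proof -
 obtain c where c: "c : charts_at A p" using charts_at_nonempty[OF p] by blast
 obtain a where a: "!!v. v : tsp A p ==> al v = a \<bullet> v c" using cot_repr[OF al c] by blast
 obtain f where f: "f : F" "!!v. v : tsp A p ==> dif A p f v = a \<bullet> v c"
  using covector_extension[OF p c] by metis
 have "dif A p f = al"
  by (rule cot_eqI[OF dif_cotangent[OF f(1) p] al]) (simp add: a f)
 thus ?thesis using f by blast
qed

lemma covecs_dif:
 assumes p: "p : carrier_of A" and "set als <= ctsp A p"
 shows "EX fs. set fs <= F & map (dif A p) fs = als"
 using assms(2)
proof (induction als)
 case (Cons al als)
 then obtain fs where "set fs <= F" "map (dif A p) fs = als" by auto
 moreover obtain f where "f : F" "dif A p f = al" using covec_dif[OF p] Cons.prems by auto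
 ultimately show ?case by (intro exI[of _ "f # fs"]) simp
qed simp

lemma MD_head_zero:
 assumes X: "X : MD k" and p: "p : carrier_of A" and f: "f : F" and df: "dif A p f = 0"
 shows "X (f # fs) p = 0"
proof (rule derivation_vanishes[of "%f. X (f # fs) p", OF _ _ p f df])
 show "X ((r *: f + s *: g) # fs) p = r * X (f # fs) p + s * X (g # fs) p" if "f : F" "g : F" for f g r s
  by (simp add: ALT_lin[OF MD_ALT[OF X] that] lin_apply)
 show "X ((f * g) # fs) p = f p * X (g # fs) p + g p * X (f # fs) p" if "f : F" "g : F" for f g
  by (simp add: MD_deriv[OF X that] fplus times_fun_apply)
qed

lemma MD_slot_zero:
 assumes X: "X : MD k" and p: "p : carrier_of A" and f: "f : F" and df: "dif A p f = 0"
 shows "X (xs @ f # ys) p = 0"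
proof (induction xs arbitrary: ys rule: rev_induct)
 case Nil
 show ?case using MD_head_zero[OF assms] by simp
next
 case (snoc x xs)
 have "X ((xs @ [x]) @ f # ys) p = - X (xs @ f # x # ys) p"
  using ALT_swap[OF MD_ALT[OF X], of xs x f ys] by (simp add: uminus_apply)
 thus ?case by (simp add: snoc)
qed

text \<open>Entries are exchanged one at a time: their difference has zero differential at
  \<open>p\<close>, and by skew symmetry the vanishing in the first slot holds in every
  slot.\<close>

lemma MD_differential_cong:
 assumes X: "X : MD k" and p: "p : carrier_of A"
  and "set fs <= F" "set gs <= F" "map (dif A p) fs = map (dif A p) gs"
 shows "X fs p = X gs p"
proof -
 have len: "length fs = length gs" using assms(5) by (metis length_map)
 have "X (xs @ fs) p = X (xs @ gs) p" for xs
  using len assms(3-5)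
 proof (induction fs gs arbitrary: xs rule: list_induct2)
  case (Cons f fs g gs)
  have fg: "f : F" "g : F" using Cons.prems by auto
  have "dif A p (1 *: f + (- 1) *: g) = 0"
   using Cons.prems by (simp only: dif_lin[OF fg p]) simp
  hence "X (xs @ (1 *: f + (- 1) *: g) # fs) p = 0"
   by (intro MD_slot_zero[OF X p]) (simp_all add: fg)
  hence "X (xs @ f # fs) p = X (xs @ g # fs) p"
   unfolding ALT_lin_slot[OF MD_ALT[OF X] fg] by (simp add: fplus uminus_apply minus_apply)
  also have "... = X ((xs @ [g]) @ gs) p"
   using Cons.IH[of "xs @ [g]"] Cons.prems by simp
  finally show ?case by simp
 qed simp
 from this[of "[]"] show ?thesis by simp
qed

lemma multivector_at_MD:
 assumes X: "X : MD k" and p: "p : carrier_of A" and fs: "set fs <= F"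
 shows "multivector_at A X p (map (dif A p) fs) = X fs p"
proof -
 let ?gs = "SOME gs. set gs <= F & map (dif A p) gs = map (dif A p) fs"
 have "set ?gs <= F & map (dif A p) ?gs = map (dif A p) fs"
  by (rule someI[of "%gs. set gs <= F & map (dif A p) gs = map (dif A p) fs" fs]) (simp add: fs)
 thus ?thesis unfolding multivector_at_def by (intro MD_differential_cong[OF X p]) (use fs in auto)
qed

lemma alternating_form_MD:
 assumes X: "X : MD k" and p: "p : carrier_of A"
 shows "alternating_form (ctsp A p) k (multivector_at A X p)"
 unfolding alternating_form_def
proof (intro conjI allI impI)
 fix xs ys al bt r s
 assume *: "set xs Un set ys Un {al, bt} <= ctsp A p & length xs + 1 + length ys = k"
 obtain fx where fx: "set fx <= F" "map (dif A p) fx = xs" using covecs_dif[OF p, of xs] * by auto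
 obtain fy where fy: "set fy <= F" "map (dif A p) fy = ys" using covecs_dif[OF p, of ys] * by auto
 obtain f where f: "f : F" "dif A p f = al" using covec_dif[OF p, of al] * by auto
 obtain g where g: "g : F" "dif A p g = bt" using covec_dif[OF p, of bt] * by auto
 have "multivector_at A X p (map (dif A p) (fx @ h # fy)) = X (fx @ h # fy) p" if "h : F" for h
  by (rule multivector_at_MD[OF X p]) (use that fx fy in auto)
 from this[OF f(1)] this[OF g(1)] this[of "r *: f + s *: g"]
 show "multivector_at A X p (xs @ (r *: al + s *: bt) # ys)
  = r * multivector_at A X p (xs @ al # ys) + s * multivector_at A X p (xs @ bt # ys)"
  using f g by (simp add: fx fy dif_lin[OF f(1) g(1) p] ALT_lin_slot[OF MD_ALT[OF X] f(1) g(1)] lin_apply)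
next
 fix xs ys al
 assume *: "set xs Un set ys Un {al} <= ctsp A p & length xs + 2 + length ys = k"
 obtain fx where fx: "set fx <= F" "map (dif A p) fx = xs" using covecs_dif[OF p, of xs] * by auto
 obtain fy where fy: "set fy <= F" "map (dif A p) fy = ys" using covecs_dif[OF p, of ys] * by auto
 obtain f where f: "f : F" "dif A p f = al" using covec_dif[OF p, of al] * by auto
 have "multivector_at A X p (map (dif A p) (fx @ f # f # fy)) = X (fx @ f # f # fy) p"
  by (rule multivector_at_MD[OF X p]) (use f fx fy in auto)
 thus "multivector_at A X p (xs @ al # al # ys) = 0"
  using f by (simp add: fx fy ALT_repeat[OF MD_ALT[OF X]] fzero)
qed

lemma alternating_form_lin:
 assumes "alternating_form V k om" "set xs <= V" "set ys <= V" "al : V" "bt : V" "length xs + 1 + length ys = k"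
 shows "om (xs @ (r *: al + s *: bt) # ys) = r * om (xs @ al # ys) + s * om (xs @ bt # ys)"
 using conjunct1[OF assms(1)[unfolded alternating_form_def], rule_format, of xs ys al bt r s] assms(2-6) by blast

lemma alternating_form_repeat:
 assumes "alternating_form V k om" "set xs <= V" "set ys <= V" "al : V" "length xs + 2 + length ys = k"
 shows "om (xs @ al # al # ys) = 0"
 using conjunct2[OF assms(1)[unfolded alternating_form_def], rule_format, of xs ys al] assms(2-5) by blast

lemma mvf_point:
 assumes X: "X : multivector_fields A k" and p: "p : carrier_of A"
  and F: "set xs <= F" "set ys <= F" "u : F" "v : F"
 shows "length xs + 1 + length ys = k ==>
   X (xs @ (r *: u + s *: v) # ys) p = r * X (xs @ u # ys) p + s * X (xs @ v # ys) p"
  and "length xs + 2 + length ys = k ==> X (xs @ u # u # ys) p = 0"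
  and "1 + length ys = k ==> X ((u * v) # ys) p = u p * X (v # ys) p + v p * X (u # ys) p"
proof -
 obtain om where om: "alternating_form (ctsp A p) k om"
  and Xom: "!!fs. length fs = k ==> set fs <= F ==> X fs p = om (map (dif A p) fs)"
  using X p unfolding multivector_fields_def by blast
 let ?d = "dif A p"
 have m: "set (map ?d zs) <= ctsp A p" if "set zs <= F" for zs
  using that dif_cotangent[OF _ p] by auto
 note d = dif_cotangent[OF F(3) p] dif_cotangent[OF F(4) p]
 show "X (xs @ (r *: u + s *: v) # ys) p = r * X (xs @ u # ys) p + s * X (xs @ v # ys) p"
  if "length xs + 1 + length ys = k"
  using alternating_form_lin[OF om m[OF F(1)] m[OF F(2)] d, of r s] that F
  by (simp add: Xom dif_lin[OF F(3,4) p])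
 show "X (xs @ u # u # ys) p = 0" if "length xs + 2 + length ys = k"
  using alternating_form_repeat[OF om m[OF F(1)] m[OF F(2)] d(1)] that F by (simp add: Xom)
 show "X ((u * v) # ys) p = u p * X (v # ys) p + v p * X (u # ys) p" if "1 + length ys = k"
  using alternating_form_lin[OF om _ m[OF F(2)] d(2,1), of "[]" "u p" "v p"] that F
  by (simp add: Xom dif_mult[OF F(3,4) p])
qed

text \<open>For a multiderivation the values on covectors are well defined by
  \<open>MD_differential_cong\<close>; conversely a pointwise form composed with differentials
  inherits the product rule. From here on multivector fields are treated purely
  algebraically.\<close>

lemma mvf_MD: "multivector_fields A k = MD k"
proof (intro equalityI subsetI)
 fix X assume X: "X : MD k"
 note XA = MD_ALT[OF X]
 have "EX om. alternating_form (ctsp A p) k om & (ALL fs. length fs = k & set fs <= F --> X fs p = om (map (dif A p) fs))"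
  if "p : carrier_of A" for p
  using alternating_form_MD[OF X that] multivector_at_MD[OF X that] by metis
 thus "X : multivector_fields A k"
  using ALT_dom[OF XA] ALT_F[OF XA] unfolding multivector_fields_def by blast
next
 fix X assume X: "X : multivector_fields A k"
 have dom: "X fs = 0" if "~ (length fs = k & set fs <= F)" for fs using X that unfolding multivector_fields_def by blast
 have XF: "X fs : F" for fs using X unfolding multivector_fields_def by blast
 note off = smf_zero[OF XF]
 show "X : MD k"
  unfolding MD_def ALT_def mem_Collect_eq
 proof (intro conjI allI ballI impI)
  show "X fs = 0" if "~ (length fs = k & set fs <= F)" for fs by (rule dom[OF that])
  show "X fs : F" for fs by (rule XF)
  fix f g r s fs assume fg: "f : F" "g : F"
  show "X ((r *: f + s *: g) # fs) = r *: X (f # fs) + s *: X (g # fs)"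
  proof (cases "1 + length fs = k & set fs <= F")
   case True
   show ?thesis
   proof
    fix p show "X ((r *: f + s *: g) # fs) p = (r *: X (f # fs) + s *: X (g # fs)) p"
     using mvf_point(1)[OF X, of p "[]" fs f g r s] True fg
     by (cases "p : carrier_of A") (simp_all add: lin_apply off)
   qed
  next
   case False
   hence "X (h # fs) = 0" for h by (intro dom) auto
   thus ?thesis by simp
  qed
 next
  fix f g fs assume fg: "f : F" "g : F"
  show "X ((f * g) # fs) = f * X (g # fs) + g * X (f # fs)"
  proof (cases "1 + length fs = k & set fs <= F")
   case True
   show ?thesis
   proof
    fix p show "X ((f * g) # fs) p = (f * X (g # fs) + g * X (f # fs)) p"
     using mvf_point(3)[OF X, of p "[]" fs f g] True fg
     by (cases "p : carrier_of A") (simp_all add: fplus times_fun_apply off)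
   qed
  next
   case False
   hence "X (h # fs) = 0" for h by (intro dom) auto
   thus ?thesis by simp
  qed
 next
  fix xs u v ys
  show "X (xs @ u # v # ys) = - X (xs @ v # u # ys)"
  proof (cases "length xs + 2 + length ys = k & set xs <= F & set ys <= F & u : F & v : F")
   case True
   hence uv: "u + v : F" by simp
   show ?thesis
   proof
    fix p
    show "X (xs @ u # v # ys) p = (- X (xs @ v # u # ys)) p"
    proof (cases "p : carrier_of A")
     case p: True
     have 0: "X (xs @ w # w # ys) p = 0" if "w : F" for w
      using mvf_point(2)[OF X p, of xs ys w] True that by simp
     have 1: "X (xs @ (u + v) # w # ys) p = X (xs @ u # w # ys) p + X (xs @ v # w # ys) p" if "w : F" for w
      using mvf_point(1)[OF X p, of xs "w # ys" u v 1 1] True that by simp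
     have 2: "X (xs @ w # (u + v) # ys) p = X (xs @ w # u # ys) p + X (xs @ w # v # ys) p" if "w : F" for w
      using mvf_point(1)[OF X p, of "xs @ [w]" ys u v 1 1] True that by simp
     \<comment> \<open>Polarization: the form vanishes on the repeated entries \<open>u + v\<close>,
       \<open>u\<close> and \<open>v\<close>.\<close>
     have "X (xs @ u # v # ys) p + X (xs @ v # u # ys) p = 0"
      using 0[OF uv] 1[OF uv] 2[of u] 2[of v] 0[of u] 0[of v] True by simp
     thus ?thesis by (simp add: uminus_apply)
    qed (simp add: off uminus_apply)
   qed
  next
   case False
   hence "X (xs @ u # v # ys) = 0" "X (xs @ v # u # ys) = 0" by (auto intro!: dom)
   thus ?thesis by simp
  qed
 qed
qed

end

section \<open>Submanifolds and coisotropy\<close>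

lemma in_subspace_if_orthogonal:
 fixes x :: "'e::euclidean_space"
 assumes "subspace S" "!!a. a : ocomp S ==> a \<bullet> x = 0"
 shows "x : S"
proof -
 have "x : ocomp (ocomp S)"
  using assms(2) by (simp add: orthogonal_comp_def orthogonal_def)
 thus ?thesis by (simp add: orthogonal_comp_self[OF assms(1)])
qed

text \<open>The line \<open>z + t *: w\<close> stays in \<open>S'\<close>, so \<open>tu\<close> maps
  it into \<open>S\<close> for small \<open>t\<close>. Its inner product with a vector orthogonal to
  \<open>S\<close> is identically zero there, hence so is the derivative.\<close>

lemma derivative_in_subspace:
 fixes tu :: "'e::euclidean_space => 'f::euclidean_space"
 assumes D: "(tu has_derivative D) (at z)" and S: "subspace S" and S': "subspace S'" and U: "open U" "z : U"
  and z: "z : S'" and im: "!!x. x : U ==> x : S' ==> tu x : S" and w: "w : S'"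
 shows "D w : S"
proof (rule in_subspace_if_orthogonal[OF S])
 fix a assume a: "a : ocomp S"
 have l: "((%t. z + t *: w) has_derivative (%t. t *: w)) (at (0::real))" by (auto intro!: derivative_eq_intros)
 have "((%t. tu (z + t *: w)) has_derivative (%t. D (t *: w))) (at 0)"
  by (rule has_derivative_compose[OF l]) (simp add: D)
 hence 1: "((%t. a \<bullet> tu (z + t *: w)) has_derivative (%t. a \<bullet> D (t *: w))) (at 0)"
  by (rule has_derivative_inner_right)
 let ?V = "(%t. z + t *: w) -` U"
 have V: "open ?V" by (intro open_vimage U continuous_intros)
 have "0 : ?V" using U by simp
 have "a \<bullet> tu (z + t *: w) = 0" if "t : ?V" for t
 proof -
  have "z + t *: w : S'" using z w by (intro subspace_add subspace_scale S')
  hence "tu (z + t *: w) : S" using that by (intro im) auto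
  thus ?thesis using a by (simp add: orthogonal_comp_def orthogonal_def inner_commute[of a])
 qed
 hence "((%t. 0) has_derivative (%t. a \<bullet> D (t *: w))) (at 0)"
  by (intro has_derivative_transform_within_open[OF 1 V \<open>0 : ?V\<close>]) simp
 hence "(%t. a \<bullet> D (t *: w)) = (%t. 0)" by (rule has_derivative_unique) simp
 from fun_cong[OF this, of 1] show "a \<bullet> D w = 0" by simp
qed

context smooth_atlas
begin

lemma sliceD:
 assumes "slice_chart A N c S"
 shows "c : smooth_charts A" "subspace S" "snd c ` (fst c Int N) = cimg c Int S" "is_chart c"
  and "x : fst c ==> x : N \<longleftrightarrow> snd c x : S"
  and "x : fst c ==> c : charts_at A x"
proof -
 show 1: "c : smooth_charts A" "subspace S" "snd c ` (fst c Int N) = cimg c Int S"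
  using assms by (simp_all add: slice_chart_def)
 show c: "is_chart c" using 1(1) by (rule smch_chart)
 show "c : charts_at A x" if "x : fst c" for x using 1(1) that by (simp add: charts_at_def)
 show "x : N \<longleftrightarrow> snd c x : S" if x: "x : fst c" for x
 proof
  assume "x : N" thus "snd c x : S" using x 1(3) by blast
 next
  assume "snd c x : S"
  hence "snd c x : snd c ` (fst c Int N)" using x 1(3) by blast
  then obtain y where "snd c x = snd c y" "y : fst c" "y : N" by auto
  thus "x : N" using c x by (auto simp: is_chart_def dest: inj_onD)
 qed
qed

lemma slice_tangent_transition:
 assumes c: "slice_chart A N c S" and d: "slice_chart A N d S'" and p: "p : fst c" "p : fst d" "p : N"
  and w: "w : S"
 shows "trd p c d w : S'"
proof -
 note c' = sliceD[OF c] and d' = sliceD[OF d]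
 note cp = c'(6)[OF p(1)] and dp = d'(6)[OF p(2)]
 show ?thesis
 proof (rule derivative_in_subspace[OF trd_has_derivative[OF cp dp] d'(2) c'(2) chart_image_nbhd[OF cp dp] _ _ w])
 show "snd c p : S" using c'(5)[OF p(1)] p(3) by simp
 fix x assume "x : snd c ` (fst c Int fst d)" "x : S"
 then obtain y where y: "x = snd c y" "y : fst c" "y : fst d" "y : N" using c'(5) by blast
 thus "(snd d o cinv c) x : S'" using ch_simps(1)[OF c'(4)] d'(5) by simp
 qed
qed

text \<open>The definition asks for some slice chart. Transition derivatives map the model subspaces
  into each other, so any slice chart at \<open>p\<close> decides tangency.\<close>

lemma stan_iff:
 assumes c: "slice_chart A N c S" and p: "p : fst c" "p : N"
 shows "v : stan A N p \<longleftrightarrow> v : tsp A p & v c : S"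
proof
 assume "v : stan A N p"
 then obtain d S' where v: "v : tsp A p" and d: "slice_chart A N d S'" "p : fst d" "v d : S'"
  by (auto simp: submanifold_tangent_def)
 have "v c = trd p d c (v d)"
  by (rule tangent_transition[OF sliceD(6)[OF d(1,2)] sliceD(6)[OF c p(1)] v])
 thus "v : tsp A p & v c : S"
  using slice_tangent_transition[OF d(1) c d(2) p d(3)] v by simp
next
 assume "v : tsp A p & v c : S"
 thus "v : stan A N p" unfolding submanifold_tangent_def using c p by blast
qed

lemma dif_vanishing_conormal:
 assumes c: "slice_chart A N c S" and p: "p : fst c" "p : N" and f: "f : F" and z: "!!x. x : N ==> f x = 0"
 shows "dif A p f : conormal_space A N p"
proof -
 note c' = sliceD[OF c]
 have pc: "p : carrier_of A" using smch_carrier[OF c'(1) p(1)] .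
 have "dif A p f v = 0" if v: "v : stan A N p" for v
 proof -
  have v': "v : tsp A p" "v c : S" using v stan_iff[OF c p] by auto
  have "fder (f o cinv c) (at (snd c p)) (v c) : {0}"
  proof (rule derivative_in_subspace[OF smf_deriv[OF f c'(6)[OF p(1)]] _ c'(2) ch_simps(4)[OF c'(4)]])
   show "subspace {0 :: real}" by simp
   show "snd c p : cimg c" "snd c p : S" "v c : S" using p v' c'(5) by auto
   fix x assume x: "x : cimg c" "x : S"
   hence "cinv c x : N"
    using c'(5)[of "cinv c x"] ch_simps(2,3)[OF c'(4) x(1)] by simp
   thus "(f o cinv c) x : {0}" using z by simp
  qed
  thus ?thesis using dif_eq[OF f c'(6)[OF p(1)] v'(1)] by simp
 qed
 thus ?thesis using dif_cotangent[OF f pc] by (simp add: conormal_space_def)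
qed

end

context bump_atlas
begin

definition covec :: "'a => ('a, 'e) chart => 'e => ('a, 'e) covector" where
 "covec p c a = (%v. if v : tsp A p then a \<bullet> v c else 0)"

lemma covec_cotangent: "c : charts_at A p ==> covec p c a : ctsp A p"
 by (rule cotangentI) (simp_all add: covec_def)

lemma cot_covec:
 assumes "al : ctsp A p" "c : charts_at A p"
 obtains a where "al = covec p c a"
proof -
 obtain a where a: "!!v. v : tsp A p ==> al v = a \<bullet> v c" using cot_repr[OF assms] by blast
 have "al = covec p c a"
  by (rule cot_eqI[OF assms(1) covec_cotangent[OF assms(2)]]) (simp add: a covec_def)
 thus thesis by (rule that)
qed

lemma covec_lin: "covec p c (r *: a + s *: b) = r *: covec p c a + s *: covec p c b"
 by (auto simp: covec_def fun_eq_iff fplus fscale inner_add_left)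

text \<open>Justifies the definite description in \<open>sharp\<close>: in a chart, covectors are
  inner products, and the functional obtained by fixing \<open>al\<close> is represented by exactly
  one vector.\<close>

lemma sharp_characterization:
 assumes X: "X : MD 2" and p: "p : carrier_of A" and al: "al : ctsp A p"
 shows "sharp A X p al : tsp A p & (ALL bt:ctsp A p. bt (sharp A X p al) = multivector_at A X p [al, bt])"
proof -
 obtain c where c: "c : charts_at A p" using charts_at_nonempty[OF p] by blast
 have lin: "multivector_at A X p [al, r *: bt + s *: ga] = r * multivector_at A X p [al, bt] + s * multivector_at A X p [al, ga]"
  if "bt : ctsp A p" "ga : ctsp A p" for r s bt ga
  using alternating_form_lin[OF alternating_form_MD[OF X p], of "[al]" "[]" bt ga r s] that al by simp
 define L where "L a = multivector_at A X p [al, covec p c a]" for a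
 have "L (r *: a + s *: b) = r * L a + s * L b" for r s a b
  unfolding L_def covec_lin by (rule lin[OF covec_cotangent[OF c] covec_cotangent[OF c]])
 from this[of 1 _ 1] this[of _ _ 0] have "linear L" by (intro linearI) simp_all
 note L = lin_sum[OF this]
 define w where "w = tvec p c (SUM b:Basis. L b *: b)"
 have w: "w : tsp A p" "w c = (SUM b:Basis. L b *: b)"
  using tvec_tangent[OF c] c by (simp_all add: w_def)
 have "\<exists>!w. w : tsp A p & (ALL bt:ctsp A p. bt w = multivector_at A X p [al, bt])"
 proof (rule ex1I[of _ w], intro conjI ballI)
  show "w : tsp A p" by (rule w)
  fix bt assume "bt : ctsp A p"
  then obtain a where a: "bt = covec p c a" using cot_covec[OF _ c] by blast
  have "bt w = a \<bullet> (SUM b:Basis. L b *: b)" using w by (simp add: a covec_def)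
  also have "... = L a" unfolding L[of a] by (simp add: inner_sum_right mult.commute)
  finally show "bt w = multivector_at A X p [al, bt]" by (simp add: L_def a)
 next
  fix w' assume w': "w' : tsp A p & (ALL bt:ctsp A p. bt w' = multivector_at A X p [al, bt])"
  have "ALL a. a \<bullet> w' c = a \<bullet> w c"
  proof
   fix a
   have "a \<bullet> w' c = L a" using w' covec_cotangent[OF c, of a] by (auto simp: L_def covec_def[of p c a])
   also have "... = a \<bullet> w c" unfolding L[of a] w(2) by (simp add: inner_sum_right mult.commute)
   finally show "a \<bullet> w' c = a \<bullet> w c" .
  qed
  hence "w' c = w c" using vector_eq_ldot[of "w' c" "w c"] by blast
  thus "w' = w" using tangent_eqI[OF c] w' w by blast
 qed
 from theI'[OF this] show ?thesis unfolding sharp_def[of A X p al, symmetric] .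
qed

text \<open>In a slice chart a vector is tangent to \<open>N\<close> iff it is orthogonal to the
  complement of \<open>S\<close>, and the vectors of that complement represent conormal covectors.
  This turns coisotropy into a condition that can be tested on functions.\<close>

lemma coisotropic_iff:
 assumes X: "X : MD 2"
 shows "coisotropic A X N \<longleftrightarrow> submanifold A N & (ALL p:N. ALL f:F. ALL g:F.
  dif A p f : conormal_space A N p --> dif A p g : conormal_space A N p --> X [f, g] p = 0)"
proof -
 have "(sharp A X p ` conormal_space A N p <= stan A N p) \<longleftrightarrow> (ALL f:F. ALL g:F.
  dif A p f : conormal_space A N p --> dif A p g : conormal_space A N p --> X [f, g] p = 0)"
  if N: "submanifold A N" and p: "p : N" for p
 proof -
  have pc: "p : carrier_of A" using N p by (auto simp: submanifold_def)
  obtain c S where cS: "slice_chart A N c S" "p : fst c" using N p by (auto simp: submanifold_def)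
  note c' = sliceD[OF cS(1)] and c = sliceD(6)[OF cS]
  have co: "al : ctsp A p" if "al : conormal_space A N p" for al using that by (simp add: conormal_space_def)
  have ev: "X [f, g] p = dif A p g (sharp A X p (dif A p f))" if "f : F" "g : F" for f g
   using multivector_at_MD[OF X pc, of "[f, g]"] that sharp_characterization[OF X pc dif_cotangent[OF that(1) pc]]
    dif_cotangent[OF that(2) pc] by simp
  show ?thesis
  proof (intro iffI ballI impI)
   fix f g assume "sharp A X p ` conormal_space A N p <= stan A N p" "f : F" "g : F"
    "dif A p f : conormal_space A N p" "dif A p g : conormal_space A N p"
   thus "X [f, g] p = 0" unfolding ev[OF \<open>f : F\<close> \<open>g : F\<close>] by (auto simp: conormal_space_def)
  next
   assume *: "ALL f:F. ALL g:F. dif A p f : conormal_space A N p --> dif A p g : conormal_space A N p --> X [f, g] p = 0"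
   show "sharp A X p ` conormal_space A N p <= stan A N p"
   proof
    fix w assume "w : sharp A X p ` conormal_space A N p"
    then obtain al where al: "al : conormal_space A N p" "w = sharp A X p al" by auto
    obtain f where f: "f : F" "dif A p f = al" using covec_dif[OF pc co[OF al(1)]] by auto
    have w: "w : tsp A p" using sharp_characterization[OF X pc co[OF al(1)]] al by simp
    have "w c : S"
    proof (rule in_subspace_if_orthogonal[OF c'(2)])
     fix a assume a: "a : ocomp S"
     have cn: "covec p c a : conormal_space A N p"
      using a covec_cotangent[OF c] stan_iff[OF cS p]
      by (auto simp: conormal_space_def covec_def orthogonal_comp_def orthogonal_def inner_commute)
     obtain g where g: "g : F" "dif A p g = covec p c a" using covec_dif[OF pc covec_cotangent[OF c]] by auto
     have "X [f, g] p = 0" using * f g cn al by simp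
     thus "a \<bullet> w c = 0" using ev[OF f(1) g(1)] w by (simp add: f g al(2) covec_def)
    qed
    thus "w : stan A N p" using stan_iff[OF cS p] w by simp
   qed
  qed
 qed
 thus ?thesis unfolding coisotropic_def by blast
qed

end

section \<open>Bump functions on a manifold\<close>

context smooth_atlas
begin

lemma chart_image_Int:
 assumes "is_chart c"
 shows "snd c ` (fst c Int (U Int V)) = snd c ` (fst c Int U) Int snd c ` (fst c Int V)"
 using assms by (auto simp: is_chart_def dest: inj_onD)

lemma openin_manifold_topology:
 "openin (manifold_topology A) U \<longleftrightarrow> U <= carrier_of A & (ALL c:A. open (snd c ` (fst c Int U)))"
proof -
 have "istopology (%W. W <= carrier_of A & (ALL c:A. open (snd c ` (fst c Int W))))"
  unfolding istopology_def
 proof (intro conjI allI impI)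
  fix S T assume "S <= carrier_of A & (ALL c:A. open (snd c ` (fst c Int S)))" "T <= carrier_of A & (ALL c:A. open (snd c ` (fst c Int T)))"
  thus "S Int T <= carrier_of A" "ALL c:A. open (snd c ` (fst c Int (S Int T)))"
   using chart_image_Int[OF atlas_chart] by auto
 next
  fix K assume *: "ALL S:K. S <= carrier_of A & (ALL c:A. open (snd c ` (fst c Int S)))"
  show "\<Union>K <= carrier_of A" using * by blast
  show "ALL c:A. open (snd c ` (fst c Int \<Union>K))"
  proof
   fix c assume c: "c : A"
   have "snd c ` (fst c Int \<Union>K) = (UN S:K. snd c ` (fst c Int S))" by auto
   moreover have "open (UN S:K. snd c ` (fst c Int S))" by (rule open_UN) (use * c in blast)
   ultimately show "open (snd c ` (fst c Int \<Union>K))" by simp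
  qed
 qed
 thus ?thesis unfolding manifold_topology_def by (simp add: topology_inverse')
qed

lemma open_smooth_chart_image:
 assumes U: "openin (manifold_topology A) U" and d: "d : smooth_charts A"
 shows "open (snd d ` (fst d Int U))"
proof (subst open_subopen, safe)
 fix x assume x: "x : fst d" "x : U"
 obtain c where c: "c : A" "x : fst c" using smch_carrier[OF d x(1)] by (rule carrier_chart)
 have cd: "is_chart c" "is_chart d" using c d atlas_chart smch_chart by auto
 let ?N = "snd d ` (fst d Int fst c)"
 have tr: "open ?N" "smooth_on ?N (snd c o cinv d)"
  using smch_trans[OF d atlas_smch[OF c(1)]] by (auto simp: smooth_transition_def)
 have "open (snd c ` (fst c Int U))" using U c(1) by (simp add: openin_manifold_topology)
 hence "open (?N Int (snd c o cinv d) -` (snd c ` (fst c Int U)))"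
  by (intro continuous_open_preimage[OF sm_continuous[OF tr(2)] tr(1)])
 moreover have "snd d x : ?N Int (snd c o cinv d) -` (snd c ` (fst c Int U))"
  using x c ch_simps(1)[OF cd(2)] by auto
 moreover have "?N Int (snd c o cinv d) -` (snd c ` (fst c Int U)) <= snd d ` (fst d Int U)"
 proof safe
  fix y y' assume y: "y : fst d" "y : fst c" "(snd c o cinv d) (snd d y) = snd c y'" "y' : fst c" "y' : U"
  hence "snd c y = snd c y'" using ch_simps(1)[OF cd(2)] by simp
  hence "y = y'" using y cd(1) by (auto simp: is_chart_def dest: inj_onD)
  thus "snd d y : snd d ` (fst d Int U)" using y by auto
 qed
 ultimately show "EX T. open T & snd d x : T & T <= snd d ` (fst d Int U)" by blast
qed

text \<open>The coordinate ball is compact, so its preimage is closed in a Hausdorff space; the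
  complement is therefore open in every smooth chart.\<close>

lemma closed_ball_complement:
 assumes H: "Hausdorff_space (manifold_topology A)" and c: "c : smooth_charts A"
  and ball: "cball z0 r <= cimg c" and d: "d : smooth_charts A"
 shows "open (snd d ` (fst d - {x:fst c. snd c x : cball z0 r}))"
proof -
 let ?V = "cimg c" and ?K = "{x:fst c. snd c x : cball z0 r}"
 have cc: "is_chart c" by (rule smch_chart[OF c])
 have car: "openin (manifold_topology A) (carrier_of A)"
 proof -
  have "fst e Int carrier_of A = fst e" if "e : A" for e using that by (auto simp: carrier_of_def)
  thus ?thesis by (simp add: openin_manifold_topology open_chart)
 qed
 have "continuous_map (top_of_set ?V) (manifold_topology A) (cinv c)"
  unfolding continuous_map_def
 proof (intro conjI allI impI)
  show "cinv c : topspace (top_of_set ?V) \<rightarrow> topspace (manifold_topology A)"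
   using ch_simps(3)[OF cc] smch_carrier[OF c] openin_subset[OF car] by auto
  fix U assume U: "openin (manifold_topology A) U"
  have "{x:topspace (top_of_set ?V). cinv c x : U} = snd c ` (fst c Int U)"
   using ch_simps(1)[OF cc] by auto
  thus "openin (top_of_set ?V) {x:topspace (top_of_set ?V). cinv c x : U}"
   using open_smooth_chart_image[OF U c] ch_simps(4)[OF cc] by (simp add: openin_open_eq image_mono)
 qed
 moreover have "compactin (top_of_set ?V) (cball z0 r)" using ball by (simp add: compactin_subtopology)
 ultimately have "compactin (manifold_topology A) (cinv c ` cball z0 r)" by (rule image_compactin[rotated])
 moreover have "cinv c ` cball z0 r = ?K"
 proof (intro equalityI subsetI)
  fix x assume "x : cinv c ` cball z0 r"
  thus "x : ?K" using ch_simps(2,3)[OF cc] ball by auto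
 next
  fix x assume "x : ?K"
  thus "x : cinv c ` cball z0 r" using ch_simps(1)[OF cc] by (auto intro!: image_eqI[of _ _ "snd c x"])
 qed
 ultimately have "closedin (manifold_topology A) ?K" using compactin_imp_closedin[OF H] by simp
 hence "openin (manifold_topology A) (carrier_of A - ?K)" by (rule openin_diff[OF car])
 moreover have "fst d Int (carrier_of A - ?K) = fst d - ?K" using smch_carrier[OF d] by auto
 ultimately show ?thesis using open_smooth_chart_image[of "carrier_of A - ?K", OF _ d] by simp
qed

text \<open>The radius of the bump is halved so that its support lies in a closed ball inside the
  chart. Each point then lies in the chart ball, where the formula is smooth, or has a neighbourhood
  off that closed ball, where the function is zero.\<close>

lemma bump_extension_smooth:
 assumes H: "Hausdorff_space (manifold_topology A)" and c: "c : smooth_charts A"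
  and r: "r > 0" "ball z0 r <= cimg c" and h: "smooth_on (ball z0 r) h"
 shows "(%x. if x : fst c & snd c x : ball z0 r then bump z0 (r / 2) (snd c x) * h (snd c x) else 0) : F"
  (is "?e : F")
proof (rule smfI)
 have cc: "is_chart c" by (rule smch_chart[OF c])
 fix x assume "x ~: carrier_of A"
 thus "?e x = 0" using smch_carrier[OF c] by auto
next
 have cc: "is_chart c" by (rule smch_chart[OF c])
 fix p assume p: "p : carrier_of A"
 show "EX d W. d : smooth_charts A & p : fst d & open W & snd d p : W & W <= cimg d & smooth_on W (?e o cinv d)"
 proof (cases "p : fst c & snd c p : ball z0 r")
  case True
  have "smooth_on (ball z0 r) (%z. bump z0 (r / 2) z * h z)"
   by (intro sm_mult h sm_subset[OF sm_bump]) auto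
  hence "smooth_on (ball z0 r) (?e o cinv c)"
   by (rule sm_cong[OF open_ball]) (use r ch_simps(2,3)[OF cc] in auto)
  thus ?thesis using True c r by (intro exI[of _ c] exI[of _ "ball z0 r"]) auto
 next
  case False
  let ?K = "{x:fst c. snd c x : cball z0 (r / 2)}"
  obtain d where d: "d : A" "p : fst d" using p by (rule carrier_chart)
  note ds = atlas_smch[OF d(1)]
  have dd: "is_chart d" by (rule atlas_chart[OF d(1)])
  have sub: "cball z0 (r / 2) <= ball z0 r" using r by auto
  let ?W = "snd d ` (fst d - ?K)"
  have W: "open ?W" by (rule closed_ball_complement[OF H c _ ds]) (use sub r in auto)
  have e0: "?e x = 0" if "x ~: ?K" for x
  proof (cases "x : fst c & snd c x : ball z0 r")
   case True
   hence "snd c x ~: ball z0 (r / 2)" using that by auto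
   thus ?thesis using bump_zero[of "r / 2" "snd c x" z0] r by simp
  qed auto
  have "smooth_on ?W (%z. 0 :: real)" by (rule sm_const[OF W])
  hence "smooth_on ?W (?e o cinv d)"
  proof (rule sm_cong[OF W])
   fix z assume "z : ?W"
   then obtain y where y: "z = snd d y" "y : fst d" "y ~: ?K" by blast
   have "(?e o cinv d) z = ?e y" using ch_simps(1)[OF dd y(2)] y(1) by (simp only: o_apply)
   thus "0 = (?e o cinv d) z" by (rule trans[OF _ sym, OF e0[OF y(3), symmetric]])
  qed
  moreover have "p ~: ?K" using False sub by auto
  ultimately show ?thesis using d ds W by (intro exI[of _ d] exI[of _ ?W]) auto
 qed
qed

end

lemma manifold_smooth_atlas: "manifold A ==> smooth_atlas A"
 by unfold_locales (auto simp: manifold_def)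

lemma manifold_bump_atlas:
 assumes "manifold (A :: ('a, 'e::euclidean_space) atlas)"
 shows "bump_atlas A"
proof -
 interpret smooth_atlas A by (rule manifold_smooth_atlas[OF assms])
 have H: "Hausdorff_space (manifold_topology A)" using assms by (simp add: manifold_def)
 show ?thesis
 proof
  fix p assume "p : carrier_of A"
  then obtain c where c: "c : A" "p : fst c" by (rule carrier_chart)
  note cs = atlas_smch[OF c(1)]
  have cc: "is_chart c" by (rule atlas_chart[OF c(1)])
  obtain r where r: "r > 0" "ball (snd c p) r <= cimg c"
   using ch_simps(4)[OF cc] c(2) openE by (metis image_eqI)
  let ?z = "snd c p"
  define bt where "bt = (%x. if x : fst c & snd c x : ball ?z r then bump ?z (r / 2) (snd c x) * 1 else 0)"
  have bt: "bt : F" unfolding bt_def by (rule bump_extension_smooth[OF H cs r]) (simp add: sm_const)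
  have "bt p = 1" using c r bump_center[of "r / 2" ?z] by (simp add: bt_def)
  moreover have "(%x. if x : fst c & snd c x : ball ?z r then bt x * h (snd c x) else 0) : F"
   if "smooth_on (ball ?z r) h" for h
  proof -
   have "(%x. if x : fst c & snd c x : ball ?z r then bt x * h (snd c x) else 0)
    = (%x. if x : fst c & snd c x : ball ?z r then bump ?z (r / 2) (snd c x) * h (snd c x) else 0)"
    by (auto simp: bt_def)
   thus ?thesis using bump_extension_smooth[OF H cs r that] by simp
  qed
  ultimately show "EX c:A. EX W bt. p : fst c & open W & convex W & snd c p : W & W <= cimg c & bt : F & bt p = 1 &
   (ALL h. smooth_on W h --> (%x. if x : fst c & snd c x : W then bt x * h (snd c x) else 0) : F)"
   using c r bt by (intro bexI[of _ c] exI[of _ "ball ?z r"] exI[of _ bt]) auto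
 qed
qed

section \<open>The normal bundle\<close>

definition oproj :: "'e::euclidean_space set => 'e => 'e" where
 "oproj S x = (THE y. y : S & x - y : ocomp S)"

lemma orthogonal_comp_Int: "x : S ==> x : ocomp S ==> x = (0 :: 'e::euclidean_space)"
 by (auto simp: orthogonal_comp_def orthogonal_def)

lemma oproj_unique:
 assumes S: "subspace S" and y: "y : S" "x - y : ocomp S"
 shows "oproj S x = y"
 unfolding oproj_def
proof (rule the_equality)
 show "y : S & x - y : ocomp S" using y by simp
 fix z assume z: "z : S & x - z : ocomp S"
 have "(x - y) - (x - z) : ocomp S"
  by (rule subspace_diff[OF subspace_orthogonal_comp]) (use y z in auto)
 moreover have "z - y : S" using y z by (intro subspace_diff S) auto
 ultimately have "z - y = 0" by (intro orthogonal_comp_Int[of _ S]) auto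
 thus "z = y" by simp
qed

lemma oproj_props:
 assumes S: "subspace S"
 shows "oproj S x : S" "x - oproj S x : ocomp S"
proof -
 obtain y z where yz: "y : span S" "!!w. w : span S ==> orthogonal z w" "x = y + z"
  using orthogonal_subspace_decomp_exists[of S x] by blast
 have y: "y : S" using yz(1) span_minimal[OF subset_refl S] by blast
 have z: "x - y : ocomp S"
  using yz(2) yz(3) by (auto simp: orthogonal_comp_def span_base orthogonal_commute)
 have "oproj S x = y" by (rule oproj_unique[OF S y z])
 thus "oproj S x : S" "x - oproj S x : ocomp S" using y z by auto
qed

lemma oproj_self: "subspace S ==> x : S ==> oproj S x = x"
 by (rule oproj_unique) (simp_all add: subspace_0 subspace_orthogonal_comp)

lemma oproj_comp: "subspace S ==> x : ocomp S ==> oproj S x = 0"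
 by (rule oproj_unique) (simp_all add: subspace_0)

lemma linear_oproj:
 assumes S: "subspace S" shows "linear (oproj S)"
proof (rule linearI)
 note p = oproj_props[OF S]
 show "oproj S (x + y) = oproj S x + oproj S y" for x y
 proof (rule oproj_unique[OF S subspace_add[OF S p(1) p(1)]])
  have "(x - oproj S x) + (y - oproj S y) : ocomp S"
   by (intro subspace_add subspace_orthogonal_comp p)
  thus "x + y - (oproj S x + oproj S y) : ocomp S" by (simp add: algebra_simps)
 qed
 show "oproj S (r *: x) = r *: oproj S x" for r x
 proof (rule oproj_unique[OF S subspace_scale[OF S p(1)]])
  have "r *: (x - oproj S x) : ocomp S" by (intro subspace_scale subspace_orthogonal_comp p)
  thus "r *: x - r *: oproj S x : ocomp S" by (simp add: scaleR_diff_right)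
 qed
qed

definition perp :: "'e::euclidean_space set => 'e => 'e" where
 "perp S x = x - oproj S x"

lemma linear_perp: "subspace S ==> linear (perp S)"
 unfolding perp_def by (intro linear_compose_sub linear_ident linear_oproj)

lemma perp_props:
 assumes S: "subspace S"
 shows "perp S x : ocomp S" "x - perp S x : S"
  and "x : S ==> perp S x = 0" "x : ocomp S ==> perp S x = x"
  and "perp S x = perp S y \<longleftrightarrow> x - y : S" "oproj S x + perp S x = x"
proof -
 show 1: "perp S x : ocomp S" "x - perp S x : S" using oproj_props[OF S] by (simp_all add: perp_def)
 show 0: "x : S ==> perp S x = 0" for x by (simp add: perp_def oproj_self[OF S])
 show "x : ocomp S ==> perp S x = x" by (simp add: perp_def oproj_comp[OF S])
 show "oproj S x + perp S x = x" by (simp add: perp_def)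
 show "perp S x = perp S y \<longleftrightarrow> x - y : S"
 proof
  assume "perp S x = perp S y"
  hence "x - y = oproj S (x - y)" by (simp add: perp_def linear_diff[OF linear_oproj[OF S]] algebra_simps)
  thus "x - y : S" using oproj_props(1)[OF S, of "x - y"] by simp
 next
  assume "x - y : S"
  hence "perp S (x - y) = 0" by (rule 0)
  thus "perp S x = perp S y" by (simp add: linear_diff[OF linear_perp[OF S]])
 qed
qed

section \<open>Normal vectors in a slice chart\<close>

context smooth_atlas
begin

text \<open>Every element of the fibre has this form, so operations on cosets become vector
  operations on the representative \<open>y\<close>, which matters only modulo
  \<open>S\<close>.\<close>

definition nv :: "'a => ('a, 'e) chart => 'e set => 'e => ('a, 'e) nvector" where
 "nv p c S y = {v:tsp A p. v c - y : S}"

end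

locale slice_point = smooth_atlas A for A :: "('a, 'e::euclidean_space) atlas" +
 fixes C :: "'a set" and c :: "('a, 'e) chart" and S :: "'e set" and p :: 'a
 assumes slice: "slice_chart A C c S" and point: "p : fst c" "p : C"
begin

lemma S: "subspace S" by (rule sliceD(2)[OF slice])
lemma cp: "c : charts_at A p" by (rule sliceD(6)[OF slice point(1)])

lemma tangent_nv: "stan A C p = nv p c S 0"
 using stan_iff[OF slice point] by (auto simp: nv_def)

lemma coset_eq_nv:
 assumes v: "v : tsp A p"
 shows "(%w. v + w) ` stan A C p = nv p c S (v c)"
proof (intro equalityI subsetI)
 fix x assume "x : (%w. v + w) ` stan A C p"
 then obtain w where "x = v + w" "w : tsp A p" "w c : S" using stan_iff[OF slice point] by auto
 thus "x : nv p c S (v c)" using subspace_add[OF sub_tan v] by (simp add: nv_def fplus)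
next
 fix x assume x: "x : nv p c S (v c)"
 hence "x - v : stan A C p"
  using stan_iff[OF slice point] subspace_diff[OF sub_tan _ v] by (simp add: nv_def minus_apply)
 hence "v + (x - v) : (%w. v + w) ` stan A C p" by (rule imageI)
 thus "x : (%w. v + w) ` stan A C p" by simp
qed

lemma normal_space_nv: "normal_space A C p = range (nv p c S)"
proof (intro equalityI subsetI)
 fix u assume "u : normal_space A C p"
 thus "u : range (nv p c S)" using coset_eq_nv by (auto simp: normal_space_def)
next
 fix u assume "u : range (nv p c S)"
 then obtain y where y: "u = nv p c S y" by auto
 hence "u = (%w. tvec p c y + w) ` stan A C p"
  using coset_eq_nv[OF tvec_tangent[OF cp]] by (simp add: cp)
 thus "u : normal_space A C p" using tvec_tangent[OF cp] by (auto simp: normal_space_def)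
qed

lemma nv_normal [simp]: "nv p c S y : normal_space A C p"
 by (simp add: normal_space_nv)

lemma tvec_in_nv: "tvec p c y : nv p c S y"
 using tvec_tangent[OF cp] by (simp add: nv_def cp subspace_0[OF S])

lemma nv_cong:
 assumes "y - y' : S" shows "nv p c S y = nv p c S y'"
proof -
 have "x - y : S \<longleftrightarrow> x - y' : S" for x
  using subspace_add[OF S _ assms, of "x - y"] subspace_diff[OF S _ assms, of "x - y'"] by auto
 thus ?thesis by (simp add: nv_def)
qed

lemma coord_nv [simp]: "coord c S (nv p c S y) = perp S y"
 unfolding normal_coord_def
proof (rule the_equality)
 show "perp S y : ocomp S & (ALL v:nv p c S y. v c - perp S y : S)"
  using perp_props(1)[OF S] nv_cong[OF perp_props(2)[OF S], of y] by (auto simp: nv_def)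
 fix z assume z: "z : ocomp S & (ALL v:nv p c S y. v c - z : S)"
 hence "y - z : S" using tvec_in_nv[of y] cp by auto
 hence "perp S y = perp S z" by (simp add: perp_props(5)[OF S])
 thus "z = perp S y" using z perp_props(4)[OF S] by simp
qed

lemma nv_perp: "nv p c S (perp S y) = nv p c S y"
 by (rule sym, rule nv_cong[OF perp_props(2)[OF S]])

lemma nv_coord: "u : normal_space A C p ==> nv p c S (coord c S u) = u"
 using nv_perp by (auto simp: normal_space_nv)

lemma coord_comp: "u : normal_space A C p ==> coord c S u : ocomp S"
 using perp_props(1)[OF S] by (auto simp: normal_space_nv)

lemma coord_inj: "u : normal_space A C p ==> u' : normal_space A C p ==> coord c S u = coord c S u' ==> u = u'"
 by (rule trans[OF nv_coord[symmetric] trans[OF arg_cong[of _ _ "nv p c S"] nv_coord]])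

lemma nplus_nv: "nplus (nv p c S y) (nv p c S y') = nv p c S (y + y')"
proof (intro equalityI subsetI)
 fix x assume "x : nplus (nv p c S y) (nv p c S y')"
 then obtain v v' where *: "x = v + v'" "v : tsp A p" "v c - y : S" "v' : tsp A p" "v' c - y' : S"
  by (auto simp: nplus_def nv_def)
 have "(v c - y) + (v' c - y') : S" using * by (intro subspace_add[OF S])
 thus "x : nv p c S (y + y')"
  using * subspace_add[OF sub_tan] by (simp add: nv_def fplus algebra_simps)
next
 fix x assume x: "x : nv p c S (y + y')"
 have "x - tvec p c y' : nv p c S y"
  using x subspace_diff[OF sub_tan _ tvec_tangent[OF cp]] by (simp add: nv_def minus_apply cp algebra_simps)
 moreover have "x = (x - tvec p c y') + tvec p c y'" by simp
 ultimately show "x : nplus (nv p c S y) (nv p c S y')" using tvec_in_nv unfolding nplus_def by blast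
qed

lemma nscale_nv: "nscale A C p r (nv p c S y) = nv p c S (r *: y)"
proof (intro equalityI subsetI)
 fix x assume "x : nscale A C p r (nv p c S y)"
 then obtain v w where *: "x = r *: v + 1 *: w" "v : tsp A p" "v c - y : S" "w : tsp A p" "w c : S"
  using stan_iff[OF slice point] by (auto simp: nscale_def nv_def)
 have "r *: (v c - y) + w c : S" using * by (intro subspace_add[OF S] subspace_scale[OF S])
 moreover have "x c - r *: y = r *: (v c - y) + w c" by (simp only: *(1) lin_apply) (simp add: algebra_simps)
 ultimately show "x : nv p c S (r *: y)"
  using tangent_lin[OF *(2,4), of r 1] *(1) by (simp only: nv_def mem_Collect_eq simp_thms)
next
 fix x assume x: "x : nv p c S (r *: y)"
 have "x - r *: tvec p c y : stan A C p"
  using x subspace_diff[OF sub_tan _ subspace_scale[OF sub_tan tvec_tangent[OF cp]]]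
  by (simp add: stan_iff[OF slice point] nv_def minus_apply fscale cp)
 moreover have "x = r *: tvec p c y + (x - r *: tvec p c y)" by simp
 ultimately show "x : nscale A C p r (nv p c S y)" using tvec_in_nv unfolding nscale_def by blast
qed

lemma nplus_normal: "u : normal_space A C p ==> u' : normal_space A C p ==> nplus u u' : normal_space A C p"
 by (auto simp: normal_space_nv nplus_nv)

lemma nscale_normal: "u : normal_space A C p ==> nscale A C p r u : normal_space A C p"
 by (auto simp: normal_space_nv nscale_nv)

lemma zero_normal: "stan A C p : normal_space A C p"
 by (simp add: tangent_nv)

lemma coord_nplus: "u : normal_space A C p ==> u' : normal_space A C p ==>
  coord c S (nplus u u') = coord c S u + coord c S u'"
 by (auto simp: normal_space_nv nplus_nv linear_add[OF linear_perp[OF S]])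

lemma coord_nscale: "u : normal_space A C p ==> coord c S (nscale A C p r u) = r *: coord c S u"
 by (auto simp: normal_space_nv nscale_nv linear_scale[OF linear_perp[OF S]])

lemma coord_zero: "coord c S (stan A C p) = 0"
 by (simp add: tangent_nv linear_0[OF linear_perp[OF S]])

lemma nv_transition:
 assumes d: "slice_chart A C d S'" "p : fst d"
 shows "nv p c S y = nv p d S' (trd p c d y)"
proof -
 interpret d: slice_point A C d S' p by unfold_locales (use d point in auto)
 have "nv p c S y = (%w. tvec p c y + w) ` stan A C p"
  by (simp add: coset_eq_nv[OF tvec_tangent[OF cp]] cp)
 also have "... = nv p d S' (tvec p c y d)" by (rule d.coset_eq_nv[OF tvec_tangent[OF cp]])
 also have "tvec p c y d = trd p c d y" using d.cp by (simp add: tvec_def)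
 finally show ?thesis .
qed

end

section \<open>The atlas of the normal bundle\<close>

lemma is_chart_inj: "is_chart c ==> x : fst c ==> y : fst c ==> snd c x = snd c y ==> x = y"
 by (rule inj_onD[of "snd c" "fst c"]) (simp_all add: is_chart_def)

text \<open>The tubular embedding is left out here: it serves to transport the Poisson structure
  from M, which happens in a context of its own.\<close>

locale tubular = M: bump_atlas A for A :: "('a, 'e::euclidean_space) atlas" +
 fixes C :: "'a set"
 assumes Hausdorff: "Hausdorff_space (manifold_topology A)" and submanifold_C: "submanifold A C"
begin

abbreviation (input) slice where "slice == slice_chart A C"
abbreviation (input) nch where "nch == normal_chart A C"
abbreviation (input) fpm where "fpm == fp_multivector_fields A C"
abbreviation (input) nsc where "nsc == nscale A C"
abbreviation (input) tC where "tC == stan A C"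
abbreviation (input) npts where "npts == normal_points A C"
abbreviation (input) vlift where "vlift == vertical_lift A C"
abbreviation (input) nsec where "nsec == normal_sections A C"
abbreviation (input) fpf where "fpf == fp_functions A C"
abbreviation (input) fpv where "fpv == fp_vector_fields A C"
abbreviation (input) cnf where "cnf == conormal_fibre A C"
abbreviation (input) pcov where "pcov == project_covector A C"
abbreviation (input) graph where "graph == graph_minus A C"
abbreviation (input) zsec where "zsec == zero_section A C"

lemma slice_pointI: "slice c S ==> p : fst c ==> p : C ==> slice_point A C c S p"
 by unfold_locales

lemma obtain_slice:
 assumes "p : C" obtains c S where "slice c S" "p : fst c" "slice_point A C c S p"
 using submanifold_C assms slice_pointI unfolding submanifold_def by blast

lemma slice_oproj:
 assumes cS: "slice c S" and z: "oproj S z : cimg c"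
 shows "cinv c (oproj S z) : fst c" "cinv c (oproj S z) : C" "snd c (cinv c (oproj S z)) = oproj S z"
  and "slice_point A C c S (cinv c (oproj S z))"
proof -
 note c = M.sliceD[OF cS]
 show 1: "cinv c (oproj S z) : fst c" "snd c (cinv c (oproj S z)) = oproj S z"
  using ch_simps(2,3)[OF c(4) z] by auto
 thus "cinv c (oproj S z) : C" using c(5)[OF 1(1)] oproj_props(1)[OF c(2)] by simp
 thus "slice_point A C c S (cinv c (oproj S z))" using cS 1 by (intro slice_pointI)
qed

lemma nch_dom: "(p, u) : fst (nch c S) \<longleftrightarrow> p : fst c & p : C & u : normal_space A C p"
 by (auto simp: normal_chart_def normal_points_def)

lemma nch_apply: "snd (nch c S) (p, u) = snd c p + coord c S u"
 by (simp add: normal_chart_def)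

text \<open>Base and fibre coordinates occupy complementary orthogonal subspaces, so
  \<open>oproj S\<close> and \<open>perp S\<close> read them off.\<close>

lemma nch_oproj:
 assumes cS: "slice c S" and q: "(p, u) : fst (nch c S)"
 shows "oproj S (snd (nch c S) (p, u)) = snd c p"
  and "perp S (snd (nch c S) (p, u)) = coord c S u"
  and "M.nv p c S (snd (nch c S) (p, u)) = u"
proof -
 note c = M.sliceD[OF cS]
 have p: "p : fst c" "p : C" "u : normal_space A C p" using q by (auto simp: nch_dom)
 interpret sp: slice_point A C c S p by (rule slice_pointI[OF cS p(1,2)])
 have s: "snd c p : S" using c(5)[OF p(1)] p(2) by simp
 note n = sp.coord_comp[OF p(3)]
 have "oproj S (snd c p + coord c S u) = snd c p"
  by (simp add: linear_add[OF linear_oproj[OF c(2)]] oproj_self[OF c(2) s] oproj_comp[OF c(2) n])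
 thus 1: "oproj S (snd (nch c S) (p, u)) = snd c p" by (simp add: nch_apply)
 have "perp S (snd c p + coord c S u) = coord c S u"
  by (simp add: linear_add[OF linear_perp[OF c(2)]] perp_props(3)[OF c(2) s] perp_props(4)[OF c(2) n])
 thus 2: "perp S (snd (nch c S) (p, u)) = coord c S u" by (simp add: nch_apply)
 show "M.nv p c S (snd (nch c S) (p, u)) = u"
  using sp.nv_perp[of "snd (nch c S) (p, u)"] sp.nv_coord[OF p(3)] by (simp add: 2)
qed

lemma nch_image:
 assumes cS: "slice c S"
 shows "cimg (nch c S) = {z. oproj S z : cimg c}"
  and "is_chart (nch c S)"
  and "oproj S z : cimg c ==> cinv (nch c S) z = (cinv c (oproj S z), M.nv (cinv c (oproj S z)) c S z)"
proof -
 note c = M.sliceD[OF cS]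
 let ?T = "nch c S"
 have pre: "(cinv c (oproj S z), M.nv (cinv c (oproj S z)) c S z) : fst ?T
   & snd ?T (cinv c (oproj S z), M.nv (cinv c (oproj S z)) c S z) = z" if z: "oproj S z : cimg c" for z
 proof -
  note s = slice_oproj[OF cS z]
  show ?thesis
   by (simp add: nch_dom nch_apply s slice_point.nv_normal[OF s(4)] slice_point.coord_nv[OF s(4)] perp_props(6)[OF c(2)])
 qed
 show im: "cimg ?T = {z. oproj S z : cimg c}"
 proof (intro equalityI subsetI)
  fix z assume "z : cimg ?T"
  then obtain p u where pu: "z = snd ?T (p, u)" "(p, u) : fst ?T" by force
  thus "z : {z. oproj S z : cimg c}" using nch_oproj(1)[OF cS pu(2)] by (simp add: nch_dom)
 next
  fix z assume "z : {z. oproj S z : cimg c}"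
  hence z: "oproj S z : cimg c" by simp
  show "z : cimg ?T" using pre[OF z] by (metis image_eqI)
 qed
 have inj: "inj_on (snd ?T) (fst ?T)"
 proof (rule inj_onI)
  fix q q' assume q: "q : fst ?T" "q' : fst ?T" and eq: "snd ?T q = snd ?T q'"
  obtain p u p' u' where pq: "q = (p, u)" "q' = (p', u')" by (metis surj_pair)
  have "snd c p = snd c p'"
   using nch_oproj(1)[OF cS q(1)[unfolded pq]] nch_oproj(1)[OF cS q(2)[unfolded pq]] eq[unfolded pq] by simp
  moreover have "p : fst c" "p' : fst c" using q pq by (simp_all add: nch_dom)
  ultimately have p: "p = p'" by (intro is_chart_inj[OF c(4)])
  have "u = M.nv p c S (snd ?T q)" using nch_oproj(3)[OF cS q(1)[unfolded pq(1)]] pq(1) by simp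
  also have "... = M.nv p' c S (snd ?T q')" by (simp only: p eq)
  also have "... = u'" using nch_oproj(3)[OF cS q(2)[unfolded pq(2)]] pq(2) by simp
  finally show "q = q'" using p pq by simp
 qed
 have "open (oproj S -` (cimg c))"
  by (rule open_vimage[OF ch_simps(4)[OF c(4)]]) (rule linear_continuous_on[OF linear_conv_bounded_linear[THEN iffD1, OF linear_oproj[OF c(2)]]])
 thus ch: "is_chart ?T" using inj im by (simp add: is_chart_def vimage_def)
 show "cinv ?T z = (cinv c (oproj S z), M.nv (cinv c (oproj S z)) c S z)" if "oproj S z : cimg c"
  using ch_simps(1)[OF ch] pre[OF that] by metis
qed

lemma open_slab: "subspace S ==> open U ==> open {z. oproj S z : U}"
 using open_vimage[OF _ linear_continuous_on[OF linear_conv_bounded_linear[THEN iffD1, OF linear_oproj]], of U S]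
 by (simp add: vimage_def)

abbreviation slab :: "('a, 'e) chart => 'e set => 'e set" where "slab c S == {z. oproj S z : cimg c}"

lemma nch_point:
 assumes cS: "slice c S" and z: "oproj S z : cimg c"
 obtains x u where "x : C" "x : fst c" "u : normal_space A C x" "cinv (nch c S) z = (x, u)"
  "snd (nch c S) (x, u) = z" "oproj S z = snd c x"
proof -
 note s = slice_oproj[OF cS z]
 have "snd (nch c S) (cinv (nch c S) z) = z"
  by (rule ch_simps(2)[OF nch_image(2)[OF cS]]) (simp add: nch_image(1)[OF cS] z)
 thus thesis
  using that[OF s(2,1) slice_point.nv_normal[OF s(4)] nch_image(3)[OF cS z]] s(3) nch_image(3)[OF cS z] by simp
qed

text \<open>In coordinates the base point moves by the transition \<open>?t\<close> of M and the
  normal vector by the normal part of the derivative of \<open>?t\<close>. This explicit formula is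
  smooth.\<close>

lemma nch_transition:
 assumes cS: "slice c S" and dT: "slice d T"
 shows "smooth_transition (nch c S) (nch d T)"
proof -
 let ?c = "nch c S" and ?d = "nch d T"
 note c = M.sliceD[OF cS] and d = M.sliceD[OF dT]
 let ?U = "snd c ` (fst c Int fst d)" and ?t = "snd d o cinv c"
 have tr: "open ?U" "smooth_on ?U ?t"
  using M.smch_trans[OF c(1) d(1)] by (auto simp: smooth_transition_def)
 let ?V = "{z. oproj S z : ?U}"
 have V: "open ?V" by (rule open_slab[OF c(2) tr(1)])
 have point: "EX p u. z = snd ?c (p, u) & (p, u) : fst ?c & (p, u) : fst ?d & oproj S z = snd c p & cinv ?c z = (p, u) & u = M.nv p c S z"
  if z: "z : ?V" for z
 proof -
  have z': "oproj S z : cimg c" using z by auto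
  have "z : cimg ?c" unfolding nch_image(1)[OF cS] using z' by (rule CollectI)
  then obtain q where q: "q : fst ?c" "z = snd ?c q" by blast
  obtain p u where pu: "q = (p, u)" by (metis surj_pair)
  note o = nch_oproj[OF cS q(1)[unfolded pu]]
  obtain p' where p': "snd c p = snd c p'" "p' : fst c" "p' : fst d" using z o(1) q pu by auto
  have p: "p : fst c" "p : C" "u : normal_space A C p" using q pu by (auto simp: nch_dom)
  have "p = p'" by (rule is_chart_inj[OF c(4) p(1) p'(2,1)])
  hence "(p, u) : fst ?d" using p p' by (simp add: nch_dom)
  thus ?thesis using q pu o ch_simps(1)[OF nch_image(2)[OF cS] q(1)] by (intro exI[of _ p] exI[of _ u]) simp
 qed
 have dom: "snd ?c ` (fst ?c Int fst ?d) = ?V"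
 proof (intro equalityI subsetI)
  fix z assume "z : snd ?c ` (fst ?c Int fst ?d)"
  then obtain p u where "z = snd ?c (p, u)" "(p, u) : fst ?c" "(p, u) : fst ?d" by force
  thus "z : ?V" using nch_oproj(1)[OF cS] by (auto simp: nch_dom)
 next
  fix z assume "z : ?V" thus "z : snd ?c ` (fst ?c Int fst ?d)" using point by blast
 qed
 have o: "smooth_on ?V (oproj S)" "oproj S ` ?V <= ?U" by (auto intro: sm_linear linear_oproj c(2) V)
 have "smooth_on ?V (%z. ?t (oproj S z) + perp T (fder ?t (at (oproj S z)) (perp S z)))"
  by (intro sm_add[OF V] sm_compose[OF V o(1) tr(2) o(2)] sm_linear_compose[OF linear_perp[OF d(2)] V]
   sm_deriv_apply[OF V o sm_linear[OF linear_perp[OF c(2)] V] tr(2)])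
 hence "smooth_on ?V (snd ?d o cinv ?c)"
 proof (rule sm_cong[OF V])
  fix z assume "z : ?V"
  then obtain p u where pu: "z = snd ?c (p, u)" "(p, u) : fst ?c" "(p, u) : fst ?d" "oproj S z = snd c p" "cinv ?c z = (p, u)" "u = M.nv p c S z"
   using point by blast
  have p: "p : fst c" "p : fst d" "p : C" using pu(2,3) by (simp_all add: nch_dom)
  interpret sp: slice_point A C c S p by (rule slice_pointI[OF cS p(1,3)])
  interpret dp: slice_point A C d T p by (rule slice_pointI[OF dT p(2,3)])
  have "u = M.nv p d T (M.trd p c d (perp S z))" unfolding pu(6) using sp.nv_transition[OF dT p(2)] sp.nv_perp[of z] by metis
  hence "coord d T u = perp T (M.trd p c d (perp S z))" using dp.coord_nv by simp
  thus "?t (oproj S z) + perp T (fder ?t (at (oproj S z)) (perp S z)) = (snd ?d o cinv ?c) z"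
   using pu(5) ch_simps(1)[OF c(4) p(1)] by (simp add: pu(4) nch_apply M.trd_def)
 qed
 thus ?thesis using V unfolding smooth_transition_def dom by simp
qed

lemma smooth_atlas_bundle: "smooth_atlas (normal_bundle A C)"
 by unfold_locales (auto simp: normal_bundle_def intro: nch_image(2) nch_transition)

lemma carrier_bundle: "carrier_of (normal_bundle A C) = npts"
proof (intro equalityI subsetI)
 fix q assume "q : carrier_of (normal_bundle A C)"
 thus "q : npts" by (auto simp: carrier_of_def normal_bundle_def normal_chart_def)
next
 fix q assume q: "q : npts"
 obtain p u where pu: "q = (p, u)" by (metis surj_pair)
 hence p: "p : C" using q by (simp add: normal_points_def)
 obtain c S where c: "slice c S" "p : fst c" using p by (rule obtain_slice)
 have "q : fst (nch c S)" using q c(2) by (simp add: normal_chart_def pu)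
 moreover have "nch c S : normal_bundle A C" unfolding normal_bundle_def using c(1) by blast
 ultimately show "q : carrier_of (normal_bundle A C)" unfolding carrier_of_def by blast
qed

sublocale B: smooth_atlas "normal_bundle A C"
 by (rule smooth_atlas_bundle)

lemma nch_smooth:
 assumes "slice c S" shows "nch c S : smooth_charts (normal_bundle A C)"
 by (rule B.atlas_smch) (unfold normal_bundle_def, use assms in blast)

lemma in_npts: "(p, u) : npts \<longleftrightarrow> p : C & u : normal_space A C p"
 by (simp add: normal_points_def)

lemma bundle_functionI:
 assumes 0: "!!q. q ~: npts ==> f q = 0"
  and loc: "!!p u. p : C ==> u : normal_space A C p ==> EX c S W. slice c S & p : fst c & open W &
   snd (nch c S) (p, u) : W & W <= {z. oproj S z : cimg c} & smooth_on W (f o cinv (nch c S))"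
 shows "f : B.F"
proof (rule B.smfI)
 show "f q = 0" if "q ~: carrier_of (normal_bundle A C)" for q using 0 that by (simp add: carrier_bundle)
 fix q assume "q : carrier_of (normal_bundle A C)"
 then obtain p u where q: "q = (p, u)" "p : C" "u : normal_space A C p"
  unfolding carrier_bundle by (cases q) (simp add: in_npts)
 then obtain c S W where *: "slice c S" "p : fst c" "open W" "snd (nch c S) (p, u) : W"
   "W <= {z. oproj S z : cimg c}" "smooth_on W (f o cinv (nch c S))" using loc by blast
 show "EX c W. c : smooth_charts (normal_bundle A C) & q : fst c & open W & snd c q : W & W <= cimg c & smooth_on W (f o cinv c)"
  using * q by (intro exI[of _ "nch c S"] exI[of _ W])
   (simp add: nch_smooth nch_dom nch_image(1))
qed

section \<open>Cutting off functions on the bundle\<close>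

definition basic :: "('a => real) => ('a, 'e) npoint => real" where
 "basic f q = (if q : npts then f (fst q) else 0)"

text \<open>The cutoff involves only the base coordinate, so an \<open>h\<close> that is linear or
  affine along the fibres gives a function of the same kind.\<close>

definition bump_ext :: "('a, 'e) chart => 'e set => 'e => real => ('e => real) => ('a, 'e) npoint => real" where
 "bump_ext c S z0 r h q = (if q : fst (nch c S) & snd c (fst q) : ball z0 r
  then bump z0 (r / 2) (snd c (fst q)) * h (snd (nch c S) q) else 0)"

text \<open>Away from the ball, the complement of a closed ball is taken in M and pulled back to the
  bundle: the function vanishes on all fibres over it, so no separation property of the bundle is
  involved.\<close>

lemma bump_ext_smooth:
 assumes cS: "slice c S" and r: "r > 0" "ball z0 r <= cimg c"
  and h: "smooth_on {z. oproj S z : ball z0 r} h"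
 shows "bump_ext c S z0 r h : B.F"
proof (rule bundle_functionI)
 note c = M.sliceD[OF cS]
 show "bump_ext c S z0 r h q = 0" if "q ~: npts" for q using that by (auto simp: bump_ext_def normal_chart_def)
 fix p u assume p: "p : C" and u: "u : normal_space A C p"
 show "EX d T W. slice d T & p : fst d & open W & snd (nch d T) (p, u) : W &
   W <= {z. oproj T z : cimg d} & smooth_on W (bump_ext c S z0 r h o cinv (nch d T))"
 proof (cases "p : fst c & snd c p : ball z0 r")
  case True
  let ?W = "{z. oproj S z : ball z0 r}"
  have W: "open ?W" by (rule open_slab[OF c(2) open_ball])
  have "smooth_on ?W (%z. bump z0 (r / 2) (oproj S z) * h z)"
   by (intro sm_mult W h sm_compose[OF W sm_linear[OF linear_oproj[OF c(2)] W] sm_bump]) auto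
  hence "smooth_on ?W (bump_ext c S z0 r h o cinv (nch c S))"
  proof (rule sm_cong[OF W])
   fix z assume z: "z : ?W"
   hence z': "oproj S z : cimg c" using r(2) by auto
   note s = slice_oproj[OF cS z']
   show "bump z0 (r / 2) (oproj S z) * h z = (bump_ext c S z0 r h o cinv (nch c S)) z"
    using z by (simp add: nch_image(3)[OF cS z'] bump_ext_def nch_dom nch_apply s
     slice_point.nv_normal[OF s(4)] slice_point.coord_nv[OF s(4)] perp_props(6)[OF c(2)])
  qed
  moreover have "snd (nch c S) (p, u) : ?W"
   using nch_oproj(1)[OF cS, of p u] p u True by (simp add: nch_dom)
  moreover have "?W <= {z. oproj S z : cimg c}" using r(2) by blast
  ultimately show ?thesis using cS W True by blast
 next
  case False
  obtain d T where dT: "slice d T" "p : fst d" using p by (rule obtain_slice)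
  note d = M.sliceD[OF dT(1)]
  let ?K = "{x:fst c. snd c x : cball z0 (r / 2)}"
  have sub: "cball z0 (r / 2) <= ball z0 r" using r by auto
  let ?D = "snd d ` (fst d - ?K)"
  have D: "open ?D" by (rule M.closed_ball_complement[OF Hausdorff c(1) _ d(1)]) (use sub r in auto)
  let ?W = "{z. oproj T z : ?D}"
  have W: "open ?W" by (rule open_slab[OF d(2) D])
  have e0: "bump_ext c S z0 r h (x, v) = 0" if "x ~: ?K" for x v
  proof (cases "(x, v) : fst (nch c S) & snd c x : ball z0 r")
   case True
   hence "snd c x ~: ball z0 (r / 2)" using that by (auto simp: nch_dom)
   thus ?thesis using bump_zero[of "r / 2" "snd c x" z0] r by (simp add: bump_ext_def)
  next
   case False
   thus ?thesis by (auto simp: bump_ext_def)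
  qed
  have "smooth_on ?W (%z. 0 :: real)" by (rule sm_const[OF W])
  hence "smooth_on ?W (bump_ext c S z0 r h o cinv (nch d T))"
  proof (rule sm_cong[OF W])
   fix z assume "z : ?W"
   then obtain x where x: "oproj T z = snd d x" "x : fst d" "x ~: ?K" by blast
   hence z: "oproj T z : cimg d" by blast
   have "cinv d (oproj T z) = x" unfolding x(1) by (rule ch_simps(1)[OF d(4) x(2)])
   hence "(bump_ext c S z0 r h o cinv (nch d T)) z = bump_ext c S z0 r h (x, M.nv x d T z)"
    by (simp only: o_apply nch_image(3)[OF dT(1) z])
   thus "0 = (bump_ext c S z0 r h o cinv (nch d T)) z" by (simp only: e0[OF x(3)])
  qed
  moreover have "p ~: ?K" using False sub by auto
  hence "snd (nch d T) (p, u) : ?W"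
   using nch_oproj(1)[OF dT(1), of p u] p u dT(2) by (simp add: nch_dom)
  moreover have "?W <= {z. oproj T z : cimg d}" by blast
  ultimately show ?thesis using dT W by blast
 qed
qed

lemma obtain_slice_ball:
 assumes "p : C"
 obtains c S r where "slice c S" "p : fst c" "slice_point A C c S p" "r > 0" "ball (snd c p) r <= cimg c"
proof -
 obtain c S where c: "slice c S" "p : fst c" "slice_point A C c S p" using assms by (rule obtain_slice)
 have "snd c p : cimg c" using c(2) by (rule imageI)
 then obtain r where "r > 0" "ball (snd c p) r <= cimg c"
  using ch_simps(4)[OF M.sliceD(4)[OF c(1)]] openE by blast
 thus thesis using c that by blast
qed

text \<open>The bump function that is used on the bundle is constant along the fibres.\<close>

lemma bump_atlas_bundle: "bump_atlas (normal_bundle A C)"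
proof
 fix q assume "q : carrier_of (normal_bundle A C)"
 then obtain p u where q: "q = (p, u)" "p : C" "u : normal_space A C p"
  unfolding carrier_bundle by (cases q) (simp add: in_npts)
 obtain c S r where cS: "slice c S" "p : fst c" and r: "r > 0" "ball (snd c p) r <= cimg c"
  using q(2) by (rule obtain_slice_ball)
 note c = M.sliceD[OF cS(1)]
 let ?T = "nch c S" and ?W = "{z. oproj S z : ball (snd c p) r}" and ?e = "bump_ext c S (snd c p) r"
 have qT: "q : fst ?T" using q cS by (simp add: nch_dom)
 have W: "open ?W" by (rule open_slab[OF c(2) open_ball])
 have TW: "snd ?T x : ?W \<longleftrightarrow> snd c (fst x) : ball (snd c p) r" if "x : fst ?T" for x
  using nch_oproj(1)[OF cS(1), of "fst x" "snd x"] that by simp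
 have bt: "?e (%_. 1) : B.F" "?e (%_. 1) q = 1"
 proof -
  show "?e (%_. 1) : B.F" by (rule bump_ext_smooth[OF cS(1) r sm_const[OF W]])
  show "?e (%_. 1) q = 1" using qT r(1) bump_center[of "r / 2" "snd c p"] by (simp add: bump_ext_def q(1))
 qed
 have "convex ?W"
  using convex_linear_vimage[OF linear_oproj[OF c(2)] convex_ball] by (simp add: vimage_def)
 moreover have "(%x. if x : fst ?T & snd ?T x : ?W then ?e (%_. 1) x * h (snd ?T x) else 0) : B.F" if h: "smooth_on ?W h" for h
 proof -
  have "(%x. if x : fst ?T & snd ?T x : ?W then ?e (%_. 1) x * h (snd ?T x) else 0) = ?e h"
   by (rule ext) (use TW in \<open>auto simp: bump_ext_def\<close>)
  thus ?thesis using bump_ext_smooth[OF cS(1) r h] by simp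
 qed
 moreover have "?W <= cimg ?T" unfolding nch_image(1)[OF cS(1)] using r(2) by blast
 moreover have "snd ?T q : ?W" using TW[OF qT] r(1) by (simp add: q(1))
 moreover have "?T : normal_bundle A C" unfolding normal_bundle_def using cS(1) by blast
 ultimately show "EX c:normal_bundle A C. EX W bt. q : fst c & open W & convex W & snd c q : W & W <= cimg c &
   bt : B.F & bt q = 1 & (ALL h. smooth_on W h --> (%x. if x : fst c & snd c x : W then bt x * h (snd c x) else 0) : B.F)"
  using qT W bt by (intro bexI[of _ ?T] exI[of _ ?W] exI[of _ "?e (%_. 1)"]) blast+
qed

sublocale B: bump_atlas "normal_bundle A C"
 by (rule bump_atlas_bundle)

section \<open>Vertical differentials and fibrewise linear functions\<close>

abbreviation V :: "'a => ('a, 'e) nvector set" where "V == normal_space A C"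
abbreviation vd where "vd == vertical_differential A C"
abbreviation zp :: "'a => ('a, 'e) npoint" where "zp == zero_vec A C"

lemma nch_at:
 assumes "slice c S" "p : fst c" "p : C" "w : V p"
 shows "nch c S : charts_at (normal_bundle A C) (p, w)"
 using assms nch_smooth by (simp add: charts_at_def nch_dom)

lemma V_closed:
 assumes "p : C"
 shows "u : V p ==> u' : V p ==> nplus u u' : V p" "u : V p ==> nsc p r u : V p" "tC p : V p"
 using assms by (auto elim!: obtain_slice intro: slice_point.nplus_normal slice_point.nscale_normal slice_point.zero_normal)

lemma V_simps:
 assumes p: "p : C" and u: "u : V p"
 shows "nsc p 0 u = tC p" "nsc p 1 u = u"
  and "nplus u (tC p) = u" "nplus (tC p) u = u"
  and "nsc p r (nsc p s u) = nsc p (r * s) u"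
proof -
 obtain c S where cS: "slice c S" "p : fst c" "slice_point A C c S p" using p by (rule obtain_slice)
 interpret sp: slice_point A C c S p by (rule cS(3))
 obtain y where y: "u = M.nv p c S y" using u by (auto simp: sp.normal_space_nv)
 show "nsc p 0 u = tC p" "nsc p 1 u = u"
  "nplus u (tC p) = u" "nplus (tC p) u = u"
  "nsc p r (nsc p s u) = nsc p (r * s) u"
  by (simp_all add: y sp.tangent_nv sp.nscale_nv sp.nplus_nv)
qed

lemma zp_normal: "p : C ==> zp p : npts"
 by (simp add: zero_vec_def in_npts V_closed)

lemma chart_line:
 assumes cS: "slice c S" "p : fst c" and p: "p : C" and wu: "w : V p" "u : V p"
 shows "snd (nch c S) (p, nplus w (nsc p t u)) = snd (nch c S) (p, w) + t *: coord c S u"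
proof -
 interpret sp: slice_point A C c S p by (rule slice_pointI[OF cS p])
 show ?thesis using wu by (simp add: nch_apply sp.coord_nplus sp.nscale_normal sp.coord_nscale)
qed

lemma chart_zero:
 assumes cS: "slice c S" "p : fst c" and p: "p : C"
 shows "snd (nch c S) (zp p) = snd c p"
 using slice_point.coord_zero[OF slice_pointI[OF cS p]] by (simp add: zero_vec_def nch_apply)

text \<open>Stated for any chart in which the fibre lines are straight, because it is applied both
  to the bundle charts and to the sheared charts adapted to a graph.\<close>

lemma vd_along_chart:
 assumes d: "d : charts_at (normal_bundle A C) (p, w)" and wu: "w : V p" "u : V p" and f: "f : B.F"
  and line: "!!t. (p, nplus w (nsc p t u)) : fst d" "!!t. snd d (p, nplus w (nsc p t u)) = snd d (p, w) + t *: y"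
 shows "vd (p, w) f u = fder (f o cinv d) (at (snd d (p, w))) y"
proof -
 let ?z = "snd d (p, w)"
 let ?f = "f o cinv d" let ?D = "fder ?f (at ?z)"
 have Dh: "(?f has_derivative ?D) (at ?z)" by (rule B.smf_deriv[OF f d])
 have l: "((%t. ?z + t *: y) has_derivative (%t. t *: y)) (at (0::real))" by (auto intro!: derivative_eq_intros)
 have "((%t. ?f (?z + t *: y)) has_derivative (%t. ?D (t *: y))) (at 0)"
  by (rule has_derivative_compose[OF l]) (simp only: scaleR_zero_left add_0_right Dh)
 moreover have "?D (t *: y) = ?D y * t" for t using linear_scale[OF has_derivative_linear[OF Dh], of t y] by simp
 moreover have "?f (?z + t *: y) = f (p, nplus w (nsc p t u))" for t
  using ch_simps(1)[OF B.smch_chart[OF B.charts_atD(1)[OF d]] line(1)[of t]] by (simp add: line(2))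
 ultimately have "((%t. f (p, nplus w (nsc p t u))) has_field_derivative ?D y) (at 0)"
  by (simp add: has_field_derivative_def)
 from DERIV_imp_deriv[OF this] show ?thesis using wu by (simp add: vertical_differential_def)
qed

lemma vd_eq:
 assumes cS: "slice c S" "p : fst c" and p: "p : C" and wu: "w : V p" "u : V p" and f: "f : B.F"
 shows "vd (p, w) f u = fder (f o cinv (nch c S)) (at (snd (nch c S) (p, w))) (coord c S u)"
 by (rule vd_along_chart[OF nch_at[OF cS p wu(1)] wu f _ chart_line[OF cS p wu]])
  (use cS p V_closed[OF p] wu in \<open>simp add: nch_dom\<close>)

lemma vd_differential:
 assumes cS: "slice c S" "p : fst c" and p: "p : C" and wu: "w : V p" "u : V p" and f: "f : B.F"
 shows "vd (p, w) f u = dif (normal_bundle A C) (p, w) f (B.tvec (p, w) (nch c S) (coord c S u))"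
 using B.dif_eq[OF f nch_at[OF cS p wu(1)] B.tvec_tangent[OF nch_at[OF cS p wu(1)]]]
  nch_at[OF cS p wu(1)] by (simp add: vd_eq[OF assms])

lemma vd_off: "u ~: V p ==> vd (p, w) f u = 0"
 by (simp add: vertical_differential_def)

lemma vd_lin:
 assumes p: "p : C" "w : V p" and f: "f : B.F" and g: "g : B.F"
 shows "vd (p, w) (r *: f + s *: g) = r *: vd (p, w) f + s *: vd (p, w) g"
proof
 fix u
 obtain c S where cS: "slice c S" "p : fst c" using p(1) by (rule obtain_slice)
 have q: "(p, w) : carrier_of (normal_bundle A C)" using p by (simp add: carrier_bundle in_npts)
 show "vd (p, w) (r *: f + s *: g) u = (r *: vd (p, w) f + s *: vd (p, w) g) u"
  by (cases "u : V p") (simp_all add: vd_differential[OF cS p(1,2)] f g B.dif_lin[OF f g q] B.lin_apply vd_off)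
qed

lemma vd_mult:
 assumes p: "p : C" "w : V p" and f: "f : B.F" and g: "g : B.F"
 shows "vd (p, w) (f * g) = f (p, w) *: vd (p, w) g + g (p, w) *: vd (p, w) f"
proof
 fix u
 obtain c S where cS: "slice c S" "p : fst c" using p(1) by (rule obtain_slice)
 have q: "(p, w) : carrier_of (normal_bundle A C)" using p by (simp add: carrier_bundle in_npts)
 show "vd (p, w) (f * g) u = (f (p, w) *: vd (p, w) g + g (p, w) *: vd (p, w) f) u"
  by (cases "u : V p") (simp_all add: vd_differential[OF cS p(1,2)] f g B.mult_F B.dif_mult[OF f g q] B.lin_apply vd_off)
qed

lemma conormal_fibreI:
 assumes p: "p : C" and 0: "!!u. u ~: V p ==> xj u = 0"
  and lin: "!!u u' r s. u : V p ==> u' : V p ==> xj (nplus (nsc p r u) (nsc p s u')) = r * xj u + s * xj u'"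
 shows "xj : cnf p"
 using 0 lin by (simp add: conormal_fibre_def)

lemma vd_conormal:
 assumes p: "p : C" "w : V p" and f: "f : B.F"
 shows "vd (p, w) f : cnf p"
proof (rule conormal_fibreI[OF p(1) vd_off])
 fix u u' r s assume u: "u : V p" "u' : V p"
 obtain c S where cS: "slice c S" "p : fst c" "slice_point A C c S p" using p(1) by (rule obtain_slice)
 interpret sp: slice_point A C c S p by (rule cS(3))
 note lin = has_derivative_linear[OF B.smf_deriv[OF f nch_at[OF cS(1,2) p]]]
 show "vd (p, w) f (nplus (nsc p r u) (nsc p s u')) = r * vd (p, w) f u + s * vd (p, w) f u'"
  using u by (simp add: vd_eq[OF cS(1,2) p _ f] sp.nplus_normal sp.nscale_normal sp.coord_nplus sp.coord_nscale
    linear_add[OF lin] linear_scale[OF lin])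
qed

lemma conormal_fibre_repr:
 assumes xj: "xj : cnf p" and cS: "slice c S" "p : fst c" and p: "p : C"
 obtains a where "!!u. u : V p ==> xj u = a \<bullet> coord c S u"
proof -
 interpret sp: slice_point A C c S p by (rule slice_pointI[OF cS p])
 define L where "L y = xj (M.nv p c S y)" for y
 have "L (r *: x + s *: y) = r * L x + s * L y" for r s x y
  using xj sp.nv_normal unfolding L_def conormal_fibre_def sp.nplus_nv[symmetric] sp.nscale_nv[symmetric] by blast
 from this[of 1 _ 1] this[of _ _ 0] have "linear L" by (intro linearI) simp_all
 note s = lin_sum[OF this]
 show thesis
 proof (rule that[of "SUM b:Basis. L b *: b"])
  fix u assume u: "u : V p"
  have "xj u = L (coord c S u)" by (simp add: L_def sp.nv_coord[OF u])
  also have "... = (SUM b:Basis. L b *: b) \<bullet> coord c S u"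
   unfolding s[of "coord c S u"] by (simp add: inner_sum_left inner_commute[of "coord c S u"] mult.commute)
  finally show "xj u = (SUM b:Basis. L b *: b) \<bullet> coord c S u" .
 qed
qed

section \<open>Functions that are linear along the fibres\<close>

definition fib :: "'a => (('a, 'e) npoint => real) => ('a, 'e) nvector => real" where
 "fib p l u = (if u : V p then l (p, u) else 0)"

text \<open>These functions stand in for conormal covectors: they realize all of them on each fibre,
  their vertical differential is constant along it, and they vanish on the zero section.\<close>

definition La :: "(('a, 'e) npoint => real) set" where
 "La = {l:B.F. ALL p:C. fib p l : cnf p}"

definition rho :: "(('a, 'e) npoint => real) => ('a, 'e) npoint => real" where
 "rho f = basic (%p. f (zp p))"

definition lin :: "(('a, 'e) npoint => real) => ('a, 'e) npoint => real" where
 "lin f q = (if q : npts then vd (zp (fst q)) f (snd q) else 0)"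

lemma La_F: "l : La ==> l : B.F"
 by (simp add: La_def)

lemma rho_apply: "p : C ==> u : V p ==> rho f (p, u) = f (zp p)"
 by (simp add: rho_def basic_def in_npts)

lemma fib_lin: "p : C ==> fib p (lin f) = vd (zp p) f"
 by (rule ext) (simp add: fib_def lin_def in_npts zero_vec_def vd_off)

lemma smooth_via_chart:
 assumes 0: "!!q. q ~: npts ==> f q = 0"
  and h: "!!c S. slice c S ==> smooth_on {z. oproj S z : cimg c} (h c S)"
  and eq: "!!c S p u. slice c S ==> p : fst c ==> p : C ==> u : V p ==> f (p, u) = h c S (snd (nch c S) (p, u))"
 shows "f : B.F"
proof (rule bundle_functionI[OF 0])
 fix p u assume p: "p : C" and u: "u : V p"
 obtain c S where cS: "slice c S" "p : fst c" using p by (rule obtain_slice)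
 note c = M.sliceD[OF cS(1)]
 let ?W = "{z. oproj S z : cimg c}"
 have W: "open ?W" by (rule open_slab[OF c(2) ch_simps(4)[OF c(4)]])
 have "smooth_on ?W (f o cinv (nch c S))"
 proof (rule sm_cong[OF W h[OF cS(1)]])
  fix z assume "z : ?W"
  hence z: "oproj S z : cimg c" by simp
  show "h c S z = (f o cinv (nch c S)) z"
   by (rule nch_point[OF cS(1) z]) (use eq[OF cS(1)] in auto)
 qed
 moreover have "snd (nch c S) (p, u) : ?W"
  using nch_oproj(1)[OF cS(1), of p u] p u cS(2) by (simp add: nch_dom)
 ultimately show "EX c S W. slice c S & p : fst c & open W &
   snd (nch c S) (p, u) : W & W <= {z. oproj S z : cimg c} & smooth_on W (f o cinv (nch c S))"
  using cS W by blast
qed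

lemma rep_smooth:
 assumes cS: "slice c S" and f: "f : B.F"
 shows "smooth_on {z. oproj S z : cimg c} (f o cinv (nch c S))"
 using B.smf_local[OF f nch_smooth[OF cS]] by (simp add: nch_image(1)[OF cS])

lemma chart_rep_apply:
 assumes "slice c S" "p : fst c" "p : C" "u : V p"
 shows "(f o cinv (nch c S)) (snd (nch c S) (p, u)) = f (p, u)"
 using ch_simps(1)[OF nch_image(2)[OF assms(1)], of "(p, u)"] assms by (simp add: nch_dom)

lemma oproj_domain:
 assumes "slice c S"
 shows "open {z. oproj S z : cimg c}" "oproj S ` {z. oproj S z : cimg c} <= {z. oproj S z : cimg c}"
proof -
 note S = M.sliceD(2)[OF assms]
 show "open {z. oproj S z : cimg c}" by (rule open_slab[OF S ch_simps(4)[OF M.sliceD(4)[OF assms]]])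
 show "oproj S ` {z. oproj S z : cimg c} <= {z. oproj S z : cimg c}"
  unfolding image_subset_iff mem_Collect_eq oproj_self[OF S oproj_props(1)[OF S]] by (intro ballI) (erule CollectD)
qed

lemma rho_smooth:
 assumes f: "f : B.F" shows "rho f : B.F"
proof (rule smooth_via_chart)
 show "rho f q = 0" if "q ~: npts" for q using that by (simp add: rho_def basic_def)
 fix c S assume cS: "slice c S"
 note W = oproj_domain[OF cS] and S = M.sliceD(2)[OF cS]
 show "smooth_on {z. oproj S z : cimg c} (%z. (f o cinv (nch c S)) (oproj S z))"
  by (rule sm_compose[OF W(1) sm_linear[OF linear_oproj[OF S] W(1)] rep_smooth[OF cS f] W(2)])
 fix p u assume p: "p : fst c" "p : C" "u : V p"
 have "oproj S (snd (nch c S) (p, u)) = snd (nch c S) (zp p)"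
  using nch_oproj(1)[OF cS, of p u] p chart_zero[OF cS p(1,2)] by (simp add: nch_dom)
 thus "rho f (p, u) = (f o cinv (nch c S)) (oproj S (snd (nch c S) (p, u)))"
  using chart_rep_apply[OF cS p(1,2) V_closed(3)[OF p(2)], of f] p by (simp add: rho_apply zero_vec_def)
qed

lemma lin_smooth:
 assumes f: "f : B.F" shows "lin f : B.F"
proof (rule smooth_via_chart)
 show "lin f q = 0" if "q ~: npts" for q using that by (simp add: lin_def)
 fix c S assume cS: "slice c S"
 note W = oproj_domain[OF cS] and S = M.sliceD(2)[OF cS]
 show "smooth_on {z. oproj S z : cimg c}
   (%z. fder (f o cinv (nch c S)) (at (oproj S z)) (perp S z))"
  by (rule sm_deriv_apply[OF W(1) sm_linear[OF linear_oproj[OF S] W(1)] W(2) sm_linear[OF linear_perp[OF S] W(1)] rep_smooth[OF cS f]])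
 fix p u assume p: "p : fst c" "p : C" "u : V p"
 have "oproj S (snd (nch c S) (p, u)) = snd (nch c S) (zp p)"
   "perp S (snd (nch c S) (p, u)) = coord c S u"
  using nch_oproj(1,2)[OF cS, of p u] p chart_zero[OF cS p(1,2)] by (simp_all add: nch_dom)
 thus "lin f (p, u) = fder (f o cinv (nch c S))
   (at (oproj S (snd (nch c S) (p, u)))) (perp S (snd (nch c S) (p, u)))"
  using vd_eq[OF cS p(1,2) V_closed(3)[OF p(2)] p(3) f] p by (simp add: lin_def in_npts zero_vec_def)
qed

lemma lin_La:
 assumes f: "f : B.F" shows "lin f : La"
 using lin_smooth[OF f] vd_conormal[OF _ V_closed(3) f] by (auto simp: La_def fib_lin zero_vec_def)

lemma La_zero:
 assumes l: "l : La" and p: "p : C" shows "l (zp p) = 0"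
proof -
 let ?t = "tC p"
 have t: "?t : V p" by (rule V_closed(3)[OF p])
 have "fib p l (nplus (nsc p 0 ?t) (nsc p 0 ?t)) = 0 * fib p l ?t + 0 * fib p l ?t"
  using l p t unfolding La_def conormal_fibre_def by blast
 thus ?thesis by (simp add: V_simps[OF p t] t fib_def zero_vec_def)
qed

lemma La_line:
 assumes l: "l : La" and p: "p : C" and wu: "w : V p" "u : V p"
 shows "l (p, nplus w (nsc p t u)) = l (p, w) + t * l (p, u)"
proof -
 have "fib p l (nplus (nsc p 1 w) (nsc p t u)) = 1 * fib p l w + t * fib p l u"
  using l p wu unfolding La_def conormal_fibre_def by blast
 thus ?thesis using wu by (simp add: fib_def V_simps[OF p] V_closed[OF p])
qed

lemma vd_La:
 assumes l: "l : La" and p: "p : C" and w: "w : V p"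
 shows "vd (p, w) l = fib p l"
proof
 fix u show "vd (p, w) l u = fib p l u"
 proof (cases "u : V p")
  case True
  have "((%t. l (p, w) + t * l (p, u)) has_field_derivative l (p, u)) (at 0)" by (auto intro!: derivative_eq_intros)
  from DERIV_imp_deriv[OF this] show ?thesis
   using True by (simp add: vertical_differential_def fib_def La_line[OF l p w])
 qed (simp add: vd_off fib_def)
qed

lemma vd_const:
 assumes p: "p : C" "w : V p" and c: "!!u u'. u : V p ==> u' : V p ==> f (p, u) = f (p, u')"
 shows "vd (p, w) f = 0"
proof
 fix u show "vd (p, w) f u = 0 u"
 proof (cases "u : V p")
  case True
  have "f (p, nplus w (nsc p t u)) = f (p, w)" for t
   by (rule c) (use p True V_closed[OF p(1)] in auto)
  thus ?thesis using True by (simp add: vertical_differential_def fzero)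
 qed (simp add: vd_off fzero)
qed

lemma vd_rho: "p : C ==> w : V p ==> vd (p, w) (rho f) = 0"
 by (rule vd_const) (simp_all add: rho_apply)

text \<open>A fibre coordinate times a bump of the base point. With \<open>b\<close> running through
  the basis these span the conormal fibres over all points where the bump is nonzero, so one family
  serves a whole neighbourhood.\<close>

definition lincoord :: "('a, 'e) chart => 'e set => 'e => real => 'e => ('a, 'e) npoint => real" where
 "lincoord c S z0 r b = bump_ext c S z0 r (%z. b \<bullet> perp S z)"

lemma lincoord_apply:
 assumes cS: "slice c S" and x: "x : C" "u : V x"
 shows "lincoord c S z0 r b (x, u) =
  (if x : fst c & snd c x : ball z0 r then bump z0 (r / 2) (snd c x) * (b \<bullet> coord c S u) else 0)"
 using nch_oproj(2)[OF cS(1), of x u] x by (auto simp: lincoord_def bump_ext_def nch_dom)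

lemma lincoord_La:
 assumes cS: "slice c S" and r: "r > 0" "ball z0 r <= cimg c"
 shows "lincoord c S z0 r b : La"
proof -
 note S = M.sliceD(2)[OF cS]
 have W: "open {z. oproj S z : ball z0 r}" by (rule open_slab[OF S open_ball])
 let ?l = "lincoord c S z0 r b"
 note l = lincoord_apply[OF cS]
 have "?l : B.F"
  unfolding lincoord_def by (rule bump_ext_smooth[OF cS r]) (intro sm_inner sm_const sm_linear linear_perp S W)
 moreover have "fib x ?l : cnf x" if x: "x : C" for x
 proof (rule conormal_fibreI[OF x])
  show "fib x ?l u = 0" if "u ~: V x" for u using that by (simp add: fib_def)
  fix u u' r s assume u: "u : V x" "u' : V x"
  show "fib x ?l (nplus (nsc x r u) (nsc x s u')) = r * fib x ?l u + s * fib x ?l u'"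
  proof (cases "x : fst c")
   case True
   interpret sp: slice_point A C c S x by (rule slice_pointI[OF cS True x])
   show ?thesis using u by (simp add: fib_def l[OF x] sp.nplus_normal sp.nscale_normal sp.coord_nplus sp.coord_nscale algebra_simps)
  next
   case False
   thus ?thesis using u V_closed[OF x] by (simp add: fib_def l[OF x])
  qed
 qed
 ultimately show ?thesis by (simp add: La_def)
qed

lemma conormal_ext:
 assumes p: "p : C" and xj: "xj : cnf p"
 shows "EX l:La. fib p l = xj"
proof -
 obtain c S r where cS: "slice c S" "p : fst c" "slice_point A C c S p" and r: "r > 0" "ball (snd c p) r <= cimg c"
  using p by (rule obtain_slice_ball)
 obtain a where a: "!!u. u : V p ==> xj u = a \<bullet> coord c S u" using conormal_fibre_repr[OF xj cS(1,2) p] by blast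
 have "fib p (lincoord c S (snd c p) r a) = xj"
 proof
  fix u show "fib p (lincoord c S (snd c p) r a) u = xj u"
   using lincoord_apply[OF cS(1) p] a xj cS(2) r(1) bump_center[of "r / 2" "snd c p"]
   by (cases "u : V p") (simp_all add: fib_def conormal_fibre_def)
 qed
 thus ?thesis using lincoord_La[OF cS(1) r] by blast
qed

section \<open>The zero section and covectors along it\<close>

abbreviation B where "B == normal_bundle A C"

lemma zero_slice:
 assumes cS: "slice c S"
 shows "slice_chart B (zsec) (nch c S) S"
 unfolding slice_chart_def
proof (intro conjI)
 let ?T = "nch c S"
 note c = M.sliceD[OF cS]
 show "?T : smooth_charts B" "subspace S" by (rule nch_smooth[OF cS], rule c(2))
 show "snd ?T ` (fst ?T Int zsec) = cimg ?T Int S"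
 proof (intro equalityI subsetI)
  fix z assume "z : snd ?T ` (fst ?T Int zsec)"
  then obtain q where q: "z = snd ?T q" "q : fst ?T" "q : zsec" by blast
  then obtain p where p: "q = zp p" "p : C" by (auto simp: zero_section_def)
  hence pc: "p : fst c" using q(2) by (simp add: zero_vec_def nch_dom)
  have "z : S" using c(5)[OF pc] p(2) by (simp add: q(1) p(1) chart_zero[OF cS pc p(2)])
  thus "z : cimg ?T Int S" using q by blast
 next
  fix z assume "z : cimg ?T Int S"
  then obtain p u where q: "z = snd ?T (p, u)" "(p, u) : fst ?T" "z : S" by force
  hence p: "p : fst c" "p : C" "u : V p" by (simp_all add: nch_dom)
  interpret sp: slice_point A C c S p by (rule slice_pointI[OF cS p(1,2)])
  have "coord c S u = 0" using nch_oproj(2)[OF cS q(2)] perp_props(3)[OF c(2) q(3)] q(1) by simp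
  hence "u = tC p" by (intro sp.coord_inj[OF p(3) sp.zero_normal]) (simp add: sp.coord_zero)
  hence "(p, u) : zsec" using p(2) by (simp add: zero_section_def zero_vec_def)
  thus "z : snd ?T ` (fst ?T Int zsec)" using q by blast
 qed
qed

lemma zp_chart:
 assumes "slice c S" "p : fst c" "p : C"
 shows "nch c S : charts_at B (zp p)" "zp p : fst (nch c S)" "zp p : zsec"
 using nch_at[OF assms V_closed(3)] assms V_closed(3)
 by (simp_all add: zero_vec_def nch_dom zero_section_def)

lemma velocity_fibre:
 assumes cS: "slice c S" "p : fst c" and p: "p : C" and u: "u : V p"
 shows "velocity B (%t. (p, nsc p t u)) = B.tvec (zp p) (nch c S) (coord c S u)"
proof
 fix d
 let ?T = "nch c S" and ?y = "coord c S u"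
 note T = zp_chart(1)[OF cS p]
 note t = V_closed(3)[OF p]
 have ga0: "(p, nsc p 0 u) = zp p" by (simp add: zero_vec_def V_simps[OF p u])
 show "velocity B (%t. (p, nsc p t u)) d = B.tvec (zp p) ?T ?y d"
 proof (cases "d : charts_at B (zp p)")
  case True
  have line: "snd ?T (p, nsc p t u) = snd ?T (zp p) + t *: ?y" for t
   using chart_line[OF cS p t u, of t] V_simps(4)[OF p V_closed(2)[OF p u]] by (simp add: zero_vec_def)
  have dom: "(p, nsc p t u) : fst ?T" for t using cS p V_closed[OF p] u by (simp add: nch_dom)
  have l: "((%t. snd ?T (zp p) + t *: ?y) has_derivative (%t. t *: ?y)) (at (0::real))" by (auto intro!: derivative_eq_intros)
  have "((%t. (snd d o cinv ?T) (snd ?T (zp p) + t *: ?y)) has_derivative (%t. B.trd (zp p) ?T d (t *: ?y))) (at 0)"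
   by (rule has_derivative_compose[OF l]) (simp only: scaleR_zero_left add_0_right B.trd_has_derivative[OF T True])
  moreover have "(snd d o cinv ?T) (snd ?T (zp p) + t *: ?y) = (snd d o (%t. (p, nsc p t u))) t" for t
   using ch_simps(1)[OF nch_image(2)[OF cS(1)] dom[of t]] by (simp add: line)
  ultimately have "((snd d o (%t. (p, nsc p t u))) has_vector_derivative B.trd (zp p) ?T d ?y) (at 0)"
   by (simp add: has_vector_derivative_def linear_scale[OF B.trd_linear[OF T True]] o_def)
  from vector_derivative_at[OF this] show ?thesis using True by (simp add: velocity_def B.tvec_def ga0)
 qed (simp add: velocity_def B.tvec_def ga0)
qed

text \<open>At a point of the zero section the tangent space is the sum of the tangent space of the
  zero section and of the fibre directions, and the latter are velocities of lines in the
  fibre.\<close>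

lemma zp_cotangent_eqI:
 assumes p: "p : C" and ab: "al : ctsp B (zp p)" "bt : ctsp B (zp p)"
  and 0: "!!v. v : stan B (zsec) (zp p) ==> al v = bt v"
  and vel: "!!u. u : V p ==> al (velocity B (%t. (p, nsc p t u))) = bt (velocity B (%t. (p, nsc p t u)))"
 shows "al = bt"
proof (rule B.cot_eqI[OF ab])
 fix v assume v: "v : tsp B (zp p)"
 obtain c S where cS: "slice c S" "p : fst c" "slice_point A C c S p" using p by (rule obtain_slice)
 interpret sp: slice_point A C c S p by (rule cS(3))
 let ?T = "nch c S"
 note T = zp_chart[OF cS(1,2) p]
 define s where "s = B.tvec (zp p) ?T (oproj S (v ?T))"
 define n where "n = B.tvec (zp p) ?T (perp S (v ?T))"
 have sn: "s : tsp B (zp p)" "n : tsp B (zp p)"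
  unfolding s_def n_def by (rule B.tvec_tangent[OF T(1)])+
 have "v = 1 *: s + 1 *: n"
  by (rule B.tangent_eqI[OF T(1) v B.tangent_lin[OF sn]])
   (simp add: fplus s_def n_def T(1) perp_props(6)[OF sp.S])
 hence split: "ga v = ga s + ga n" if "ga : ctsp B (zp p)" for ga
  using that sn unfolding cotangent_space_def by (simp only: mem_Collect_eq mult_1)
 have "s : stan B (zsec) (zp p)"
  unfolding B.stan_iff[OF zero_slice[OF cS(1)] T(2,3)] using sn(1) oproj_props(1)[OF sp.S] T(1) by (simp add: s_def)
 hence "al s = bt s" by (rule 0)
 have "n = velocity B (%t. (p, nsc p t (M.nv p c S (v ?T))))"
  unfolding velocity_fibre[OF cS(1,2) p sp.nv_normal] by (simp add: n_def)
 hence "al n = bt n" using vel[OF sp.nv_normal] by simp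
 show "al v = bt v" unfolding split[OF ab(1)] split[OF ab(2)] \<open>al s = bt s\<close> \<open>al n = bt n\<close> ..
qed

lemma zp_carrier: "p : C ==> zp p : carrier_of B"
 by (simp add: carrier_bundle zp_normal)

lemma vd_velocity:
 assumes p: "p : C" and u: "u : V p" and f: "f : B.F"
 shows "dif B (zp p) f (velocity B (%t. (p, nsc p t u))) = vd (zp p) f u"
proof -
 obtain c S where cS: "slice c S" "p : fst c" using p by (rule obtain_slice)
 show ?thesis using vd_differential[OF cS p V_closed(3)[OF p] u f] by (simp add: velocity_fibre[OF cS p u] zero_vec_def)
qed

lemma dif_zero_section:
 assumes p: "p : C" and f: "f : B.F" and 0: "!!x. x : C ==> f (zp x) = 0"
  and v: "v : stan B (zsec) (zp p)"
 shows "dif B (zp p) f v = 0"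
proof -
 obtain c S where cS: "slice c S" "p : fst c" using p by (rule obtain_slice)
 have "dif B (zp p) f : conormal_space B (zsec) (zp p)"
  by (rule B.dif_vanishing_conormal[OF zero_slice[OF cS(1)] zp_chart(2,3)[OF cS p] f]) (auto simp: zero_section_def 0)
 thus ?thesis using v by (simp add: conormal_space_def)
qed

lemma zp_differential_eqI:
 assumes p: "p : C" and fg: "f : B.F" "g : B.F" and z: "!!x. x : C ==> f (zp x) = g (zp x)" and v: "vd (zp p) f = vd (zp p) g"
 shows "dif B (zp p) f = dif B (zp p) g"
proof -
 note zp = zp_carrier[OF p]
 note lin = B.dif_lin[OF fg zp, of 1 "-1"]
 let ?h = "1 *: f + (-1) *: g"
 have h: "?h : B.F" by (intro subspace_add[OF B.subspace_F] subspace_scale[OF B.subspace_F] fg)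
 show ?thesis
 proof (rule zp_cotangent_eqI[OF p B.dif_cotangent[OF fg(1) zp] B.dif_cotangent[OF fg(2) zp]])
  show "dif B (zp p) f (velocity B (%t. (p, nsc p t u))) = dif B (zp p) g (velocity B (%t. (p, nsc p t u)))"
   if "u : V p" for u using v by (simp add: vd_velocity[OF p that] fg)
  fix w assume w: "w : stan B (zsec) (zp p)"
  have "dif B (zp p) ?h w = 0"
   by (rule dif_zero_section[OF p h _ w]) (simp only: B.lin_apply z, simp)
  thus "dif B (zp p) f w = dif B (zp p) g w" unfolding lin B.lin_apply by simp
 qed
qed

text \<open>A fibrewise linear \<open>l\<close> vanishes on the zero section and is its own vertical
  derivative there, so its differential has the two properties that characterize the projected
  covector.\<close>

lemma project_covector_La:
 assumes p: "p : C" and l: "l : La"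
 shows "pcov p (fib p l) = dif B (zp p) l"
 unfolding project_covector_def
proof (rule the_equality)
 note lF = La_F[OF l] and zp = zp_carrier[OF p]
 have vd: "vd (zp p) l = fib p l" using vd_La[OF l p V_closed(3)[OF p]] by (simp add: zero_vec_def)
 show D: "dif B (zp p) l : ctsp B (zp p) &
  (ALL v:stan B (zsec) (zp p). dif B (zp p) l v = 0) &
  (ALL u:V p. dif B (zp p) l (velocity B (%t. (p, nsc p t u))) = fib p l u)"
  using B.dif_cotangent[OF lF zp] dif_zero_section[OF p lF La_zero[OF l]] vd_velocity[OF p _ lF] vd by simp
 fix al assume "al : ctsp B (zp p) &
  (ALL v:stan B (zsec) (zp p). al v = 0) &
  (ALL u:V p. al (velocity B (%t. (p, nsc p t u))) = fib p l u)"
 thus "al = dif B (zp p) l" by (intro zp_cotangent_eqI[OF p]) (use D in simp_all)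
qed

abbreviation RP where "RP == restrict_project A C"

text \<open>Turns the projection into evaluation of \<open>X\<close>, on the zero section, at
  fibrewise linear functions with the right vertical differentials; it is used in this form from
  here on.\<close>

lemma RP_eq:
 assumes X: "X : B.MD k" and p: "p : C" "w : V p" and fs: "set fs <= B.F"
  and ls: "set ls <= La" "map (fib p) ls = map (vd (p, w)) fs"
 shows "RP X fs (p, w) = X ls (zp p)"
proof -
 have "map (%f. pcov p (vd (p, w) f)) fs = map (pcov p) (map (fib p) ls)"
  unfolding ls(2) by simp
 also have "... = map (dif B (zp p)) ls"
  unfolding map_map by (rule map_cong[OF refl]) (use ls(1) project_covector_La[OF p(1)] in auto)
 finally have "RP X fs (p, w) = multivector_at B X (zp p) (map (dif B (zp p)) ls)"
  using fs p by (simp add: restrict_project_def in_npts)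
 also have "... = X ls (zp p)"
  by (rule B.multivector_at_MD[OF X zp_carrier[OF p(1)]]) (use ls(1) La_F in blast)
 finally show ?thesis .
qed

lemma RP_off: "set fs <= B.F ==> q ~: npts ==> RP X fs q = 0" "~ set fs <= B.F ==> RP X fs = 0"
 by (auto simp: restrict_project_def fun_eq_iff fzero)

text \<open>The sum \<open>rho f + lin f\<close> is the first-order Taylor expansion of
  \<open>f\<close> along the fibres: on the zero section it has the same values and the same
  vertical derivatives.\<close>

lemma dif_split:
 assumes p: "p : C" and f: "f : B.F"
 shows "dif B (zp p) f = dif B (zp p) (rho f + lin f)"
proof (rule zp_differential_eqI[OF p f])
 note rl = rho_smooth[OF f] lin_smooth[OF f]
 note t = V_closed(3)
 show "rho f + lin f : B.F" by (rule subspace_add[OF B.subspace_F rl])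
 show "f (zp x) = (rho f + lin f) (zp x)" if "x : C" for x
  using La_zero[OF lin_La[OF f] that] rho_apply[OF that t[OF that], of f] by (simp add: fplus zero_vec_def)
 have "vd (zp p) (1 *: rho f + 1 *: lin f) = vd (zp p) f"
  using vd_lin[OF p t[OF p] rl, of 1 1] vd_rho[OF p t[OF p], of f] vd_La[OF lin_La[OF f] p t[OF p]] fib_lin[OF p, of f]
  by (simp only: zero_vec_def[symmetric]) simp
 thus "vd (zp p) f = vd (zp p) (rho f + lin f)" by simp
qed

lemma MD_split:
 assumes X: "X : B.MD k" and p: "p : C" and f: "f : B.F" and fs: "set fs <= B.F"
 shows "X (f # fs) (zp p) = X (rho f # fs) (zp p) + X (lin f # fs) (zp p)"
proof -
 note rl = rho_smooth[OF f] lin_smooth[OF f]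
 have "X (f # fs) (zp p) = X ((rho f + lin f) # fs) (zp p)"
  by (rule B.MD_differential_cong[OF X zp_carrier[OF p]])
   (use fs f rl subspace_add[OF B.subspace_F rl] dif_split[OF p f] in auto)
 also have "... = X (rho f # fs) (zp p) + X (lin f # fs) (zp p)"
  using B.ALT_lin[OF B.MD_ALT[OF X] rl, of 1 1 fs] by (simp add: fplus)
 finally show ?thesis .
qed

section \<open>The projection onto vertical fibrewise constant multivector fields\<close>

abbreviation N :: "nat => ('a, 'e) npoint multivector set" where "N == normal_multisections A C"

lemma N_MD: "a : N k ==> a : B.MD k"
 using B.mvf_MD by (auto simp: normal_multisections_def)

lemma zpV: "p : C ==> zp p = (p, tC p)" "p : C ==> tC p : V p"
 by (simp_all add: zero_vec_def V_closed)

lemma La_vd: "l : La ==> p : C ==> vd (zp p) l = fib p l"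
 using vd_La zpV by simp

text \<open>One form \<eta> serves all points of a fibre, so values at two of them can be compared
  once the vertical differentials agree.\<close>

lemma N_apply:
 assumes a: "a : N k" and p: "p : C" "w : V p" "w' : V p" and fs: "set fs <= B.F" "set gs <= B.F"
  and eq: "map (vd (p, w)) fs = map (vd (p, w')) gs"
 shows "a fs (p, w) = a gs (p, w')"
proof (cases "length fs = k")
 case True
 hence len: "length gs = k" using eq by (metis length_map)
 obtain \<eta> where "!!w fs. w : V p ==> length fs = k ==> set fs <= B.F ==> a fs (p, w) = \<eta> (map (vd (p, w)) fs)"
  using a p(1) unfolding normal_multisections_def by blast
 note this[OF p(2) True fs(1)] this[OF p(3) len fs(2)]
 thus ?thesis by (simp only: eq)
next
 case False
 hence "length gs ~= k" using eq by (metis length_map)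
 hence "a fs = 0" "a gs = 0" using B.ALT_dom[OF B.MD_ALT[OF N_MD[OF a]]] False by auto
 thus ?thesis by (simp add: fzero)
qed

lemma La_lin:
 assumes l: "l : La" "l' : La"
 shows "r *: l + s *: l' : La" "fib p (r *: l + s *: l') = r *: fib p l + s *: fib p l'"
proof -
 show f: "fib p (r *: l + s *: l') = r *: fib p l + s *: fib p l'" for p
  by (rule HOL.ext) (simp add: fib_def B.lin_apply)
 have "r *: l + s *: l' : B.F" by (intro subspace_add[OF B.subspace_F] subspace_scale[OF B.subspace_F] La_F l)
 moreover have "r *: xj + s *: xj' : cnf p" if "xj : cnf p" "xj' : cnf p" for xj xj' p
  using that by (simp add: conormal_fibre_def B.lin_apply algebra_simps)
 ultimately show "r *: l + s *: l' : La" using l by (simp add: La_def f)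
qed

lemma La_subspace: "subspace La"
proof -
 have "0 : La"
  by (auto simp: La_def fib_def[abs_def] conormal_fibre_def fzero subspace_0[OF B.subspace_F])
 thus ?thesis using La_lin(1)[of _ _ 1 1] La_lin(1)[of _ 0 _ 0] unfolding subspace_def by auto
qed

lemma fib_sum: "finite I ==> (!!b. b : I ==> l b : La) ==> fib p (SUM b:I. k b *: l b) u = (SUM b:I. k b * fib p (l b) u)"
 by (simp add: fib_def B.fun_sum_apply fscale)

lemma ALT_slot_sum:
 assumes X: "X : B.ALT k" and I: "finite I" "!!b. b : I ==> l b : B.F"
 shows "X (xs @ (SUM b:I. c b *: l b) # ys) q = (SUM b:I. c b * X (xs @ l b # ys) q)"
 using I
proof (induction I rule: finite_induct)
 case empty
 have "X (xs @ (0 *: 0 + 0 *: 0) # ys) = 0 *: X (xs @ 0 # ys) + 0 *: X (xs @ 0 # ys)"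
  by (rule B.ALT_lin_slot[OF X]) simp_all
 hence "X (xs @ 0 # ys) = 0" by (simp only: scaleR_zero_left add_0_right)
 hence "X (xs @ 0 # ys) q = 0" by (rule trans[OF fun_cong[of _ 0 q]]) (rule fzero)
 thus ?case by (simp only: sum.empty)
next
 case (insert b I)
 have "(SUM b:I. c b *: l b) : B.F" using insert by (intro subspace_sum[OF B.subspace_F]) simp
 hence "X (xs @ (c b *: l b + 1 *: (SUM b:I. c b *: l b)) # ys) =
   c b *: X (xs @ l b # ys) + 1 *: X (xs @ (SUM b:I. c b *: l b) # ys)"
  using insert by (intro B.ALT_lin_slot[OF X]) simp_all
 hence "X (xs @ (c b *: l b + 1 *: (SUM b:I. c b *: l b)) # ys) q =
   c b * X (xs @ l b # ys) q + 1 * X (xs @ (SUM b:I. c b *: l b) # ys) q"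
  by (simp only: B.lin_apply real_scaleR_def)
 thus ?case using insert by simp
qed

lemma MD_fib_cong:
 assumes X: "X : B.MD k" and p: "p : C" and l: "set ls <= La" "set ls' <= La" "map (fib p) ls = map (fib p) ls'"
 shows "X ls (zp p) = X ls' (zp p)"
proof (rule B.MD_differential_cong[OF X zp_carrier[OF p]])
 show "set ls <= B.F" "set ls' <= B.F" using l La_F by auto
 have "map (pcov p) (map (fib p) xs) = map (dif B (zp p)) xs" if "set xs <= La" for xs
  unfolding map_map by (rule map_cong[OF refl]) (use that project_covector_La[OF p] in auto)
 from this[OF l(1)] this[OF l(2)] show "map (dif B (zp p)) ls = map (dif B (zp p)) ls'" by (simp only: l(3))
qed

text \<open>Chosen independently at each point \<open>q\<close>. Smooth dependence on
  \<open>q\<close> is not built in and has to come from coordinate functions that do not vary with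
  the point.\<close>

definition lift :: "('a, 'e) npoint => (('a, 'e) npoint => real) => ('a, 'e) npoint => real" where
 "lift q f = (SOME l. l : La & fib (fst q) l = vd q f)"

lemma lift:
 assumes "p : C" "w : V p" "f : B.F"
 shows "lift (p, w) f : La" "fib p (lift (p, w) f) = vd (p, w) f"
proof -
 obtain l where "l : La" "fib p l = vd (p, w) f"
  using conormal_ext[OF assms(1) vd_conormal[OF assms]] by blast
 hence "lift (p, w) f : La & fib (fst (p, w)) (lift (p, w) f) = vd (p, w) f"
  unfolding lift_def by (intro someI[of "%l. l : La & fib (fst (p, w)) l = vd (p, w) f" l]) simp
 thus "lift (p, w) f : La" "fib p (lift (p, w) f) = vd (p, w) f" by simp_all
qed

lemma RP_lift:
 assumes X: "X : B.MD k" and p: "p : C" "w : V p" and fs: "set fs <= B.F"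
 shows "RP X fs (p, w) = X (map (lift (p, w)) fs) (zp p)"
 by (rule RP_eq[OF X p fs]) (use fs lift[OF p] in auto)

text \<open>A neighbourhood of the whole fibre over the centre on which one may divide by the
  bump.\<close>

lemma bump_domain:
 assumes cS: "slice c S" and r: "r > 0" "ball z0 r <= cimg c"
 obtains W where "open W" "W <= slab c S" "!!z. oproj S z = z0 ==> z : W"
  "!!z. z : W ==> oproj S z : ball z0 r & bump z0 (r / 2) (oproj S z) ~= 0"
  "smooth_on W (%z. inverse (bump z0 (r / 2) (oproj S z)))"
proof -
 note S = M.sliceD(2)[OF cS]
 let ?bt = "%z. bump z0 (r / 2) (oproj S z)" and ?W = "{z. oproj S z : ball z0 r}"
 have W: "open ?W" by (rule open_slab[OF S open_ball])
 have bt: "smooth_on ?W ?bt"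
  by (rule sm_compose[OF W sm_linear[OF linear_oproj[OF S] W] sm_bump]) auto
 have W': "open (?W Int ?bt -` (- {0}))"
  by (rule continuous_open_preimage[OF sm_continuous[OF bt] W]) (intro open_Compl closed_singleton)
 have "smooth_on (?W Int ?bt -` (- {0})) (%z. inverse (?bt z))"
  by (intro sm_inverse W' sm_subset[OF bt]) auto
 moreover have "?W Int ?bt -` (- {0}) <= slab c S" using r(2) by blast
 ultimately show thesis using that[OF W'] r(1) bump_center[of "r / 2" z0] by auto
qed

text \<open>In a slice chart the vertical differentials are combinations of those of the \<open>dim\<close> many linear functions
  obtained from the coordinates, which are independent of the point, with smooth coefficients.\<close>

lemma RP_smooth:
 assumes X: "X : B.MD k" and fs: "set fs <= B.F"
 shows "RP X fs : B.F"
proof (rule bundle_functionI)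
 show "RP X fs q = 0" if "q ~: npts" for q by (rule RP_off(1)[OF fs that])
 fix p0 w0 assume p0: "p0 : C" and w0: "w0 : V p0"
 obtain c S r where cS: "slice c S" "p0 : fst c" and r: "r > 0" "ball (snd c p0) r <= cimg c"
  using p0 by (rule obtain_slice_ball)
 let ?T = "nch c S" and ?bt = "%z. bump (snd c p0) (r / 2) (oproj S z)"
 define lb where "lb b = lincoord c S (snd c p0) r b" for b
 obtain W where W: "open W" and Wd: "W <= slab c S" and W0: "!!z. oproj S z = snd c p0 ==> z : W"
  and WW: "!!z. z : W ==> oproj S z : ball (snd c p0) r & ?bt z ~= 0" and inv: "smooth_on W (%z. inverse (?bt z))"
  using bump_domain[OF cS(1) r] by blast
 have lb: "lb b (x, u) = (if x : fst c & snd c x : ball (snd c p0) r then bump (snd c p0) (r / 2) (snd c x) * (b \<bullet> coord c S u) else 0)"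
  if "x : C" "u : V x" for x u b
  unfolding lb_def by (rule lincoord_apply[OF cS(1) that])
 have lbLa: "lb b : La" for b unfolding lb_def by (rule lincoord_La[OF cS(1) r])
 have lbF: "lb b : B.F" for b by (rule La_F[OF lbLa])
 \<comment> \<open>Division by the bump compensates the factor contained in \<open>lb\<close>, so
   that the combination reproduces the vertical differential exactly.\<close>
 define co where "co f b z = fder (f o cinv ?T) (at z) b * inverse (?bt z)" for f :: "('a, 'e) npoint => real" and b z
 have co_smooth: "smooth_on W (co f b)" if "f : B.F" for f b
  unfolding co_def
  by (intro sm_mult W sm_deriv sm_subset[OF rep_smooth[OF cS(1) that] Wd] inv)
 have point: "EX x u. x : C & x : fst c & u : V x & cinv ?T z = (x, u) & snd ?T (x, u) = z & oproj S z = snd c x" if z: "z : W" for z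
 proof -
  have z': "oproj S z : cimg c" using z Wd by blast
  show ?thesis by (rule nch_point[OF cS(1) z']) blast
 qed
 have vd_co: "vd (x, u) f = fib x (SUM b:Basis. co f b z *: lb b)"
  if x: "x : C" "x : fst c" "u : V x" "snd ?T (x, u) = z" "oproj S z = snd c x" "z : W" "f : B.F" for x u z f
 proof
  fix v show "vd (x, u) f v = fib x (SUM b:Basis. co f b z *: lb b) v"
  proof (cases "v : V x")
   case True
   have ball: "snd c x : ball (snd c p0) r" using WW[OF x(6)] x(5) by simp
   have "linear (fder (f o cinv ?T) (at z))"
    using has_derivative_linear[OF B.smf_deriv[OF x(7) nch_at[OF cS(1) x(2,1,3)]]] x(4) by simp
   note L = lin_sum[OF this, of "coord c S v"]
   have b0: "?bt z ~= 0" using WW[OF x(6)] by simp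
   have "vd (x, u) f v = (SUM b:Basis. (coord c S v \<bullet> b) * fder (f o cinv ?T) (at z) b)"
    using vd_eq[OF cS(1) x(2,1,3) True x(7)] by (simp add: x(4) L)
   also have "... = (SUM b:Basis. co f b z * fib x (lb b) v)"
    using b0 ball True x(2) by (intro sum.cong refl) (simp add: co_def fib_def lb[OF x(1)] x(5)[symmetric] inner_commute field_simps)
   also have "... = fib x (SUM b:Basis. co f b z *: lb b) v" by (simp add: fib_sum lbLa)
   finally show ?thesis .
  qed (simp add: vd_off fib_def)
 qed
 \<comment> \<open>The slots are processed one at a time: the entries \<open>\<mu>s\<close> no
   longer depend on \<open>z\<close>, while the remaining ones are still lifts that do.\<close>
 have "smooth_on W (%z. X (\<mu>s @ map (lift (cinv ?T z)) fs) (zp (fst (cinv ?T z))))" if "set \<mu>s <= La" for \<mu>s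
  using that fs
 proof (induction fs arbitrary: \<mu>s)
  case Nil
  have "smooth_on W (rho (X \<mu>s) o cinv ?T)"
   by (rule sm_subset[OF rep_smooth[OF cS(1) rho_smooth[OF B.ALT_F[OF B.MD_ALT[OF X]]]] Wd])
  thus ?case
  proof (rule sm_cong[OF W])
   fix z assume "z : W"
   then obtain x u where "x : C" "u : V x" "cinv ?T z = (x, u)" using point by blast
   thus "(rho (X \<mu>s) o cinv ?T) z = X (\<mu>s @ map (lift (cinv ?T z)) []) (zp (fst (cinv ?T z)))"
    by (simp add: rho_apply)
  qed
 next
  case (Cons f fs)
  have f: "f : B.F" "set fs <= B.F" using Cons.prems by auto
  have "smooth_on W (%z. X ((\<mu>s @ [lb b]) @ map (lift (cinv ?T z)) fs) (zp (fst (cinv ?T z))))" for b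
   using Cons.IH[of "\<mu>s @ [lb b]"] Cons.prems lbLa f by simp
  hence "smooth_on W (%z. SUM b:Basis. co f b z * X ((\<mu>s @ [lb b]) @ map (lift (cinv ?T z)) fs) (zp (fst (cinv ?T z))))"
   by (intro sm_sum sm_mult W co_smooth f)
  thus ?case
  proof (rule sm_cong[OF W])
   fix z assume z: "z : W"
   then obtain x u where x: "x : C" "x : fst c" "u : V x" "cinv ?T z = (x, u)" "snd ?T (x, u) = z" "oproj S z = snd c x" using point by blast
   let ?l = "SUM b:Basis. co f b z *: lb b"
   have l: "?l : La" by (intro subspace_sum[OF La_subspace] subspace_scale[OF La_subspace] lbLa)
   have "X (\<mu>s @ map (lift (x, u)) (f # fs)) (zp x) = X (\<mu>s @ ?l # map (lift (x, u)) fs) (zp x)"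
    by (rule MD_fib_cong[OF X x(1)])
     (use Cons.prems f l lift[OF x(1,3)] vd_co[OF x(1,2,3,5,6) z f(1)] in auto)
   also have "... = (SUM b:Basis. co f b z * X (\<mu>s @ lb b # map (lift (x, u)) fs) (zp x))"
    by (rule ALT_slot_sum[OF B.MD_ALT[OF X]]) (simp_all add: lbF)
   finally show "(SUM b:Basis. co f b z * X ((\<mu>s @ [lb b]) @ map (lift (cinv ?T z)) fs) (zp (fst (cinv ?T z))))
    = X (\<mu>s @ map (lift (cinv ?T z)) (f # fs)) (zp (fst (cinv ?T z)))" by (simp add: x(4))
  qed
 qed
 from this[of "[]"] have "smooth_on W (%z. X (map (lift (cinv ?T z)) fs) (zp (fst (cinv ?T z))))" by simp
 hence "smooth_on W (RP X fs o cinv ?T)"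
 proof (rule sm_cong[OF W])
  fix z assume "z : W"
  then obtain x u where "x : C" "u : V x" "cinv ?T z = (x, u)" using point by blast
  thus "X (map (lift (cinv ?T z)) fs) (zp (fst (cinv ?T z))) = (RP X fs o cinv ?T) z"
   using RP_lift[OF X _ _ fs, of x u] by simp
 qed
 moreover have "snd ?T (p0, w0) : W"
  using nch_oproj(1)[OF cS(1), of p0 w0] p0 w0 cS(2) by (intro W0) (simp add: nch_dom)
 ultimately show "EX c S W. slice c S & p0 : fst c & open W &
   snd (nch c S) (p0, w0) : W & W <= {z. oproj S z : cimg c} & smooth_on W (RP X fs o cinv (nch c S))"
  using cS W Wd by blast
qed

lemma normal_cases:
 assumes "!!p w. p : C ==> w : V p ==> f (p, w) = g (p, w)" "!!q. q ~: npts ==> f q = g q"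
 shows "f = g"
proof
 fix q show "f q = g q" using assms by (cases q, cases "q : npts") (auto simp: in_npts)
qed

lemma MD_eqI:
 assumes X: "X : B.MD k" and Y: "Y : B.MD k"
  and eq: "!!p w fs. p : C ==> w : V p ==> length fs = k ==> set fs <= B.F ==> X fs (p, w) = Y fs (p, w)"
 shows "X = Y"
proof
 fix fs
 note XA = B.MD_ALT[OF X] and YA = B.MD_ALT[OF Y]
 show "X fs = Y fs"
 proof (cases "length fs = k & set fs <= B.F")
  case True
  thus ?thesis
   using B.smf_zero[OF B.ALT_F[OF XA]] B.smf_zero[OF B.ALT_F[OF YA]]
   by (intro normal_cases) (simp_all add: eq carrier_bundle)
 qed (simp add: B.ALT_dom[OF XA] B.ALT_dom[OF YA])
qed

text \<open>It suffices to test on functions that realize every covector at every point. Affine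
  functions and functions pulled back from M are the two classes it is applied to.\<close>

lemma MD_zeroI:
 assumes X: "X : B.MD k" and G: "G <= B.F"
  and cov: "!!p w f. p : C ==> w : V p ==> f : B.F ==> EX g:G. dif B (p, w) g = dif B (p, w) f"
  and 0: "!!p w gs. p : C ==> w : V p ==> set gs <= G ==> X gs (p, w) = 0"
 shows "X = 0"
proof (rule MD_eqI[OF X subspace_0[OF B.sub_MD]])
 fix p w fs assume p: "p : C" "w : V p" and fs: "length fs = k" "set fs <= B.F"
 have "ALL f:set fs. EX g:G. dif B (p, w) g = dif B (p, w) f" using cov[OF p] fs(2) by blast
 then obtain h where h: "!!f. f : set fs ==> h f : G & dif B (p, w) (h f) = dif B (p, w) f" by metis
 have "X fs (p, w) = X (map h fs) (p, w)"
  by (rule B.MD_differential_cong[OF X]) (use p fs h G in \<open>auto simp: carrier_bundle in_npts\<close>)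
 thus "X fs (p, w) = 0 fs (p, w)" using 0[OF p, of "map h fs"] h by (auto simp: fzero)
qed

lemma RP_slot:
 assumes X: "X : B.MD k" and p: "p : C" "w : V p" and F: "f : B.F" "g : B.F" "h : B.F" "set fs <= B.F"
  and vd: "vd (p, w) h = r *: vd (p, w) f + s *: vd (p, w) g"
 shows "RP X (h # fs) (p, w) = r * RP X (f # fs) (p, w) + s * RP X (g # fs) (p, w)"
proof -
 let ?l = "lift (p, w)"
 note l = lift[OF p F(1)] lift[OF p F(2)]
 have "RP X (h # fs) (p, w) = X ((r *: ?l f + s *: ?l g) # map ?l fs) (zp p)"
  by (rule RP_eq[OF X p]) (use F(3,4) lift[OF p] La_lin[OF l(1,3)] vd l(2,4) in auto)
 also have "... = r * X (map ?l (f # fs)) (zp p) + s * X (map ?l (g # fs)) (zp p)"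
  using B.ALT_lin[OF B.MD_ALT[OF X] La_F[OF l(1)] La_F[OF l(3)]] by (simp add: B.lin_apply)
 finally show ?thesis using F by (simp add: RP_lift[OF X p])
qed

lemma RP_MD:
 assumes X: "X : B.MD k" shows "RP X : B.MD k"
 unfolding B.MD_def B.ALT_def mem_Collect_eq
proof (intro conjI allI ballI impI)
 note XA = B.MD_ALT[OF X]
 show "RP X fs = 0" if fs: "~ (length fs = k & set fs <= B.F)" for fs
 proof (cases "set fs <= B.F")
  case True
  show ?thesis
  proof (rule normal_cases)
   fix p w assume p: "p : C" "w : V p"
   have "X (map (lift (p, w)) fs) = 0" by (rule B.ALT_dom[OF XA]) (use True fs in auto)
   thus "RP X fs (p, w) = 0 (p, w)" by (simp add: RP_lift[OF X p True] fzero)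
  qed (simp add: RP_off(1)[OF True] fzero)
 qed (rule RP_off(2))
 show F: "RP X fs : B.F" for fs
  using RP_smooth[OF X] RP_off(2) by (cases "set fs <= B.F") simp_all
 show "RP X ((r *: f + s *: g) # fs) = r *: RP X (f # fs) + s *: RP X (g # fs)" if fg: "f : B.F" "g : B.F" for f g r s fs
 proof (cases "set fs <= B.F")
  case True
  show ?thesis
  proof (rule normal_cases)
   fix p w assume p: "p : C" "w : V p"
   show "RP X ((r *: f + s *: g) # fs) (p, w) = (r *: RP X (f # fs) + s *: RP X (g # fs)) (p, w)"
    using RP_slot[OF X p fg _ True vd_lin[OF p fg]] fg by (simp add: B.lin_apply)
  qed (use True fg in \<open>simp add: RP_off(1) B.lin_apply\<close>)
 qed (simp add: RP_off(2))
 show "RP X ((f * g) # fs) = f * RP X (g # fs) + g * RP X (f # fs)" if fg: "f : B.F" "g : B.F" for f g fs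
 proof (cases "set fs <= B.F")
  case True
  show ?thesis
  proof (rule normal_cases)
   fix p w assume p: "p : C" "w : V p"
   show "RP X ((f * g) # fs) (p, w) = (f * RP X (g # fs) + g * RP X (f # fs)) (p, w)"
    using RP_slot[OF X p fg(2,1) B.mult_F[OF fg] True vd_mult[OF p fg]] by (simp add: fplus times_fun_apply)
  qed (use True fg B.mult_F[OF fg] in \<open>simp add: RP_off(1) fplus times_fun_apply\<close>)
 next
  case False
  thus ?thesis by (simp add: RP_off(2))
 qed
 show "RP X (xs @ u # v # ys) = - RP X (xs @ v # u # ys)" for xs u v ys
 proof (cases "set (xs @ u # v # ys) <= B.F")
  case True
  hence T': "set (xs @ v # u # ys) <= B.F" by auto
  show ?thesis
  proof (rule normal_cases)
   fix p w assume p: "p : C" "w : V p"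
   show "RP X (xs @ u # v # ys) (p, w) = (- RP X (xs @ v # u # ys)) (p, w)"
    unfolding uminus_apply RP_lift[OF X p True] RP_lift[OF X p T'] map_append list.map
     B.ALT_swap[OF XA, of "map (lift (p, w)) xs" "lift (p, w) u" "lift (p, w) v"] ..
  qed (simp add: RP_off(1)[OF True] RP_off(1)[OF T'] uminus_apply)
 next
  case False
  hence "~ set (xs @ v # u # ys) <= B.F" by auto
  from RP_off(2)[OF this] RP_off(2)[OF False] show ?thesis by simp
 qed
qed

lemma pcov_cot:
 assumes p: "p : C" and xj: "xj : cnf p"
 shows "pcov p xj : ctsp B (zp p)"
proof -
 obtain l where l: "l : La" "fib p l = xj" using conormal_ext[OF p xj] by blast
 show ?thesis
  using B.dif_cotangent[OF La_F[OF l(1)] zp_carrier[OF p]] project_covector_La[OF p l(1)] l(2) by simp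
qed

lemma pcov_lin:
 assumes p: "p : C" and xj: "xj : cnf p" "xj' : cnf p"
 shows "pcov p (r *: xj + s *: xj') = r *: pcov p xj + s *: pcov p xj'"
proof -
 obtain l where l: "l : La" "fib p l = xj" using conormal_ext[OF p xj(1)] by blast
 obtain l' where l': "l' : La" "fib p l' = xj'" using conormal_ext[OF p xj(2)] by blast
 show ?thesis
  unfolding l(2)[symmetric] l'(2)[symmetric] La_lin(2)[OF l(1) l'(1), symmetric]
   project_covector_La[OF p La_lin(1)[OF l(1) l'(1)]] project_covector_La[OF p l(1)] project_covector_La[OF p l'(1)]
  by (rule B.dif_lin[OF La_F[OF l(1)] La_F[OF l'(1)] zp_carrier[OF p]])
qed

lemma RP_N:
 assumes X: "X : B.MD k" shows "RP X : N k"
 unfolding normal_multisections_def mem_Collect_eq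
proof (intro conjI ballI)
 show "RP X : multivector_fields B k" unfolding B.mvf_MD by (rule RP_MD[OF X])
 fix p assume p: "p : C"
 let ?om = "multivector_at B X (zp p)" and ?P = "pcov p"
 note om = B.alternating_form_MD[OF X zp_carrier[OF p]]
 show "\<exists>\<eta>. alternating_form (cnf p) k \<eta> &
  (ALL w:V p. ALL fs. length fs = k & set fs <= B.F --> RP X fs (p, w) = \<eta> (map (vd (p, w)) fs))"
 proof (intro exI[of _ "%xjs. ?om (map ?P xjs)"] conjI ballI allI impI)
  show "alternating_form (cnf p) k (%xjs. ?om (map ?P xjs))"
   unfolding alternating_form_def
  proof (intro conjI allI impI)
   fix xs ys al bt r s
   assume *: "set xs Un set ys Un {al, bt} <= cnf p & length xs + 1 + length ys = k"
   hence ab: "al : cnf p" "bt : cnf p" by auto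
   have "?om (map ?P xs @ (r *: ?P al + s *: ?P bt) # map ?P ys) = r * ?om (map ?P xs @ ?P al # map ?P ys) + s * ?om (map ?P xs @ ?P bt # map ?P ys)"
    by (rule B.alternating_form_lin[OF om]) (use * pcov_cot[OF p] in auto)
   thus "?om (map ?P (xs @ (r *: al + s *: bt) # ys)) = r * ?om (map ?P (xs @ al # ys)) + s * ?om (map ?P (xs @ bt # ys))"
    by (simp add: pcov_lin[OF p ab])
  next
   fix xs ys al assume *: "set xs Un set ys Un {al} <= cnf p & length xs + 2 + length ys = k"
   have "?om (map ?P xs @ ?P al # ?P al # map ?P ys) = 0"
    by (rule B.alternating_form_repeat[OF om]) (use * pcov_cot[OF p] in auto)
   thus "?om (map ?P (xs @ al # al # ys)) = 0" by simp
  qed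
  fix w fs assume "w : V p" "length fs = k & set fs <= B.F"
  thus "RP X fs (p, w) = ?om (map ?P (map (vd (p, w)) fs))"
   using p by (simp add: restrict_project_def in_npts o_def)
 qed
qed

lemma RP_id:
 assumes a: "a : N k" shows "RP a = a"
proof (rule MD_eqI[OF RP_MD[OF N_MD[OF a]] N_MD[OF a]])
 fix p w fs assume p: "p : C" "w : V p" and fs: "set fs <= B.F"
 show "RP a fs (p, w) = a fs (p, w)"
  unfolding RP_lift[OF N_MD[OF a] p fs] zpV(1)[OF p(1)]
 proof (rule N_apply[OF a p(1) zpV(2)[OF p(1)] p(2) _ fs])
  show "set (map (lift (p, w)) fs) <= B.F" using fs lift(1)[OF p] La_F by auto
  show "map (vd (p, tC p)) (map (lift (p, w)) fs) = map (vd (p, w)) fs"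
   unfolding map_map
   by (rule map_cong[OF refl]) (use fs La_vd[OF lift(1)[OF p] p(1)] lift(2)[OF p] zpV(1)[OF p(1)] in auto)
 qed
qed

text \<open>Through \<open>lift\<close>, the projection sees only the values at fibrewise linear
  functions on the zero section.\<close>

lemma RP_cong:
 assumes X: "X : B.MD k" and Y: "Y : B.MD l" and eq: "!!p ls. p : C ==> set ls <= La ==> X ls (zp p) = Y ls (zp p)"
 shows "RP X = RP Y"
proof
 fix fs
 show "RP X fs = RP Y fs"
 proof (cases "set fs <= B.F")
  case True
  show ?thesis
  proof (rule normal_cases)
   fix p w assume p: "p : C" "w : V p"
   have "set (map (lift (p, w)) fs) <= La" using True lift(1)[OF p] by auto
   thus "RP X fs (p, w) = RP Y fs (p, w)"
    unfolding RP_lift[OF X p True] RP_lift[OF Y p True] by (rule eq[OF p(1)])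
  qed (simp add: RP_off(1)[OF True])
 qed (simp add: RP_off(2))
qed

lemma RP_La:
 assumes X: "X : B.MD k" and p: "p : C" "w : V p" and ls: "set ls <= La"
 shows "RP X ls (p, w) = X ls (zp p)"
proof (rule RP_eq[OF X p _ ls])
 show "set ls <= B.F" using ls La_F by blast
 show "map (fib p) ls = map (vd (p, w)) ls" by (rule map_cong[OF refl]) (use ls vd_La[OF _ p] in auto)
qed

lemma RP_lin:
 assumes X: "X : B.MD k" and Y: "Y : B.MD k"
 shows "RP (r *: X + s *: Y) = r *: RP X + s *: RP Y"
proof -
 have lin: "r *: U + s *: U' : B.MD k" if "U : B.MD k" "U' : B.MD k" for U U'
  by (intro subspace_add[OF B.sub_MD] subspace_scale[OF B.sub_MD] that)
 note XY = lin[OF X Y]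
 show ?thesis
 proof (rule MD_eqI[OF RP_MD[OF XY] lin[OF RP_MD[OF X] RP_MD[OF Y]]])
  fix p w fs assume p: "p : C" "w : V p" and fs: "set fs <= B.F"
  show "RP (r *: X + s *: Y) fs (p, w) = (r *: RP X + s *: RP Y) fs (p, w)"
   by (simp only: B.lin_apply RP_lift[OF XY p fs] RP_lift[OF X p fs] RP_lift[OF Y p fs])
 qed
qed

text \<open>On the zero section the inner value \<open>Y L\<close> may be replaced by its
  restriction to that section plus its vertical derivative. The first is what \<open>RP Y\<close>
  retains, the second is all that \<open>RP X\<close> sees in its first slot. This is the geometric
  content of the identity for the projection of a bracket.\<close>

lemma comp_La:
 assumes X: "X : B.MD k" and Y: "Y : B.MD l" and p: "p : C" and ls: "set ls <= La"
 shows "B.comp X Y ls (zp p) = B.comp X (RP Y) ls (zp p) + B.comp (RP X) Y ls (zp p)"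
proof -
 note XA = B.MD_ALT[OF X] and YA = B.MD_ALT[OF Y]
 have "X (Y L # R) (zp p) = X (RP Y L # R) (zp p) + RP X (Y L # R) (zp p)" if LR: "mset L + mset R = mset ls" for L R
 proof -
  have L: "set L <= La" "set R <= La" using B.mset_split_set[OF LR] ls by auto
  have R: "set R <= B.F" using L(2) La_F by blast
  have YF: "Y L : B.F" by (rule B.ALT_F[OF YA])
  have "RP Y L = rho (Y L)"
  proof (rule normal_cases)
   fix p w assume p: "p : C" "w : V p"
   show "RP Y L (p, w) = rho (Y L) (p, w)" by (simp add: RP_La[OF Y p L(1)] rho_apply p)
  next
   fix q assume q: "q ~: npts"
   have "set L <= B.F" using L(1) La_F by blast
   thus "RP Y L q = rho (Y L) q" using q by (simp add: RP_off(1) rho_def basic_def)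
  qed
  moreover have "RP X (Y L # R) (zp p) = X (lin (Y L) # R) (zp p)"
  proof (rule RP_eq[OF X p zpV(2)[OF p], of "Y L # R" "lin (Y L) # R", folded zpV(1)[OF p]])
   show "set (Y L # R) <= B.F" using YF R by simp
   show "set (lin (Y L) # R) <= La" using L(2) lin_La[OF YF] by simp
   have "map (fib p) R = map (vd (zp p)) R" by (rule map_cong[OF refl]) (use La_vd[OF _ p] L(2) in auto)
   thus "map (fib p) (lin (Y L) # R) = map (vd (zp p)) (Y L # R)" by (simp add: fib_lin[OF p])
  qed
  ultimately show ?thesis using MD_split[OF X p YF R] by simp
 qed
 thus ?thesis unfolding B.comp_def ssum_fun_apply ssum_add[symmetric] by (rule ssum_cong)
qed

lemma RP_schouten:
 assumes X: "X : B.MD k" and Y: "Y : B.MD l"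
 shows "RP (schouten X Y) = RP (schouten (RP X) Y) + RP (schouten X (RP Y))"
proof -
 let ?s = "sg ((int k - 1) * (int l - 1))"
 note XA = B.MD_ALT[OF X] and YA = B.MD_ALT[OF Y]
 note X' = RP_MD[OF X] and Y' = RP_MD[OF Y]
 note XA' = B.MD_ALT[OF X'] and YA' = B.MD_ALT[OF Y']
 have "RP (schouten X Y) = RP (1 *: schouten (RP X) Y + 1 *: schouten X (RP Y))"
 proof (rule RP_cong)
  show "schouten X Y : B.MD (k + l - 1)" by (rule B.schouten_MD[OF X Y])
  show "1 *: schouten (RP X) Y + 1 *: schouten X (RP Y) : B.MD (k + l - 1)"
   by (intro subspace_add[OF B.sub_MD] subspace_scale[OF B.sub_MD] B.schouten_MD X Y X' Y')
  fix p ls assume p: "p : C" and ls: "set ls <= La"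
  have ev: "schouten U U' ls (zp p) = sg ((int k - 1) * (int l - 1)) * B.comp U U' ls (zp p) - B.comp U' U ls (zp p)"
   if "U : B.ALT k" "U' : B.ALT l" for U U'
   by (simp add: B.schouten_comp[OF that] minus_apply fscale)
  show "schouten X Y ls (zp p) = (1 *: schouten (RP X) Y + 1 *: schouten X (RP Y)) ls (zp p)"
   unfolding B.lin_apply ev[OF XA YA] ev[OF XA' YA] ev[OF XA YA'] comp_La[OF X Y p ls] comp_La[OF Y X p ls]
   by (simp add: algebra_simps)
 qed
 also have "... = RP (schouten (RP X) Y) + RP (schouten X (RP Y))"
  using RP_lin[OF B.schouten_MD[OF X' Y] B.schouten_MD[OF X Y'], of 1 1] by simp
 finally show ?thesis .
qed

text \<open>Functions that are affine along the fibres: their differentials fill the cotangent space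
  at every point of the bundle, horizontal directions included.\<close>

definition affine_functions :: "(('a, 'e) npoint => real) set" where
 "affine_functions = {g:B.F. ALL p:C. ALL w:V p. vd (p, w) g = vd (zp p) g}"

text \<open>In a bundle chart the function is affine with the prescribed gradient \<open>a\<close>
  and vanishes at the chosen point, so the base bump does not change its differential there.\<close>

lemma affine_covector:
 assumes p: "p : C" "w : V p" and f: "f : B.F"
 shows "EX g:affine_functions. dif B (p, w) g = dif B (p, w) f"
proof -
 obtain c S r where cS: "slice c S" "p : fst c" and r: "r > 0" "ball (snd c p) r <= cimg c"
  using p(1) by (rule obtain_slice_ball)
 note S = M.sliceD(2)[OF cS(1)]
 let ?T = "nch c S"
 let ?z = "snd ?T (p, w)" and ?W = "{z. oproj S z : ball (snd c p) r}"
 note T = nch_at[OF cS p]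
 have q: "(p, w) : carrier_of B" "(p, w) : fst ?T" using p cS by (simp_all add: carrier_bundle in_npts nch_dom)
 have W: "open ?W" by (rule open_slab[OF S open_ball])
 have zW: "?z : ?W" using nch_oproj(1)[OF cS(1) q(2)] r(1) by simp
 obtain a where a: "!!v. v : tsp B (p, w) ==> dif B (p, w) f v = a \<bullet> v ?T"
  using B.cot_repr[OF B.dif_cotangent[OF f q(1)] T] by blast
 define g where "g = bump_ext c S (snd c p) r (%z. a \<bullet> (z - ?z))"
 have gF: "g : B.F"
  unfolding g_def by (rule bump_ext_smooth[OF cS(1) r]) (intro sm_inner sm_const sm_diff sm_ident W)
 have g: "g (x, u) = (if x : fst c & snd c x : ball (snd c p) r then bump (snd c p) (r / 2) (snd c x) * (a \<bullet> (snd ?T (x, u) - ?z)) else 0)"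
  if x: "x : C" "u : V x" for x u
  using x by (auto simp: g_def bump_ext_def nch_dom)
 have vdg: "vd (x, u) g v = (if x : fst c & snd c x : ball (snd c p) r then bump (snd c p) (r / 2) (snd c x) * (a \<bullet> coord c S v) else 0)"
  if x: "x : C" "u : V x" "v : V x" for x u v
 proof (cases "x : fst c & snd c x : ball (snd c p) r")
  case True
  have "g (x, nplus u (nsc x t v)) = bump (snd c p) (r / 2) (snd c x) * (a \<bullet> (snd ?T (x, u) + t *: coord c S v - ?z))" for t
   using True g[OF x(1) V_closed(1)[OF x(1,2) V_closed(2)[OF x(1,3)]]] chart_line[OF cS(1) _ x, of t] by simp
  moreover have "((%t. bump (snd c p) (r / 2) (snd c x) * (a \<bullet> (snd ?T (x, u) + t *: coord c S v - ?z)))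
    has_field_derivative bump (snd c p) (r / 2) (snd c x) * (a \<bullet> coord c S v)) (at 0)"
   by (auto intro!: derivative_eq_intros simp: inner_add_right inner_diff_right)
  ultimately show ?thesis using True x(3) by (simp add: vertical_differential_def DERIV_imp_deriv)
 next
  case False
  have "g (x, nplus u (nsc x t v)) = 0" for t
   using False g[OF x(1) V_closed(1)[OF x(1,2) V_closed(2)[OF x(1,3)]]] by auto
  thus ?thesis using False x(3) by (auto simp: vertical_differential_def)
 qed
 have "vd (x, u) g = vd (zp x) g" if x: "x : C" "u : V x" for x u
 proof
  fix v show "vd (x, u) g v = vd (zp x) g v"
   by (cases "v : V x") (simp_all add: vdg[OF x] vdg[OF x(1) zpV(2)[OF x(1)]] zpV(1)[OF x(1)] vd_off)
 qed
 hence "g : affine_functions" using gF by (simp add: affine_functions_def)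
 moreover have "dif B (p, w) g = dif B (p, w) f"
 proof (rule B.cot_eqI[OF B.dif_cotangent[OF gF q(1)] B.dif_cotangent[OF f q(1)]])
  fix v assume v: "v : tsp B (p, w)"
  let ?b = "%z. bump (snd c p) (r / 2) (oproj S z)"
  have "smooth_on ?W ?b" by (rule sm_compose[OF W sm_linear[OF linear_oproj[OF S] W] sm_bump]) auto
  hence b: "(?b has_derivative fder ?b (at ?z)) (at ?z)" by (rule sm_has_derivative[OF _ zW])
  have b1: "?b ?z = 1" using nch_oproj(1)[OF cS(1) q(2)] r(1) bump_center[of "r / 2" "snd c p"] by simp
  have h: "((%z. a \<bullet> (z - ?z)) has_derivative (%v. a \<bullet> v)) (at ?z)" by (auto intro!: derivative_eq_intros)
  have "((%z. ?b z * (a \<bullet> (z - ?z))) has_derivative (%v. a \<bullet> v)) (at ?z)"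
   using has_derivative_mult[OF b h] b1 by simp
  moreover have "?b z * (a \<bullet> (z - ?z)) = (g o cinv ?T) z" if z: "z : ?W" for z
  proof -
   have z': "oproj S z : cimg c" using z r(2) by auto
   show ?thesis by (rule nch_point[OF cS(1) z']) (use z g in auto)
  qed
  ultimately have "((g o cinv ?T) has_derivative (%v. a \<bullet> v)) (at ?z)"
   by (rule has_derivative_transform_within_open[OF _ W zW])
  from frechet_derivative_at[OF this, symmetric] show "dif B (p, w) g v = dif B (p, w) f v"
   using B.dif_eq[OF gF T v] a[OF v] by simp
 qed
 ultimately show ?thesis by blast
qed

lemma N_affine_const:
 assumes a: "a : N k" and p: "p : C" "w : V p" and gs: "set gs <= affine_functions"
 shows "a gs (p, w) = a gs (zp p)"
 unfolding zpV(1)[OF p(1)]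
proof (rule N_apply[OF a p zpV(2)[OF p(1)]])
 show "set gs <= B.F" "set gs <= B.F" using gs by (auto simp: affine_functions_def)
 show "map (vd (p, w)) gs = map (vd (p, tC p)) gs"
  by (rule map_cong[OF refl]) (use gs p zpV(1)[OF p(1)] in \<open>auto simp: affine_functions_def\<close>)
qed

lemma N_const_head:
 assumes a: "a : N k" and p: "p : C" "w : V p" and f: "f : B.F" "!!u u'. u : V p ==> u' : V p ==> f (p, u) = f (p, u')"
  and gs: "set gs <= B.F"
 shows "a (f # gs) (p, w) = 0"
proof -
 have v: "vd (p, w) f = 0" by (rule vd_const[OF p]) (rule f(2))
 have v0: "vd (p, w) 0 = 0" by (rule vd_const[OF p]) (simp add: fzero)
 have "a (f # gs) (p, w) = a (0 # gs) (p, w)"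
  by (rule N_apply[OF a p p(2)]) (simp_all add: f(1) gs v v0)
 also have "... = 0" by (simp add: B.ALT_zero[OF B.MD_ALT[OF N_MD[OF a]]] fzero)
 finally show ?thesis .
qed

text \<open>On affine arguments \<open>b\<close> yields a function that is constant along the
  fibres, and \<open>a\<close> annihilates it because it sees vertical differentials only.\<close>

lemma N_comp_affine:
 assumes a: "a : N k" and b: "b : N l" and p: "p : C" "w : V p" and gs: "set gs <= affine_functions"
 shows "B.comp a b gs (p, w) = 0"
proof -
 have "a (b L # R) (p, w) = 0" if LR: "mset L + mset R = mset gs" for L R
 proof -
  have L: "set L <= affine_functions" "set R <= affine_functions" using B.mset_split_set[OF LR] gs by auto
  show ?thesis
  proof (rule N_const_head[OF a p B.ALT_F[OF B.MD_ALT[OF N_MD[OF b]]]])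
   show "b L (p, u) = b L (p, u')" if "u : V p" "u' : V p" for u u'
    by (rule trans[OF N_affine_const[OF b p(1) that(1) L(1)] N_affine_const[OF b p(1) that(2) L(1), symmetric]])
   show "set R <= B.F" using L(2) by (auto simp: affine_functions_def)
  qed
 qed
 hence "B.comp a b gs (p, w) = ssum (%_. 1) (%L R. 0) gs"
  unfolding B.comp_def ssum_fun_apply by (rule ssum_cong)
 thus ?thesis by simp
qed

lemma N_abelian:
 assumes a: "a : N k" and b: "b : N l"
 shows "schouten a b = 0"
proof (rule MD_zeroI[OF B.schouten_MD[OF N_MD[OF a] N_MD[OF b]] _ affine_covector])
 show "affine_functions <= B.F" by (auto simp: affine_functions_def)
 fix p w gs assume p: "p : C" "w : V p" and gs: "set gs <= affine_functions"
 show "schouten a b gs (p, w) = 0"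
  unfolding B.schouten_comp[OF B.MD_ALT[OF N_MD[OF a]] B.MD_ALT[OF N_MD[OF b]]] minus_apply
  using N_comp_affine[OF a b p gs] N_comp_affine[OF b a p gs] by (simp add: fscale minus_apply)
qed

text \<open>The sections are the fixed points of a linear map, which makes closure under linear
  combinations immediate.\<close>

lemma N_iff: "a : N k \<longleftrightarrow> a : B.MD k & RP a = a"
 using N_MD RP_id RP_N by metis

lemma subspace_N: "subspace (N k)"
proof -
 have lin: "r *: a + s *: b : N k" if "a : N k" "b : N k" for a b r s
  using that RP_lin[of a k b r s] subspace_add[OF B.sub_MD subspace_scale[OF B.sub_MD] subspace_scale[OF B.sub_MD]]
  by (simp add: N_iff)
 have "RP (0 *: 0 + 0 *: 0) = 0 *: RP 0 + 0 *: RP 0"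
  by (rule RP_lin[of _ k]) (simp_all add: subspace_0[OF B.sub_MD])
 hence "0 : N k" by (simp add: N_iff subspace_0[OF B.sub_MD])
 thus ?thesis using lin[of _ _ 1 1] lin[of _ 0 _ 0] unfolding subspace_def by auto
qed

section \<open>Fibrewise polynomial fields\<close>

lemma fpf_iff:
 "f : fpf \<longleftrightarrow> f : B.F & (ALL c S. slice c S --> (ALL p:C Int fst c.
   EX g. rpf g & (ALL u:V p. f (p, u) = g (coord c S u))))"
 by (simp add: fp_functions_def)

lemma fpfI:
 assumes "f : B.F" "!!c S p. slice c S ==> p : C ==> p : fst c ==>
  EX g. rpf g & (ALL u:V p. f (p, u) = g (coord c S u))"
 shows "f : fpf"
 using assms by (simp add: fpf_iff)

lemma fpfD:
 assumes "f : fpf" "slice c S" "p : C" "p : fst c"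
 obtains g where "rpf g" "!!u. u : V p ==> f (p, u) = g (coord c S u)"
proof -
 have "EX g. rpf g & (ALL u:V p. f (p, u) = g (coord c S u))"
  using assms unfolding fpf_iff by blast
 thus thesis using that by blast
qed

lemma fpf_mult:
 assumes f: "f : fpf" and g: "g : fpf"
 shows "f * g : fpf"
proof (rule fpfI)
 show "f * g : B.F" using f g by (intro B.mult_F) (simp_all add: fpf_iff)
 fix c S p assume *: "slice c S" "p : C" "p : fst c"
 obtain h where h: "rpf h" "!!u. u : V p ==> f (p, u) = h (coord c S u)" using fpfD[OF f *] by blast
 obtain k where k: "rpf k" "!!u. u : V p ==> g (p, u) = k (coord c S u)" using fpfD[OF g *] by blast
 show "EX m. rpf m & (ALL u:V p. (f * g) (p, u) = m (coord c S u))"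
  using rpfI(4)[OF h(1) k(1)] h(2) k(2) by (intro exI[of _ "%x. h x * k x"]) (simp add: times_fun_apply)
qed

lemma fpf_lin:
 assumes f: "f : fpf" and g: "g : fpf"
 shows "r *: f + s *: g : fpf"
proof (rule fpfI)
 show "r *: f + s *: g : B.F" using f g by (simp add: fpf_iff)
 fix c S p assume *: "slice c S" "p : C" "p : fst c"
 obtain h where h: "rpf h" "!!u. u : V p ==> f (p, u) = h (coord c S u)" using fpfD[OF f *] by blast
 obtain k where k: "rpf k" "!!u. u : V p ==> g (p, u) = k (coord c S u)" using fpfD[OF g *] by blast
 show "EX m. rpf m & (ALL u:V p. (r *: f + s *: g) (p, u) = m (coord c S u))"
  using rpfI(3)[OF rpfI(4)[OF rpfI(2) h(1)]
    rpfI(4)[OF rpfI(2) k(1)], of r s] h(2) k(2)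
  by (intro exI[of _ "%x. r * h x + s * k x"]) (simp add: B.lin_apply)
qed

lemma subspace_fp_functions: "subspace (fpf)"
proof -
 have "0 : fpf"
  by (rule fpfI) (auto simp: fzero intro!: exI[of _ "%_. 0"] rpfI(2))
 thus ?thesis using fpf_lin[of _ _ 1 1] fpf_lin[of _ 0 _ 0] unfolding subspace_def by auto
qed

lemma fp_vector_fields_iff: "X : fpv \<longleftrightarrow> X : B.MD 1 & (ALL f:fpf. X [f] : fpf)"
 by (simp add: fp_vector_fields_def B.mvf_MD)

lemma schouten_vector_fields:
 assumes X: "X : B.MD 1" and Y: "Y : B.MD 1"
 shows "schouten X Y [f] = X [Y [f]] - Y [X [f]]"
proof -
 note XA = B.MD_ALT[OF X] and YA = B.MD_ALT[OF Y]
 have c: "B.comp U U' [f] = U [U' [f]]" if "U : B.ALT 1" "U' : B.ALT 1" for U U'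
  using B.ALT_dom[OF that(2), of "[]"] B.ALT_zero[OF that(1)] by (simp add: B.comp_def)
 show ?thesis by (simp add: B.schouten_comp[OF XA YA] minus_apply fscale c[OF XA YA] c[OF YA XA])
qed

text \<open>Closure under the bracket follows from \<open>[X, Y] f = X (Y f) - Y (X f)\<close>,
  since fibrewise polynomial fields are defined by the functions they preserve.\<close>

lemma field_submodule_fp: "field_submodule B.F (fpf) (fpv)"
proof unfold_locales
 let ?F0 = "fpf" and ?F1 = "fpv"
 show "subspace ?F0" by (rule subspace_fp_functions)
 show "?F0 <= B.F" by (auto simp: fpf_iff)
 show "f * g : ?F0" if "f : ?F0" "g : ?F0" for f g using that by (rule fpf_mult)
 show "subspace ?F1"
  using subspace_fp_functions B.sub_MD[of 1]
  by (auto simp: subspace_def fp_vector_fields_iff fplus[of _ _ "[_]"] fzero[of "[_]"] fscale[of _ "_ :: ('a, 'e) npoint multivector"])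
 show "?F1 <= B.MD 1" by (auto simp: fp_vector_fields_iff)
 show "X [f] : ?F0" if "X : ?F1" "f : ?F0" for X f using that by (simp add: fp_vector_fields_iff)
 show "(%fs. f * X fs) : ?F1" if X: "X : ?F1" and f: "f : ?F0" for X f
  unfolding fp_vector_fields_iff
 proof
  have fF: "f : B.F" using f by (simp add: fpf_iff)
  have X1: "X : B.MD 1" using X by (simp add: fp_vector_fields_iff)
  note XA = B.MD_ALT[OF X1]
  show "(%fs. f * X fs) : B.MD 1"
   unfolding B.MD_def B.ALT_def mem_Collect_eq
  proof (intro conjI allI ballI impI)
   show "f * X fs = 0" if "~ (length fs = 1 & set fs <= B.F)" for fs using B.ALT_dom[OF XA that] by simp
   show "f * X fs : B.F" for fs by (rule B.mult_F[OF fF B.ALT_F[OF XA]])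
   show "f * X (xs @ u # v # ys) = - (f * X (xs @ v # u # ys))" for xs u v ys
    unfolding B.ALT_swap[OF XA, of xs u v ys] by simp
   show "f * X ((r *: g + s *: h) # fs) = r *: (f * X (g # fs)) + s *: (f * X (h # fs))" if "g : B.F" "h : B.F" for g h r s fs
    unfolding B.ALT_lin[OF XA that] by (rule HOL.ext) (simp add: times_fun_apply fplus fscale algebra_simps)
   show "f * X ((g * h) # fs) = g * (f * X (h # fs)) + h * (f * X (g # fs))" if "g : B.F" "h : B.F" for g h fs
    unfolding B.MD_deriv[OF X1 that] by (simp add: algebra_simps)
  qed
  show "ALL g:?F0. f * X [g] : ?F0" using X f fpf_mult by (simp add: fp_vector_fields_iff)
 qed
 show "schouten X Y : ?F1" if X: "X : ?F1" and Y: "Y : ?F1" for X Y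
  using X Y B.schouten_MD[of X 1 Y 1] subspace_diff[OF subspace_fp_functions]
  by (simp add: fp_vector_fields_iff schouten_vector_fields)
qed

sublocale fp: field_submodule "B.F" "fpf" "fpv"
 by (rule field_submodule_fp)

lemma fp_multivector_fields_eq: "fpm k = fp.FP k"
proof -
 have w: "wedge B Xs = B.wedge_F Xs" for Xs by (simp add: wedge_def B.wedge_F_def)
 show ?thesis by (simp add: fp_multivector_fields_def fp.FP_def B.mvf_MD w)
qed

end

section \<open>The graded Lie algebra of multivector fields\<close>

lemma graded_pieceE:
 assumes "x : graded_piece V (i + 1)"
 obtains "x = 0" | k where "i = int k - 1" "x : V k"
proof (cases "i + 1 >= 0")
 case True
 thus thesis using assms that(2)[of "nat (i + 1)"] by (simp add: graded_piece_def)
next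
 case False
 thus thesis using assms that(1) by (simp add: graded_piece_def)
qed

lemma graded_pieceI: "x : V k ==> i = int k - 1 ==> x : graded_piece V (i + 1)"
 by (simp add: graded_piece_def)

lemma subspace_graded_piece: "(!!k. subspace (V k)) ==> subspace (graded_piece V i)"
 by (simp add: graded_piece_def)

context fun_algebra
begin

text \<open>Components of different degrees are supported on lists of different lengths, so a
  vanishing sum can be read off length by length.\<close>

lemma graded_space_ALT:
 assumes V: "!!k. subspace (V k)" "!!k. V k <= ALT k"
 shows "graded_space (%i. graded_piece V (i + 1))"
 unfolding graded_space_def
proof (intro conjI allI impI ballI)
 show "subspace (graded_piece V (i + 1))" for i by (rule subspace_graded_piece[OF V(1)])
 fix I :: "int set" and x i
 assume *: "finite I & (ALL i:I. x i : graded_piece V (i + 1)) & (SUM i:I. x i) = 0" and i: "i : I"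
 have len: "x j fs = 0" if "j : I" "int (length fs) ~= j + 1" for j fs
 proof -
  have "x j : graded_piece V (j + 1)" using * that by blast
  thus ?thesis
  proof (rule graded_pieceE)
   fix k assume "j = int k - 1" "x j : V k"
   thus ?thesis using that(2) V(2) by (intro ALT_dom[of "x j" k]) auto
  qed (simp add: fzero)
 qed
 show "x i = 0"
 proof
  fix fs show "x i fs = 0 fs"
  proof (cases "int (length fs) = i + 1")
   case True
   have "(SUM j:I. x j) fs = (SUM j:I. x j fs)" by (induction I rule: infinite_finite_induct) (simp_all add: fplus fzero)
   also have "... = x i fs + (SUM j:I - {i}. x j fs)" using * i by (intro sum.remove) auto
   also have "(SUM j:I - {i}. x j fs) = 0" by (rule sum.neutral) (use len True in auto)
   finally show ?thesis using * by (simp add: fzero)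
  qed (simp add: len[OF i] fzero)
 qed
qed

lemma schouten_lin_left:
 assumes "X : ALT k" "Y : ALT k" "Z : ALT n"
 shows "schouten (r *: X + s *: Y) Z = r *: schouten X Z + s *: schouten Y Z"
proof -
 have XY: "r *: X : ALT k" "s *: Y : ALT k" by (intro subspace_scale[OF sub_ALT] assms)+
 have XYs: "r *: X + s *: Y : ALT k" by (intro subspace_add[OF sub_ALT] XY)
 show ?thesis
  unfolding schouten_comp[OF assms(1,3)] schouten_comp[OF assms(2,3)] schouten_comp[OF XYs assms(3)]
   comp_add_left comp_scale_left comp_add_right[OF assms(3) XY] comp_scale_right[OF assms(3,1)] comp_scale_right[OF assms(3,2)]
  by (simp add: scaleR_diff_right scaleR_add_right mult.commute)
qed

abbreviation graded_MD :: "int => 'a multivector set" where "graded_MD i == graded_piece MD (i + 1)"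

text \<open>The truncated degree \<open>k + l - 1\<close> is wrong only for two functions; their
  bracket is 0, as it must be in a negative graded piece.\<close>

lemma graded_schouten:
 assumes V: "!!k. V k <= MD k" "!!k. 0 : V k" "!!X Y k l. X : V k ==> Y : V l ==> schouten X Y : V (k + l - 1)"
  and x: "x : graded_piece V (i + 1)" and y: "y : graded_piece V (j + 1)"
 shows "schouten x y : graded_piece V (i + j + 1)"
 using x
proof (rule graded_pieceE)
 have 0: "0 : graded_piece V n" for n using V(2) by (simp add: graded_piece_def)
 show ?thesis if "x = 0" using y
 proof (rule graded_pieceE)
  fix l assume "y : V l"
  hence "y : MD l" using V(1) by blast
  thus ?thesis using schouten_zero(1)[OF MD_ALT] that 0 by simp
 next
  assume "y = 0"
  thus ?thesis using that schouten_zero(1)[OF subspace_0[OF sub_ALT]] 0 by simp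
 qed
 fix k assume k: "i = int k - 1" "x : V k"
 have xM: "x : MD k" using V(1) k by auto
 show ?thesis using y
 proof (rule graded_pieceE)
  assume "y = 0" thus ?thesis using schouten_zero(2)[OF MD_ALT[OF xM]] 0 by simp
 next
  fix l assume l: "j = int l - 1" "y : V l"
  have yM: "y : MD l" using V(1) l by auto
  show ?thesis
  proof (cases "k + l = 0")
   case True
   thus ?thesis using schouten_0_0 MD_ALT[OF xM] MD_ALT[OF yM] 0 by simp
  next
   case False
   hence "i + j = int (k + l - 1) - 1" using k l by auto
   thus ?thesis by (rule graded_pieceI[of _ V, OF V(3)[OF k(2) l(2)]])
  qed
 qed
qed

lemma graded_lin:
 assumes x: "x : graded_MD i" "y : graded_MD i" and z: "z : graded_MD j"
 shows "schouten (r *: x + s *: y) z = r *: schouten x z + s *: schouten y z"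
proof -
 have "EX k. x : ALT k & y : ALT k" "EX n. z : ALT n"
  using x z MD_ALT subspace_0[OF sub_ALT] by (auto simp: graded_piece_def split: if_splits)
 thus ?thesis using schouten_lin_left by blast
qed

lemma graded_anti:
 assumes x: "x : graded_MD i" and y: "y : graded_MD j"
 shows "schouten x y = - (sg (i * j) *: schouten y x)"
proof -
 have z: "schouten 0 u = 0" "schouten u 0 = 0" if "u : graded_MD n" for u n
  using that schouten_zero[OF MD_ALT] schouten_zero[OF subspace_0[OF sub_ALT]]
  by (auto elim!: graded_pieceE)
 from x show ?thesis
 proof (rule graded_pieceE)
  assume "x = 0" thus ?thesis using z[OF y] by simp
 next
  fix k assume k: "i = int k - 1" "x : MD k"
  from y show ?thesis
  proof (rule graded_pieceE)
   assume "y = 0" thus ?thesis using z[OF x] by simp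
  next
   fix l assume l: "j = int l - 1" "y : MD l"
   show ?thesis unfolding k(1) l(1) by (rule schouten_anti[OF MD_ALT[OF k(2)] MD_ALT[OF l(2)]])
  qed
 qed
qed

lemma graded_jacobi:
 assumes x: "x : graded_MD i" and y: "y : graded_MD j" and z: "z : graded_MD n"
 shows "schouten (schouten x y) z = schouten x (schouten y z) + sg (j * n) *: schouten (schouten x z) y"
proof -
 have 0: "schouten 0 u = 0" "schouten u 0 = 0" if "u : graded_MD n" for u n
  using that schouten_zero[OF MD_ALT] schouten_zero[OF subspace_0[OF sub_ALT]]
  by (auto elim!: graded_pieceE)
 have br: "schouten u v : graded_MD (a + b)" if "u : graded_MD a" "v : graded_MD b" for u v a b
  by (rule graded_schouten[OF _ subspace_0[OF sub_MD] schouten_MD that]) simp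
 consider "x = 0" | "y = 0" | "z = 0" | a b c where "i = int a - 1" "x : MD a" "j = int b - 1" "y : MD b" "n = int c - 1" "z : MD c"
  using x y z by (elim graded_pieceE) auto
 thus ?thesis
 proof cases
  case 1 thus ?thesis using 0[OF y] 0[OF z] 0[OF br[OF y z]] by simp
 next
  case 2 thus ?thesis using 0[OF x] 0[OF z] 0[OF br[OF x z]] by simp
 next
  case 3 thus ?thesis using 0[OF x] 0[OF y] 0[OF br[OF x y]] by simp
 next
  case 4
  thus ?thesis using schouten_jacobi[OF MD_ALT MD_ALT MD_ALT, of x a y b z c] by simp
 qed
qed

end

section \<open>The derived bracket data on the normal bundle\<close>

context tubular
begin

lemma schouten_fp: "X : fpm k ==> Y : fpm l ==>
  schouten X Y : fpm (k + l - 1)"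
 unfolding fp_multivector_fields_eq by (rule fp.schouten_FP)

lemma fp_MD: "X : fpm k ==> X : B.MD k"
 unfolding fp_multivector_fields_eq by (rule fp.FP_MD)

lemma subspace_fp: "subspace (fpm k)"
 unfolding fp_multivector_fields_eq by (rule fp.sub_FP)

lemma RP_zero: "RP 0 = 0"
 using RP_lin[of 0 0 0 0 0] by (simp add: subspace_0[OF B.sub_MD])

lemma derived_brackets_multivector_fields:
 assumes po: "po : fpm 2" "schouten po po = 0" "RP po = 0"
 shows "derived_brackets B.graded_MD (%i. graded_piece N (i + 1)) (%i. graded_piece (fpm) (i + 1))
  schouten RP po"
proof
 show "subspace (B.graded_MD i)" for i by (rule subspace_graded_piece[OF B.sub_MD])
 show "graded_space (%i. graded_piece N (i + 1))"
  by (rule B.graded_space_ALT[OF subspace_N]) (auto intro: N_MD B.MD_ALT)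
 show "graded_space (%i. graded_piece (fpm) (i + 1))"
  by (rule B.graded_space_ALT[OF subspace_fp]) (auto intro: fp_MD B.MD_ALT)
 show "graded_piece N (i + 1) <= B.graded_MD i" "graded_piece (fpm) (i + 1) <= B.graded_MD i" for i
  using N_MD fp_MD by (auto simp: graded_piece_def)
 show "schouten x y : B.graded_MD (i + j)" if "x : B.graded_MD i" "y : B.graded_MD j" for x y i j
  by (rule B.graded_schouten[OF _ subspace_0[OF B.sub_MD] B.schouten_MD that]) simp
 show "schouten x y : graded_piece (fpm) (i + j + 1)"
  if "x : graded_piece (fpm) (i + 1)" "y : graded_piece (fpm) (j + 1)" for x y i j
  by (rule B.graded_schouten[OF _ subspace_0[OF subspace_fp] schouten_fp that]) (auto intro: fp_MD)
 show "schouten (r *: x + s *: y) z = r *: schouten x z + s *: schouten y z"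
  if "x : B.graded_MD i" "y : B.graded_MD i" "z : B.graded_MD j" for x y z i j r s by (rule B.graded_lin[OF that])
 show "schouten x y = - (sg (i * j) *: schouten y x)" if "x : B.graded_MD i" "y : B.graded_MD j" for x y i j
  by (rule B.graded_anti[OF that])
 show "schouten (schouten x y) z = schouten x (schouten y z) + sg (j * k) *: schouten (schouten x z) y"
  if "x : B.graded_MD i" "y : B.graded_MD j" "z : B.graded_MD k" for x y z i j k by (rule B.graded_jacobi[OF that])
 show "RP x : graded_piece N (i + 1)" if "x : B.graded_MD i" for x i
  using that RP_N by (auto simp: graded_piece_def RP_zero)
 show "RP (r *: x + s *: y) = r *: RP x + s *: RP y" if "x : B.graded_MD i" "y : B.graded_MD i" for x y i r s
  using that RP_lin RP_zero by (auto simp: graded_piece_def split: if_splits)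
 have N0: "N k <= B.MD k" for k using N_MD by auto
 show "schouten a b = 0" if "a : graded_piece N (i + 1)" "b : graded_piece N (j + 1)" for a b i j
  using that N_abelian[OF subspace_0[OF subspace_N] subspace_0[OF subspace_N]] N_abelian[OF subspace_0[OF subspace_N]] N_abelian[OF _ subspace_0[OF subspace_N]] N_abelian
  by (auto simp: graded_piece_def split: if_splits)
 show "RP (schouten x y) = RP (schouten (RP x) y) + RP (schouten x (RP y))" if "x : B.graded_MD i" "y : B.graded_MD j" for x y i j
 proof -
  have "EX k. x : B.MD k" "EX k. y : B.MD k"
   using that subspace_0[OF B.sub_MD] by (auto simp: graded_piece_def split: if_splits)
  thus ?thesis using RP_schouten by blast
 qed
 show "po : graded_piece (fpm) (1 + 1)" using po by (simp add: graded_piece_def)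
 show "schouten po po = 0" "RP po = 0" by (rule po)+
qed

section \<open>Normal sections as vertical vector fields\<close>

abbreviation section_coord :: "('a => ('a, 'e) nvector) => ('a, 'e) chart => 'e set => 'e => 'e" where
 "section_coord s c S z == coord c S (s (fst (cinv (nch c S) z)))"

lemma nsec_iff:
 "s : nsec \<longleftrightarrow> (ALL p:C. s p : V p) &
  (ALL c S. slice c S --> smooth_on {z. oproj S z : cimg c} (section_coord s c S))"
 by (auto simp: normal_sections_def nch_image(1))

lemma section_coord_apply:
 assumes "slice c S" "p : fst c" "p : C" "u : V p"
 shows "section_coord s c S (snd (nch c S) (p, u)) = coord c S (s p)"
 using ch_simps(1)[OF nch_image(2)[OF assms(1)], of "(p, u)"] assms by (simp add: nch_dom)

lemma vlift_apply:
 "f : B.F ==> p : C ==> w : V p ==> vlift s [f] (p, w) = vd (p, w) f (s p)"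
 by (simp add: vertical_lift_def in_npts)

lemma vlift_off:
 "~ (length fs = 1 & set fs <= B.F) ==> vlift s fs = 0" "q ~: npts ==> vlift s fs q = 0"
 by (auto simp: vertical_lift_def fun_eq_iff fzero)

lemma vlift_MD:
 assumes s: "s : nsec" shows "vlift s : B.MD 1"
 unfolding B.MD_def B.ALT_def mem_Collect_eq
proof (intro conjI allI ballI impI)
 let ?a = "vlift s"
 have sV: "s p : V p" if "p : C" for p using s that by (simp add: nsec_iff)
 show off: "?a fs = 0" if "~ (length fs = 1 & set fs <= B.F)" for fs by (rule vlift_off(1)[OF that])
 show "?a fs : B.F" for fs
 proof (cases "length fs = 1 & set fs <= B.F")
  case True
  then obtain f where f: "fs = [f]" "f : B.F" by (cases fs) auto
  show ?thesis unfolding f(1)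
  proof (rule smooth_via_chart)
   show "?a [f] q = 0" if "q ~: npts" for q by (rule vlift_off(2)[OF that])
   fix c S assume cS: "slice c S"
   note W = oproj_domain(1)[OF cS]
   have si: "smooth_on {z. oproj S z : cimg c} (section_coord s c S)" using s cS unfolding nsec_iff by blast
   show "smooth_on {z. oproj S z : cimg c} (%z. fder (f o cinv (nch c S)) (at z) (section_coord s c S z))"
    by (rule sm_deriv_apply[OF W sm_ident[OF W] _ si rep_smooth[OF cS f(2)]]) simp
   fix p u assume p: "p : fst c" "p : C" "u : V p"
   show "?a [f] (p, u) = fder (f o cinv (nch c S)) (at (snd (nch c S) (p, u)))
     (section_coord s c S (snd (nch c S) (p, u)))"
    unfolding section_coord_apply[OF cS p] vlift_apply[OF f(2) p(2,3)]
    by (rule vd_eq[OF cS p sV[OF p(2)] f(2)])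
  qed
 next
  case False
  from off[OF False] show ?thesis by simp
 qed
 show "?a ((r *: f + t *: g) # fs) = r *: ?a (f # fs) + t *: ?a (g # fs)" if fg: "f : B.F" "g : B.F" for f g r t fs
 proof (cases "fs = []")
  case True
  have F: "r *: f + t *: g : B.F" using fg by simp
  show ?thesis unfolding True
   by (rule normal_cases) (simp_all only: vlift_apply[OF F] vlift_apply[OF fg(1)] vlift_apply[OF fg(2)] B.lin_apply
    vd_lin[OF _ _ fg] vlift_off(2) real_scaleR_def mult_zero_right add_0_right simp_thms)
 qed (simp add: off)
 show "?a ((f * g) # fs) = f * ?a (g # fs) + g * ?a (f # fs)" if fg: "f : B.F" "g : B.F" for f g fs
 proof (cases "fs = []")
  case True
  have F: "f * g : B.F" using fg by simp
  show ?thesis unfolding True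
   by (rule normal_cases) (simp_all add: vlift_apply[OF F] vlift_apply[OF fg(1)] vlift_apply[OF fg(2)]
    fplus times_fun_apply fscale[of _ "vertical_differential A C _ _"] vd_mult[OF _ _ fg] vlift_off(2))
 qed (simp add: off)
 show "?a (xs @ u # v # ys) = - ?a (xs @ v # u # ys)" for xs u v ys
 proof -
  have "?a (xs @ u # v # ys) = 0" "?a (xs @ v # u # ys) = 0" by (rule off, simp)+
  thus ?thesis by simp
 qed
qed

lemma vlift_N:
 assumes s: "s : nsec" shows "vlift s : N 1"
 unfolding N_iff
proof
 let ?a = "vlift s"
 show a: "?a : B.MD 1" by (rule vlift_MD[OF s])
 show "RP ?a = ?a"
 proof (rule MD_eqI[OF RP_MD[OF a] a])
  fix p w and fs :: "(('a, 'e) npoint => real) list"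
  assume p: "p : C" "w : V p" and fs: "length fs = 1" "set fs <= B.F"
  obtain f where f: "fs = [f]" "f : B.F" using fs by (cases fs) auto
  note l = lift[OF p f(2)]
  have "RP ?a fs (p, w) = ?a [lift (p, w) f] (zp p)" using RP_lift[OF a p fs(2)] f(1) by simp
  also have "... = vd (zp p) (lift (p, w) f) (s p)"
   using vlift_apply[OF La_F[OF l(1)] p(1) zpV(2)[OF p(1)]] by (simp add: zpV(1)[OF p(1)])
  also have "... = ?a fs (p, w)" by (simp add: La_vd[OF l(1) p(1)] l(2) f vlift_apply[OF f(2) p])
  finally show "RP ?a fs (p, w) = ?a fs (p, w)" .
 qed
qed

text \<open>On fibrewise linear functions, \<open>a\<close> at a point is a linear functional of the
  conormal covector, hence evaluation at one normal vector; its coordinates are assembled from the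
  values on coordinate functions.\<close>

lemma N1_at:
 assumes a: "a : N 1" and p: "p : C"
 shows "EX v:V p. ALL l:La. a [l] (zp p) = l (p, v)"
proof -
 note aM = N_MD[OF a]
 obtain c S r where cS: "slice c S" "p : fst c" "slice_point A C c S p" and r: "r > 0" "ball (snd c p) r <= cimg c"
  using p by (rule obtain_slice_ball)
 interpret sp: slice_point A C c S p by (rule cS(3))
 let ?l = "lincoord c S (snd c p) r"
 note lLa = lincoord_La[OF cS(1) r]
 have lp: "?l b (p, u) = b \<bullet> coord c S u" if "u : V p" for b u
  using lincoord_apply[OF cS(1) p that, of "snd c p" r b] cS(2) r(1) bump_center[of "r / 2" "snd c p"] by simp
 define y where "y = (SUM b:Basis. a [?l b] (zp p) *: b)"
 have rep: "a [l] (zp p) = al \<bullet> y" if l: "l : La" "!!u. u : V p ==> l (p, u) = al \<bullet> coord c S u" for l al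
 proof -
  have "fib p l = fib p (SUM b:Basis. (al \<bullet> b) *: ?l b)"
  proof
   fix u show "fib p l u = fib p (SUM b:Basis. (al \<bullet> b) *: ?l b) u"
    unfolding fib_sum[OF finite_Basis lLa]
   proof (cases "u : V p")
    case True
    show "fib p l u = (SUM b:Basis. (al \<bullet> b) * fib p (?l b) u)"
     using True euclidean_inner[of al "coord c S u"] by (simp add: fib_def l(2) lp inner_commute)
   qed (simp add: fib_def)
  qed
  hence "a ([] @ [l]) (zp p) = a ([] @ [SUM b:Basis. (al \<bullet> b) *: ?l b]) (zp p)"
   by (intro MD_fib_cong[OF aM p]) (use l(1) lLa in \<open>auto intro!: subspace_sum[OF La_subspace] subspace_scale[OF La_subspace]\<close>)
  also have "... = (SUM b:Basis. (al \<bullet> b) * a ([] @ [?l b]) (zp p))"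
   by (rule ALT_slot_sum[OF B.MD_ALT[OF aM]]) (simp_all add: La_F lLa)
  also have "... = al \<bullet> y" by (simp add: y_def inner_sum_right mult.commute)
  finally show ?thesis by simp
 qed
 have "a [l] (zp p) = l (p, M.nv p c S y)" if l: "l : La" for l
 proof -
  have "fib p l : cnf p" using l p by (simp add: La_def)
  then obtain al where "!!u. u : V p ==> fib p l u = al \<bullet> coord c S u" using conormal_fibre_repr[OF _ cS(1,2) p] by blast
  hence al: "l (p, u) = al \<bullet> coord c S u" if "u : V p" for u using that by (simp add: fib_def split: if_splits)
  have orth: "v \<bullet> w = 0" if "v : S" "w : ocomp S" for v w using that by (simp add: orthogonal_comp_def orthogonal_def)
  \<comment> \<open>Fibre coordinates are orthogonal to \<open>S\<close>, so the representing vector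
    may be projected. The pairing with \<open>y\<close> then depends on \<open>y\<close> only modulo
    \<open>S\<close>, as it must for a normal vector.\<close>
  have al': "l (p, u) = perp S al \<bullet> coord c S u" if u: "u : V p" for u
   using al[OF u] orth[OF perp_props(2)[OF sp.S] sp.coord_comp[OF u], of al] by (simp add: inner_diff_left)
  have "a [l] (zp p) = perp S al \<bullet> y" by (rule rep[OF l al'])
  also have "... = perp S al \<bullet> perp S y"
   using orth[OF perp_props(2)[OF sp.S] perp_props(1)[OF sp.S], of y al] by (simp add: inner_diff_left inner_commute[of "perp S al"])
  also have "... = l (p, M.nv p c S y)" by (simp add: al' sp.nv_normal)
  finally show ?thesis .
 qed
 thus ?thesis using sp.nv_normal by blast
qed

text \<open>Identifies the degree 0 part of the second summand with sections of \<nu>C. The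
  pointwise vectors of \<open>N1_at\<close> form a smooth section because their coordinates are
  values of \<open>a\<close> on fixed functions, divided by the bump.\<close>

lemma N1_vertical_lift:
 assumes a: "a : N 1" shows "EX s:nsec. a = vlift s"
proof -
 note aM = N_MD[OF a]
 have "ALL p:C. EX v. v : V p & (ALL l:La. a [l] (zp p) = l (p, v))" using N1_at[OF a] by blast
 then obtain s where s: "!!p. p : C ==> s p : V p" "!!p l. p : C ==> l : La ==> a [l] (zp p) = l (p, s p)" by metis
 have ap: "a [f] (p, w) = vd (p, w) f (s p)" if p: "p : C" "w : V p" and f: "f : B.F" for p w f
 proof -
  have "a [f] (p, w) = a [lift (p, w) f] (zp p)" using RP_lift[OF aM p, of "[f]"] RP_id[OF a] f by simp
  also have "... = fib p (lift (p, w) f) (s p)" using s(2)[OF p(1) lift(1)[OF p f]] s(1)[OF p(1)] by (simp add: fib_def)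
  finally show ?thesis by (simp add: lift(2)[OF p f])
 qed
 have "smooth_on {z. oproj S z : cimg c} (section_coord s c S)" if cS: "slice c S" for c S
 proof (rule sm_local)
  let ?T = "nch c S" and ?Om = "{z. oproj S z : cimg c}"
  show "open ?Om" by (rule oproj_domain(1)[OF cS])
  fix z0 assume "z0 : ?Om"
  hence z0: "oproj S z0 : cimg c" by simp
  obtain r where r: "r > 0" "ball (oproj S z0) r <= cimg c"
   using ch_simps(4)[OF M.sliceD(4)[OF cS]] z0 openE by blast
  let ?l = "lincoord c S (oproj S z0) r" and ?bt = "%z. bump (oproj S z0) (r / 2) (oproj S z)"
  note lLa = lincoord_La[OF cS r]
  obtain W where W: "open W" and Wd: "W <= ?Om" and W0: "!!z. oproj S z = oproj S z0 ==> z : W"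
   and WW: "!!z. z : W ==> oproj S z : ball (oproj S z0) r & ?bt z ~= 0" and inv: "smooth_on W (%z. inverse (?bt z))"
   using bump_domain[OF cS r] by blast
  have "smooth_on W (%z. SUM b:Basis. ((a [?l b] o cinv ?T) z * inverse (?bt z)) *: b)"
   by (intro sm_sum sm_scaleR sm_const sm_mult W inv
     sm_subset[OF rep_smooth[OF cS B.ALT_F[OF B.MD_ALT[OF aM]]] Wd])
  hence "smooth_on W (section_coord s c S)"
  proof (rule sm_cong[OF W])
   fix z assume z: "z : W"
   hence z': "oproj S z : cimg c" using Wd by blast
   note o = slice_oproj[OF cS z'] and n = slice_point.nv_normal[OF slice_oproj(4)[OF cS z']]
   let ?x = "cinv c (oproj S z)"
   have ci: "cinv ?T z = (?x, M.nv ?x c S z)" by (rule nch_image(3)[OF cS z'])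
   have ball: "snd c ?x : ball (oproj S z0) r" using WW[OF z] o(3) by simp
   have "a [?l b] (?x, M.nv ?x c S z) = ?bt z * (b \<bullet> coord c S (s ?x))" for b
   proof -
    have "a [?l b] (?x, M.nv ?x c S z) = ?l b (?x, s ?x)"
     using ap[OF o(2) n La_F[OF lLa], of b] s(1)[OF o(2)] by (simp add: vd_La[OF lLa o(2) n] fib_def)
    thus ?thesis using ball by (simp add: lincoord_apply[OF cS o(2) s(1)[OF o(2)]] o)
   qed
   hence "(SUM b:Basis. ((a [?l b] o cinv ?T) z * inverse (?bt z)) *: b) = (SUM b:Basis. (coord c S (s ?x) \<bullet> b) *: b)"
    using WW[OF z] by (intro sum.cong refl) (simp add: ci inner_commute)
   thus "(SUM b:Basis. ((a [?l b] o cinv ?T) z * inverse (?bt z)) *: b) = section_coord s c S z"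
    by (simp add: ci euclidean_representation)
  qed
  moreover have "z0 : W" by (rule W0) (rule refl)
  ultimately show "EX U. open U & z0 : U & smooth_on (?Om Int U) (section_coord s c S)"
   using W Wd by (intro exI[of _ W]) (simp add: Int_absorb1)
 qed
 hence sN: "s : nsec" using s(1) by (simp add: nsec_iff)
 moreover have "a = vlift s"
 proof (rule MD_eqI[OF aM vlift_MD[OF sN]])
  fix p w and fs :: "(('a, 'e) npoint => real) list"
  assume p: "p : C" "w : V p" and fs: "length fs = 1" "set fs <= B.F"
  obtain f where "fs = [f]" using fs by (cases fs) auto
  thus "a fs (p, w) = vlift s fs (p, w)" using fs ap[OF p] vlift_apply[OF _ p] by simp
 qed
 ultimately show ?thesis by blast
qed

end

section \<open>Graphs of normal sections\<close>

context smooth_atlas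
begin

text \<open>Compatibility with the whole atlas is obtained by passing through \<open>c0\<close>,
  which covers every point of the common domain.\<close>

lemma smooth_charts_same_domain:
 assumes c0: "c0 : smooth_charts A" and c: "is_chart c" and dom: "fst c = fst c0"
  and tr: "smooth_transition c c0" "smooth_transition c0 c"
 shows "c : smooth_charts A"
proof -
 note cc0 = smch_chart[OF c0]
 have glue: "smooth_transition e d"
  if e: "is_chart e" "is_chart d" and via: "!!x. x : fst e ==> x : fst d ==> x : fst c0"
   "smooth_transition e c0" "smooth_transition c0 d" for e d
 proof -
  let ?U = "snd e ` (fst e Int fst d)"
  have loc: "EX W. open W & z : W & W <= ?U & smooth_on W (snd d o cinv e)" if z: "z : ?U" for z
  proof -
   obtain x where x: "z = snd e x" "x : fst e" "x : fst d" using z by auto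
   obtain W where "open W" "snd e x : W" "W <= snd e ` (fst e Int fst c0 Int fst d)" "smooth_on W (snd d o cinv e)"
    using smooth_transition_via[OF e(1) cc0 e(2) via(2,3) x(2) via(1)[OF x(2,3)] x(3)] by blast
   thus ?thesis using x(1) by (intro exI[of _ W]) auto
  qed
  hence o: "open ?U" by (subst open_subopen) blast
  have "smooth_on ?U (snd d o cinv e)"
  proof (rule sm_local[OF o])
   fix z assume "z : ?U"
   then obtain W where "open W" "z : W" "W <= ?U" "smooth_on W (snd d o cinv e)" using loc by blast
   thus "EX V. open V & z : V & smooth_on (?U Int V) (snd d o cinv e)"
    by (intro exI[of _ W]) (simp add: Int_absorb1)
  qed
  thus ?thesis using o by (simp add: smooth_transition_def)
 qed
 show ?thesis
  unfolding smooth_charts_def mem_Collect_eq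
 proof (intro conjI ballI)
  show "fst c <= carrier_of A" using smch_carrier[OF c0] dom by auto
  fix d assume d: "d : A"
  note ds = atlas_smch[OF d]
  show "smooth_transition c d" by (rule glue[OF c atlas_chart[OF d] _ tr(1) smch_trans[OF c0 ds]]) (simp add: dom)
  show "smooth_transition d c" by (rule glue[OF atlas_chart[OF d] c _ smch_trans[OF ds c0] tr(2)]) (simp add: dom)
 qed (rule c)
qed

end

context tubular
begin

text \<open>The bundle chart sheared by adding the section; it flattens the graph of the negative
  section to \<open>S\<close>.\<close>

definition graph_chart :: "('a => ('a, 'e) nvector) => ('a, 'e) chart => 'e set => (('a, 'e) npoint, 'e) chart" where
 "graph_chart s c S = (fst (nch c S), %q. snd (nch c S) q + coord c S (s (fst q)))"

lemma graph_chart_smooth: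
 assumes s: "s : nsec" and cS: "slice c S"
 shows "graph_chart s c S : smooth_charts B"
  and "q : fst (graph_chart s c S) ==> oproj S (snd (graph_chart s c S) q) = snd c (fst q)"
proof -
 let ?T = "nch c S" and ?G = "graph_chart s c S" and ?Om = "{z. oproj S z : cimg c}"
 note c = M.sliceD[OF cS]
 note T = nch_smooth[OF cS] and Tc = nch_image(2)[OF cS] and Tim = nch_image(1)[OF cS]
 have sV: "s p : V p" if "p : C" for p using s that by (simp add: nsec_iff)
 have comp: "oproj S (coord c S (s x)) = 0" if "x : fst c" "x : C" for x
  by (rule oproj_comp[OF c(2) slice_point.coord_comp[OF slice_pointI[OF cS that] sV[OF that(2)]]])
 have dom: "fst q : fst c" "fst q : C" "oproj S (snd ?T q) = snd c (fst q)" if "q : fst ?T" for q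
  using that nch_dom[of "fst q" "snd q"] nch_oproj(1)[OF cS, of "fst q" "snd q"] by simp_all
 have Gdom: "fst ?G = fst ?T" and G: "snd ?G q = snd ?T q + coord c S (s (fst q))" for q by (simp_all add: graph_chart_def)
 show op: "oproj S (snd ?G q) = snd c (fst q)" if "q : fst ?G" for q
  using dom[of q] comp[of "fst q"] that by (simp add: G Gdom linear_add[OF linear_oproj[OF c(2)]])
 have si: "smooth_on ?Om (section_coord s c S)" using s cS unfolding nsec_iff by blast
 note W = oproj_domain(1)[OF cS]
 have fst_inv: "fst (cinv ?T z) = cinv c (oproj S z)" if "z : ?Om" for z
  using nch_image(3)[OF cS, of z] that by simp
 have inj: "inj_on (snd ?G) (fst ?G)"
 proof (rule inj_onI)
  fix q q' assume q: "q : fst ?G" "q' : fst ?G" and eq: "snd ?G q = snd ?G q'"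
  have "snd c (fst q) = snd c (fst q')" using op[OF q(1)] op[OF q(2)] eq by simp
  hence f: "fst q = fst q'" using dom q Gdom by (intro is_chart_inj[OF c(4)]) simp_all
  hence "snd ?T q = snd ?T q'" using eq by (simp add: G)
  thus "q = q'" using q Gdom by (intro is_chart_inj[OF Tc]) simp_all
 qed
 have pre: "cinv ?T (z - section_coord s c S z) : fst ?G & snd ?G (cinv ?T (z - section_coord s c S z)) = z
   & snd ?T (cinv ?T (z - section_coord s c S z)) = z - section_coord s c S z" if z: "z : ?Om" for z
 proof -
  let ?x = "cinv c (oproj S z)" and ?y = "z - section_coord s c S z"
  have o: "oproj S z : cimg c" using z by simp
  note x = slice_oproj[OF cS o]
  have "oproj S ?y = oproj S z" using comp[OF x(1,2)] by (simp add: linear_diff[OF linear_oproj[OF c(2)]] fst_inv[OF z])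
  hence y: "?y : ?Om" and fy: "fst (cinv ?T ?y) = ?x" using z fst_inv[of ?y] by simp_all
  have "cinv ?T ?y : fst ?T" "snd ?T (cinv ?T ?y) = ?y"
   using ch_simps(2,3)[OF Tc, of ?y] y unfolding Tim by blast+
  thus ?thesis unfolding G Gdom fy unfolding fst_inv[OF z] by simp
 qed
 have im: "cimg ?G = ?Om"
 proof (intro equalityI subsetI)
  fix z assume "z : cimg ?G"
  then obtain q where q: "z = snd ?G q" "q : fst ?G" by blast
  thus "z : ?Om" using op[OF q(2)] dom(1)[of q] Gdom by simp
 next
  fix z assume "z : ?Om"
  from pre[OF this] show "z : cimg ?G" by (intro image_eqI[of _ _ "cinv ?T (z - section_coord s c S z)"]) simp_all
 qed
 have Gc: "is_chart ?G" using inj W by (simp add: is_chart_def im)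
 have inv: "cinv ?G z = cinv ?T (z - section_coord s c S z)" if z: "z : ?Om" for z
  using ch_simps(1)[OF Gc conjunct1[OF pre[OF z]]] pre[OF z] by simp
 show "?G : smooth_charts B"
 proof (rule B.smooth_charts_same_domain[OF T Gc Gdom])
  have "smooth_on ?Om (%z. z - section_coord s c S z)" by (intro sm_diff sm_ident W si)
  hence "smooth_on ?Om (snd ?T o cinv ?G)"
  proof (rule sm_cong[OF W])
   fix z assume z: "z : ?Om"
   have "snd ?T (cinv ?G z) = z - section_coord s c S z"
    using pre[OF z] by (simp only: inv[OF z])
   thus "z - section_coord s c S z = (snd ?T o cinv ?G) z" by simp
  qed
  thus "smooth_transition ?G ?T" using W im by (simp add: smooth_transition_def Gdom)
  have "smooth_on ?Om (%z. z + section_coord s c S z)" by (intro sm_add sm_ident W si)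
  hence "smooth_on ?Om (snd ?G o cinv ?T)"
  proof (rule sm_cong[OF W])
   fix z assume "z : ?Om"
   hence "snd ?T (cinv ?T z) = z" using ch_simps(2)[OF Tc, of z] unfolding Tim by blast
   thus "z + section_coord s c S z = (snd ?G o cinv ?T) z" by (simp add: G)
  qed
  thus "smooth_transition ?T ?G" using W Tim by (simp add: smooth_transition_def Gdom)
 qed
qed

lemma graph_slice:
 assumes s: "s : nsec" and cS: "slice c S"
 shows "slice_chart B (graph s) (graph_chart s c S) S"
 unfolding slice_chart_def
proof (intro conjI)
 let ?T = "nch c S" and ?G = "graph_chart s c S"
 note c = M.sliceD[OF cS]
 have sV: "s p : V p" if "p : C" for p using s that by (simp add: nsec_iff)
 show "?G : smooth_charts B" "subspace S" by (rule graph_chart_smooth(1)[OF s cS], rule c(2))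
 have iff: "snd ?G (p, u) : S \<longleftrightarrow> u = nsc p (-1) (s p)" if q: "(p, u) : fst ?T" for p u
 proof -
  have p: "p : fst c" "p : C" "u : V p" using q by (simp_all add: nch_dom)
  interpret sp: slice_point A C c S p by (rule slice_pointI[OF cS p(1,2)])
  note sp' = sV[OF p(2)]
  have pS: "snd c p : S" using c(5)[OF p(1)] p(2) by simp
  let ?n = "coord c S u + coord c S (s p)"
  have n: "?n : ocomp S" by (intro subspace_add[OF subspace_orthogonal_comp] sp.coord_comp p sp')
  have "snd ?G (p, u) = snd c p + ?n" by (simp add: graph_chart_def nch_apply)
  hence "snd ?G (p, u) : S \<longleftrightarrow> ?n : S" using subspace_add[OF c(2) pS, of ?n] subspace_diff[OF c(2) _ pS, of "snd c p + ?n"] by auto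
  also have "... \<longleftrightarrow> ?n = 0" using orthogonal_comp_Int[OF _ n] subspace_0[OF c(2)] by metis
  also have "... \<longleftrightarrow> coord c S u = coord c S (nsc p (-1) (s p))"
   by (simp add: sp.coord_nscale[OF sp'] add_eq_0_iff2)
  also have "... \<longleftrightarrow> u = nsc p (-1) (s p)" using sp.coord_inj[OF p(3) sp.nscale_normal[OF sp']] by blast
  finally show ?thesis .
 qed
 have Gdom: "fst ?G = fst ?T" by (simp add: graph_chart_def)
 show "snd ?G ` (fst ?G Int graph s) = cimg ?G Int S"
 proof (intro equalityI subsetI)
  fix z assume "z : snd ?G ` (fst ?G Int graph s)"
  then obtain p where q: "z = snd ?G (p, nsc p (-1) (s p))" "(p, nsc p (-1) (s p)) : fst ?G" by (auto simp: graph_minus_def)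
  thus "z : cimg ?G Int S" using iff[OF q(2)[unfolded Gdom]] by blast
 next
  fix z assume "z : cimg ?G Int S"
  then obtain p u where q: "z = snd ?G (p, u)" "(p, u) : fst ?G" "z : S" by force
  hence "u = nsc p (-1) (s p)" "p : C" using iff[OF q(2)[unfolded Gdom]] by (simp_all add: Gdom nch_dom)
  hence "(p, u) : graph s" by (simp add: graph_minus_def)
  thus "z : snd ?G ` (fst ?G Int graph s)" using q by blast
 qed
qed

lemma graph_submanifold:
 assumes s: "s : nsec"
 shows "submanifold B (graph s)"
proof -
 have sV: "nsc p (-1) (s p) : V p" if "p : C" for p using s that V_closed(2)[OF that] by (simp add: nsec_iff)
 obtain d where d: "!!p. p : C ==> EX c S. slice c S & p : fst c & dim S = d"
  using submanifold_C unfolding submanifold_def by blast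
 show ?thesis
  unfolding submanifold_def carrier_bundle
 proof (intro conjI exI[of _ d] ballI)
  show "graph s <= npts" using sV by (auto simp: graph_minus_def in_npts)
  fix q assume "q : graph s"
  then obtain p where p: "q = (p, nsc p (-1) (s p))" "p : C" by (auto simp: graph_minus_def)
  obtain c S where cS: "slice c S" "p : fst c" "dim S = d" using d[OF p(2)] by blast
  have "q : fst (graph_chart s c S)" using p cS sV by (simp add: graph_chart_def nch_dom)
  thus "EX c S. slice_chart B (graph s) c S & q : fst c & dim S = d" using graph_slice[OF s cS(1)] cS(3) by blast
 qed
qed

text \<open>At a point of the graph the tangent space is the sum of the tangent space of the graph
  and of the fibre directions, so a conormal covector is determined by its vertical part.\<close>

lemma graph_differential_eqI:
 assumes s: "s : nsec" and p: "p : C" and w: "w = nsc p (-1) (s p)"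
  and f: "f : B.F" and g: "g : B.F"
  and con: "dif B (p, w) f : conormal_space B (graph s) (p, w)"
   "dif B (p, w) g : conormal_space B (graph s) (p, w)"
  and vd: "vd (p, w) f = vd (p, w) g"
 shows "dif B (p, w) f = dif B (p, w) g"
proof -
 have sV: "s p : V p" and wV: "w : V p" using s p V_closed(2)[OF p] by (simp_all add: nsec_iff w)
 have qc: "(p, w) : carrier_of B" using p wV by (simp add: carrier_bundle in_npts)
 obtain c S where cS: "slice c S" "p : fst c" "slice_point A C c S p" using p by (rule obtain_slice)
 interpret sp: slice_point A C c S p by (rule cS(3))
 let ?G = "graph_chart s c S"
 note sl = graph_slice[OF s cS(1)]
 have qG: "(p, w) : fst ?G" using p cS wV by (simp add: graph_chart_def nch_dom)
 have qg: "(p, w) : graph s" using p by (simp add: graph_minus_def w)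
 have Gat: "?G : charts_at B (p, w)" using graph_chart_smooth(1)[OF s cS(1)] qG by (simp add: charts_at_def)
 show ?thesis
 proof (rule B.cot_eqI[OF B.dif_cotangent[OF f qc] B.dif_cotangent[OF g qc]])
  fix v assume v: "v : tsp B (p, w)"
  define v1 where "v1 = B.tvec (p, w) ?G (oproj S (v ?G))"
  define v2 where "v2 = B.tvec (p, w) ?G (perp S (v ?G))"
  have v12: "v1 : tsp B (p, w)" "v2 : tsp B (p, w)"
   unfolding v1_def v2_def by (rule B.tvec_tangent[OF Gat])+
  have "v = 1 *: v1 + 1 *: v2"
   by (rule B.tangent_eqI[OF Gat v B.tangent_lin[OF v12]])
    (simp add: fplus v1_def v2_def Gat perp_props(6)[OF sp.S])
  hence split: "ga v = ga v1 + ga v2" if "ga : ctsp B (p, w)" for ga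
   using that v12 unfolding cotangent_space_def by (simp only: mem_Collect_eq mult_1)
  have "v1 : stan B (graph s) (p, w)"
   unfolding B.stan_iff[OF sl qG qg] using v12(1) oproj_props(1)[OF sp.S] Gat by (simp add: v1_def)
  hence 1: "dif B (p, w) f v1 = 0" "dif B (p, w) g v1 = 0" using con by (simp_all add: conormal_space_def)
  let ?u = "M.nv p c S (v ?G)"
  have line: "(p, nplus w (nsc p t ?u)) : fst ?G"
   "snd ?G (p, nplus w (nsc p t ?u)) = snd ?G (p, w) + t *: perp S (v ?G)" for t
   using p cS V_closed[OF p] wV chart_line[OF cS(1,2) p wV sp.nv_normal, of t]
   by (simp_all add: graph_chart_def nch_dom)
  have "dif B (p, w) h v2 = vd (p, w) h ?u" if h: "h : B.F" for h
   using vd_along_chart[OF Gat wV sp.nv_normal h line] B.dif_eq[OF h Gat v12(2)] Gat by (simp add: v2_def)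
  hence 2: "dif B (p, w) f v2 = dif B (p, w) g v2" using f g vd by simp
  show "dif B (p, w) f v = dif B (p, w) g v"
   unfolding split[OF B.dif_cotangent[OF f qc]] split[OF B.dif_cotangent[OF g qc]] 1 2 ..
 qed
qed

lemma La_nscale: "l : La ==> p : C ==> u : V p ==> l (p, nsc p r u) = r * l (p, u)"
 using La_line[of l p "tC p" u r] La_zero[of l p] V_simps(4)[of p "nsc p r u"] V_closed[of p]
 by (simp add: zero_vec_def)

text \<open>For fibrewise linear \<open>f\<close>, the function \<open>vlift s [f]\<close> is
  constant along fibres with value \<open>f (p, s p)\<close>, so \<open>f + vlift s [f]\<close>
  vanishes at the point \<open>- s p\<close>. Its vertical differential is still that of
  \<open>f\<close>; hence the differentials of these functions give every conormal covector of the
  graph.\<close>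

lemma coisotropic_graph_iff:
 assumes s: "s : nsec" and Z: "Z : B.MD 2"
 shows "coisotropic B Z (graph s) \<longleftrightarrow> (ALL p:C. ALL f:La. ALL g:La.
  Z [f + vlift s [f], g + vlift s [g]] (p, nsc p (-1) (s p)) = 0)"
proof -
 let ?a = "vlift s" let ?g = "graph s"
 note aA = B.MD_ALT[OF vlift_MD[OF s]]
 have sV: "s p : V p" if "p : C" for p using s that by (simp add: nsec_iff)
 have wV: "nsc p (-1) (s p) : V p" if "p : C" for p by (rule V_closed(2)[OF that sV[OF that]])
 have F: "f + ?a [f] : B.F" if "f : La" for f by (intro B.F_simps(2) La_F that B.ALT_F[OF aA])
 have aLa: "?a [f] (p, w) = f (p, s p)" if "f : La" "p : C" "w : V p" for f p w
  using sV[OF that(2)] by (simp add: vlift_apply[OF La_F[OF that(1)] that(2,3)] vd_La[OF that] fib_def)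
 have con: "dif B (p, nsc p (-1) (s p)) (f + ?a [f]) : conormal_space B ?g (p, nsc p (-1) (s p))"
  if f: "f : La" and p: "p : C" for f p
 proof -
  obtain c S where cS: "slice c S" "p : fst c" using p by (rule obtain_slice)
  show ?thesis
  proof (rule B.dif_vanishing_conormal[OF graph_slice[OF s cS(1)] _ _ F[OF f]])
   show "(p, nsc p (-1) (s p)) : fst (graph_chart s c S)" using p cS wV by (simp add: graph_chart_def nch_dom)
   show "(p, nsc p (-1) (s p)) : ?g" using p by (simp add: graph_minus_def)
   fix q assume "q : ?g"
   then obtain x where x: "q = (x, nsc x (-1) (s x))" "x : C" by (auto simp: graph_minus_def)
   show "(f + ?a [f]) q = 0"
    using La_nscale[OF f x(2) sV[OF x(2)], of "-1"] aLa[OF f x(2) wV[OF x(2)]] by (simp add: x(1) fplus)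
  qed
 qed
 have vda: "vd (p, w) (f + ?a [f]) = fib p f" if f: "f : La" and p: "p : C" "w : V p" for f p w
 proof -
  have c: "vd (p, w) (?a [f]) = 0" by (rule vd_const[OF p]) (simp add: aLa[OF f p(1)])
  show ?thesis using vd_lin[OF p La_F[OF f] B.ALT_F[OF aA], of 1 1 "[f]"] c vd_La[OF f p] by simp
 qed
 show ?thesis
  unfolding B.coisotropic_iff[OF Z]
 proof (intro iffI conjI ballI impI)
  fix p f g assume *: "submanifold B ?g & (ALL q:?g. ALL f:B.F. ALL g:B.F. dif B q f : conormal_space B ?g q -->
   dif B q g : conormal_space B ?g q --> Z [f, g] q = 0)" and p: "p : C" and fg: "f : La" "g : La"
  have "(p, nsc p (-1) (s p)) : ?g" using p by (simp add: graph_minus_def)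
  thus "Z [f + ?a [f], g + ?a [g]] (p, nsc p (-1) (s p)) = 0"
   using * F[OF fg(1)] F[OF fg(2)] con[OF fg(1) p] con[OF fg(2) p] by blast
 next
  show "submanifold B ?g" by (rule graph_submanifold[OF s])
  fix q f g assume *: "ALL p:C. ALL f:La. ALL g:La. Z [f + ?a [f], g + ?a [g]] (p, nsc p (-1) (s p)) = 0"
   and q: "q : ?g" and fg: "f : B.F" "g : B.F" and cn: "dif B q f : conormal_space B ?g q" "dif B q g : conormal_space B ?g q"
  obtain p where p: "q = (p, nsc p (-1) (s p))" "p : C" using q by (auto simp: graph_minus_def)
  have qc: "q : carrier_of B" using p wV by (simp add: carrier_bundle in_npts)
  have eq: "lift q h : La & dif B q h = dif B q (lift q h + ?a [lift q h])"
   if h: "h : B.F" "dif B q h : conormal_space B ?g q" for h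
  proof -
   note l = lift[OF p(2) wV[OF p(2)] h(1), folded p(1)]
   have "dif B q h = dif B q (lift q h + ?a [lift q h])"
    unfolding p(1)
    by (rule graph_differential_eqI[OF s p(2) refl h(1) F[OF l(1), unfolded p(1)] h(2)[unfolded p(1)] con[OF l(1) p(2), unfolded p(1)]])
     (simp add: vda[OF l(1)[unfolded p(1)] p(2) wV[OF p(2)]] l(2)[unfolded p(1)])
   thus ?thesis using l(1) by simp
  qed
  note f = eq[OF fg(1) cn(1)] and g = eq[OF fg(2) cn(2)]
  have "Z [f, g] q = Z [lift q f + ?a [lift q f], lift q g + ?a [lift q g]] q"
   by (rule B.MD_differential_cong[OF Z qc]) (use fg f g F in auto)
  thus "Z [f, g] q = 0" using * f g p by simp
 qed
qed

end

section \<open>Iterated brackets with a vertical vector field\<close>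

lemma (in field_submodule) FP_eval:
 assumes "X : FP k" "set fs <= V0" shows "X fs : V0"
 using assms
proof (induction arbitrary: fs rule: FP_induct)
 case (add k X Y)
 thus ?case using subspace_add[OF V0(1)] by (simp add: fplus[of X Y fs])
next
 case (scale k X c)
 thus ?case using subspace_scale[OF V0(1)] by (simp add: fscale[of c X])
next
 case (zero k)
 thus ?case using subspace_0[OF V0(1)] by (simp add: fzero[of fs])
next
 case (func X)
 show ?case
 proof (cases "fs = []")
  case True
  thus ?thesis using func by (simp add: FP_def)
 next
  case False
  hence "X fs = 0" by (intro ALT_dom[OF FP_ALT[OF func(1)]]) simp
  thus ?thesis using subspace_0[OF V0(1)] by simp
 qed
next
 case (field X)
 show ?case
 proof (cases "length fs = 1")
  case True
  then obtain f where "fs = [f]" by (cases fs) auto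
  thus ?thesis using V1(3)[OF field(1)] field(2) by simp
 next
  case False
  hence "X fs = 0" by (intro ALT_dom[OF MD_ALT[OF V1_MD[OF field(1)]]]) simp
  thus ?thesis using subspace_0[OF V0(1)] by simp
 qed
next
 case (wedge k W X)
 have "W L * X R : V0" if LR: "mset L + mset R = mset fs" for L R
 proof (cases "length R = 1")
  case True
  then obtain f where "R = [f]" by (cases R) auto
  thus ?thesis using mset_split_set[OF LR] wedge V1(3) by (intro V0(3)) auto
 next
  case False
  hence "X R = 0" by (intro ALT_dom[OF MD_ALT[OF V1_MD[OF wedge.hyps(2)]]]) simp
  thus ?thesis using subspace_0[OF V0(1)] by simp
 qed
 thus ?case unfolding wdg_def by (rule ssum_closed[OF V0(1)])
qed

context tubular
begin

lemma foldl_replicate_Suc: "foldl schouten X (replicate (Suc n) a) = schouten (foldl schouten X (replicate n a)) a"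
proof -
 have "replicate (Suc n) a = replicate n a @ [a]" by (simp add: replicate_append_same)
 thus ?thesis by (simp only: foldl_append foldl.simps)
qed

lemma iterated_bracket_MD:
 assumes "X : B.MD k" "a : B.MD 1" shows "foldl schouten X (replicate n a) : B.MD k"
proof (induction n)
 case (Suc n)
 show ?case using B.schouten_MD[OF Suc assms(2)] unfolding foldl_replicate_Suc by simp
qed (simp add: assms(1))

context
 fixes s assumes s: "s : nsec"
begin

private abbreviation "a == vlift s"

text \<open>The path in the fibre from the zero section at \<open>t = 0\<close> to the graph of the
  negative section at \<open>t = 1\<close>.\<close>

private abbreviation gp :: "'a => real => ('a, 'e) npoint" where "gp p t == (p, nsc p (- t) (s p))"

text \<open>Minus the Lie derivative of \<open>X\<close> along the vertical field, written out on
  two functions.\<close>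

lemma schouten_bivector_vertical_lift:
 assumes X: "X : B.MD 2"
 shows "schouten X a [f, g] = X [a [f], g] + X [f, a [g]] - a [X [f, g]]"
proof -
 note XA = B.MD_ALT[OF X] and aA = B.MD_ALT[OF vlift_MD[OF s]]
 have 0: "a [] = 0" "a [f, g] = 0" "X [] = 0" "X [f] = 0" "X [g] = 0"
  by (rule B.ALT_dom[OF aA] B.ALT_dom[OF XA], simp)+
 have 1: "X [a [g], f] = - X [f, a [g]]" by (rule B.ALT_swap_head[OF XA])
 have "B.comp X a [f, g] = X [a [f], g] + X [f, a [g]]"
  by (simp add: B.comp_def 0 B.ALT_zero[OF XA] 1 sg_def)
 moreover have "B.comp a X [f, g] = a [X [f, g]]"
  by (simp add: B.comp_def 0 B.ALT_zero[OF aA] sg_def)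
 ultimately show ?thesis by (simp add: B.schouten_comp[OF XA aA] minus_apply fscale sg_def)
qed

lemma gp_normal:
 assumes p: "p : C" shows "s p : V p" "nsc p (- t) (s p) : V p" "gp p 0 = zp p"
proof -
 show 1: "s p : V p" using s p by (simp add: nsec_iff)
 show "nsc p (- t) (s p) : V p" by (rule V_closed(2)[OF p 1])
 show "gp p 0 = zp p" by (simp add: V_simps(1)[OF p 1] zpV(1)[OF p])
qed

lemma along_vertical_lift:
 assumes p: "p : C" and h: "h : B.F" and P: "!!t. h (gp p t) = poly P t"
 shows "a [h] (gp p t) = - poly (pderiv P) t"
proof -
 note V = gp_normal[OF p]
 have eq: "nplus (nsc p (- t) (s p)) (nsc p tu (s p)) = nsc p (- (t - tu)) (s p)" for tu
 proof -
  obtain c S where cS: "slice c S" "p : fst c" "slice_point A C c S p" using p by (rule obtain_slice)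
  interpret sp: slice_point A C c S p by (rule cS(3))
  obtain y where y: "s p = M.nv p c S y" using V(1) by (auto simp: sp.normal_space_nv)
  show ?thesis by (simp add: y sp.nscale_nv sp.nplus_nv scaleR_left_diff_distrib)
 qed
 have "((%tu. poly P (t - tu)) has_field_derivative poly (pderiv P) (t - 0) * (- 1)) (at 0)"
  by (rule DERIV_chain'[where f = "%tu. t - tu"]) (auto intro!: derivative_eq_intros poly_DERIV)
 from DERIV_imp_deriv[OF this] have d: "deriv (%tu. poly P (t - tu)) 0 = - poly (pderiv P) t" by simp
 have "h (p, nplus (nsc p (- t) (s p)) (nsc p tu (s p))) = poly P (t - tu)" for tu
  unfolding eq by (rule P)
 hence "vd (gp p t) h (s p) = deriv (%tu. poly P (t - tu)) 0" using V(1) by (simp add: vertical_differential_def)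
 thus ?thesis by (simp add: vlift_apply[OF h p V(2)] d)
qed

text \<open>Bracketing with \<open>a\<close> acts as D + E1 + E2: D is the derivative in
  \<open>t\<close>, and E1, E2 replace \<open>f\<close> by \<open>a [f]\<close> and \<open>g\<close>
  by \<open>a [g]\<close>. These commute, and E1, E2 square to zero by the hypotheses on
  \<open>f\<close> and \<open>g\<close>. The binomial formula therefore stops at (E1 + E2)^2 = 2 E1
  E2, which gives the coefficients \<open>n\<close> and \<open>n * (n - 1)\<close>. Truncated
  exponents occur only with coefficient 0.\<close>

lemma iterated_bracket_along:
 assumes X: "X : B.MD 2" and p: "p : C"
 shows "f : B.F ==> g : B.F ==> a [a [f]] = 0 ==> a [a [g]] = 0 ==>
  (!!t. X [f, g] (gp p t) = poly P00 t) ==> (!!t. X [a [f], g] (gp p t) = poly P10 t) ==>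
  (!!t. X [f, a [g]] (gp p t) = poly P01 t) ==> (!!t. X [a [f], a [g]] (gp p t) = poly P11 t) ==>
  foldl schouten X (replicate n a) [f, g] (gp p t) = poly ((pderiv ^^ n) P00 + smult (real n) ((pderiv ^^ (n - 1)) (P10 + P01))
   + smult (real (n * (n - 1))) ((pderiv ^^ (n - 2)) P11)) t"
proof (induction n arbitrary: f g P00 P10 P01 P11 t)
 case 0
 thus ?case by simp
next
 case (Suc n)
 let ?Y = "foldl schouten X (replicate n a)"
 have Y: "?Y : B.MD 2" by (rule iterated_bracket_MD[OF X vlift_MD[OF s]])
 note XA = B.MD_ALT[OF X] and aA = B.MD_ALT[OF vlift_MD[OF s]]
 have aF: "a [h] : B.F" for h by (rule B.ALT_F[OF aA])
 have a0: "a [0] = 0" by (rule B.ALT_zero[OF aA])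
 have 0: "X [0, h] q = 0" "X [h, 0] q = 0" for h q
  using fun_cong[OF B.ALT_zero[OF XA, of "[h]"], of q] fun_cong[OF B.ALT_zero2[OF XA, of h "[]"], of q] fzero[of q] by (simp_all only:)
 have "foldl schouten X (replicate (Suc n) a) [f, g] (gp p t)
   = ?Y [a [f], g] (gp p t) + ?Y [f, a [g]] (gp p t) - a [?Y [f, g]] (gp p t)"
  unfolding foldl_replicate_Suc by (simp add: schouten_bivector_vertical_lift[OF Y] fplus minus_apply)
 also have "?Y [a [f], g] (gp p t) = poly ((pderiv ^^ n) P10 + smult (real n) ((pderiv ^^ (n - 1)) (0 + P11))
   + smult (real (n * (n - 1))) ((pderiv ^^ (n - 2)) 0)) t"
  by (rule Suc.IH) (use Suc.prems aF in \<open>simp_all add: a0 0\<close>)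
 also have "?Y [f, a [g]] (gp p t) = poly ((pderiv ^^ n) P01 + smult (real n) ((pderiv ^^ (n - 1)) (P11 + 0))
   + smult (real (n * (n - 1))) ((pderiv ^^ (n - 2)) 0)) t"
  by (rule Suc.IH) (use Suc.prems aF in \<open>simp_all add: a0 0\<close>)
 also have "a [?Y [f, g]] (gp p t) = - poly (pderiv ((pderiv ^^ n) P00 + smult (real n) ((pderiv ^^ (n - 1)) (P10 + P01))
   + smult (real (n * (n - 1))) ((pderiv ^^ (n - 2)) P11))) t"
  by (rule along_vertical_lift[OF p B.ALT_F[OF B.MD_ALT[OF Y]]]) (rule Suc.IH[OF Suc.prems])
 finally have *: "foldl schouten X (replicate (Suc n) a) [f, g] (gp p t) =
   poly ((pderiv ^^ n) P10 + smult (real n) ((pderiv ^^ (n - 1)) P11) + ((pderiv ^^ n) P01 + smult (real n) ((pderiv ^^ (n - 1)) P11))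
   + pderiv ((pderiv ^^ n) P00 + smult (real n) ((pderiv ^^ (n - 1)) (P10 + P01)) + smult (real (n * (n - 1))) ((pderiv ^^ (n - 2)) P11))) t"
  by simp
 have 1: "smult (real n) (pderiv ((pderiv ^^ (n - 1)) Q)) = smult (real n) ((pderiv ^^ n) Q)" for Q :: "real poly"
  by (cases n) simp_all
 have 2: "smult (real (n * (n - 1))) (pderiv ((pderiv ^^ (n - 2)) Q)) = smult (real (n * (n - 1))) ((pderiv ^^ (n - 1)) Q)" for Q :: "real poly"
 proof (cases "n < 2")
  case False
  hence "n - 1 = Suc (n - 2)" by simp
  thus ?thesis by simp
 next
  case True
  hence "n = 0 | n = 1" by auto
  thus ?thesis by auto
 qed
 show ?case
  unfolding * pderiv_add pderiv_smult 1 2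
  by (simp add: higher_pderiv_add smult_add_right algebra_simps)
qed

text \<open>\<open>Q\<close> is the function t -> X [f + t a[f], g + t a[g]] evaluated at
  \<open>gp p t\<close>, a polynomial because all the functions and \<open>X\<close> are fibrewise
  polynomial. Its Taylor coefficients at 0 are the iterated brackets, and its value at 1 is the
  value on the graph.\<close>

lemma iterated_bracket_polynomial:
 assumes X: "X : fpm 2" and p: "p : C" and f: "f : La" and g: "g : La"
 obtains Q where "!!n. foldl schouten X (replicate n a) [f, g] (zp p) = fact n * coeff Q n"
  "poly Q 1 = X [f + a [f], g + a [g]] (p, nsc p (-1) (s p))"
proof -
 note V = gp_normal[OF p]
 have XM: "X : B.MD 2" by (rule fp_MD[OF X])
 note XA = B.MD_ALT[OF XM] and aA = B.MD_ALT[OF vlift_MD[OF s]]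
 have aF: "a [h] : B.F" for h by (rule B.ALT_F[OF aA])
 have aLa: "a [h] (x, w) = h (x, s x)" if "h : La" "x : C" "w : V x" for h x w
  using gp_normal(1)[OF that(2)] by (simp add: vlift_apply[OF La_F[OF that(1)] that(2,3)] vd_La[OF that] fib_def)
 have aa: "a [a [h]] = 0" if h: "h : La" for h
 proof (rule normal_cases)
  fix x w assume x: "x : C" "w : V x"
  have "vd (x, w) (a [h]) = 0" by (rule vd_const[OF x]) (simp add: aLa[OF h x(1)])
  thus "a [a [h]] (x, w) = 0 (x, w)" by (simp add: vlift_apply[OF aF x] fzero)
 qed (simp add: vlift_off(2) fzero)
 have Lafp: "h : fpf" if h: "h : La" for h
 proof (rule fpfI[OF La_F[OF h]])
  fix c S x assume c: "slice c S" "x : C" "x : fst c"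
  have "fib x h : cnf x" using h c by (simp add: La_def)
  then obtain al where al: "!!u. u : V x ==> fib x h u = al \<bullet> coord c S u" using conormal_fibre_repr[OF _ c(1,3,2)] by blast
  have "rpf (%y. al \<bullet> y)" by (rule rpfI(1)) (rule bounded_linear_inner_right)
  thus "EX k. rpf k & (ALL u:V x. h (x, u) = k (coord c S u))"
   using al by (intro exI[of _ "%y. al \<bullet> y"]) (simp add: fib_def)
 qed
 have afp: "a [h] : fpf" if h: "h : La" for h
 proof (rule fpfI[OF aF])
  fix c S x assume "x : C"
  thus "EX k. rpf k & (ALL u:V x. a [h] (x, u) = k (coord c S u))"
   using aLa[OF h] by (intro exI[of _ "%_. h (x, s x)"]) (simp add: rpfI(2))
 qed
 have "EX P. ALL t. h (gp p t) = poly P t" if h: "h : fpf" for h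
 proof -
  obtain c S where cS: "slice c S" "p : fst c" "slice_point A C c S p" using p by (rule obtain_slice)
  interpret sp: slice_point A C c S p by (rule cS(3))
  obtain k where k: "rpf k" "!!u. u : V p ==> h (p, u) = k (coord c S u)"
   using fpfD[OF h cS(1) p cS(2)] by blast
  have "polynomial_function (%t::real. (- t) *: coord c S (s p))"
   by (intro polynomial_function_bounded_linear bounded_linear_scaleR_left[THEN bounded_linear_compose] bounded_linear_minus bounded_linear_ident)
  from real_polynomial_function_compose[OF this k(1)]
  have "rpf (%t. h (gp p t))"
   using V by (simp add: o_def k(2) sp.coord_nscale)
  from real_polynomial_function_imp_sum[OF this]
  obtain c n where cn: "(%t. h (gp p t)) = (%t. SUM i<=n. c i * t ^ i)" by blast
  have "h (gp p t) = poly (SUM i<=n. monom (c i) i) t" for t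
   using fun_cong[OF cn, of t] by (simp add: poly_sum poly_monom)
  thus ?thesis by blast
 qed
 moreover have "X [h, k] : fpf" if "h : fpf" "k : fpf" for h k
  by (rule fp.FP_eval[of _ 2]) (use X that in \<open>simp_all add: fp_multivector_fields_eq\<close>)
 ultimately have ex: "EX P. ALL t. X [h, k] (gp p t) = poly P t" if "h : fpf" "k : fpf" for h k using that by blast
 obtain P00 where P00: "!!t. X [f, g] (gp p t) = poly P00 t" using ex[OF Lafp[OF f] Lafp[OF g]] by blast
 obtain P10 where P10: "!!t. X [a [f], g] (gp p t) = poly P10 t" using ex[OF afp[OF f] Lafp[OF g]] by blast
 obtain P01 where P01: "!!t. X [f, a [g]] (gp p t) = poly P01 t" using ex[OF Lafp[OF f] afp[OF g]] by blast
 obtain P11 where P11: "!!t. X [a [f], a [g]] (gp p t) = poly P11 t" using ex[OF afp[OF f] afp[OF g]] by blast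
 define Q where "Q = P00 + pCons 0 (P10 + P01 + pCons 0 P11)"
 have at0: "poly ((pderiv ^^ n) P) 0 = fact n * coeff P n" for n and P :: "real poly"
  by (simp add: poly_0_coeff_0 coeff_higher_pderiv pochhammer_fact)
 show thesis
 proof (rule that[of Q])
  fix n
  have "foldl schouten X (replicate n a) [f, g] (zp p) = poly ((pderiv ^^ n) P00 + smult (real n) ((pderiv ^^ (n - 1)) (P10 + P01))
    + smult (real (n * (n - 1))) ((pderiv ^^ (n - 2)) P11)) 0"
   unfolding V(3)[symmetric]
   by (rule iterated_bracket_along[OF XM p La_F[OF f] La_F[OF g] aa[OF f] aa[OF g] P00 P10 P01 P11])
  also have "... = fact n * coeff P00 n + real n * (fact (n - 1) * coeff (P10 + P01) (n - 1)) + real (n * (n - 1)) * (fact (n - 2) * coeff P11 (n - 2))"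
   by (simp only: poly_add poly_smult at0)
  also have "... = fact n * coeff Q n"
  proof (cases n)
   case (Suc m)
   show ?thesis
    unfolding Suc Q_def by (cases m) (simp_all add: coeff_pCons algebra_simps)
  qed (simp add: Q_def)
  finally show "foldl schouten X (replicate n a) [f, g] (zp p) = fact n * coeff Q n" .
 next
  have "X [f + a [f], g + a [g]] = X [f, g + a [g]] + X [a [f], g + a [g]]"
   by (rule B.ALT_add[OF XA La_F[OF f] aF])
  also have "... = X [f, g] + X [f, a [g]] + (X [a [f], g] + X [a [f], a [g]])"
   using B.ALT_lin_slot[OF XA La_F[OF g] aF, of "[f]" 1 1 g "[]"] B.ALT_lin_slot[OF XA La_F[OF g] aF, of "[a [f]]" 1 1 g "[]"] by simp
  finally have e: "X [f + a [f], g + a [g]] = X [f, g] + X [f, a [g]] + (X [a [f], g] + X [a [f], a [g]])" .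
  show "poly Q 1 = X [f + a [f], g + a [g]] (p, nsc p (-1) (s p))"
   unfolding e fplus P00 P10 P01 P11 by (simp add: Q_def)
 qed
qed

end

section \<open>The Poisson structure on the normal bundle\<close>

context
 fixes ps :: "('a, 'e) npoint => 'a"
 assumes emb: "open_embedding B A ps" and zero: "!!p. p : C ==> ps (zp p) = p"
begin

private abbreviation pull :: "('a => real) => ('a, 'e) npoint => real" where
 "pull == (%f q. if q : npts then f (ps q) else 0)"

lemma embedding_chart:
 assumes c: "c : B" and d: "d : A"
 shows "open (snd c ` (fst c Int ps -` fst d))" "smooth_on (snd c ` (fst c Int ps -` fst d)) (snd d o ps o cinv c)"
 using emb c d unfolding open_embedding_def smooth_map_def Let_def by blast+

lemma embedding_carrier: "q : carrier_of B ==> ps q : carrier_of A"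
 using emb by (auto simp: open_embedding_def smooth_map_def)

lemma pull_rep:
 assumes c: "c : B" and d: "d : A" and z: "z : snd c ` (fst c Int ps -` fst d)"
 shows "(f o cinv d) ((snd d o ps o cinv c) z) = (pull f o cinv c) z"
proof -
 obtain x where x: "z = snd c x" "x : fst c" "ps x : fst d" using z by auto
 have "x : npts" using c x(2) by (auto simp: carrier_of_def carrier_bundle[symmetric])
 thus ?thesis
  using ch_simps(1)[OF B.atlas_chart[OF c] x(2)] ch_simps(1)[OF M.atlas_chart[OF d] x(3)] by (simp add: x(1))
qed

lemma pull_smooth:
 assumes f: "f : M.F" shows "pull f : B.F"
proof (rule B.smfI)
 show "pull f q = 0" if "q ~: carrier_of B" for q using that by (simp add: carrier_bundle)
 fix q assume q: "q : carrier_of B"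
 obtain c where c: "c : B" "q : fst c" using q by (rule B.carrier_chart)
 obtain d where d: "d : A" "ps q : fst d" using embedding_carrier[OF q] by (rule M.carrier_chart)
 let ?V = "snd c ` (fst c Int ps -` fst d)"
 note V = embedding_chart[OF c(1) d(1)]
 have fd: "smooth_on (cimg d) (f o cinv d)" by (rule M.smf_local[OF f M.atlas_smch[OF d(1)]])
 have "smooth_on ?V (%z. (f o cinv d) ((snd d o ps o cinv c) z))"
  by (rule sm_compose[OF V fd]) (use ch_simps(1)[OF B.atlas_chart[OF c(1)]] in auto)
 hence "smooth_on ?V (pull f o cinv c)" by (rule sm_cong[OF V(1)]) (rule pull_rep[OF c(1) d(1)])
 thus "EX c W. c : smooth_charts B & q : fst c & open W & snd c q : W & W <= cimg c & smooth_on W (pull f o cinv c)"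
  using c d V(1) B.atlas_smch by (intro exI[of _ c] exI[of _ ?V]) auto
qed

text \<open>The inverse of the embedding is smooth, so the coordinate derivative of the embedding is
  invertible. The covector is carried to M by the inverse derivative, realized there by a function,
  and that function is pulled back.\<close>

lemma pull_covector:
 assumes q: "q : carrier_of B" and al: "al : ctsp B q"
 shows "EX f:M.F. dif B q (pull f) = al"
proof -
 obtain c where c: "c : B" "q : fst c" using q by (rule B.carrier_chart)
 obtain d where d: "d : A" "ps q : fst d" using embedding_carrier[OF q] by (rule M.carrier_chart)
 have cat: "c : charts_at B q" using c B.atlas_smch by (simp add: charts_at_def)
 have dat: "d : charts_at A (ps q)" using d M.atlas_smch by (simp add: charts_at_def)
 note cc = B.atlas_chart[OF c(1)] and dd = M.atlas_chart[OF d(1)]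
 let ?V = "snd c ` (fst c Int ps -` fst d)" and ?u = "snd d o ps o cinv c"
 note V = embedding_chart[OF c(1) d(1)]
 let ?U = "ps ` carrier_of B" and ?psi = "inv_into (carrier_of B) ps"
 let ?d = "(fst d Int ?U, snd d)"
 let ?V' = "snd ?d ` (fst ?d Int ?psi -` fst c)" and ?v = "snd c o ?psi o cinv ?d"
 have "?d : open_submanifold A ?U" using d(1) by (auto simp: open_submanifold_def)
 hence V': "open ?V'" "smooth_on ?V' ?v"
  using emb c(1) unfolding open_embedding_def smooth_map_def Let_def by blast+
 have inj: "inj_on ps (carrier_of B)" using emb by (simp add: open_embedding_def)
 have uv: "?u z : ?V' & ?v (?u z) = z" if z: "z : ?V" for z
 proof -
  obtain x where x: "z = snd c x" "x : fst c" "ps x : fst d" using z by auto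
  have xB: "x : carrier_of B" by (rule B.smch_carrier[OF B.atlas_smch[OF c(1)] x(2)])
  have i: "?psi (ps x) = x" by (rule inv_into_f_f[OF inj xB])
  have u: "?u z = snd d (ps x)" using ch_simps(1)[OF cc x(2)] by (simp add: x(1))
  have "inj_on (snd d) (fst d Int ?U)" using dd by (auto simp: is_chart_def intro: inj_on_subset)
  hence "cinv ?d (snd d (ps x)) = ps x"
   unfolding chart_inv_def fst_conv snd_conv by (rule inv_into_f_f) (use x xB in auto)
  hence "?v (?u z) = z" unfolding u by (simp add: i x(1))
  moreover have "?u z : ?V'" unfolding u fst_conv snd_conv by (rule imageI) (use x xB i in auto)
  ultimately show ?thesis by simp
 qed
 let ?z = "snd c q"
 have zV: "?z : ?V" using c d by auto
 let ?Du = "fder ?u (at ?z)" and ?Dv = "fder ?v (at (?u ?z))"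
 have Du: "(?u has_derivative ?Du) (at ?z)" by (rule sm_has_derivative[OF V(2) zV])
 have Dv: "(?v has_derivative ?Dv) (at (?u ?z))" by (rule sm_has_derivative[OF V'(2)]) (use uv[OF zV] in blast)
 have "(?v o ?u has_derivative ?Dv o ?Du) (at ?z)" by (rule diff_chain_at[OF Du Dv])
 moreover have "((%z. z) has_derivative (%w. w)) (at ?z)" by (rule has_derivative_ident)
 hence "(?v o ?u has_derivative (%w. w)) (at ?z)"
  by (rule has_derivative_transform_within_open[OF _ V(1) zV]) (use uv in simp)
 ultimately have "?Dv o ?Du = (%w. w)" by (rule has_derivative_unique)
 hence inv: "?Dv (?Du w) = w" for w by (simp add: fun_eq_iff)
 obtain a where a: "!!v. v : tsp B q ==> al v = a \<bullet> v c" using B.cot_repr[OF al cat] by blast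
 \<comment> \<open>The transpose of the derivative of the inverse embedding, applied to
   \<open>a\<close>.\<close>
 define b where "b = (SUM e:Basis. (a \<bullet> ?Dv e) *: e)"
 have b: "b \<bullet> w = a \<bullet> ?Dv w" for w
  unfolding lin_sum[OF has_derivative_linear[OF Dv], of w]
  by (simp add: b_def inner_sum_left inner_sum_right inner_commute mult.commute)
 obtain f where f: "f : M.F" "!!v. v : tsp A (ps q) ==> dif A (ps q) f v = b \<bullet> v d"
  using M.covector_extension[OF embedding_carrier[OF q] dat, of b] by metis
 have "dif B q (pull f) = al"
 proof (rule B.cot_eqI[OF B.dif_cotangent[OF pull_smooth[OF f(1)] q] al])
  fix v assume v: "v : tsp B q"
  have uz: "?u ?z = snd d (ps q)" using ch_simps(1)[OF cc c(2)] by simp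
  let ?Df = "fder (f o cinv d) (at (snd d (ps q)))"
  have Df: "((f o cinv d) has_derivative ?Df) (at (?u ?z))" unfolding uz by (rule M.smf_deriv[OF f(1) dat])
  have Dfb: "?Df w = b \<bullet> w" for w
   using M.dif_eq[OF f(1) dat M.tvec_tangent[OF dat], of w] f(2)[OF M.tvec_tangent[OF dat], of w] dat by simp
  have "((f o cinv d) o ?u has_derivative ?Df o ?Du) (at ?z)" by (rule diff_chain_at[OF Du Df])
  hence "((pull f o cinv c) has_derivative ?Df o ?Du) (at ?z)"
   by (rule has_derivative_transform_within_open[OF _ V(1) zV]) (use pull_rep[OF c(1) d(1)] in simp)
  note e = frechet_derivative_at[OF this, symmetric]
  show "dif B q (pull f) v = al v"
   unfolding B.dif_eq[OF pull_smooth[OF f(1)] cat v] e comp_apply[of ?Df ?Du] Dfb b inv a[OF v] ..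
 qed
 thus ?thesis using f(1) by blast
qed

text \<open>The embedding is the identity on C, so \<open>f\<close> in the chart of M and its
  pullback in the bundle chart agree on the subspace \<open>S\<close>, and so do their derivatives
  along it. For \<open>l\<close>, which vanishes on the zero section, that derivative is
  zero.\<close>

lemma pull_conormal:
 assumes p: "p : C" and f: "f : M.F" and l: "l : La" and d: "dif B (zp p) (pull f) = dif B (zp p) l"
 shows "dif A p f : conormal_space A C p"
proof -
 obtain c S where cS: "slice c S" "p : fst c" using p by (rule obtain_slice)
 note c = M.sliceD[OF cS(1)]
 note cat = c(6)[OF cS(2)]
 let ?T = "nch c S" let ?O = "cimg c"
 note T = zp_chart[OF cS p]
 have pA: "p : carrier_of A" by (rule M.smch_carrier[OF c(1) cS(2)])
 have "dif A p f v = 0" if v: "v : tC p" for v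
 proof -
  have v': "v : tsp A p" "v c : S" using v M.stan_iff[OF cS p] by auto
  let ?Df = "fder (f o cinv c) (at (snd c p))"
  let ?Dg = "fder (pull f o cinv ?T) (at (snd c p))"
  have Df: "((f o cinv c) has_derivative ?Df) (at (snd c p))" by (rule M.smf_deriv[OF f cat])
  have Dg: "((pull f o cinv ?T) has_derivative ?Dg) (at (snd c p))"
   using B.smf_deriv[OF pull_smooth[OF f] T(1)] by (simp only: chart_zero[OF cS p])
  have "?Df (v c) - ?Dg (v c) : {0}"
  proof (rule derivative_in_subspace[OF has_derivative_diff[OF Df Dg] _ c(2) ch_simps(4)[OF c(4)]])
   show "subspace {0 :: real}" by simp
   show "snd c p : ?O" "snd c p : S" "v c : S" using cS(2) p c(5)[OF cS(2)] v' by auto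
   fix z assume z: "z : ?O" "z : S"
   have oz: "oproj S z = z" by (rule oproj_self[OF c(2) z(2)])
   have zO: "oproj S z : ?O" using z(1) oz by simp
   note x = slice_oproj[OF cS(1) zO]
   interpret sx: slice_point A C c S "cinv c (oproj S z)" by (rule x(4))
   have "M.nv (cinv c (oproj S z)) c S z = tC (cinv c (oproj S z))"
    unfolding sx.tangent_nv by (rule sx.nv_cong) (use z(2) in simp)
   hence "cinv ?T z = zp (cinv c z)" using nch_image(3)[OF cS(1) zO] by (simp add: oz zero_vec_def)
   hence "(pull f o cinv ?T) z = f (cinv c z)" using x(2) zero[of "cinv c z"] zp_normal[of "cinv c z"] by (simp add: oz)
   thus "(f o cinv c) z - (pull f o cinv ?T) z : {0}" by simp
  qed
  hence "dif A p f v = ?Dg (v c)" using M.dif_eq[OF f cat v'(1)] by simp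
  also have "... = dif B (zp p) (pull f) (B.tvec (zp p) ?T (v c))"
   using B.dif_eq[OF pull_smooth[OF f] T(1) B.tvec_tangent[OF T(1)], of "v c"] T(1) by (simp add: chart_zero[OF cS p])
  also have "... = dif B (zp p) l (B.tvec (zp p) ?T (v c))" by (simp only: d)
  also have "... = 0"
  proof (rule dif_zero_section[OF p La_F[OF l] La_zero[OF l]])
   show "B.tvec (zp p) ?T (v c) : stan B (zsec) (zp p)"
    unfolding B.stan_iff[OF zero_slice[OF cS(1)] T(2,3)] using v'(2) T(1) B.tvec_tangent[OF T(1)] by simp
  qed
  finally show ?thesis .
 qed
 thus ?thesis using M.dif_cotangent[OF f pA] by (simp add: conormal_space_def)
qed

context
 fixes pM :: "'a multivector" and po :: "('a, 'e) npoint multivector"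
 assumes pM: "pM : M.MD 2" and pb: "is_pullback A C ps 2 pM po"
begin

lemma pullback_MD: "po : B.MD 2"
 using pb by (simp add: is_pullback_def B.mvf_MD)

lemma pullback_eval:
 assumes fs: "set fs <= M.F" shows "po (map pull fs) = pull (pM fs)"
proof (cases "length fs = 2")
 case True
 show ?thesis
 proof (rule normal_cases)
  fix p w assume "p : C" "w : V p"
  hence "(p, w) : npts" by (simp add: in_npts)
  thus "po (map pull fs) (p, w) = pull (pM fs) (p, w)" using pb True fs unfolding is_pullback_def by simp
 next
  fix q assume "q ~: npts"
  thus "po (map pull fs) q = pull (pM fs) q"
   using B.smf_zero[OF B.ALT_F[OF B.MD_ALT[OF pullback_MD]]] by (simp add: carrier_bundle)
 qed
next
 case False
 hence "pM fs = 0" "po (map pull fs) = 0"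
  using M.ALT_dom[OF M.MD_ALT[OF pM], of fs] B.ALT_dom[OF B.MD_ALT[OF pullback_MD], of "map pull fs"] by auto
 thus ?thesis by (auto simp: fun_eq_iff fzero)
qed

text \<open>Naturality gives the bracket only on pulled back functions, but these realize every
  covector and the bracket is a multiderivation.\<close>

lemma pullback_schouten:
 assumes jac: "schouten pM pM = 0"
 shows "schouten po po = 0"
proof -
 note po = B.MD_ALT[OF pullback_MD] and poM = M.MD_ALT[OF pM]
 note pp = B.schouten_MD[OF pullback_MD pullback_MD]
 have comp: "B.comp po po (map pull fs) q = M.comp pM pM fs (ps q)" if fs: "set fs <= M.F" and q: "q : npts" for fs q
  unfolding B.comp_def M.comp_def ssum_map ssum_fun_apply
 proof (rule ssum_cong)
  fix L R assume "mset L + mset R = mset fs"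
  hence LR: "set L <= M.F" "set R <= M.F" using fs M.mset_split_set by blast+
  have "po (po (map pull L) # map pull R) = po (map pull (pM L # R))" by (simp add: pullback_eval[OF LR(1)])
  also have "... = pull (pM (pM L # R))" by (rule pullback_eval) (use LR M.ALT_F[OF poM] in auto)
  finally show "po (po (map pull L) # map pull R) q = pM (pM L # R) (ps q)" using q by simp
 qed
 have sch: "schouten po po (map pull fs) q = 0" if fs: "set fs <= M.F" and q: "q : npts" for fs q
 proof -
  have "schouten po po (map pull fs) q = schouten pM pM fs (ps q)"
   unfolding B.schouten_comp[OF po po] M.schouten_comp[OF poM poM] by (simp add: minus_apply fscale comp[OF fs q])
  thus ?thesis by (simp add: jac fzero)
 qed
 show ?thesis
 proof (rule MD_zeroI[OF pp])
  show "pull ` M.F <= B.F" using pull_smooth by auto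
  fix p w assume p: "p : C" "w : V p"
  hence q: "(p, w) : npts" "(p, w) : carrier_of B" by (simp_all add: in_npts carrier_bundle)
  show "EX g:pull ` M.F. dif B (p, w) g = dif B (p, w) f" if "f : B.F" for f
   using pull_covector[OF q(2) B.dif_cotangent[OF that q(2)]] by blast
  fix gs assume "set gs <= pull ` M.F"
  hence "gs : map pull ` lists M.F" unfolding lists_image[symmetric] by auto
  thus "schouten po po gs (p, w) = 0" using sch[OF _ q(1)] by auto
 qed
qed

text \<open>On the zero section, fibrewise linear functions can be exchanged for pullbacks of
  functions whose differentials are conormal to C; on those, coisotropy of C applies.\<close>

lemma pullback_RP:
 assumes coiso: "coisotropic A pM C"
 shows "RP po = 0"
proof -
 have "RP po = RP 0"
 proof (rule RP_cong[OF pullback_MD subspace_0[OF B.sub_MD]])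
  fix p ls assume p: "p : C" and ls: "set ls <= La"
  note pc = zp_carrier[OF p]
  show "po ls (zp p) = 0 ls (zp p)"
  proof (cases "length ls = 2")
   case True
   then obtain l k where lk: "ls = [l, k]" by (auto simp: length_Suc_conv numeral_2_eq_2)
   have La: "l : La" "k : La" using ls lk by auto
   obtain f where f: "f : M.F" "dif B (zp p) (pull f) = dif B (zp p) l"
    using pull_covector[OF pc B.dif_cotangent[OF La_F[OF La(1)] pc]] by blast
   obtain g where g: "g : M.F" "dif B (zp p) (pull g) = dif B (zp p) k"
    using pull_covector[OF pc B.dif_cotangent[OF La_F[OF La(2)] pc]] by blast
   have "po [l, k] (zp p) = po (map pull [f, g]) (zp p)"
    by (rule B.MD_differential_cong[OF pullback_MD pc]) (use La La_F f g pull_smooth in auto)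
   also have "... = pM [f, g] p"
    using pullback_eval[of "[f, g]"] f(1) g(1) zp_normal[OF p] zero[OF p] by simp
   also have "... = 0"
    using coiso f(1) g(1) p pull_conormal[OF p f(1) La(1) f(2)] pull_conormal[OF p g(1) La(2) g(2)]
    unfolding M.coisotropic_iff[OF pM] by blast
   finally show ?thesis by (simp add: lk fzero)
  next
   case False
   hence "po ls = 0" by (intro B.ALT_dom[OF B.MD_ALT[OF pullback_MD]]) simp
   thus ?thesis by (simp add: fzero)
  qed
 qed
 thus ?thesis by (simp add: RP_zero)
qed

end

end

end

section \<open>Maurer-Cartan elements\<close>

lemma tendsto_fun_iff: "(f \<longlongrightarrow> l) F \<longleftrightarrow> (ALL x. ((%n. f n x) \<longlongrightarrow> l x) F)"
 for f :: "'n => 'a => 'b::topological_space"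
 using limitin_componentwise[of "%_ :: 'a. euclidean :: 'b topology" UNIV f l F]
 by (simp add: euclidean_product_topology)

text \<open>Pointwise convergence splits the series into real series, one for each component, list
  of functions and point.\<close>

lemma sums_multivector_pair_iff:
 fixes S :: "nat => 'a multivector \<times> 'b multivector"
 shows "S sums 0 \<longleftrightarrow> (ALL fs q. (%n. fst (S n) fs q) sums 0) & (ALL fs q. (%n. snd (S n) fs q) sums 0)"
proof -
 have app: "(\<Sum>i<n. f i) fs q = (\<Sum>i<n. f i fs q)" for f :: "nat => 'c multivector" and n fs q
  by (induction n) (simp_all add: fplus fzero)
 have "S sums 0 \<longleftrightarrow> ((%n. fst (\<Sum>i<n. S i)) \<longlongrightarrow> 0) sequentially & ((%n. snd (\<Sum>i<n. S i)) \<longlongrightarrow> 0) sequentially"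
  unfolding sums_def
  using tendsto_fst[of "%n. \<Sum>i<n. S i" 0 sequentially] tendsto_snd[of "%n. \<Sum>i<n. S i" 0 sequentially]
   tendsto_Pair[of "%n. fst (\<Sum>i<n. S i)" 0 sequentially "%n. snd (\<Sum>i<n. S i)" 0] by (auto simp: zero_prod_def)
 thus ?thesis
  unfolding sums_def fst_sum snd_sum tendsto_fun_iff[where 'a = "('a => real) list"] tendsto_fun_iff[where 'a = 'a and 'b = real]
   tendsto_fun_iff[where 'a = "('b => real) list"] tendsto_fun_iff[where 'a = 'b and 'b = real] app
  by (simp add: fzero)
qed

lemma coeff_sums_poly: "(%n. coeff Q n) sums poly Q (1 :: real)"
proof -
 have "(%n. coeff Q n) sums (SUM n<=degree Q. coeff Q n)"
  by (rule sums_finite) (auto simp: coeff_eq_0 not_le)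
 thus ?thesis by (simp add: poly_altdef)
qed

context tubular
begin

context
 fixes po :: "('a, 'e) npoint multivector"
 assumes po: "po : fpm 2" "schouten po po = 0" "RP po = 0"
begin

interpretation D: derived_brackets B.graded_MD "%i. graded_piece N (i + 1)" "%i. graded_piece (fpm) (i + 1)"
  schouten RP po
 by (rule derived_brackets_multivector_fields[OF po])

definition deformation_bracket ::
 "(('a, 'e) npoint multivector \<times> ('a, 'e) npoint multivector) list => ('a, 'e) npoint multivector \<times> ('a, 'e) npoint multivector" where
 "deformation_bracket = D.m"

lemma deformation_space_eq: "deformation_space A C i = D.W i"
 by (simp add: deformation_space_def add.assoc)

lemma L_infinity_1_deformation_bracket: "L_infinity_1 (deformation_space A C) deformation_bracket"
proof -
 have "deformation_space A C = (%i. D.W i)" by (rule HOL.ext) (rule deformation_space_eq)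
 thus ?thesis using D.L_infinity_1_m by (simp add: deformation_bracket_def)
qed

text \<open>In the doubly shifted space a k-vector field has degree \<open>int k - 2\<close>. The
  summands 1 are left unevaluated to match the index \<open>d + 1\<close> of the abstract
  brackets.\<close>

lemma fp_graded: "X : fpm k ==> X : graded_piece (fpm) (int k - 2 + 1 + 1)"
 by (simp add: graded_piece_def)

lemma N_graded: "set as <= (\<Union>j. N j) ==> set as <= (\<Union>i. graded_piece N (i + 1))"
proof
 fix a assume "set as <= (\<Union>j. N j)" "a : set as"
 then obtain j where "a : N j" by blast
 hence "a : graded_piece N ((int j - 1) + 1)" by (rule graded_pieceI) simp
 thus "a : (\<Union>i. graded_piece N (i + 1))" by blast
qed

lemma deformation_bracket_many:
 assumes Xs: "set Xs <= (\<Union>k. fpm k)" and as: "set as <= (\<Union>j. N j)" "length Xs >= 3 | length Xs = 2 & as ~= []"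
 shows "deformation_bracket (map (%X. (X, 0)) Xs @ map (%a. (0, a)) as) = 0"
 unfolding deformation_bracket_def
proof (rule D.m_many[OF _ N_graded[OF as(1)] as(2)])
 show "set Xs <= (\<Union>i. graded_piece (fpm) (i + 1))" using Xs fp_graded by blast
qed

lemma deformation_bracket_simps:
 "X : fpm k ==> deformation_bracket [(X, 0)] = (- schouten po X, RP X)"
 "X : fpm k ==> Y : fpm l ==>
  deformation_bracket [(X, 0), (Y, 0)] = (((-1) powi (int k - 1)) *: schouten X Y, 0)"
 "set as <= (\<Union>j. N j) ==> deformation_bracket (map (%a. (0, a)) as) = (0, RP (foldl schouten po as))"
 "set as <= (\<Union>j. N j) ==> as ~= [] ==> X : fpm k ==>
  deformation_bracket ((X, 0) # map (%a. (0, a)) as) = (0, RP (foldl schouten X as))"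
 unfolding deformation_bracket_def
 by (erule D.m_X[OF fp_graded], simp only: powi_minus_one D.m_XY[OF fp_graded fp_graded] diff_add_cancel, simp,
  erule D.m_as[OF N_graded], erule D.m_Xas[OF N_graded _ fp_graded])

text \<open>Term \<open>n\<close> pairs the coefficient \<open>Suc n\<close> of \<open>Q\<close>
  with the coefficient \<open>n\<close> of \<open>R\<close>, because one of the \<open>Suc n\<close>
  entries is used up by supplying \<open>ro\<close>. The missing coefficient 0 of \<open>Q\<close>
  is the value of \<open>po\<close> on two conormal covectors of C and vanishes since
  \<open>RP po = 0\<close>.\<close>

lemma MC_series_point:
 assumes s: "s : nsec" and ro: "ro : fpm 2" and p: "p : C" and fg: "f : La" "g : La"
 defines "a == vlift s"
 shows "(%n. (1 / fact (Suc n)) * (foldl schouten po (replicate (Suc n) a) [f, g] (zp p)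
   + real (Suc n) * foldl schouten ro (replicate n a) [f, g] (zp p)))
  sums (po + ro) [f + a [f], g + a [g]] (p, nsc p (-1) (s p))"
proof -
 obtain Q where Q: "!!n. foldl schouten po (replicate n a) [f, g] (zp p) = fact n * coeff Q n"
  "poly Q 1 = po [f + a [f], g + a [g]] (p, nsc p (-1) (s p))"
  using iterated_bracket_polynomial[OF s po(1) p fg] unfolding a_def by blast
 obtain R where R: "!!n. foldl schouten ro (replicate n a) [f, g] (zp p) = fact n * coeff R n"
  "poly R 1 = ro [f + a [f], g + a [g]] (p, nsc p (-1) (s p))"
  using iterated_bracket_polynomial[OF s ro p fg] unfolding a_def by blast
 have "RP po [f, g] (zp p) = po [f, g] (zp p)"
  using RP_La[OF fp_MD[OF po(1)] p zpV(2)[OF p], of "[f, g]"] fg by (simp add: zpV(1)[OF p])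
 hence "coeff Q 0 = 0" using Q(1)[of 0] po(3) by (simp add: fzero)
 hence "(%n. coeff Q (Suc n)) sums poly Q 1" using coeff_sums_poly[of Q] by (subst sums_Suc_iff) simp
 hence "(%n. coeff Q (Suc n) + coeff R n) sums (poly Q 1 + poly R 1)" by (rule sums_add[OF _ coeff_sums_poly])
 moreover have "(1 / fact (Suc n)) * (foldl schouten po (replicate (Suc n) a) [f, g] (zp p)
   + real (Suc n) * foldl schouten ro (replicate n a) [f, g] (zp p)) = coeff Q (Suc n) + coeff R n" for n
 proof -
  have "real (Suc n) * fact n = fact (Suc n)" by (simp add: algebra_simps)
  hence "real (Suc n) * (fact n * coeff R n) = fact (Suc n) * coeff R n" by (metis mult.assoc)
  hence "foldl schouten po (replicate (Suc n) a) [f, g] (zp p) + real (Suc n) * foldl schouten ro (replicate n a) [f, g] (zp p)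
   = fact (Suc n) * (coeff Q (Suc n) + coeff R n)" unfolding Q(1) R(1) by (simp only: distrib_left)
  thus ?thesis by (simp only: mult_1 divide_inverse mult.assoc[symmetric] left_inverse[OF fact_nonzero])
 qed
 ultimately show ?thesis by (simp add: Q(2) R(2) fplus)
qed

text \<open>The projection reduces both conditions to pairs of fibrewise linear functions: at a
  general point of the bundle its value is the value on the lifts at the zero section, where the sum
  of the series is known.\<close>

lemma MC_second_component:
 assumes s: "s : nsec" and ro: "ro : fpm 2"
 defines "a == vlift s"
 shows "(ALL fs q. (%n. ((1 / fact (Suc n)) *: (RP (foldl schouten po (replicate (Suc n) a)) + real (Suc n) *: RP (foldl schouten ro (replicate n a)))) fs q) sums 0)
  \<longleftrightarrow> coisotropic B (po + ro) (graph s)"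
  (is "(ALL fs q. (%n. ?S n fs q) sums 0) \<longleftrightarrow> _")
proof -
 note poM = fp_MD[OF po(1)] and roM = fp_MD[OF ro] and aM = vlift_MD[OF s, folded a_def]
 have Z: "po + ro : B.MD 2" by (rule subspace_add[OF B.sub_MD poM roM])
 note pon = iterated_bracket_MD[OF poM aM] and ron = iterated_bracket_MD[OF roM aM]
 have S: "?S n fs q = (1 / fact (Suc n)) * (RP (foldl schouten po (replicate (Suc n) a)) fs q + real (Suc n) * RP (foldl schouten ro (replicate n a)) fs q)" for n fs q
  by (simp only: fscale fplus real_scaleR_def)
 show ?thesis
  unfolding coisotropic_graph_iff[OF s Z, folded a_def]
 proof (intro iffI ballI allI)
  fix p f g assume *: "ALL fs q. (%n. ?S n fs q) sums 0" and p: "p : C" and fg: "f : La" "g : La"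
  have RP: "RP X [f, g] (zp p) = X [f, g] (zp p)" if "X : B.MD 2" for X
   using RP_La[OF that p zpV(2)[OF p], of "[f, g]"] fg by (simp add: zpV(1)[OF p])
  have "(%n. ?S n [f, g] (zp p)) sums 0" using * by blast
  hence "(%n. (1 / fact (Suc n)) * (foldl schouten po (replicate (Suc n) a) [f, g] (zp p)
   + real (Suc n) * foldl schouten ro (replicate n a) [f, g] (zp p))) sums 0"
   unfolding S RP[OF pon] RP[OF ron] .
  from sums_unique2[OF MC_series_point[OF s ro p fg, folded a_def] this]
  show "(po + ro) [f + a [f], g + a [g]] (p, nsc p (-1) (s p)) = 0" .
 next
  fix fs q assume *: "ALL p:C. ALL f:La. ALL g:La. (po + ro) [f + a [f], g + a [g]] (p, nsc p (-1) (s p)) = 0"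
  show "(%n. ?S n fs q) sums 0"
  proof (cases "q : npts & length fs = 2 & set fs <= B.F")
   case True
   obtain p w where q: "q = (p, w)" by (metis surj_pair)
   hence p: "p : C" "w : V p" using True by (simp_all add: in_npts)
   obtain f g where fg: "fs = [f, g]" using True by (auto simp: length_Suc_conv numeral_2_eq_2)
   have F: "f : B.F" "g : B.F" using True fg by auto
   note l = lift(1)[OF p F(1)] lift(1)[OF p F(2)]
   have RP: "RP X fs q = X [lift q f, lift q g] (zp p)" if "X : B.MD 2" for X
    using RP_lift[OF that p, of fs] F by (simp add: fg q)
   have "(po + ro) [lift q f + a [lift q f], lift q g + a [lift q g]] (p, nsc p (-1) (s p)) = 0" using * p(1) l q by blast
   thus ?thesis
    unfolding S RP[OF pon] RP[OF ron] using MC_series_point[OF s ro p(1) l, folded a_def q] by simp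
  next
   case False
   have 0: "RP X fs q = 0" if X: "X : B.MD 2" for X
   proof (cases "length fs = 2 & set fs <= B.F")
    case True
    thus ?thesis using False RP_off(1) by blast
   next
    case False
    hence "RP X fs = 0" by (intro B.ALT_dom[OF B.MD_ALT[OF RP_MD[OF X]]]) simp
    thus ?thesis by (simp add: fzero)
   qed
   show ?thesis unfolding S 0[OF pon] 0[OF ron] by simp
  qed
 qed
qed

text \<open>Only two terms are nonzero. Since the bracket of \<open>po\<close> with itself vanishes,
  they add up to minus one half of the bracket of \<open>po + ro\<close> with itself.\<close>

lemma MC_first_component:
 assumes ro: "ro : fpm 2"
 shows "(ALL fs q. (%n. ((1 / fact (Suc n)) *: (if n = 0 then - schouten po ro else if n = 1 then - schouten ro ro else 0)) fs q) sums 0)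
  \<longleftrightarrow> poisson_structure B (po + ro)"
proof -
 let ?S = "%n. (1 / fact (Suc n)) *: (if n = 0 then - schouten po ro else if n = 1 then - schouten ro ro else 0)"
 note poM = fp_MD[OF po(1)] and roM = fp_MD[OF ro]
 note poA = B.MD_ALT[OF poM] and roA = B.MD_ALT[OF roM]
 have Z: "po + ro : B.MD 2" by (rule subspace_add[OF B.sub_MD poM roM])
 have l: "schouten (po + ro) U = schouten po U + schouten ro U" if "U : B.ALT 2" for U
  using B.schouten_lin_left[OF poA roA that, of 1 1] by simp
 have sw: "schouten U U' = schouten U' U" if "U : B.ALT 2" "U' : B.ALT 2" for U U'
  using B.schouten_anti[OF that] by (simp add: sg_def)
 have "schouten (po + ro) (po + ro) = schouten po (po + ro) + schouten ro (po + ro)" by (rule l[OF B.MD_ALT[OF Z]])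
 also have "schouten po (po + ro) = schouten po po + schouten ro po" by (rule trans[OF sw[OF poA B.MD_ALT[OF Z]] l[OF poA]])
 also have "schouten ro (po + ro) = schouten po ro + schouten ro ro" by (rule trans[OF sw[OF roA B.MD_ALT[OF Z]] l[OF roA]])
 finally have ZZ: "schouten (po + ro) (po + ro) = 2 *: schouten po ro + schouten ro ro"
  by (simp add: po(2) sw[OF roA poA] scaleR_2)
 have sum: "(%n. ?S n fs q) sums (- (1 / 2) * schouten (po + ro) (po + ro) fs q)" for fs q
 proof -
  have "(%n. ?S n fs q) sums (SUM n:{0, 1}. ?S n fs q)"
   by (rule sums_finite) (auto simp: fscale fzero)
  moreover have "(SUM n:{0, 1}. ?S n fs q) = - (1 / 2) * schouten (po + ro) (po + ro) fs q"
   unfolding ZZ by (simp add: fscale fplus uminus_apply field_simps)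
  ultimately show ?thesis by simp
 qed
 have "(ALL fs q. (%n. ?S n fs q) sums 0) \<longleftrightarrow> (ALL fs q. schouten (po + ro) (po + ro) fs q = 0)"
 proof (intro iffI allI)
  fix fs q assume "ALL fs q. (%n. ?S n fs q) sums 0"
  hence "(%n. ?S n fs q) sums 0" by blast
  from sums_unique2[OF sum this] show "schouten (po + ro) (po + ro) fs q = 0" by simp
 next
  fix fs q assume "ALL fs q. schouten (po + ro) (po + ro) fs q = 0"
  hence "schouten (po + ro) (po + ro) fs q = 0" by blast
  from sum[of fs q, unfolded this] show "(%n. ?S n fs q) sums 0" by simp
 qed
 also have "... \<longleftrightarrow> schouten (po + ro) (po + ro) = 0" by (auto simp: fun_eq_iff fzero)
 finally show ?thesis using Z by (simp add: poisson_structure_def B.mvf_MD)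
qed

lemma maurer_cartan_deformation_bracket:
 "maurer_cartan (deformation_space A C) deformation_bracket =
  {(ro, vlift s) | ro s. ro : fpm 2 & s : nsec &
   poisson_structure B (po + ro) & coisotropic B (po + ro) (graph s)}" (is "_ = ?R")
proof -
 have W0: "deformation_space A C 0 = fpm 2 \<times> N 1" by (simp add: deformation_space_def graded_piece_def)
 have MC: "(%n. (1 / fact (Suc n)) *: deformation_bracket (replicate (Suc n) (ro, vlift s))) sums 0 \<longleftrightarrow>
  poisson_structure B (po + ro) & coisotropic B (po + ro) (graph s)"
  if ro: "ro : fpm 2" and s: "s : nsec" for ro s
 proof -
  let ?a = "vlift s"
  have "ro : graded_piece (fpm) (1 + 1)" "?a : graded_piece N (0 + 1)"
   using ro vlift_N[OF s] by (simp_all add: graded_piece_def)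
  note m = D.m_replicate[OF this, folded deformation_bracket_def]
  show ?thesis
   unfolding sums_multivector_pair_iff m fst_scaleR snd_scaleR fst_conv snd_conv
    MC_first_component[OF ro] MC_second_component[OF s ro] ..
 qed
 show ?thesis
 proof (intro equalityI subsetI)
  fix al assume al: "al : maurer_cartan (deformation_space A C) deformation_bracket"
  obtain ro b where rob: "al = (ro, b)" by (metis surj_pair)
  have "ro : fpm 2" "b : N 1" using al by (simp_all add: maurer_cartan_def W0 rob)
  moreover obtain s where "s : nsec" "b = vlift s" using N1_vertical_lift[OF \<open>b : N 1\<close>] by blast
  ultimately show "al : ?R"
   using al MC[of ro s] by (auto simp: maurer_cartan_def rob)
 next
  fix al assume "al : ?R"
  then obtain ro s where *: "al = (ro, vlift s)" "ro : fpm 2" "s : nsec"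
   "poisson_structure B (po + ro)" "coisotropic B (po + ro) (graph s)" by blast
  thus "al : maurer_cartan (deformation_space A C) deformation_bracket"
   using MC[OF *(2,3)] vlift_N[OF *(3)] by (simp add: maurer_cartan_def W0)
 qed
qed

end

end

theorem corollary2p5:
  fixes A :: "('a, 'e::euclidean_space) atlas"
    and \<pi>\<^sub>M :: "'a multivector"
    and C :: "'a set"
    and \<psi> :: "('a, 'e) npoint \<Rightarrow> 'a"
    and \<pi> :: "('a, 'e) npoint multivector"
  assumes "manifold A"
    and "poisson_structure A \<pi>\<^sub>M"
    and "coisotropic A \<pi>\<^sub>M C"
    and "tubular_embedding A C \<psi>"
    and "is_pullback A C \<psi> 2 \<pi>\<^sub>M \<pi>"
    and "\<pi> \<in> fp_multivector_fields A C 2"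
  shows "\<exists>m. L_infinity_1 (deformation_space A C) m \<and>
    maurer_cartan (deformation_space A C) m =
      {(\<rho>, vertical_lift A C s) | \<rho> s. \<rho> \<in> fp_multivector_fields A C 2 \<and> s \<in> normal_sections A C \<and>
         poisson_structure (normal_bundle A C) (\<pi> + \<rho>) \<and>
         coisotropic (normal_bundle A C) (\<pi> + \<rho>) (graph_minus A C s)} \<and>
    (\<forall>k. \<forall>X \<in> fp_multivector_fields A C k.
       m [(X, 0)] = (- schouten \<pi> X, restrict_project A C X)) \<and>
    (\<forall>j. \<forall>a \<in> normal_multisections A C j.
       m [(0, a)] = (0, restrict_project A C (schouten \<pi> a))) \<and>
    (\<forall>k l. \<forall>X \<in> fp_multivector_fields A C k. \<forall>Y \<in> fp_multivector_fields A C l.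
       m [(X, 0), (Y, 0)] = (((-1) powi (int k - 1)) *\<^sub>R schouten X Y, 0)) \<and>
    (\<forall>as. as \<noteq> [] \<and> set as \<subseteq> (\<Union>j. normal_multisections A C j) \<longrightarrow>
       m (map (\<lambda>a. (0, a)) as) = (0, restrict_project A C (foldl schouten \<pi> as))) \<and>
    (\<forall>k as. as \<noteq> [] \<and> set as \<subseteq> (\<Union>j. normal_multisections A C j) \<longrightarrow>
       (\<forall>X \<in> fp_multivector_fields A C k.
          m ((X, 0) # map (\<lambda>a. (0, a)) as) = (0, restrict_project A C (foldl schouten X as)))) \<and>
    (\<forall>Xs as. set Xs \<subseteq> (\<Union>k. fp_multivector_fields A C k) \<and>
       set as \<subseteq> (\<Union>j. normal_multisections A C j) \<and>
       (length Xs \<ge> 3 \<or> length Xs = 2 \<and> as \<noteq> []) \<longrightarrow>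
       m (map (\<lambda>X. (X, 0)) Xs @ map (\<lambda>a. (0, a)) as) = 0)"
proof -
 have H: "Hausdorff_space (manifold_topology A)" using assms(1) by (simp add: manifold_def)
 have C: "submanifold A C" using assms(3) by (simp add: coisotropic_def)
 interpret tubular A C by (intro tubular.intro tubular_axioms.intro manifold_bump_atlas assms(1) H C)
 have \<pi>\<^sub>M: "\<pi>\<^sub>M : M.MD 2" "schouten \<pi>\<^sub>M \<pi>\<^sub>M = 0"
  using assms(2) by (simp_all add: poisson_structure_def M.mvf_MD)
 have emb: "open_embedding B A \<psi>" and zero: "!!p. p : C ==> \<psi> (zp p) = p"
  using assms(4) by (simp_all add: tubular_embedding_def)
 \<comment> \<open>The two equations demanded of the element that generates the brackets: one comes
   from the Jacobi identity on M, the other from coisotropy of C.\<close>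
 have "schouten \<pi> \<pi> = 0" "RP \<pi> = 0"
  by (rule pullback_schouten[OF emb zero \<pi>\<^sub>M(1) assms(5) \<pi>\<^sub>M(2)], assumption,
   rule pullback_RP[OF emb zero \<pi>\<^sub>M(1) assms(5,3)], assumption)
 note \<pi> = assms(6) this
 show ?thesis
 proof (intro exI[of _ "deformation_bracket \<pi>"] conjI allI ballI impI; (elim conjE)?)
  show "L_infinity_1 (deformation_space A C) (deformation_bracket \<pi>)" by (rule L_infinity_1_deformation_bracket[OF \<pi>])
  show "maurer_cartan (deformation_space A C) (deformation_bracket \<pi>) =
   {(\<rho>, vlift s) | \<rho> s. \<rho> : fpm 2 & s : nsec &
    poisson_structure (normal_bundle A C) (\<pi> + \<rho>) &
    coisotropic (normal_bundle A C) (\<pi> + \<rho>) (graph s)}" by (rule maurer_cartan_deformation_bracket[OF \<pi>])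
  show "deformation_bracket \<pi> [(0, a)] = (0, RP (schouten \<pi> a))" if "a : N j" for a j
   using deformation_bracket_simps(3)[OF \<pi>, of "[a]"] that by auto
 qed (rule deformation_bracket_simps[OF \<pi>] deformation_bracket_many[OF \<pi>]; assumption)+
qed

end
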